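(* Let $s\in(1/2,1)$, $\varphi\in C^{3s}(\mathbb R^n)$, and let $u\in C^{1+s}(\mathbb R^n)$ be a solution to $\min\{(-\Delta)^su,u-\varphi\}=0$ on $\mathbb R^n$. There exist constants $C,r_0>0$ such that for all $x_0\in\Gamma(u)$ and every $0<r<r_0$ one has $$\frac{d}{dr}\left(W_L(v,r,x_0)+Cr^{2s-1}\right)\ge\frac{2}{r^{n+2}}\int_{\partial B_r(x_0)}\left(\frac{(1+s)v_{x_0}}{r}-\nabla v_{x_0}\cdot\nu\right)^2|y|^a,$$ where $\nu$ is the outer unit normal to $\partial B_r(x_0)$. In particular, the function $r\mapsto W_L(v,r,x_0)+Cr^{2s-1}$ is nondecreasing on $(0,r_0)$.
   Context: Let $n\in\mathbb N$, $s\in(1/2,1)$, $a:=1-2s$. For an integer $k\ge0$, $C^k(\mathbb R^n)$ is the space of $k$ times continuously differentiable functions with bounded derivatives up to order $k$; for $0<\delta<1$, $C^{k+\delta}(\mathbb R^n)$ is the subspace of functions whose order-$k$ derivatives have finite global $\delta$-Hölder seminorm. Fractional Laplacian: $(-\Delta)^s\psi(x)=c_{n,s}\,\mathrm{p.v.}\int_{\mathbb R^n}\frac{\psi(x)-\psi(z)}{|x-z|^{n+2s}}\,dz$, $c_{n,s}>0$. Points of $\mathbb R^{n+1}$ are written $(x,y)$, $x\in\mathbb R^n$, $y\in\mathbb R$; $x_0\in\mathbb R^n$ is identified with $(x_0,0)$. $B_r(x_0)$ is the ball in $\mathbb R^{n+1}$, $B'_r(x_0)$ the ball in $\mathbb R^n$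 (identified with $\mathbb R^n\times\{0\}$), $B_r=B_r(0)$. A function $\psi$ on $\mathbb R^n$ is extended to $y>0$ by $\psi(x,y)=\int_{\mathbb R^n}P(z,y)\psi(x-z)\,dz$, where $P(x,y)=C_{n,s}\,y^{2s}(|x|^2+y^2)^{-(n+2s)/2}$ with $\int_{\mathbb R^n} P(z,y)\,dz=1$, and evenly to $y<0$. The constant $c_{n,s}$ is normalized so that $\lim_{y\downarrow0}y^a\partial_y\psi(x,y)=-(-\Delta)^s\psi(x)$. Free boundary: $\Gamma(u)=\partial\{u=\varphi\}$. For $x_0\in\Gamma(u)$: height function $v_{x_0}(x,y)=u(x,y)-\varphi(x,y)-\frac1{2s}(-\Delta)^s\varphi(x_0)|y|^{1-a}$; source $h_{x_0}(x)=2\left((-\Delta)^s\varphi(x)-(-\Delta)^s\varphi(x_0)\right)$. For $r>0$, $$F_{x_0}(r)=\int_{\partial B_r}|v_{x_0}(x_0+\cdot)|^2|y|^a,\qquad I_{x_0}(r)=\int_{B_r(x_0)}|\nabla v_{x_0}|^2|y|^a+\int_{B'_r(x_0)}v_{x_0}h_{x_0},$$ and the Weiss-type functional is $$W_L(v,r,x_0)=\frac1{r^{n+2}}I_{x_0}(r)-\frac{1+s}{r^{n+3}}F_{x_0}(r).$$ *)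

theory Defs
  imports "HOL-Analysis.Analysis"
begin

text \<open>
  Points of \<open>\<real>\<^sup>n\<close> have type \<open>real ^ 'n\<close>, points \<open>(x, y)\<close> of \<open>\<real>\<^sup>n\<^sup>+\<^sup>1\<close> have type
  \<open>(real ^ 'n) \<times> real\<close>, whose library norm is the Euclidean one.  The parameter of the weight
  \<open>\<bar>y\<bar>\<^sup>a\<close> is \<open>a = 1 - 2s\<close>; since \<open>0 powr a = 0\<close>, the weight is \<open>0\<close> rather than \<open>\<infinity>\<close> on the
  hyperplane \<open>y = 0\<close>, which is a null set for all the integrals in which it occurs.
\<close>

section \<open>Hoelder spaces\<close>

definition partial_deriv :: "'a::euclidean_space \<Rightarrow> ('a \<Rightarrow> real) \<Rightarrow> 'a \<Rightarrow> real" where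
  "partial_deriv b f = (\<lambda>x. frechet_derivative f (at x) b)"

text \<open>The set of all partial derivatives of order exactly \<open>k\<close>.\<close>

fun partial_derivs :: "nat \<Rightarrow> ('a::euclidean_space \<Rightarrow> real) \<Rightarrow> ('a \<Rightarrow> real) set" where
  "partial_derivs 0 f = {f}"
| "partial_derivs (Suc k) f = (\<Union>b\<in>Basis. partial_derivs k (partial_deriv b f))"

definition Ck_space :: "nat \<Rightarrow> ('a::euclidean_space \<Rightarrow> real) set" where
  "Ck_space k =
     {f. (\<forall>j<k. \<forall>g\<in>partial_derivs j f. g differentiable_on UNIV) \<and>
         (\<forall>j\<le>k. \<forall>g\<in>partial_derivs j f. continuous_on UNIV g \<and> bounded (range g))}"

text \<open>
  \<open>holder_space \<alpha>\<close> is \<open>C\<^sup>k\<^sup>+\<^sup>\<delta>\<close> for \<open>\<alpha> = k + \<delta>\<close> with \<open>k\<close> an integer and \<open>0 \<le> \<delta> < 1\<close>; if \<open>\<alpha>\<close> is an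
  integer, there is no Hoelder condition.
\<close>

definition holder_space :: "real \<Rightarrow> ('a::euclidean_space \<Rightarrow> real) set" where
  "holder_space \<alpha> =
     {f \<in> Ck_space (nat \<lfloor>\<alpha>\<rfloor>).
        frac \<alpha> > 0 \<longrightarrow>
          (\<forall>g\<in>partial_derivs (nat \<lfloor>\<alpha>\<rfloor>) f. \<exists>M. \<forall>x z. \<bar>g x - g z\<bar> \<le> M * norm (x - z) powr frac \<alpha>)}"

section \<open>Extension to the upper half space and fractional Laplacian\<close>

definition poisson_profile :: "real \<Rightarrow> real ^ 'n \<Rightarrow> real \<Rightarrow> real" where
  "poisson_profile s x y =
     y powr (2 * s) * ((norm x)\<^sup>2 + y\<^sup>2) powr (- (real CARD('n) + 2 * s) / 2)"

definition poisson_const :: "'n::finite itself \<Rightarrow> real \<Rightarrow> real" where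
  "poisson_const _ s =
     (THE C. \<forall>y>0. (\<integral>z. C * poisson_profile s (z :: real ^ 'n) y \<partial>lborel) = 1)"

definition poisson_kernel :: "real \<Rightarrow> real ^ 'n \<Rightarrow> real \<Rightarrow> real" where
  "poisson_kernel s x y = poisson_const TYPE('n) s * poisson_profile s x y"

definition extension :: "real \<Rightarrow> (real ^ 'n \<Rightarrow> real) \<Rightarrow> (real ^ 'n) \<times> real \<Rightarrow> real" where
  "extension s \<psi> = (\<lambda>(x, y).
     if y = 0 then \<psi> x else (\<integral>z. poisson_kernel s z \<bar>y\<bar> * \<psi> (x - z) \<partial>lborel))"

definition pv_integral :: "real \<Rightarrow> (real ^ 'n \<Rightarrow> real) \<Rightarrow> real ^ 'n \<Rightarrow> real" where
  "pv_integral s \<psi> x =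
     Lim (at_right 0) (\<lambda>\<epsilon>.
       set_lebesgue_integral lborel {z. \<epsilon> < norm (x - z)}
         (\<lambda>z. (\<psi> x - \<psi> z) / norm (x - z) powr (real CARD('n) + 2 * s)))"

text \<open>
  The constant \<open>c\<^bsub>n,s\<^esub>\<close> is the one for which the weighted normal derivative of the extension is
  minus the fractional Laplacian.
\<close>

definition frac_lap_const :: "'n::finite itself \<Rightarrow> real \<Rightarrow> real" where
  "frac_lap_const _ s =
     (THE c. c > 0 \<and>
        (\<forall>\<psi> \<in> Ck_space 2. \<forall>x :: real ^ 'n.
           ((\<lambda>y. y powr (1 - 2 * s) * deriv (\<lambda>t. extension s \<psi> (x, t)) y)
              \<longlongrightarrow> - (c * pv_integral s \<psi> x)) (at_right 0)))"

definition frac_lap :: "real \<Rightarrow> (real ^ 'n \<Rightarrow> real) \<Rightarrow> real ^ 'n \<Rightarrow> real" where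
  "frac_lap s \<psi> x = frac_lap_const TYPE('n) s * pv_integral s \<psi> x"

section \<open>The obstacle problem\<close>

definition obstacle_solution ::
    "real \<Rightarrow> (real ^ 'n \<Rightarrow> real) \<Rightarrow> (real ^ 'n \<Rightarrow> real) \<Rightarrow> bool" where
  "obstacle_solution s \<phi> u \<longleftrightarrow> (\<forall>x. min (frac_lap s u x) (u x - \<phi> x) = 0)"

definition free_boundary ::
    "(real ^ 'n \<Rightarrow> real) \<Rightarrow> (real ^ 'n \<Rightarrow> real) \<Rightarrow> (real ^ 'n) set" where
  "free_boundary \<phi> u = frontier {x. u x = \<phi> x}"

definition height_fun :: "real \<Rightarrow> (real ^ 'n \<Rightarrow> real) \<Rightarrow> (real ^ 'n \<Rightarrow> real) \<Rightarrow> real ^ 'n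
    \<Rightarrow> (real ^ 'n) \<times> real \<Rightarrow> real" where
  "height_fun s \<phi> u x0 = (\<lambda>(x, y).
     let a = 1 - 2 * s in
       extension s u (x, y) - extension s \<phi> (x, y)
         - 1 / (2 * s) * frac_lap s \<phi> x0 * \<bar>y\<bar> powr (1 - a))"

definition source_fun ::
    "real \<Rightarrow> (real ^ 'n \<Rightarrow> real) \<Rightarrow> real ^ 'n \<Rightarrow> real ^ 'n \<Rightarrow> real" where
  "source_fun s \<phi> x0 x = 2 * (frac_lap s \<phi> x - frac_lap s \<phi> x0)"

section \<open>Surface integrals and the Weiss-type functional\<close>

text \<open>
  The surface measure on the sphere of radius \<open>r > 0\<close> about \<open>c\<close> in an \<open>N\<close>-dimensional space: the
  measure of a part \<open>A\<close> of the sphere is \<open>N / r\<close> times the Lebesgue measure of the solid cone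
  with base \<open>A\<close> and apex \<open>c\<close>.  In polar coordinates, with \<open>\<sigma>\<close> the surface measure on the unit
  sphere, that cone has measure \<open>(\<integral>\<^sub>0\<^sup>r \<rho>\<^sup>N\<^sup>-\<^sup>1 d\<rho>) \<sigma>((A - c)/r) = r\<^sup>N \<sigma>((A - c)/r) / N\<close>.
\<close>

definition sphere_measure :: "'a::euclidean_space \<Rightarrow> real \<Rightarrow> 'a measure" where
  "sphere_measure c r =
     scale_measure (ennreal (real DIM('a) / r))
       (distr (restrict_space lborel (ball c r - {c})) borel
         (\<lambda>p. c + (r / norm (p - c)) *\<^sub>R (p - c)))"

definition gradient :: "('a::real_inner \<Rightarrow> real) \<Rightarrow> 'a \<Rightarrow> 'a" where
  "gradient f p = (THE D. GDERIV f p :> D)"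

definition F_fun :: "real \<Rightarrow> (real ^ 'n \<Rightarrow> real) \<Rightarrow> (real ^ 'n \<Rightarrow> real) \<Rightarrow> real ^ 'n
    \<Rightarrow> real \<Rightarrow> real" where
  "F_fun s \<phi> u x0 r =
     (\<integral>p. (height_fun s \<phi> u x0 ((x0, 0) + p))\<^sup>2 * \<bar>snd p\<bar> powr (1 - 2 * s) \<partial>sphere_measure 0 r)"

definition I_fun :: "real \<Rightarrow> (real ^ 'n \<Rightarrow> real) \<Rightarrow> (real ^ 'n \<Rightarrow> real) \<Rightarrow> real ^ 'n
    \<Rightarrow> real \<Rightarrow> real" where
  "I_fun s \<phi> u x0 r =
     set_lebesgue_integral lborel (ball (x0, 0) r)
       (\<lambda>p. (norm (gradient (height_fun s \<phi> u x0) p))\<^sup>2 * \<bar>snd p\<bar> powr (1 - 2 * s))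
     + set_lebesgue_integral lborel (ball x0 r)
         (\<lambda>x. height_fun s \<phi> u x0 (x, 0) * source_fun s \<phi> x0 x)"

definition weiss :: "real \<Rightarrow> (real ^ 'n \<Rightarrow> real) \<Rightarrow> (real ^ 'n \<Rightarrow> real) \<Rightarrow> real ^ 'n
    \<Rightarrow> real \<Rightarrow> real" where
  "weiss s \<phi> u x0 r =
     1 / r ^ (CARD('n) + 2) * I_fun s \<phi> u x0 r
     - (1 + s) / r ^ (CARD('n) + 3) * F_fun s \<phi> u x0 r"

end

theory Submission
  imports Defs
begin

text \<open>
  Written as \<open>\<integral> P(z, 1) \<psi>(x - y z) dz\<close>, the extension of a \<open>C\<^sup>1\<^sup>+\<^sup>s\<close> function is \<open>C\<^sup>1\<close> up to
  \<open>y = 0\<close>, because \<open>2s > 1\<close>; its weighted normal derivative is the fractional Laplacian, so that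
  the extension solves a weak equation in the whole space with a density on \<open>y = 0\<close>.  Hence the
  height function \<open>V\<close> solves \<open>div(|y|\<^sup>a \<nabla>V) = 2w\<close> with a density \<open>w\<close> on \<open>y = 0\<close>, where complementarity
  and the vanishing of \<open>V\<close> and \<open>\<nabla>\<^sub>x V\<close> on the contact set give \<open>w V = h V / 2\<close> and
  \<open>w \<nabla>\<^sub>x V = h \<nabla>\<^sub>x V / 2\<close>.

  With \<open>\<eta>(p) = ((r\<^sup>2 - |p|\<^sup>2)\<^sup>+)\<^sup>2\<close>, testing the equation with \<open>\<eta> V\<close> gives the energy identity, and
  testing it with \<open>\<eta> (V(\<lambda> p) - V(p)) / (\<lambda> - 1)\<close> for \<open>\<lambda> \<rightarrow> 1\<close> gives the Rellich identity without
  using second derivatives of \<open>V\<close>.  Differentiating both in \<open>r\<close> expresses the derivative of the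
  Weiss functional as the integral on the right-hand side of the claim plus integrals of \<open>h V\<close>
  and \<open>h (x \<cdot> \<nabla>\<^sub>x V)\<close> on \<open>y = 0\<close>.  The bounds \<open>|V| \<le> K |x|\<^sup>1\<^sup>+\<^sup>s\<close>, \<open>|\<nabla>\<^sub>x V| \<le> K |x|\<^sup>s\<close> there and
  \<open>|h| \<le> K |x|\<^sup>s\<close>, the latter because \<open>\<phi> \<in> C\<^sup>3\<^sup>s\<close> has an \<open>s\<close>-Hoelder fractional Laplacian, make these
  at least \<open>- C' r\<^sup>2\<^sup>s\<^sup>-\<^sup>2\<close>.
\<close>

section \<open>Integration\<close>

text \<open>The obstacle is regularity at y = 0: V is C^1 up to there, but no bound on its second
  derivatives is available, so the equation is used only in weak form, against C^1 test functions
  with an explicit gradient. The cutoff is a square so that it is C^1. Inside the ball it is a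
  polynomial in |p|^2, so a tested identity is an identity between radial moments, and two
  differentiations in r remove the cutoff and leave integrals over balls and spheres. The exponent
  2s - 1 comes from the error: an integrand of size r^(1+2s) on a sphere of R^n contributes
  r^(n+2s), and division by r^(n+2) leaves r^(2s-2), whose primitive is a multiple of r^(2s-1). Its
  coefficient depends only on n, s and the Hoelder constants of u and \<phi>, hence one C for all
  x0. The normalising constants are given by \<open>THE\<close> and the principal value by
  \<open>Lim\<close>, so existence, uniqueness and convergence have to be established before
  anything can be computed; the functions defining \<open>frac_lap_const\<close> are those of
  \<open>Ck_space 2\<close>, to which u need not belong.\<close>

lemma integral_tendsto_at:
  fixes f :: "'b::metric_space \<Rightarrow> 'a \<Rightarrow> real"
  assumes ev: "eventually (\<lambda>p. f p \<in> borel_measurable M \<and> (AE x in M. \<bar>f p x\<bar> \<le> w x)) (at a within S)"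
    and w: "integrable M w" and l: "l \<in> borel_measurable M"
    and lim: "AE x in M. ((\<lambda>p. f p x) \<longlongrightarrow> l x) (at a within S)"
  shows "((\<lambda>p. integral\<^sup>L M (f p)) \<longlongrightarrow> integral\<^sup>L M l) (at a within S)"
  unfolding tendsto_at_iff_sequentially comp_def
proof safe
  fix X :: "nat \<Rightarrow> 'b" assume X: "\<forall>i. X i \<in> S - {a}" "X \<longlonglongrightarrow> a"
  then have fl: "filterlim X (at a within S) sequentially"
    by (auto simp: filterlim_at)
  \<comment> \<open>Domination holds only near \<open>a\<close>, so the sequence is shifted past the
    index from which its terms lie there.\<close>
  from filterlim_iff[THEN iffD1, OF fl, rule_format, OF ev]
  obtain N where N: "\<And>n. n \<ge> N \<Longrightarrow> f (X n) \<in> borel_measurable M \<and> (AE x in M. \<bar>f (X n) x\<bar> \<le> w x)"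
    unfolding eventually_sequentially by auto
  have "(\<lambda>n. integral\<^sup>L M (f (X (n + N)))) \<longlonglongrightarrow> integral\<^sup>L M l"
  proof (rule integral_dominated_convergence)
    show "AE x in M. (\<lambda>n. f (X (n + N)) x) \<longlonglongrightarrow> l x"
      using lim
    proof eventually_elim
      case (elim x)
      then have "(\<lambda>n. f (X n) x) \<longlonglongrightarrow> l x"
        using fl by (rule filterlim_compose)
      then show ?case by (rule LIMSEQ_ignore_initial_segment)
    qed
  qed (use N w l in auto)
  then show "(\<lambda>n. integral\<^sup>L M (f (X n))) \<longlonglongrightarrow> integral\<^sup>L M l"
    by (rule LIMSEQ_offset)
qed

lemma integral_isCont:
  fixes f :: "'b::metric_space \<Rightarrow> 'a \<Rightarrow> real"
  assumes ev: "eventually (\<lambda>p. f p \<in> borel_measurable M \<and> (\<forall>x\<in>space M. \<bar>f p x\<bar> \<le> w x)) (at a)"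
    and w: "integrable M w" and l: "f a \<in> borel_measurable M"
    and lim: "\<And>x. x \<in> space M \<Longrightarrow> isCont (\<lambda>p. f p x) a"
  shows "isCont (\<lambda>p. integral\<^sup>L M (f p)) a"
  unfolding isCont_def
  by (rule integral_tendsto_at[OF _ w l])
    (use ev lim in \<open>auto simp: isCont_def elim!: eventually_mono intro!: AE_I2\<close>)

lemma has_derivative_imp_DERIV_line:
  fixes f :: "'b::real_normed_vector \<Rightarrow> real"
  assumes der: "(f has_derivative f') (at (a + t *\<^sub>R h))"
  shows "((\<lambda>t. f (a + t *\<^sub>R h)) has_real_derivative f' h) (at t)"
proof (rule has_derivative_imp_has_field_derivative)
  show "((\<lambda>t. f (a + t *\<^sub>R h)) has_derivative (\<lambda>r. f' (r *\<^sub>R h))) (at t)"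
    by (rule has_derivative_compose[where g=f and f="\<lambda>t. a + t *\<^sub>R h"])
      (use der in \<open>auto intro!: derivative_eq_intros\<close>)
  show "r * f' h = f' (r *\<^sub>R h)" for r
    using linear_simps(5)[OF has_derivative_bounded_linear[OF der]] by simp
qed

text \<open>Only the derivative at \<open>a\<close> and a Lipschitz bound relative to
  \<open>a\<close> enter. Difference quotients carry the bound \<open>w\<close> over to
  \<open>f'\<close> and, along the steps 1/(n+1), give its measurability; the remainder divided by
  |p - a| is then dominated by \<open>2 * w\<close> and tends to 0 pointwise.\<close>

lemma has_derivative_integral:
  fixes f :: "'b::real_normed_vector \<Rightarrow> 'a \<Rightarrow> real"
  assumes e: "0 < e" and int: "\<And>p. dist p a < e \<Longrightarrow> integrable M (f p)"
    and der: "\<And>x. x \<in> space M \<Longrightarrow> ((\<lambda>p. f p x) has_derivative f' x) (at a)"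
    and lip: "\<And>p x. dist p a < e \<Longrightarrow> x \<in> space M \<Longrightarrow> \<bar>f p x - f a x\<bar> \<le> w x * norm (p - a)"
    and w: "integrable M w"
  shows "integrable M (\<lambda>x. f' x h)"
    and "((\<lambda>p. integral\<^sup>L M (f p)) has_derivative (\<lambda>h. \<integral>x. f' x h \<partial>M)) (at a)"
proof -
  have bl: "bounded_linear (f' x)" if "x \<in> space M" for x
    using der[OF that] by (rule has_derivative_bounded_linear)
  have lim: "((\<lambda>t. (f (a + t *\<^sub>R h) x - f a x) / t) \<longlongrightarrow> f' x h) (at_right 0)"
    if x: "x \<in> space M" for x h
  proof -
    have "((\<lambda>t. f (a + t *\<^sub>R h) x) has_real_derivative (f' x h)) (at 0)"
      using has_derivative_imp_DERIV_line[of "\<lambda>p. f p x" "f' x" a 0 h] der[OF x] by simp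
    then show ?thesis
      unfolding DERIV_def by (auto elim!: tendsto_mono[rotated] intro!: at_le)
  qed
  have ev: "eventually (\<lambda>t. t > 0 \<and> dist (a + t *\<^sub>R h) a < e) (at_right (0::real))" for h
  proof -
    have "((\<lambda>t. dist (a + t *\<^sub>R h) a) \<longlongrightarrow> dist (a + 0 *\<^sub>R h) a) (at_right (0::real))"
      by (intro tendsto_intros)
    then have "eventually (\<lambda>t. dist (a + t *\<^sub>R h) a < e) (at_right (0::real))"
      using order_tendstoD(2)[of _ _ _ e] e by simp
    then show ?thesis using eventually_at_right_less[of "0::real"] by eventually_elim auto
  qed
  have bnd: "\<bar>f' x h\<bar> \<le> w x * norm h" if x: "x \<in> space M" for x h
  proof (rule tendsto_upperbound[OF tendsto_rabs[OF lim[OF x]]])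
    show "\<forall>\<^sub>F t in at_right 0. \<bar>(f (a + t *\<^sub>R h) x - f a x) / t\<bar> \<le> w x * norm h"
      using ev[of h]
    proof eventually_elim
      case (elim t)
      then show ?case using lip[OF _ x, of "a + t *\<^sub>R h"] by (simp add: abs_divide field_simps)
    qed
  qed simp
  have seq: "filterlim (\<lambda>n. 1 / real (Suc n)) (at_right 0) sequentially"
    using LIMSEQ_Suc[OF lim_1_over_n[where 'a=real]] by (auto simp: filterlim_at)
  have meas: "(\<lambda>x. f' x h) \<in> borel_measurable M" for h
  proof -
    obtain N where N: "\<And>n. n \<ge> N \<Longrightarrow> dist (a + (1 / real (Suc n)) *\<^sub>R h) a < e"
      using filterlim_iff[THEN iffD1, OF seq, rule_format, OF ev[of h]]
      unfolding eventually_sequentially by blast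
    show ?thesis
    proof (rule borel_measurable_LIMSEQ_real)
      fix x assume x: "x \<in> space M"
      have "(\<lambda>n. (f (a + (1 / real (Suc n)) *\<^sub>R h) x - f a x) / (1 / real (Suc n))) \<longlonglongrightarrow> f' x h"
        by (rule filterlim_compose[OF lim[OF x] seq])
      then show "(\<lambda>n. (f (a + (1 / real (Suc (n+N))) *\<^sub>R h) x - f a x) / (1 / real (Suc (n+N)))) \<longlonglongrightarrow> f' x h"
        by (rule LIMSEQ_ignore_initial_segment)
    next
      fix n
      have "f (a + (1 / real (Suc (n+N))) *\<^sub>R h) \<in> borel_measurable M" "f a \<in> borel_measurable M"
        using int[OF N[of "n+N"]] int[of a] e by auto
      then show "(\<lambda>x. (f (a + (1 / real (Suc (n+N))) *\<^sub>R h) x - f a x) / (1 / real (Suc (n+N)))) \<in> borel_measurable M"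
        by (intro borel_measurable_divide borel_measurable_diff) auto
    qed
  qed
  show int': "integrable M (\<lambda>x. f' x h)" for h
    by (rule Bochner_Integration.integrable_bound[of _ "\<lambda>x. w x * norm h"])
      (use w meas bnd in \<open>auto intro!: AE_I2 intro: order_trans[OF _ abs_ge_self]\<close>)
  show "((\<lambda>p. integral\<^sup>L M (f p)) has_derivative (\<lambda>h. \<integral>x. f' x h \<partial>M)) (at a)"
    unfolding has_derivative_iff_norm
  proof (intro conjI)
    show "bounded_linear (\<lambda>h. \<integral>x. f' x h \<partial>M)"
    proof (rule bounded_linear_intro[where K="\<integral>x. w x \<partial>M"])
      fix h k :: 'b and r :: real
      have "(\<integral>x. f' x (h + k) \<partial>M) = (\<integral>x. f' x h + f' x k \<partial>M)"
        by (rule Bochner_Integration.integral_cong) (auto simp: linear_simps(1)[OF bl])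
      then show "(\<integral>x. f' x (h + k) \<partial>M) = (\<integral>x. f' x h \<partial>M) + (\<integral>x. f' x k \<partial>M)"
        using int' by simp
      have "(\<integral>x. f' x (r *\<^sub>R h) \<partial>M) = (\<integral>x. r * f' x h \<partial>M)"
        by (rule Bochner_Integration.integral_cong) (auto simp: linear_simps(5)[OF bl])
      then show "(\<integral>x. f' x (r *\<^sub>R h) \<partial>M) = r *\<^sub>R (\<integral>x. f' x h \<partial>M)" by simp
      have "norm (\<integral>x. f' x h \<partial>M) \<le> (\<integral>x. w x * norm h \<partial>M)"
        unfolding real_norm_def
        by (rule order_trans[OF integral_abs_bound integral_mono]) (use int' w bnd in auto)
      then show "norm (\<integral>x. f' x h \<partial>M) \<le> norm h * (\<integral>x. w x \<partial>M)" by (simp add: mult.commute)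
    qed
    have le: "eventually (\<lambda>p. \<bar>integral\<^sup>L M (f p) - integral\<^sup>L M (f a) - (\<integral>x. f' x (p - a) \<partial>M)\<bar> / norm (p - a)
       \<le> (\<integral>x. \<bar>f p x - f a x - f' x (p - a)\<bar> / norm (p - a) \<partial>M)) (at a)"
    proof -
      have ia: "integrable M (f a)" using int[of a] e by simp
      have "eventually (\<lambda>p. dist p a < e) (at a)" using e by (auto simp: eventually_at)
      then show ?thesis
      proof eventually_elim
        case (elim p)
        have "integral\<^sup>L M (f p) - integral\<^sup>L M (f a) - (\<integral>x. f' x (p - a) \<partial>M) = (\<integral>x. f p x - f a x - f' x (p - a) \<partial>M)"
          by (simp only: Bochner_Integration.integral_diff Bochner_Integration.integrable_diff int[OF elim] ia int')
        then have "\<bar>integral\<^sup>L M (f p) - integral\<^sup>L M (f a) - (\<integral>x. f' x (p - a) \<partial>M)\<bar> \<le> (\<integral>x. \<bar>f p x - f a x - f' x (p - a)\<bar> \<partial>M)"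
          by (simp only: integral_abs_bound)
        then show ?case by (simp add: divide_right_mono)
      qed
    qed
    have "((\<lambda>p. \<integral>x. \<bar>f p x - f a x - f' x (p - a)\<bar> / norm (p - a) \<partial>M) \<longlongrightarrow> (\<integral>x. 0 \<partial>M)) (at a)"
    proof (rule integral_tendsto_at)
      show "integrable M (\<lambda>x. 2 * w x)" using w by simp
      show "AE x in M. ((\<lambda>p. \<bar>f p x - f a x - f' x (p - a)\<bar> / norm (p - a)) \<longlongrightarrow> 0) (at a)"
        by (rule AE_I2) (use der in \<open>auto simp: has_derivative_iff_norm\<close>)
      have "eventually (\<lambda>p. dist p a < e) (at a)" using e by (auto simp: eventually_at)
      then show "\<forall>\<^sub>F p in at a. (\<lambda>x. \<bar>f p x - f a x - f' x (p - a)\<bar> / norm (p - a)) \<in> borel_measurable M \<and>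
          (AE x in M. \<bar>\<bar>f p x - f a x - f' x (p - a)\<bar> / norm (p - a)\<bar> \<le> 2 * w x)"
        using eventually_neq_at_within[of a a UNIV]
      proof eventually_elim
        case (elim p)
        have "\<bar>\<bar>f p x - f a x - f' x (p - a)\<bar> / norm (p - a)\<bar> \<le> 2 * w x" if x: "x \<in> space M" for x
          using lip[OF elim(1) x] bnd[OF x, of "p - a"] elim(2) by (simp add: field_simps)
        then show ?case
          using int[OF elim(1), THEN borel_measurable_integrable] int[of a, THEN borel_measurable_integrable] e meas[of "p - a"]
          by (simp add: AE_I2)
      qed
    qed simp
    then have lim0: "((\<lambda>p. \<integral>x. \<bar>f p x - f a x - f' x (p - a)\<bar> / norm (p - a) \<partial>M) \<longlongrightarrow> 0) (at a)"
      by simp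
    have "((\<lambda>p. \<bar>integral\<^sup>L M (f p) - integral\<^sup>L M (f a) - (\<integral>x. f' x (p - a) \<partial>M)\<bar> / norm (p - a)) \<longlongrightarrow> 0) (at a)"
      by (rule tendsto_sandwich[OF _ le tendsto_const lim0]) simp
    then show "((\<lambda>p. norm (integral\<^sup>L M (f p) - integral\<^sup>L M (f a) - (\<integral>x. f' x (p - a) \<partial>M)) / norm (p - a)) \<longlongrightarrow> 0) (at a)"
      by (simp only: real_norm_def)
  qed
qed

lemma lborel_nn_integral_affine:
  fixes f :: "'a::euclidean_space \<Rightarrow> ennreal"
  assumes [measurable]: "f \<in> borel_measurable borel" and c: "c \<noteq> 0"
  shows "(\<integral>\<^sup>+x. f x \<partial>lborel) = ennreal (\<bar>c\<bar> ^ DIM('a)) * (\<integral>\<^sup>+x. f (t + c *\<^sub>R x) \<partial>lborel)"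
  by (subst lborel_affine[OF c, of t])
     (simp add: nn_integral_density nn_integral_distr nn_integral_cmult)

lemma lborel_integrable_affine:
  fixes f :: "'a::euclidean_space \<Rightarrow> real"
  assumes f: "integrable lborel f" and c: "c \<noteq> 0"
  shows "integrable lborel (\<lambda>x. f (t + c *\<^sub>R x))"
proof -
  have [measurable]: "f \<in> borel_measurable borel" using f by auto
  have "integrable (density (distr lborel borel (\<lambda>x. t + c *\<^sub>R x)) (\<lambda>_. ennreal (\<bar>c\<bar> ^ DIM('a)))) f"
    using f lborel_affine[OF c, of t] by simp
  then show ?thesis using c
    by (simp add: integrable_density integrable_distr_eq)
qed

lemma lborel_integral_affine:
  fixes f :: "'a::euclidean_space \<Rightarrow> real"
  assumes c: "c \<noteq> 0" and [measurable]: "f \<in> borel_measurable borel"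
  shows "(\<integral>x. f x \<partial>lborel) = \<bar>c\<bar> ^ DIM('a) * (\<integral>x. f (t + c *\<^sub>R x) \<partial>lborel)"
  by (subst lborel_affine[OF c, of t])
     (simp add: integral_density integral_distr)

text \<open>Lebesgue measure is translation invariant, so the integral of f(x + e) - f(x) is 0.
  Writing this difference as the integral over t in [0, 1] of the derivative at x + t e and
  exchanging the order gives the integral of the derivative itself, again by invariance.
  Integrability takes the place of compact support.\<close>

lemma integral_directional_derivative_eq_0:
  fixes f :: "'a::euclidean_space \<Rightarrow> real"
  assumes der: "\<And>x. (f has_derivative f' x) (at x)"
    and f: "integrable lborel f" and f': "integrable lborel (\<lambda>x. f' x e)"
    and cont: "continuous_on UNIV (\<lambda>x. f' x e)"
  shows "(\<integral>x. f' x e \<partial>lborel) = 0"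
proof -
  have m[measurable]: "(\<lambda>x. f' x e) \<in> borel_measurable borel"
    using cont by (rule borel_measurable_continuous_onI)
  let ?F = "\<lambda>(t::real, x). indicator {0..1} t * f' (x + t *\<^sub>R e) e"
  have ftc: "f (x + e) - f x = (\<integral>t. ?F (t, x) \<partial>lborel)" for x
  proof -
    have "(\<integral>t. f' (x + t *\<^sub>R e) e * indicator {0..1} t \<partial>lborel) = f (x + 1 *\<^sub>R e) - f (x + 0 *\<^sub>R e)"
    proof (rule integral_FTC_Icc_real)
      fix t :: real
      show "DERIV (\<lambda>t. f (x + t *\<^sub>R e)) t :> f' (x + t *\<^sub>R e) e"
        by (rule has_derivative_imp_DERIV_line[OF der])
      show "isCont (\<lambda>t. f' (x + t *\<^sub>R e) e) t"
        using continuous_on_compose2[OF cont, of UNIV "\<lambda>t. x + t *\<^sub>R e"]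
        by (simp add: continuous_on_eq_continuous_at continuous_intros)
    qed simp
    then show ?thesis by (simp add: mult.commute)
  qed
  have shift: "integrable lborel (\<lambda>x. g (x + a))" "(\<integral>x. g (x + a) \<partial>lborel) = (\<integral>x. g x \<partial>lborel)"
    if "integrable lborel g" for g :: "'a \<Rightarrow> real" and a
    using lborel_integrable_affine[OF that, of 1 a] lborel_integral_affine[of 1 g a] that
    by (auto simp: add.commute)
  have I: "integrable (lborel \<Otimes>\<^sub>M lborel) ?F"
  proof (rule lborel_pair.Fubini_integrable)
    have "(\<integral>x. norm (?F (t, x)) \<partial>lborel) = indicator {0..1} t * (\<integral>x. \<bar>f' x e\<bar> \<partial>lborel)" for t
      using shift(2)[of "\<lambda>x. \<bar>f' x e\<bar>" "t *\<^sub>R e"] f' by (simp add: abs_mult)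
    then show "integrable lborel (\<lambda>t. \<integral>x. norm (?F (t, x)) \<partial>lborel)" by simp
    show "AE t in lborel. integrable lborel (\<lambda>x. ?F (t, x))"
      using shift(1)[OF f'] by auto
  qed simp
  have "0 = (\<integral>x. f (x + e) - f x \<partial>lborel)" using shift[OF f, of e] f by simp
  also have "\<dots> = (\<integral>x. \<integral>t. ?F (t, x) \<partial>lborel \<partial>lborel)" by (simp add: ftc)
  also have "\<dots> = (\<integral>t. \<integral>x. ?F (t, x) \<partial>lborel \<partial>lborel)"
    using lborel_pair.Fubini_integral[of "\<lambda>t x. ?F (t, x)"] I by simp
  also have "\<dots> = (\<integral>t. indicator {0..1::real} t * (\<integral>x. f' x e \<partial>lborel) \<partial>lborel)"
    using shift(2)[OF f'] by simp
  also have "\<dots> = (\<integral>x. f' x e \<partial>lborel)" by simp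
  finally show ?thesis by simp
qed

lemma gradient_bound:
  fixes f :: "'a::real_inner \<Rightarrow> real"
  assumes "convex S" and "\<And>x. x \<in> S \<Longrightarrow> (f has_derivative (\<lambda>h. g x \<bullet> h)) (at x)"
    and B: "\<And>x. x \<in> S \<Longrightarrow> norm (g x) \<le> B" and "x \<in> S" "y \<in> S"
  shows "\<bar>f x - f y\<bar> \<le> B * norm (x - y)"
proof -
  have "norm (f x - f y) \<le> B * norm (x - y)"
  proof (rule differentiable_bound[OF assms(1), where f'="\<lambda>x h. g x \<bullet> h"])
    fix z assume z: "z \<in> S"
    show "(f has_derivative (\<lambda>h. g z \<bullet> h)) (at z within S)"
      using assms(2)[OF z] by (rule has_derivative_at_withinI)
    show "onorm (\<lambda>h. g z \<bullet> h) \<le> B"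
    proof (rule onorm_bound)
      show "0 \<le> B" using B[OF z] norm_ge_zero order_trans by blast
    next
      fix h show "norm (g z \<bullet> h) \<le> B * norm h"
        using Cauchy_Schwarz_ineq2[of "g z" h] mult_right_mono[OF B[OF z] norm_ge_zero[of h]] by simp
    qed
  qed (use assms in auto)
  then show ?thesis by simp
qed

section \<open>Polar coordinates\<close>

lemma ball_borel[measurable]: "ball c r \<in> sets borel"
  by simp

abbreviation unit_sphere_measure :: "'a::euclidean_space measure" where
  "unit_sphere_measure \<equiv> sphere_measure 0 1"

lemma sets_sphere_measure[simp, measurable_cong]: "sets (sphere_measure c r) = sets borel"
  by (simp add: sphere_measure_def)

lemma space_sphere_measure[simp]: "space (sphere_measure c r) = UNIV"
  using sets_eq_imp_space_eq[OF sets_sphere_measure] by simp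

lemma nn_integral_sphere_measure:
  fixes f :: "'a::euclidean_space \<Rightarrow> ennreal"
  assumes [measurable]: "f \<in> borel_measurable borel"
  shows "(\<integral>\<^sup>+p. f p \<partial>sphere_measure c r) =
    ennreal (real DIM('a) / r) *
      (\<integral>\<^sup>+p. f (c + (r / norm (p - c)) *\<^sub>R (p - c)) * indicator (ball c r - {c}) p \<partial>lborel)"
proof -
  have [measurable]: "(\<lambda>p. c + (r / norm (p - c)) *\<^sub>R (p - c)) \<in> restrict_space lborel (ball c r - {c}) \<rightarrow>\<^sub>M borel"
    by (rule measurable_restrict_space1) simp
  show ?thesis
    by (simp add: sphere_measure_def nn_integral_scale_measure nn_integral_distr nn_integral_restrict_space)
qed

lemma nn_integral_unit_sphere_measure:
  fixes f :: "'a::euclidean_space \<Rightarrow> ennreal"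
  assumes [measurable]: "f \<in> borel_measurable borel"
  shows "(\<integral>\<^sup>+p. f p \<partial>unit_sphere_measure) =
    (\<integral>\<^sup>+p. ennreal (if norm p < 1 \<and> p \<noteq> 0 then real DIM('a) else 0) * f ((1 / norm p) *\<^sub>R p) \<partial>lborel)"
  by (subst nn_integral_sphere_measure)
    (auto simp: nn_integral_cmult[symmetric] indicator_def intro!: nn_integral_cong)

text \<open>Radial projection commutes with p -> c + r p; the cone contributes r^N and the
  normalisation 1/r, hence the factor r^(N-1).\<close>

lemma nn_integral_sphere_measure_unit:
  fixes f :: "'a::euclidean_space \<Rightarrow> ennreal"
  assumes [measurable]: "f \<in> borel_measurable borel" and r: "r > 0"
  shows "(\<integral>\<^sup>+p. f p \<partial>sphere_measure c r) =
    ennreal (r ^ (DIM('a) - 1)) * (\<integral>\<^sup>+p. f (c + r *\<^sub>R p) \<partial>unit_sphere_measure)"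
proof -
  have 1: "(\<integral>\<^sup>+p. f (c + (r / norm (p - c)) *\<^sub>R (p - c)) * indicator (ball c r - {c}) p \<partial>lborel) =
     ennreal (r ^ DIM('a)) * (\<integral>\<^sup>+p. f (c + (r / norm p) *\<^sub>R p) * indicator (ball 0 1 - {0}) p \<partial>lborel)"
    using r by (subst lborel_nn_integral_affine[of _ r c])
      (auto simp: indicator_def dist_norm intro!: arg_cong2[where f="(*)"] nn_integral_cong)
  have 2: "(\<integral>\<^sup>+p. f (c + r *\<^sub>R p) \<partial>unit_sphere_measure) =
     ennreal (real DIM('a)) * (\<integral>\<^sup>+p. f (c + (r / norm p) *\<^sub>R p) * indicator (ball 0 1 - {0}) p \<partial>lborel)"
    by (subst nn_integral_sphere_measure) simp_all
  have 3: "real DIM('a) / r * r ^ DIM('a) = r ^ (DIM('a) - 1) * real DIM('a)"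
    using r power_minus_mult[of "DIM('a)" r] DIM_positive by (auto simp: field_simps)
  show ?thesis
    unfolding nn_integral_sphere_measure[OF assms(1)] 1 2 using r 3
    by (simp add: mult.assoc[symmetric] ennreal_mult[symmetric])
qed

lemma sphere_measure_eq:
  fixes c :: "'a::euclidean_space"
  assumes r: "r > 0"
  shows "sphere_measure c r =
    density (distr unit_sphere_measure borel (\<lambda>p. c + r *\<^sub>R p)) (\<lambda>_. ennreal (r ^ (DIM('a) - 1)))"
proof (rule measure_eqI)
  fix A :: "'a set" assume "A \<in> sets (sphere_measure c r)"
  then have [measurable]: "A \<in> sets borel" by simp
  have "emeasure (sphere_measure c r) A = (\<integral>\<^sup>+p. indicator A p \<partial>sphere_measure c r)" by simp
  also have "\<dots> = ennreal (r ^ (DIM('a) - 1)) * (\<integral>\<^sup>+p. indicator A (c + r *\<^sub>R p) \<partial>unit_sphere_measure)"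
    by (rule nn_integral_sphere_measure_unit[OF _ r]) simp
  also have "(\<integral>\<^sup>+p. indicator A (c + r *\<^sub>R p) \<partial>unit_sphere_measure) =
      emeasure (distr unit_sphere_measure borel (\<lambda>p. c + r *\<^sub>R p)) A"
    by (subst nn_integral_indicator[symmetric]) (simp_all add: nn_integral_distr del: nn_integral_indicator)
  finally show "emeasure (sphere_measure c r) A =
      emeasure (density (distr unit_sphere_measure borel (\<lambda>p. c + r *\<^sub>R p)) (\<lambda>_. ennreal (r ^ (DIM('a) - 1)))) A"
    by (simp add: emeasure_density nn_integral_cmult)
qed simp

lemma integral_sphere_measure:
  fixes f :: "'a::euclidean_space \<Rightarrow> real"
  assumes [measurable]: "f \<in> borel_measurable borel" and r: "r > 0"
  shows "(\<integral>p. f p \<partial>sphere_measure c r) = r ^ (DIM('a) - 1) * (\<integral>p. f (c + r *\<^sub>R p) \<partial>unit_sphere_measure)"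
  using r by (subst sphere_measure_eq[OF r]) (simp add: integral_density integral_distr)

lemma finite_unit_sphere_measure: "finite_measure (unit_sphere_measure :: 'a::euclidean_space measure)"
proof (rule finite_measureI)
  have "emeasure (unit_sphere_measure :: 'a measure) (space unit_sphere_measure) =
      (\<integral>\<^sup>+p. indicator (UNIV::'a set) p \<partial>unit_sphere_measure)" by simp
  also have "\<dots> = ennreal (real DIM('a)) * emeasure lborel (ball (0::'a) 1 - {0})"
    by (subst nn_integral_sphere_measure) simp_all
  also have "\<dots> < \<infinity>"
    using emeasure_mono[of "ball (0::'a) 1 - {0}" "ball 0 1" lborel] emeasure_lborel_ball_finite[of "0::'a" 1]
    by (auto simp: ennreal_mult_less_top intro: order_le_less_trans)
  finally show "emeasure (unit_sphere_measure :: 'a measure) (space unit_sphere_measure) \<noteq> \<infinity>" by simp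
qed

interpretation unit_sphere: finite_measure "unit_sphere_measure :: 'a::euclidean_space measure"
  by (rule finite_unit_sphere_measure)

text \<open>The measure is an image under radial projection, hence concentrated on the sphere
  although it is defined on the Borel sets of the whole space. Cutoffs in |t p| are resolved through
  this.\<close>

lemma AE_unit_sphere: "AE p in unit_sphere_measure. norm (p::'a::euclidean_space) = 1"
proof (rule AE_I')
  have "emeasure unit_sphere_measure {p::'a. norm p \<noteq> 1} =
      (\<integral>\<^sup>+p. indicator {p::'a. norm p \<noteq> 1} p \<partial>unit_sphere_measure)" by simp
  also have "\<dots> = (\<integral>\<^sup>+p. 0 \<partial>(lborel :: 'a measure))"
    by (subst nn_integral_unit_sphere_measure, simp, rule nn_integral_cong) simp
  finally show "{p::'a. norm p \<noteq> 1} \<in> null_sets unit_sphere_measure"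
    by (simp add: null_sets_def)
qed simp

lemma nn_integral_inverse_power:
  assumes a: "a > 0" and n: "n > 0"
  shows "(\<integral>\<^sup>+t. ennreal (if a < t then 1 / t ^ Suc n else 0) \<partial>lborel) = ennreal (1 / (real n * a ^ n))"
proof -
  have "(\<integral>\<^sup>+t. ennreal (if a < t then 1 / t ^ Suc n else 0) \<partial>lborel) =
     (\<integral>\<^sup>+t. ennreal (1 / t ^ Suc n) * indicator {a..} t \<partial>lborel)"
    by (rule nn_integral_cong_AE)
      (use AE_lborel_singleton[of a] in \<open>auto elim!: eventually_mono split: split_indicator\<close>)
  also have "\<dots> = 0 - (- (1 / (real n * a ^ n)))"
  proof (rule nn_integral_FTC_atLeast)
    fix t assume t: "a \<le> t"
    have "((\<lambda>t. - (inverse t ^ n / real n)) has_real_derivative inverse t ^ (n - 1) * inverse t * inverse t) (at t)"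
      using n a t by (auto intro!: derivative_eq_intros simp: power2_eq_square)
    also have "(\<lambda>t. - (inverse t ^ n / real n)) = (\<lambda>t. - (1 / (real n * t ^ n)))"
      by (simp add: fun_eq_iff field_simps)
    also have "inverse t ^ (n - 1) * inverse t * inverse t = 1 / t ^ Suc n"
      using n power_minus_mult[of n "inverse t"] by (simp add: power_inverse field_simps)
    finally show "((\<lambda>t. - (1 / (real n * t ^ n))) has_real_derivative 1 / t ^ Suc n) (at t)" .
    show "0 \<le> 1 / t ^ Suc n" using a t by simp
  next
    show "((\<lambda>t. - (1 / (real n * t ^ n))) \<longlongrightarrow> 0) at_top"
      using n by real_asymp
  qed simp
  finally show ?thesis by simp
qed

text \<open>Since surface measure is defined by solid cones, the right side is a double integral
  over t > 0 and p in the unit ball. Substituting t -> |p| t for fixed p, and then q = t p for fixed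
  t, turns it into the integral of f(q) against N |q|^N / t^(N+1) on |q| < t.\<close>

lemma nn_integral_polar:
  fixes f :: "'a::euclidean_space \<Rightarrow> ennreal"
  assumes [measurable]: "f \<in> borel_measurable borel"
  shows "(\<integral>\<^sup>+p. f p \<partial>lborel) =
    (\<integral>\<^sup>+t. \<integral>\<^sup>+p. ennreal (if 0 < t then t ^ (DIM('a) - 1) else 0) * f (t *\<^sub>R p) \<partial>unit_sphere_measure \<partial>lborel)"
proof -
  define N where "N = DIM('a)"
  have N: "N > 0" by (simp add: N_def)
  define H where "H = (\<lambda>(t::real) q::'a. ennreal (if q \<noteq> 0 \<and> norm q < t then real N * norm q ^ N / t ^ Suc N else 0) * f q)"
  have "(\<integral>\<^sup>+t. \<integral>\<^sup>+p. ennreal (if 0 < t then t ^ (DIM('a) - 1) else 0) * f (t *\<^sub>R p) \<partial>unit_sphere_measure \<partial>lborel)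
    = (\<integral>\<^sup>+t. \<integral>\<^sup>+p. ennreal (if 0 < t \<and> norm p < 1 \<and> p \<noteq> 0 then real N * t ^ (N - 1) else 0) * f ((t / norm p) *\<^sub>R p) \<partial>lborel \<partial>lborel)"
    by (intro nn_integral_cong, subst nn_integral_unit_sphere_measure)
      (auto intro!: nn_integral_cong simp: N_def mult.assoc[symmetric] ennreal_mult[symmetric])
  also have "\<dots> = (\<integral>\<^sup>+p. \<integral>\<^sup>+t. ennreal (if 0 < t \<and> norm p < 1 \<and> p \<noteq> 0 then real N * t ^ (N - 1) else 0) * f ((t / norm p) *\<^sub>R p) \<partial>lborel \<partial>lborel)"
    by (rule lborel_pair.Fubini') simp
  also have "\<dots> = (\<integral>\<^sup>+p. \<integral>\<^sup>+t. ennreal (if 0 < t \<and> norm p < 1 \<and> p \<noteq> 0 then real N * norm p ^ N * t ^ (N - 1) else 0) * f (t *\<^sub>R p) \<partial>lborel \<partial>lborel)"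
  proof (rule nn_integral_cong)
    fix p :: 'a
    show "(\<integral>\<^sup>+t. ennreal (if 0 < t \<and> norm p < 1 \<and> p \<noteq> 0 then real N * t ^ (N - 1) else 0) * f ((t / norm p) *\<^sub>R p) \<partial>lborel) =
        (\<integral>\<^sup>+t. ennreal (if 0 < t \<and> norm p < 1 \<and> p \<noteq> 0 then real N * norm p ^ N * t ^ (N - 1) else 0) * f (t *\<^sub>R p) \<partial>lborel)"
    proof (cases "p = 0")
      case False
      then have np: "norm p > 0" by simp
      have e: "norm p * real N * (norm p * t) ^ (N - Suc 0) = real N * norm p ^ N * t ^ (N - Suc 0)" for t
        using N power_minus_mult[of N "norm p"] by (simp add: power_mult_distrib mult_ac)
      show ?thesis
        by (subst nn_integral_real_affine[where c="norm p" and t=0])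
          (use np in \<open>auto simp: e nn_integral_cmult[symmetric] mult.assoc[symmetric] ennreal_mult[symmetric] zero_less_mult_iff intro!: nn_integral_cong\<close>)
    qed simp
  qed
  also have "\<dots> = (\<integral>\<^sup>+t. \<integral>\<^sup>+p. ennreal (if 0 < t \<and> norm p < 1 \<and> p \<noteq> 0 then real N * norm p ^ N * t ^ (N - 1) else 0) * f (t *\<^sub>R p) \<partial>lborel \<partial>lborel)"
    by (rule lborel_pair.Fubini'[symmetric]) simp
  also have "\<dots> = (\<integral>\<^sup>+t. \<integral>\<^sup>+q. H t q \<partial>lborel \<partial>lborel)"
  proof (rule nn_integral_cong)
    fix t :: real
    show "(\<integral>\<^sup>+p. ennreal (if 0 < t \<and> norm p < 1 \<and> p \<noteq> 0 then real N * norm p ^ N * t ^ (N - 1) else 0) * f (t *\<^sub>R p) \<partial>lborel) =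
       (\<integral>\<^sup>+q. H t q \<partial>lborel)"
    proof (cases "t > 0")
      case True
      have e: "t ^ N * (real N * (t ^ N * x) / (t * t ^ N)) = real N * x * t ^ (N - 1)" for x
        using True N power_minus_mult[of N t] by (simp add: field_simps)
      show ?thesis
        unfolding H_def
        by (subst (2) lborel_nn_integral_affine[where c=t and t=0])
          (use True e in \<open>auto simp: nn_integral_cmult[symmetric] mult.assoc[symmetric] ennreal_mult[symmetric] power_mult_distrib N_def[symmetric] intro!: nn_integral_cong\<close>)
    next
      case False
      have "\<not> norm q < t" for q :: 'a using False norm_ge_zero[of q] by linarith
      then have "H t q = 0" for q by (simp add: H_def)
      with False show ?thesis by simp
    qed
  qed
  also have "\<dots> = (\<integral>\<^sup>+q. \<integral>\<^sup>+t. H t q \<partial>lborel \<partial>lborel)"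
    by (rule lborel_pair.Fubini') (simp add: H_def)
  \<comment> \<open>Now t is integrated alone over (|q|, infinity), where N |q|^N / t^(N+1) has mass
    1 for q different from 0.\<close>
  also have "\<dots> = (\<integral>\<^sup>+q. f q \<partial>lborel)"
  proof (rule nn_integral_cong_AE)
    show "AE q in lborel. (\<integral>\<^sup>+t. H t q \<partial>lborel) = f q"
      using AE_lborel_singleton[of 0]
    proof eventually_elim
      case (elim q)
      have "(\<integral>\<^sup>+t. H t q \<partial>lborel) = (\<integral>\<^sup>+t. ennreal (real N * norm q ^ N) * f q * ennreal (if norm q < t then 1 / t ^ Suc N else 0) \<partial>lborel)"
      proof (rule nn_integral_cong)
        fix t :: real
        have "ennreal (real N * norm q ^ N / t ^ Suc N) = ennreal (real N * norm q ^ N) * ennreal (1 / t ^ Suc N)" if "norm q < t"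
        proof -
          have "t > 0" using that norm_ge_zero[of q] by linarith
          then show ?thesis by (simp add: ennreal_mult[symmetric])
        qed
        then show "H t q = ennreal (real N * norm q ^ N) * f q * ennreal (if norm q < t then 1 / t ^ Suc N else 0)"
          using elim by (simp add: H_def mult_ac del: power_Suc)
      qed
      also have "\<dots> = ennreal (real N * norm q ^ N) * f q * ennreal (1 / (real N * norm q ^ N))"
        using elim N by (subst nn_integral_cmult) (auto simp: nn_integral_inverse_power simp del: power_Suc)
      also have "\<dots> = f q"
        using elim N by (simp add: mult.commute[of _ "f q"] mult.assoc ennreal_mult[symmetric])
      finally show ?case .
    qed
  qed
  finally show ?thesis by simp
qed

text \<open>Proved as an equality of measures: Lebesgue measure is the image of t^(N-1) dt times
  surface measure under (t, p) -> t p. This transfers integrability and signed integrals at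
  once.\<close>

lemma integral_polar:
  fixes f :: "'a::euclidean_space \<Rightarrow> real"
  assumes f: "integrable lborel f"
  shows "integrable lborel (\<lambda>t. \<integral>p. (if 0 < t then t ^ (DIM('a) - 1) else 0) * f (t *\<^sub>R p) \<partial>unit_sphere_measure)"
    and "(\<integral>p. f p \<partial>lborel) =
    (\<integral>t. \<integral>p. (if 0 < t then t ^ (DIM('a) - 1) else 0) * f (t *\<^sub>R p) \<partial>unit_sphere_measure \<partial>lborel)"
proof -
  have [measurable]: "f \<in> borel_measurable borel" using f by auto
  interpret P: pair_sigma_finite "lborel :: real measure" "unit_sphere_measure :: 'a measure" ..
  let ?w = "\<lambda>z::real \<times> 'a. if 0 < fst z then fst z ^ (DIM('a) - 1) else 0"
  let ?M = "density (lborel \<Otimes>\<^sub>M unit_sphere_measure) (\<lambda>z. ennreal (?w z))"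
  have eq: "lborel = distr ?M borel (\<lambda>z. fst z *\<^sub>R snd z)"
  proof (rule measure_eqI)
    fix A :: "'a set" assume "A \<in> sets lborel"
    then have [measurable]: "A \<in> sets borel" by simp
    have "emeasure lborel A = (\<integral>\<^sup>+p. indicator A p \<partial>lborel)" by simp
    also have "\<dots> = (\<integral>\<^sup>+t. \<integral>\<^sup>+p. ennreal (if 0 < t then t ^ (DIM('a) - 1) else 0) * indicator A (t *\<^sub>R p) \<partial>unit_sphere_measure \<partial>lborel)"
      by (rule nn_integral_polar) simp
    also have "\<dots> = (\<integral>\<^sup>+z. ennreal (?w z) * indicator A (fst z *\<^sub>R snd z) \<partial>(lborel \<Otimes>\<^sub>M unit_sphere_measure))"
      by (subst unit_sphere.nn_integral_fst[symmetric]) (simp_all cong: if_cong)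
    also have "\<dots> = (\<integral>\<^sup>+p. indicator A p \<partial>distr ?M borel (\<lambda>z. fst z *\<^sub>R snd z))"
      by (simp add: nn_integral_distr nn_integral_density del: nn_integral_indicator)
    finally show "emeasure lborel A = emeasure (distr ?M borel (\<lambda>z. fst z *\<^sub>R snd z)) A" by simp
  qed simp
  have "integrable ?M (\<lambda>z. f (fst z *\<^sub>R snd z))"
    using f by (subst (asm) eq) (simp add: integrable_distr_eq)
  then have i: "integrable (lborel \<Otimes>\<^sub>M unit_sphere_measure) (\<lambda>z. ?w z * f (fst z *\<^sub>R snd z))"
    by (subst (asm) integrable_density) simp_all
  show "integrable lborel (\<lambda>t. \<integral>p. (if 0 < t then t ^ (DIM('a) - 1) else 0) * f (t *\<^sub>R p) \<partial>unit_sphere_measure)"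
    using P.integrable_fst'[OF i] by (simp cong: if_cong)
  have "(\<integral>p. f p \<partial>lborel) = (\<integral>z. f (fst z *\<^sub>R snd z) \<partial>?M)"
    by (subst eq) (simp add: integral_distr)
  also have "\<dots> = (\<integral>z. ?w z * f (fst z *\<^sub>R snd z) \<partial>(lborel \<Otimes>\<^sub>M unit_sphere_measure))"
    by (subst integral_density) simp_all
  also have "\<dots> = (\<integral>t. \<integral>p. (if 0 < t then t ^ (DIM('a) - 1) else 0) * f (t *\<^sub>R p) \<partial>unit_sphere_measure \<partial>lborel)"
    using P.integral_fst'[OF i] by (simp cong: if_cong)
  finally show "(\<integral>p. f p \<partial>lborel) =
    (\<integral>t. \<integral>p. (if 0 < t then t ^ (DIM('a) - 1) else 0) * f (t *\<^sub>R p) \<partial>unit_sphere_measure \<partial>lborel)" .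
qed

definition sphere_area :: "'a::euclidean_space itself \<Rightarrow> real" where
  "sphere_area _ = measure (unit_sphere_measure :: 'a measure) UNIV"

lemma sphere_area_nonneg: "sphere_area TYPE('a::euclidean_space) \<ge> 0"
  by (simp add: sphere_area_def)

lemma nn_integral_radial:
  fixes f :: "real \<Rightarrow> real"
  assumes [measurable]: "f \<in> borel_measurable borel" and nn: "\<And>t. t > 0 \<Longrightarrow> f t \<ge> 0"
  shows "(\<integral>\<^sup>+p. ennreal (f (norm (p::'a::euclidean_space))) \<partial>lborel) =
    ennreal (sphere_area TYPE('a)) * (\<integral>\<^sup>+t. ennreal (if 0 < t then t ^ (DIM('a) - 1) * f t else 0) \<partial>lborel)"
proof -
  have "(\<integral>\<^sup>+p. ennreal (f (norm (p::'a))) \<partial>lborel) =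
    (\<integral>\<^sup>+t. \<integral>\<^sup>+p. ennreal (if 0 < t then t ^ (DIM('a) - 1) else 0) * ennreal (f (norm (t *\<^sub>R (p::'a)))) \<partial>unit_sphere_measure \<partial>lborel)"
    by (rule nn_integral_polar) simp
  also have "\<dots> = (\<integral>\<^sup>+t. ennreal (sphere_area TYPE('a)) * ennreal (if 0 < t then t ^ (DIM('a) - 1) * f t else 0) \<partial>lborel)"
  proof (rule nn_integral_cong)
    fix t :: real
    have "(\<integral>\<^sup>+p. ennreal (if 0 < t then t ^ (DIM('a) - 1) else 0) * ennreal (f (norm (t *\<^sub>R (p::'a)))) \<partial>unit_sphere_measure)
      = (\<integral>\<^sup>+p. ennreal (if 0 < t then t ^ (DIM('a) - 1) * f t else 0) \<partial>(unit_sphere_measure :: 'a measure))"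
      by (rule nn_integral_cong_AE)
        (use AE_unit_sphere[where 'a='a] nn in \<open>auto elim!: eventually_mono simp: ennreal_mult[symmetric]\<close>)
    then show "(\<integral>\<^sup>+p. ennreal (if 0 < t then t ^ (DIM('a) - 1) else 0) * ennreal (f (norm (t *\<^sub>R (p::'a)))) \<partial>unit_sphere_measure)
      = ennreal (sphere_area TYPE('a)) * ennreal (if 0 < t then t ^ (DIM('a) - 1) * f t else 0)"
      by (simp add: sphere_area_def unit_sphere.emeasure_eq_measure mult.commute)
  qed
  finally show ?thesis by (simp add: nn_integral_cmult)
qed

lemma
  fixes \<beta> R :: real
  assumes b: "real DIM('a::euclidean_space) + \<beta> > 0" and R: "R > 0"
  shows integrable_powr_ball: "integrable lborel (\<lambda>p::'a. norm p powr \<beta> * indicator (ball 0 R) p)"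
    and integral_powr_ball: "(\<integral>p. norm (p::'a) powr \<beta> * indicator (ball 0 R) p \<partial>lborel) =
      sphere_area TYPE('a) * R powr (real DIM('a) + \<beta>) / (real DIM('a) + \<beta>)"
proof -
  let ?g = "\<lambda>t::real. if 0 < t then t ^ (DIM('a) - 1) * (t powr \<beta> * indicator {..<R} t) else 0"
  let ?N = "real DIM('a)"
  have hi: "((\<lambda>t. t powr (?N + \<beta> - 1)) has_integral (R powr (?N + \<beta> - 1 + 1) / (?N + \<beta> - 1 + 1))) {0..R}"
    by (rule has_integral_powr_from_0) (use b R in auto)
  have "(\<integral>\<^sup>+t. ennreal (?g t) \<partial>lborel) = (\<integral>\<^sup>+t. ennreal (t powr (?N + \<beta> - 1)) * indicator {0..R} t \<partial>lborel)"
  proof (rule nn_integral_cong_AE)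
    show "AE t in lborel. ennreal (?g t) = ennreal (t powr (?N + \<beta> - 1)) * indicator {0..R} t"
      using AE_lborel_singleton[of R]
    proof eventually_elim
      case (elim t)
      have "t ^ (DIM('a) - 1) * t powr \<beta> = t powr (?N + \<beta> - 1)" if "t > 0"
        using that DIM_positive[where 'a='a] by (simp add: powr_realpow[symmetric] powr_add[symmetric] of_nat_diff Suc_leI algebra_simps)
      then show ?case using elim by (auto simp: indicator_def)
    qed
  qed
  also have "\<dots> = ennreal (R powr (?N + \<beta>) / (?N + \<beta>))"
    using nn_integral_has_integral_lebesgue'[OF _ hi] by simp
  finally have "(\<integral>\<^sup>+p. ennreal (norm (p::'a) powr \<beta> * indicator {..<R} (norm p)) \<partial>lborel) =
      ennreal (sphere_area TYPE('a)) * ennreal (R powr (?N + \<beta>) / (?N + \<beta>))"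
    by (subst nn_integral_radial) simp_all
  moreover have "R powr (?N + \<beta>) / (?N + \<beta>) \<ge> 0" using b by (intro divide_nonneg_pos) auto
  moreover have "indicator {..<R} (norm p) = (indicator (ball 0 R) p :: real)" for p :: 'a
    by (auto simp: indicator_def)
  ultimately have e: "(\<integral>\<^sup>+p. ennreal (norm (p::'a) powr \<beta> * indicator (ball 0 R) p) \<partial>lborel) =
      ennreal (sphere_area TYPE('a) * R powr (?N + \<beta>) / (?N + \<beta>))"
    using sphere_area_nonneg[where 'a='a] by (simp only: ennreal_mult[symmetric] times_divide_eq_right)
  have nn: "0 \<le> sphere_area TYPE('a) * R powr (?N + \<beta>) / (?N + \<beta>)"
    using b sphere_area_nonneg[where 'a='a] by (intro divide_nonneg_pos mult_nonneg_nonneg) auto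
  have "(\<lambda>p::'a. norm p powr \<beta> * indicator (ball 0 R) p) \<in> borel_measurable lborel"
    by (intro borel_measurable_times borel_measurable_indicator) simp_all
  then show int: "integrable lborel (\<lambda>p::'a. norm p powr \<beta> * indicator (ball 0 R) p)"
    by (rule integrableI_nn_integral_finite[OF _ _ e]) simp
  have "(\<integral>p. norm (p::'a) powr \<beta> * indicator (ball 0 R) p \<partial>lborel) =
      enn2real (\<integral>\<^sup>+p. ennreal (norm (p::'a) powr \<beta> * indicator (ball 0 R) p) \<partial>lborel)"
    by (rule integral_eq_nn_integral) (use borel_measurable_integrable[OF int] in auto)
  then show "(\<integral>p. norm (p::'a) powr \<beta> * indicator (ball 0 R) p \<partial>lborel) =
      sphere_area TYPE('a) * R powr (?N + \<beta>) / (?N + \<beta>)"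
    unfolding e using nn by (simp only: enn2real_ennreal)
qed

lemma
  fixes \<beta> R :: real
  assumes b: "real DIM('a::euclidean_space) + \<beta> < 0" and R: "R > 0"
  shows integrable_powr_outside: "integrable lborel (\<lambda>p::'a. norm p powr \<beta> * indicator (- ball 0 R) p)"
    and integral_powr_outside: "(\<integral>p. norm (p::'a) powr \<beta> * indicator (- ball 0 R) p \<partial>lborel) =
      sphere_area TYPE('a) * R powr (real DIM('a) + \<beta>) / (- (real DIM('a) + \<beta>))"
proof -
  let ?g = "\<lambda>t::real. if 0 < t then t ^ (DIM('a) - 1) * (t powr \<beta> * indicator {R..} t) else 0"
  let ?N = "real DIM('a)"
  have hi: "((\<lambda>t. t powr (?N + \<beta> - 1)) has_integral - (R powr (?N + \<beta> - 1 + 1)) / (?N + \<beta> - 1 + 1)) {R..}"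
    by (rule has_integral_powr_to_inf) (use b R in auto)
  have "(\<integral>\<^sup>+t. ennreal (?g t) \<partial>lborel) = (\<integral>\<^sup>+t. ennreal (t powr (?N + \<beta> - 1)) * indicator {R..} t \<partial>lborel)"
  proof (rule nn_integral_cong)
    fix t :: real
    have "t ^ (DIM('a) - 1) * t powr \<beta> = t powr (?N + \<beta> - 1)" if "t > 0"
      using that DIM_positive[where 'a='a] by (simp add: powr_realpow[symmetric] powr_add[symmetric] of_nat_diff Suc_leI algebra_simps)
    then show "ennreal (?g t) = ennreal (t powr (?N + \<beta> - 1)) * indicator {R..} t"
      using R by (auto simp: indicator_def)
  qed
  also have "\<dots> = ennreal (R powr (?N + \<beta>) / (- (?N + \<beta>)))"
    using nn_integral_has_integral_lebesgue'[OF _ hi] by (simp add: minus_divide_right)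
  finally have "(\<integral>\<^sup>+p. ennreal (norm (p::'a) powr \<beta> * indicator {R..} (norm p)) \<partial>lborel) =
      ennreal (sphere_area TYPE('a)) * ennreal (R powr (?N + \<beta>) / (- (?N + \<beta>)))"
    by (subst nn_integral_radial) simp_all
  moreover have "R powr (?N + \<beta>) / (- (?N + \<beta>)) \<ge> 0" using b by (intro divide_nonneg_pos) auto
  moreover have "indicator {R..} (norm p) = (indicator (- ball 0 R) p :: real)" for p :: 'a
    by (auto simp: indicator_def)
  ultimately have e: "(\<integral>\<^sup>+p. ennreal (norm (p::'a) powr \<beta> * indicator (- ball 0 R) p) \<partial>lborel) =
      ennreal (sphere_area TYPE('a) * R powr (?N + \<beta>) / (- (?N + \<beta>)))"
    using sphere_area_nonneg[where 'a='a] by (simp only: ennreal_mult[symmetric] times_divide_eq_right)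
  have nn: "0 \<le> sphere_area TYPE('a) * R powr (?N + \<beta>) / (- (?N + \<beta>))"
    using b sphere_area_nonneg[where 'a='a] by (intro divide_nonneg_pos mult_nonneg_nonneg) auto
  have "(\<lambda>p::'a. norm p powr \<beta> * indicator (- ball 0 R) p) \<in> borel_measurable lborel"
    by (intro borel_measurable_times borel_measurable_indicator) simp_all
  then show int: "integrable lborel (\<lambda>p::'a. norm p powr \<beta> * indicator (- ball 0 R) p)"
    by (rule integrableI_nn_integral_finite[OF _ _ e]) simp
  have "(\<integral>p. norm (p::'a) powr \<beta> * indicator (- ball 0 R) p \<partial>lborel) =
      enn2real (\<integral>\<^sup>+p. ennreal (norm (p::'a) powr \<beta> * indicator (- ball 0 R) p) \<partial>lborel)"
    by (rule integral_eq_nn_integral) (use borel_measurable_integrable[OF int] in auto)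
  then show "(\<integral>p. norm (p::'a) powr \<beta> * indicator (- ball 0 R) p \<partial>lborel) =
      sphere_area TYPE('a) * R powr (?N + \<beta>) / (- (?N + \<beta>))"
    unfolding e using nn by (simp only: enn2real_ennreal)
qed

section \<open>Ball and sphere integrals against a homogeneous weight\<close>

text \<open>Two instances occur, \<open>|y|^a\<close> on R^(n+1) and the constant 1 on R^n, so that
  thick and thin integrals share one calculus. For s > 1/2 the exponent a is negative and the weight
  unbounded near y = 0; hence integrability on the unit sphere is assumed rather than
  continuity.\<close>

locale homogeneous_weight =
  fixes W :: "'a::euclidean_space \<Rightarrow> real" and \<alpha> :: real
  assumes W_borel[measurable]: "W \<in> borel_measurable borel"
    and W_hom: "t > 0 \<Longrightarrow> W (t *\<^sub>R p) = t powr \<alpha> * W p"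
    and W_dim: "real DIM('a) + \<alpha> > 0"
    and W_int: "integrable unit_sphere_measure W"
begin

definition ball_int :: "('a \<Rightarrow> real) \<Rightarrow> real \<Rightarrow> real" where
  "ball_int k r = (\<integral>p. indicator (ball 0 r) p * (k p * W p) \<partial>lborel)"

definition sph_int :: "('a \<Rightarrow> real) \<Rightarrow> real \<Rightarrow> real" where
  "sph_int k r = (\<integral>p. k p * W p \<partial>sphere_measure 0 r)"

lemma sph_int_unit:
  assumes k: "continuous_on UNIV k" and r: "r > 0"
  shows "sph_int k r = r powr (real DIM('a) - 1 + \<alpha>) * (\<integral>p. k (r *\<^sub>R p) * W p \<partial>unit_sphere_measure)"
proof -
  have [measurable]: "k \<in> borel_measurable borel" using k by (rule borel_measurable_continuous_onI)
  have "sph_int k r = r ^ (DIM('a) - 1) * (\<integral>p. r powr \<alpha> * (k (r *\<^sub>R p) * W p) \<partial>unit_sphere_measure)"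
    unfolding sph_int_def by (subst integral_sphere_measure[OF _ r]) (auto simp: W_hom[OF r] mult_ac)
  also have "\<dots> = r powr (real DIM('a) - 1) * r powr \<alpha> * (\<integral>p. k (r *\<^sub>R p) * W p \<partial>unit_sphere_measure)"
    using r DIM_positive[where 'a='a] by (simp add: powr_realpow[symmetric] of_nat_diff Suc_leI)
  finally show ?thesis by (simp add: powr_add)
qed

lemma bounded_on_cball:
  fixes k :: "'a \<Rightarrow> 'c::real_normed_vector"
  assumes k: "continuous_on UNIV k"
  obtains B where "B \<ge> 0" "\<And>p. norm p \<le> r \<Longrightarrow> norm (k p) \<le> B"
proof -
  have "bounded (k ` cball 0 r)"
    by (rule compact_imp_bounded, rule compact_continuous_image)
      (use k in \<open>auto intro: continuous_on_subset\<close>)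
  then obtain B where B: "\<forall>p\<in>cball 0 r. norm (k p) \<le> B"
    unfolding bounded_iff by blast
  then have "norm (k p) \<le> B" if "norm p \<le> r" for p using that by simp
  then show ?thesis using that[of "max B 0"] by (auto simp: le_max_iff_disj)
qed

text \<open>In polar coordinates homogeneity separates the variables: the radial factor t^(N - 1 +
  \<alpha>) is integrable at 0 by \<open>W_dim\<close>, the angular one by
  \<open>W_int\<close>.\<close>

lemma integrable_weight_ball: "integrable lborel (\<lambda>p. indicator (ball 0 r) p * \<bar>W p\<bar>)"
proof (cases "r > 0")
  case True
  have iW: "integrable unit_sphere_measure (\<lambda>p. \<bar>W p\<bar>)" using W_int by simp
  have hi: "((\<lambda>t. t powr (real DIM('a) + \<alpha> - 1)) has_integral (r powr (real DIM('a) + \<alpha> - 1 + 1) / (real DIM('a) + \<alpha> - 1 + 1))) {0..r}"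
    by (rule has_integral_powr_from_0) (use W_dim True in auto)
  have "(\<integral>\<^sup>+p. ennreal (indicator (ball 0 r) p * \<bar>W p\<bar>) \<partial>lborel) =
    (\<integral>\<^sup>+t. \<integral>\<^sup>+p. ennreal (if 0 < t then t ^ (DIM('a) - 1) else 0) * ennreal (indicator (ball 0 r) (t *\<^sub>R p) * \<bar>W (t *\<^sub>R p)\<bar>) \<partial>unit_sphere_measure \<partial>lborel)"
    by (rule nn_integral_polar) simp
  also have "\<dots> \<le> (\<integral>\<^sup>+t. \<integral>\<^sup>+p. ennreal (t powr (real DIM('a) + \<alpha> - 1)) * indicator {0..r} t * ennreal \<bar>W p\<bar> \<partial>unit_sphere_measure \<partial>lborel)"
  proof (rule nn_integral_mono, rule nn_integral_mono_AE)
    fix t :: real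
    show "AE p in unit_sphere_measure. ennreal (if 0 < t then t ^ (DIM('a) - 1) else 0) * ennreal (indicator (ball 0 r) (t *\<^sub>R p) * \<bar>W (t *\<^sub>R p)\<bar>) \<le>
       ennreal (t powr (real DIM('a) + \<alpha> - 1)) * indicator {0..r} t * ennreal \<bar>W p\<bar>"
      using AE_unit_sphere
    proof eventually_elim
      case (elim p)
      have e: "t ^ (DIM('a) - Suc 0) * (t powr \<alpha> * \<bar>W p\<bar>) = t powr (real DIM('a) + \<alpha> - 1) * \<bar>W p\<bar>" if "t > 0"
        unfolding mult.assoc[symmetric] using that DIM_positive[where 'a='a] by (simp add: powr_realpow[symmetric] powr_add[symmetric] of_nat_diff Suc_leI algebra_simps)
      then show ?case
        using elim by (simp add: indicator_def W_hom abs_mult ennreal_mult[symmetric] e)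
    qed
  qed
  also have "\<dots> = (\<integral>\<^sup>+t. ennreal (t powr (real DIM('a) + \<alpha> - 1)) * indicator {0..r} t \<partial>lborel) * (\<integral>\<^sup>+p. ennreal \<bar>W p\<bar> \<partial>unit_sphere_measure)"
    by (simp add: nn_integral_cmult nn_integral_multc)
  also have "\<dots> < \<infinity>"
    using nn_integral_has_integral_lebesgue'[OF _ hi] iW
    by (auto simp: ennreal_mult_less_top integrable_iff_bounded)
  finally have fin: "(\<integral>\<^sup>+p. ennreal (indicator (ball 0 r) p * \<bar>W p\<bar>) \<partial>lborel) < \<infinity>" .
  have "(\<lambda>p. indicator (ball 0 r) p * \<bar>W p\<bar>) \<in> borel_measurable lborel"
    by (intro borel_measurable_times borel_measurable_indicator) simp_all
  then show ?thesis by (rule integrableI_bounded) (use fin in \<open>simp add: abs_mult\<close>)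
next
  case False
  then show ?thesis by (simp add: ball_empty)
qed

lemma ball_int_integrable:
  assumes k: "continuous_on UNIV k"
  shows "integrable lborel (\<lambda>p. indicator (ball 0 r) p * (k p * W p))"
proof -
  have [measurable]: "k \<in> borel_measurable borel" using k by (rule borel_measurable_continuous_onI)
  obtain B where B: "B \<ge> 0" "\<And>p. norm p \<le> r \<Longrightarrow> norm (k p) \<le> B" using bounded_on_cball[OF k] by blast
  have 1: "integrable lborel (\<lambda>p. B * (indicator (ball 0 r) p * \<bar>W p\<bar>))"
    by (rule integrable_mult_right[OF integrable_weight_ball])
  show ?thesis
    by (rule Bochner_Integration.integrable_bound[OF 1])
      (use B in \<open>auto simp: indicator_def abs_mult intro!: AE_I2 mult_right_mono\<close>)
qed

lemma sphere_integrable: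
  assumes k: "continuous_on UNIV k"
  shows "integrable unit_sphere_measure (\<lambda>p. k (r *\<^sub>R p) * W p)"
proof -
  have [measurable]: "k \<in> borel_measurable borel" using k by (rule borel_measurable_continuous_onI)
  obtain B where B: "B \<ge> 0" "\<And>p. norm p \<le> \<bar>r\<bar> \<Longrightarrow> norm (k p) \<le> B" using bounded_on_cball[OF k] by blast
  have 1: "integrable unit_sphere_measure (\<lambda>p. B * W p)" using W_int by simp
  show ?thesis
    by (rule Bochner_Integration.integrable_bound[OF 1])
      (use B AE_unit_sphere in \<open>auto simp: abs_mult intro!: mult_right_mono elim!: eventually_mono\<close>)
qed

lemma sphere_isCont:
  assumes k: "continuous_on UNIV k"
  shows "isCont (\<lambda>r. \<integral>p. k (r *\<^sub>R p) * W p \<partial>unit_sphere_measure) r"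
proof -
  have [measurable]: "k \<in> borel_measurable borel" using k by (rule borel_measurable_continuous_onI)
  obtain B where B: "B \<ge> 0" "\<And>p. norm p \<le> \<bar>r\<bar> + 1 \<Longrightarrow> norm (k p) \<le> B" using bounded_on_cball[OF k] by blast
  show ?thesis
  unfolding isCont_def
proof (rule integral_tendsto_at[where w="\<lambda>p. B * \<bar>W p\<bar>"])
  show "integrable unit_sphere_measure (\<lambda>p. B * \<bar>W p\<bar>)" using W_int by simp
  show "AE p in unit_sphere_measure. ((\<lambda>r. k (r *\<^sub>R p) * W p) \<longlongrightarrow> k (r *\<^sub>R p) * W p) (at r)"
  proof (rule AE_I2)
    fix p :: 'a
    have "isCont k (r *\<^sub>R p)" using k by (simp add: continuous_on_eq_continuous_at)
    then show "((\<lambda>r. k (r *\<^sub>R p) * W p) \<longlongrightarrow> k (r *\<^sub>R p) * W p) (at r)"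
      by (intro tendsto_mult tendsto_const isCont_tendsto_compose[of _ k]) (auto intro!: tendsto_intros)
  qed
  have "eventually (\<lambda>t. dist t r < 1) (at r)" by (auto simp: eventually_at intro!: exI[of _ 1])
  then show "\<forall>\<^sub>F t in at r. (\<lambda>p. k (t *\<^sub>R p) * W p) \<in> borel_measurable unit_sphere_measure \<and>
      (AE p in unit_sphere_measure. \<bar>k (t *\<^sub>R p) * W p\<bar> \<le> B * \<bar>W p\<bar>)"
  proof eventually_elim
    case (elim t)
    have "AE p in unit_sphere_measure. \<bar>k (t *\<^sub>R p) * W p\<bar> \<le> B * \<bar>W p\<bar>"
      using AE_unit_sphere
    proof eventually_elim
      case (elim p)
      have "norm (t *\<^sub>R p) \<le> \<bar>r\<bar> + 1" using elim \<open>dist t r < 1\<close> by (auto simp: dist_real_def)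
      from B(2)[OF this] show ?case by (simp add: abs_mult mult_right_mono)
    qed
    then show ?case by simp
  qed
qed simp
qed

lemma sph_int_continuous_on:
  assumes k: "continuous_on UNIV k"
  shows "continuous_on {0<..} (sph_int k)"
proof -
  have "continuous_on {0<..} (\<lambda>r. r powr (real DIM('a) - 1 + \<alpha>) * (\<integral>p. k (r *\<^sub>R p) * W p \<partial>unit_sphere_measure))"
    by (intro continuous_intros continuous_at_imp_continuous_on ballI sphere_isCont[OF k]) auto
  then show ?thesis by (rule continuous_on_eq) (simp add: sph_int_unit[OF k])
qed

lemma ball_int_polar:
  assumes k: "continuous_on UNIV k"
  shows "integrable lborel (\<lambda>t. indicator {0<..<r} t * sph_int k t)"
    "ball_int k r = (\<integral>t. indicator {0<..<r} t * sph_int k t \<partial>lborel)"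
proof -
  have [measurable]: "k \<in> borel_measurable borel" using k by (rule borel_measurable_continuous_onI)
  have e: "(\<integral>p. (if 0 < t then t ^ (DIM('a) - 1) else 0) * (indicator (ball 0 r) (t *\<^sub>R p) * (k (t *\<^sub>R p) * W (t *\<^sub>R p))) \<partial>unit_sphere_measure)
    = indicator {0<..<r} t * sph_int k t" for t
  proof -
    have "(\<integral>p. (if 0 < t then t ^ (DIM('a) - 1) else 0) * (indicator (ball 0 r) (t *\<^sub>R p) * (k (t *\<^sub>R p) * W (t *\<^sub>R p))) \<partial>unit_sphere_measure)
      = (\<integral>p. indicator {0<..<r} t * (t ^ (DIM('a) - 1) * (k (t *\<^sub>R p) * W (t *\<^sub>R p))) \<partial>unit_sphere_measure)"
      by (rule integral_cong_AE) (use AE_unit_sphere in \<open>auto elim!: eventually_mono simp: indicator_def\<close>)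
    also have "\<dots> = indicator {0<..<r} t * sph_int k t"
    proof (cases "0 < t \<and> t < r")
      case True
      have "sph_int k t = t ^ (DIM('a) - 1) * (\<integral>p. k (t *\<^sub>R p) * W (t *\<^sub>R p) \<partial>unit_sphere_measure)"
        unfolding sph_int_def by (subst integral_sphere_measure) (use True in simp_all)
      with True show ?thesis by simp
    qed auto
    finally show ?thesis .
  qed
  show "integrable lborel (\<lambda>t. indicator {0<..<r} t * sph_int k t)"
    "ball_int k r = (\<integral>t. indicator {0<..<r} t * sph_int k t \<partial>lborel)"
    using integral_polar[OF ball_int_integrable[OF k, of r]] by (simp_all only: e ball_int_def)
qed

text \<open>By polar coordinates \<open>ball_int\<close> is the integral of \<open>sph_int\<close>
  over the radius, so this is the fundamental theorem of calculus at a point of continuity.\<close>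

lemma ball_int_deriv:
  assumes k: "continuous_on UNIV k" and r: "r > 0"
  shows "(ball_int k has_real_derivative sph_int k r) (at r)"
proof -
  \<comment> \<open>Continuity of \<open>sph_int\<close> is known for positive radii only, so the
    part below r / 2 is kept as a constant.\<close>
  let ?a = "r / 2"
  have c: "continuous_on {?a..2*r} (sph_int k)"
    using sph_int_continuous_on[OF k] by (rule continuous_on_subset) (use r in auto)
  have "((\<lambda>x. ball_int k ?a + integral {?a..x} (sph_int k)) has_real_derivative 0 + sph_int k r) (at r within {?a..2*r})"
    by (intro DERIV_add DERIV_const integral_has_real_derivative[OF c]) (use r in auto)
  then have d: "((\<lambda>x. ball_int k ?a + integral {?a..x} (sph_int k)) has_real_derivative sph_int k r) (at r)"
    using r by (simp add: at_within_Icc_at)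
  have "eventually (\<lambda>x. x \<in> {?a<..<2*r}) (nhds r)"
    by (rule eventually_nhds_in_open) (use r in auto)
  then have ev: "eventually (\<lambda>x. ball_int k ?a + integral {?a..x} (sph_int k) = ball_int k x) (nhds r)"
  proof eventually_elim
    case (elim x)
    have cx: "continuous_on {?a..x} (sph_int k)" using c by (rule continuous_on_subset) (use elim in auto)
    have i: "integrable lborel (\<lambda>t. indicator {?a..x} t *\<^sub>R sph_int k t)"
      by (rule borel_integrable_compact) (use cx in auto)
    have "ball_int k x = (\<integral>t. indicator {0<..<?a} t * sph_int k t + indicator {?a..x} t *\<^sub>R sph_int k t \<partial>lborel)"
      unfolding ball_int_polar(2)[OF k]
    proof (rule integral_cong_AE)
      show "AE t in lborel. indicator {0<..<x} t * sph_int k t = indicator {0<..<?a} t * sph_int k t + indicator {?a..x} t *\<^sub>R sph_int k t"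
        using AE_lborel_singleton[of x] by eventually_elim (use elim r in \<open>auto simp: indicator_def\<close>)
      show "(\<lambda>t. indicator {0<..<?a} t * sph_int k t + indicator {?a..x} t *\<^sub>R sph_int k t) \<in> borel_measurable lborel"
        by (intro borel_measurable_add borel_measurable_integrable[OF ball_int_polar(1)[OF k]] borel_measurable_integrable[OF i])
    qed (rule borel_measurable_integrable[OF ball_int_polar(1)[OF k]])
    also have "\<dots> = ball_int k ?a + integral {?a..x} (sph_int k)"
      unfolding ball_int_polar(2)[OF k, of ?a]
      using set_borel_integral_eq_integral(2)[of "{?a..x}" "sph_int k"] i
      by (subst Bochner_Integration.integral_add[OF ball_int_polar(1)[OF k] i])
        (simp add: set_integrable_def set_lebesgue_integral_def)
    finally show ?case by simp
  qed
  show ?thesis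
    by (rule DERIV_cong_ev[THEN iffD1, OF refl ev refl d])
qed

text \<open>On the fixed unit sphere the radius appears only in r^(N - 1 + \<alpha>) and in k(r p);
  the radial derivative G(r p) . p equals (G q . q) / r at the point q = r p.\<close>

lemma sph_int_deriv:
  assumes k: "\<And>p. (k has_derivative (\<lambda>h. G p \<bullet> h)) (at p)" and G: "continuous_on UNIV G" and r: "r > 0"
  shows "(sph_int k has_real_derivative
    (real DIM('a) - 1 + \<alpha>) / r * sph_int k r + sph_int (\<lambda>p. G p \<bullet> p) r / r) (at r)"
proof -
  have ck: "continuous_on UNIV k" 
    by (rule has_derivative_continuous_on) (use k in \<open>auto intro: has_derivative_at_withinI\<close>)
  have cG: "continuous_on UNIV (\<lambda>p. G p \<bullet> p)" by (intro continuous_intros G)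
  obtain B where B: "B \<ge> 0" "\<And>p. norm p \<le> r + 1 \<Longrightarrow> norm (G p) \<le> B" using bounded_on_cball[OF G] by blast
  let ?\<Phi> = "\<lambda>r. \<integral>p. k (r *\<^sub>R p) * W p \<partial>unit_sphere_measure"
  let ?D = "\<integral>p. (G (r *\<^sub>R p) \<bullet> p) * W p \<partial>unit_sphere_measure"
  \<comment> \<open>\<open>has_derivative_integral\<close> asks for its bounds at every point of the
    space, so the measure is restricted to |p| = 1, where |t p| is controlled.\<close>
  define M where "M = (restrict_space unit_sphere_measure {p. norm p = 1} :: 'a measure)"
  have res: "(\<integral>p. f p \<partial>unit_sphere_measure) = (\<integral>p. f p \<partial>M)" if "f \<in> borel_measurable borel" for f :: "'a \<Rightarrow> real"
  proof -
    have "(\<integral>p. f p \<partial>unit_sphere_measure) = (\<integral>p. indicator {p. norm p = 1} p *\<^sub>R f p \<partial>unit_sphere_measure)"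
      by (rule integral_cong_AE) (use that AE_unit_sphere in \<open>auto elim!: eventually_mono\<close>)
    then show ?thesis by (simp add: M_def integral_restrict_space)
  qed
  have resi: "integrable M f" if "integrable unit_sphere_measure f" for f :: "'a \<Rightarrow> real"
    unfolding M_def using that by (subst integrable_restrict_space) (auto intro!: integrable_mult_indicator[where 'b=real, simplified])
  have [measurable]: "k \<in> borel_measurable borel" "(\<lambda>p. G p) \<in> borel_measurable borel"
    using ck G by (auto intro: borel_measurable_continuous_onI)
  have "((\<lambda>r. \<integral>p. k (r *\<^sub>R p) * W p \<partial>M) has_derivative (\<lambda>h. \<integral>p. (G (r *\<^sub>R p) \<bullet> (h *\<^sub>R p)) * W p \<partial>M)) (at r)"
  proof (rule has_derivative_integral(2)[where e=1 and w="\<lambda>p. B * \<bar>W p\<bar>"])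
    show "integrable M (\<lambda>p. k (t *\<^sub>R p) * W p)" for t by (rule resi[OF sphere_integrable[OF ck]])
    show "integrable M (\<lambda>p. B * \<bar>W p\<bar>)" using W_int by (intro resi) simp
    fix p assume "p \<in> space M"
    then have p: "norm p = 1" by (simp add: M_def space_restrict_space)
    have "((\<lambda>t. k (t *\<^sub>R p)) has_derivative (\<lambda>h. G (r *\<^sub>R p) \<bullet> (h *\<^sub>R p))) (at r)"
      by (rule has_derivative_compose[where g=k and f="\<lambda>t. t *\<^sub>R p"]) (use k in \<open>auto intro!: derivative_eq_intros\<close>)
    then show "((\<lambda>t. k (t *\<^sub>R p) * W p) has_derivative (\<lambda>h. G (r *\<^sub>R p) \<bullet> h *\<^sub>R p * W p)) (at r)"
      by (rule has_derivative_mult_left)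
    fix t assume t: "dist t r < 1"
    have "\<bar>k (t *\<^sub>R p) - k (r *\<^sub>R p)\<bar> \<le> B * norm (t *\<^sub>R p - r *\<^sub>R p)"
      by (rule gradient_bound[of "cball 0 (r+1)" k G]) (use k B p t r in \<open>auto simp: dist_real_def\<close>)
    also have "\<dots> = B * \<bar>t - r\<bar>" using p by (simp add: scaleR_diff_left[symmetric])
    finally show "\<bar>k (t *\<^sub>R p) * W p - k (r *\<^sub>R p) * W p\<bar> \<le> B * \<bar>W p\<bar> * norm (t - r)"
      using mult_right_mono[of "\<bar>k (t *\<^sub>R p) - k (r *\<^sub>R p)\<bar>" "B * \<bar>t - r\<bar>" "\<bar>W p\<bar>"]
      by (simp flip: left_diff_distrib abs_mult add: mult_ac) (simp add: abs_mult[symmetric] right_diff_distrib)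
  qed simp
  moreover have "(\<integral>p. (G (r *\<^sub>R p) \<bullet> (h *\<^sub>R p)) * W p \<partial>M) = ?D * h" for h
    by (subst res) (auto simp: mult_ac)
  ultimately have "((\<lambda>r. \<integral>p. k (r *\<^sub>R p) * W p \<partial>M) has_real_derivative ?D) (at r)"
    unfolding has_field_derivative_def by (simp only:)
  then have d: "(?\<Phi> has_real_derivative ?D) (at r)"
    by (subst res) simp_all
  have D: "sph_int (\<lambda>p. G p \<bullet> p) r = r powr (real DIM('a) - 1 + \<alpha>) * (r * ?D)"
    by (simp add: sph_int_unit[OF cG r] mult.assoc)
  let ?b = "real DIM('a) - 1 + \<alpha>"
  have "((\<lambda>r. r powr ?b * ?\<Phi> r) has_real_derivative ?b / r * (r powr ?b * ?\<Phi> r) + r powr ?b * ?D) (at r)"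
  proof -
    have "((\<lambda>r. r powr ?b * ?\<Phi> r) has_real_derivative ?b * r powr (?b - 1) * ?\<Phi> r + ?D * r powr ?b) (at r)"
      by (rule DERIV_mult[OF has_real_derivative_powr[OF r] d])
    moreover have "r powr (?b - 1) = r powr ?b / r" using r powr_diff[of r ?b 1] by simp
    ultimately show ?thesis by (simp only: times_divide_eq_right times_divide_eq_left mult_ac)
  qed
  also have "?b / r * (r powr ?b * ?\<Phi> r) + r powr ?b * ?D = ?b / r * sph_int k r + sph_int (\<lambda>p. G p \<bullet> p) r / r"
    using r by (simp add: D sph_int_unit[OF ck r])
  finally have "((\<lambda>r. r powr ?b * ?\<Phi> r) has_real_derivative ?b / r * sph_int k r + sph_int (\<lambda>p. G p \<bullet> p) r / r) (at r)" .
  moreover have "eventually (\<lambda>r. r powr ?b * ?\<Phi> r = sph_int k r) (nhds r)"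
    using eventually_nhds_in_open[of "{0<..}" r] r by (auto elim!: eventually_mono simp: sph_int_unit[OF ck])
  ultimately show ?thesis by (subst (asm) DERIV_cong_ev[OF refl _ refl])
qed

lemma sph_int_lincomb:
  assumes "continuous_on UNIV k" "continuous_on UNIV l" and r: "r > 0"
  shows "sph_int (\<lambda>p. a * k p + b * l p) r = a * sph_int k r + b * sph_int l r"
proof -
  have "continuous_on UNIV (\<lambda>p. a * k p + b * l p)" by (intro continuous_intros assms)
  moreover have "(\<integral>p. (a * k (r *\<^sub>R p) + b * l (r *\<^sub>R p)) * W p \<partial>unit_sphere_measure)
    = (\<integral>p. a * (k (r *\<^sub>R p) * W p) + b * (l (r *\<^sub>R p) * W p) \<partial>unit_sphere_measure)"
    by (simp add: algebra_simps)
  moreover have "\<dots> = a * (\<integral>p. k (r *\<^sub>R p) * W p \<partial>unit_sphere_measure) + b * (\<integral>p. l (r *\<^sub>R p) * W p \<partial>unit_sphere_measure)"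
    using sphere_integrable[OF assms(1), of r] sphere_integrable[OF assms(2), of r] by simp
  ultimately show ?thesis using assms by (simp add: sph_int_unit algebra_simps)
qed

lemma sph_int_norm_power:
  assumes "continuous_on UNIV k" and r: "r > 0"
  shows "sph_int (\<lambda>p. norm p ^ m * k p) r = r ^ m * sph_int k r"
proof -
  have c: "continuous_on UNIV (\<lambda>p. norm p ^ m * k p)" by (intro continuous_intros assms)
  have [measurable]: "k \<in> borel_measurable borel" using assms by (auto intro: borel_measurable_continuous_onI)
  have "(\<integral>p. norm (r *\<^sub>R p) ^ m * k (r *\<^sub>R p) * W p \<partial>unit_sphere_measure) = (\<integral>p. r ^ m * (k (r *\<^sub>R p) * W p) \<partial>unit_sphere_measure)"
    by (rule integral_cong_AE) (use AE_unit_sphere r in \<open>auto elim!: eventually_mono\<close>)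
  then show ?thesis using r by (simp add: sph_int_unit[OF c] sph_int_unit[OF assms])
qed

lemma sph_int_bound:
  assumes "continuous_on UNIV k" and r: "r > 0" and B: "\<And>p. norm p = r \<Longrightarrow> \<bar>k p\<bar> \<le> B"
  shows "\<bar>sph_int k r\<bar> \<le> B * r powr (real DIM('a) - 1 + \<alpha>) * (\<integral>p. \<bar>W p\<bar> \<partial>unit_sphere_measure)"
proof -
  have "\<bar>\<integral>p. k (r *\<^sub>R p) * W p \<partial>unit_sphere_measure\<bar> \<le> (\<integral>p. \<bar>k (r *\<^sub>R p) * W p\<bar> \<partial>unit_sphere_measure)"
    by (rule integral_abs_bound)
  also have "\<dots> \<le> (\<integral>p. B * \<bar>W p\<bar> \<partial>unit_sphere_measure)"
  proof (rule integral_mono_AE)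
    show "AE p in unit_sphere_measure. \<bar>k (r *\<^sub>R p) * W p\<bar> \<le> B * \<bar>W p\<bar>"
      using AE_unit_sphere by eventually_elim (use B r in \<open>auto simp: abs_mult intro!: mult_right_mono\<close>)
  qed (use sphere_integrable[OF assms(1), of r] W_int in auto)
  finally show ?thesis
    using mult_left_mono[of "\<bar>\<integral>p. k (r *\<^sub>R p) * W p \<partial>unit_sphere_measure\<bar>"
      "\<integral>p. B * \<bar>W p\<bar> \<partial>unit_sphere_measure" "r powr (real DIM('a) - 1 + \<alpha>)"]
    by (simp add: sph_int_unit[OF assms(1) r] abs_mult mult_ac)
qed

lemma ball_int_bound:
  assumes k: "continuous_on UNIV k" and B: "\<And>p. norm p < r \<Longrightarrow> \<bar>k p\<bar> \<le> B"
  shows "\<bar>ball_int k r\<bar> \<le> B * (\<integral>p. indicator (ball 0 r) p * \<bar>W p\<bar> \<partial>lborel)"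
proof -
  have "\<bar>ball_int k r\<bar> \<le> (\<integral>p. \<bar>indicator (ball 0 r) p * (k p * W p)\<bar> \<partial>lborel)"
    unfolding ball_int_def by (rule integral_abs_bound)
  also have "\<dots> \<le> (\<integral>p. B * (indicator (ball 0 r) p * \<bar>W p\<bar>) \<partial>lborel)"
  proof (rule integral_mono)
    show "integrable lborel (\<lambda>p. \<bar>indicator (ball 0 r) p * (k p * W p)\<bar>)"
      using ball_int_integrable[OF k] by (rule integrable_abs)
    show "integrable lborel (\<lambda>p. B * (indicator (ball 0 r) p * \<bar>W p\<bar>))"
      using integrable_weight_ball by (rule integrable_mult_right)
  qed (use B in \<open>auto simp: abs_mult indicator_def intro!: mult_right_mono\<close>)
  finally show ?thesis by simp
qed

end

section \<open>The Poisson kernel\<close>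

text \<open>The pattern of all singular kernels here: one power controls the singularity at 0,
  another the tail. The bound keeps the splitting radius R explicit, so that R can later be tied to
  the increment in a Hoelder estimate.\<close>

lemma
  fixes f :: "'a::euclidean_space \<Rightarrow> real"
  assumes [measurable]: "f \<in> borel_measurable borel" and R: "R > 0"
    and b1: "real DIM('a) + \<beta> > 0" and b2: "real DIM('a) + \<beta>' < 0"
    and f1: "\<And>z. z \<noteq> 0 \<Longrightarrow> norm z < R \<Longrightarrow> \<bar>f z\<bar> \<le> A * norm z powr \<beta>"
    and f2: "\<And>z. norm z \<ge> R \<Longrightarrow> \<bar>f z\<bar> \<le> A' * norm z powr \<beta>'"
  shows integrable_two_powers: "integrable lborel f"
    and integral_two_powers_bound: "(\<integral>z. \<bar>f z\<bar> \<partial>lborel) \<le>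
      A * (sphere_area TYPE('a) * R powr (real DIM('a) + \<beta>) / (real DIM('a) + \<beta>)) +
      A' * (sphere_area TYPE('a) * R powr (real DIM('a) + \<beta>') / (- (real DIM('a) + \<beta>')))"
proof -
  let ?w = "\<lambda>z::'a. A * (norm z powr \<beta> * indicator (ball 0 R) z) + A' * (norm z powr \<beta>' * indicator (- ball 0 R) z)"
  have iw: "integrable lborel ?w"
    using integrable_powr_ball[OF b1 R] integrable_powr_outside[OF b2 R] by simp
  have bnd: "\<bar>f z\<bar> \<le> ?w z" if "z \<noteq> 0" for z
    using f1[OF that] f2[of z] by (auto simp: indicator_def)
  then have ae: "AE z in lborel. \<bar>f z\<bar> \<le> ?w z"
    using AE_lborel_singleton[of 0] by (auto elim!: eventually_mono)
  show i: "integrable lborel f"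
    by (rule Bochner_Integration.integrable_bound[OF iw]) (use ae in \<open>auto elim!: eventually_mono\<close>)
  have "(\<integral>z. \<bar>f z\<bar> \<partial>lborel) \<le> (\<integral>z. ?w z \<partial>lborel)"
    by (rule integral_mono_AE) (use i iw ae in auto)
  also have "\<dots> = A * (sphere_area TYPE('a) * R powr (real DIM('a) + \<beta>) / (real DIM('a) + \<beta>)) +
      A' * (sphere_area TYPE('a) * R powr (real DIM('a) + \<beta>') / (- (real DIM('a) + \<beta>')))"
    using integrable_powr_ball[OF b1 R] integrable_powr_outside[OF b2 R]
    by (subst Bochner_Integration.integral_add) (simp_all only: integral_powr_ball[OF b1 R] integral_powr_outside[OF b2 R] integral_mult_right_zero integrable_mult_right)
  finally show "(\<integral>z. \<bar>f z\<bar> \<partial>lborel) \<le>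
      A * (sphere_area TYPE('a) * R powr (real DIM('a) + \<beta>) / (real DIM('a) + \<beta>)) +
      A' * (sphere_area TYPE('a) * R powr (real DIM('a) + \<beta>') / (- (real DIM('a) + \<beta>')))" .
qed

text \<open>All derivatives of the Poisson kernel are polynomial combinations of the following kernels,
  up to a power of \<open>y\<close>.\<close>

definition powr_kernel :: "real \<Rightarrow> real \<Rightarrow> real ^ 'n \<Rightarrow> real \<Rightarrow> real" where
  "powr_kernel s j z y = ((norm z)\<^sup>2 + y\<^sup>2) powr (- (real CARD('n) + 2 * s) / 2 - j)"

lemma powr_kernel_uminus[simp]: "powr_kernel s j (- z) y = powr_kernel s j z y"
  by (simp add: powr_kernel_def)

lemma powr_kernel_nonneg[simp]: "powr_kernel s j z y \<ge> 0"
  by (simp add: powr_kernel_def)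

lemma sum_squares_pos:
  fixes z :: "'a::real_normed_vector" assumes "y \<noteq> 0" shows "(norm z)\<^sup>2 + y\<^sup>2 > (0::real)"
  using assms by (simp add: add_nonneg_pos)

lemma powr_kernel_Suc:
  assumes "y \<noteq> 0"
  shows "((norm z)\<^sup>2 + y\<^sup>2) * powr_kernel s (j + 1) z y = powr_kernel s j z y"
proof -
  have p: "(norm z)\<^sup>2 + y\<^sup>2 > 0" using assms by (rule sum_squares_pos)
  then show ?thesis
    unfolding powr_kernel_def by (subst powr_mult_base) (auto intro!: arg_cong2[where f="(powr)"])
qed

text \<open>All three rest on y^2, |z|^2 and |y| |z| being at most |z|^2 + y^2, the factor that
  lowers the index j + 1 to j.\<close>

lemma powr_kernel_le:
  assumes "y \<noteq> 0"
  shows "y\<^sup>2 * powr_kernel s (j + 1) z y \<le> powr_kernel s j z y"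
    and "(norm z)\<^sup>2 * powr_kernel s (j + 1) z y \<le> powr_kernel s j z y"
    and "\<bar>y\<bar> * norm z * powr_kernel s (j + 1) z y \<le> powr_kernel s j z y"
proof -
  have "\<bar>y\<bar> * norm z \<le> (norm z)\<^sup>2 + y\<^sup>2"
    using sum_squares_bound[of "norm z" "\<bar>y\<bar>"] mult_nonneg_nonneg[OF norm_ge_zero[of z] abs_ge_zero[of y]]
    unfolding power2_abs mult.assoc mult.commute[of "\<bar>y\<bar>"] by linarith
  then show "y\<^sup>2 * powr_kernel s (j + 1) z y \<le> powr_kernel s j z y"
    "(norm z)\<^sup>2 * powr_kernel s (j + 1) z y \<le> powr_kernel s j z y"
    "\<bar>y\<bar> * norm z * powr_kernel s (j + 1) z y \<le> powr_kernel s j z y"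
    unfolding powr_kernel_Suc[OF assms, of z s j, symmetric] by (auto intro!: mult_right_mono)
qed

lemma powr_kernel_mono:
  fixes z :: "real ^ 'n"
  assumes "0 < \<delta>" "\<delta> \<le> \<bar>y\<bar>" "s \<ge> 0" "j \<ge> 0"
  shows "powr_kernel s j z y \<le> powr_kernel s j z \<delta>"
  unfolding powr_kernel_def
proof (rule powr_mono2')
  have "\<delta>\<^sup>2 \<le> y\<^sup>2" using power_mono[of \<delta> "\<bar>y\<bar>" 2] assms by simp
  then show "(norm z)\<^sup>2 + \<delta>\<^sup>2 \<le> (norm z)\<^sup>2 + y\<^sup>2" by simp
qed (use assms sum_squares_pos[of \<delta> z] in auto)

lemma power2_powr_half: "x > 0 \<Longrightarrow> (x\<^sup>2) powr (e / 2) = x powr (e::real)"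
  by (simp add: powr_powr flip: powr_numeral)

lemma powr_kernel_le_powr:
  fixes z :: "real ^ 'n"
  assumes "z \<noteq> 0" "s \<ge> 0"
  shows "powr_kernel s 0 z y \<le> norm z powr (- (real CARD('n) + 2 * s))"
proof -
  have "powr_kernel s 0 z y \<le> ((norm z)\<^sup>2) powr (- (real CARD('n) + 2 * s) / 2)"
    unfolding powr_kernel_def using assms by (auto intro!: powr_mono2')
  also have "\<dots> = norm z powr (- (real CARD('n) + 2 * s))"
    using assms by (intro power2_powr_half) simp
  finally show ?thesis .
qed

lemma powr_kernel_0:
  fixes z :: "real ^ 'n"
  assumes "z \<noteq> 0"
  shows "powr_kernel s 0 z 0 = norm z powr (- (real CARD('n) + 2 * s))"
  using assms power2_powr_half[of "norm z" "- (real CARD('n) + 2 * s)"] by (simp add: powr_kernel_def)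

lemma powr_kernel_deriv_z:
  fixes z :: "real ^ 'n"
  assumes "y \<noteq> 0"
  shows "((\<lambda>z. powr_kernel s j z y) has_derivative
    (\<lambda>h. - (real CARD('n) + 2 * s + 2 * j) * powr_kernel s (j + 1) z y * (z \<bullet> h))) (at z)"
proof -
  have p: "z \<bullet> z + y\<^sup>2 > 0" using sum_squares_pos[OF assms, of z] by (simp add: power2_norm_eq_inner)
  have "((\<lambda>z. z \<bullet> z + y\<^sup>2) has_derivative (\<lambda>h. 2 * (z \<bullet> h))) (at z)"
    by (auto intro!: derivative_eq_intros simp: inner_commute)
  from DERIV_compose_FDERIV[OF has_real_derivative_powr[OF p, of "- (real CARD('n) + 2 * s) / 2 - j"] this]
  show ?thesis
    unfolding powr_kernel_def power2_norm_eq_inner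
    by (elim has_derivative_eq_rhs) (auto simp: fun_eq_iff field_simps)
qed

lemma powr_kernel_deriv_y:
  fixes z :: "real ^ 'n"
  assumes "y \<noteq> 0"
  shows "((\<lambda>y. powr_kernel s j z y) has_real_derivative
    - (real CARD('n) + 2 * s + 2 * j) * y * powr_kernel s (j + 1) z y) (at y)"
proof -
  have p: "(norm z)\<^sup>2 + y\<^sup>2 > 0" using assms by (rule sum_squares_pos)
  have "((\<lambda>y. (norm z)\<^sup>2 + y\<^sup>2) has_real_derivative 2 * y) (at y)"
    by (auto intro!: derivative_eq_intros)
  from DERIV_chain2[OF has_real_derivative_powr[OF p, of "- (real CARD('n) + 2 * s) / 2 - j"] this]
  show ?thesis
    unfolding powr_kernel_def by (rule DERIV_cong) (simp add: field_simps)
qed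

lemma powr_kernel_continuous_z[continuous_intros]:
  "y \<noteq> 0 \<Longrightarrow> continuous_on A (\<lambda>z. powr_kernel s j z y)"
  by (rule has_derivative_continuous_on, rule has_derivative_at_withinI, rule powr_kernel_deriv_z)

lemma powr_kernel_measurable[measurable]: "(\<lambda>z. powr_kernel s j z y) \<in> borel_measurable borel"
  unfolding powr_kernel_def by measurable

lemma powr_kernel_integrable:
  assumes y: "y \<noteq> 0" and s: "s > 0"
  shows "integrable lborel (\<lambda>z :: real ^ 'n. powr_kernel s 0 z y)"
proof (rule integrable_two_powers[where R=1 and \<beta>=0 and \<beta>'="- (real CARD('n) + 2 * s)"])
  fix z :: "real ^ 'n"
  have "powr_kernel s 0 z y \<le> (y\<^sup>2) powr (- (real CARD('n) + 2 * s) / 2)"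
    unfolding powr_kernel_def using y s by (auto intro!: powr_mono2')
  then show "\<bar>powr_kernel s 0 z y\<bar> \<le> (y\<^sup>2) powr (- (real CARD('n) + 2 * s) / 2) * norm z powr 0" if "z \<noteq> 0"
    using that by simp
  show "\<bar>powr_kernel s 0 z y\<bar> \<le> 1 * norm z powr - (real CARD('n) + 2 * s)" if "1 \<le> norm z"
  proof -
    have "z \<noteq> 0" using that by auto
    then show ?thesis using powr_kernel_le_powr[of z s y] s by simp
  qed
qed (use s in auto)

lemma poisson_profile_eq: "poisson_profile s z y = y powr (2 * s) * powr_kernel s 0 z y"
  by (simp add: poisson_profile_def powr_kernel_def)

lemma poisson_profile_scale:
  fixes z :: "real ^ 'n"
  assumes y: "y > 0"
  shows "poisson_profile s (y *\<^sub>R z) y * y ^ CARD('n) = poisson_profile s z 1"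
proof -
  define e where "e = - (real CARD('n) + 2 * s)"
  have 1: "(norm (y *\<^sub>R z))\<^sup>2 + y\<^sup>2 = y\<^sup>2 * ((norm z)\<^sup>2 + 1)" by (simp add: power_mult_distrib algebra_simps)
  have 2: "(y\<^sup>2 * ((norm z)\<^sup>2 + 1)) powr (e / 2) = y powr e * ((norm z)\<^sup>2 + 1) powr (e / 2)"
    using y power2_powr_half[OF y, of e] by (subst powr_mult) auto
  have 3: "y powr (2 * s) * y powr e * y ^ CARD('n) = 1"
    using y by (simp add: e_def flip: powr_add powr_realpow)
  have "poisson_profile s (y *\<^sub>R z) y * y ^ CARD('n) =
      (y powr (2 * s) * y powr e * y ^ CARD('n)) * ((norm z)\<^sup>2 + 1) powr (e / 2)"
    unfolding poisson_profile_def 1 e_def[symmetric] 2 by (simp only: mult_ac)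
  then show ?thesis unfolding 3 by (simp add: poisson_profile_def e_def)
qed

lemma poisson_profile_measurable[measurable]: "(\<lambda>z. poisson_profile s z y) \<in> borel_measurable borel"
  unfolding poisson_profile_eq by measurable

lemma poisson_profile_integral:
  assumes y: "y > 0"
  shows "(\<integral>z. poisson_profile s (z::real^'n) y \<partial>lborel) = (\<integral>z. poisson_profile s (z::real^'n) 1 \<partial>lborel)"
proof -
  have "(\<integral>z. poisson_profile s (z::real^'n) y \<partial>lborel) = y ^ CARD('n) * (\<integral>z. poisson_profile s (y *\<^sub>R (z::real^'n)) y \<partial>lborel)"
    using y by (subst lborel_integral_affine[of y _ 0]) auto
  also have "\<dots> = (\<integral>z. poisson_profile s (y *\<^sub>R (z::real^'n)) y * y ^ CARD('n) \<partial>lborel)" by simp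
  finally show ?thesis by (simp add: poisson_profile_scale[OF y])
qed

text \<open>The definite description asks for one C valid for every y > 0. Scaling makes the mass of
  the profile independent of y, and the mass at y = 1 is finite and positive, so C is its
  reciprocal.\<close>

lemma poisson_const_pos:
  assumes s: "s > 0"
  shows "poisson_const TYPE('n::finite) s > 0"
    and "y > 0 \<Longrightarrow> (\<integral>z. poisson_kernel s (z::real^'n) y \<partial>lborel) = 1"
proof -
  let ?A = "\<integral>z. poisson_profile s (z::real^'n) 1 \<partial>lborel"
  have i: "integrable lborel (\<lambda>z::real^'n. poisson_profile s z 1)"
    unfolding poisson_profile_eq using powr_kernel_integrable[of 1 s, where 'n='n] s by simp
  have pos: "poisson_profile s z 1 > 0" for z :: "real^'n"
    using sum_squares_pos[of 1 z] by (simp add: poisson_profile_eq powr_kernel_def)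
  have "?A \<noteq> 0"
  proof
    assume "?A = 0"
    then have "AE z in lborel. poisson_profile s (z::real^'n) 1 = 0"
      by (subst (asm) integral_nonneg_eq_0_iff_AE[OF i]) (use pos in \<open>auto intro: less_imp_le\<close>)
    then have "AE z in (lborel :: (real^'n) measure). False"
      using pos by (auto elim!: eventually_mono simp: less_le)
    then show False by (simp add: eventually_False ae_filter_eq_bot_iff)
  qed
  moreover have "?A \<ge> 0" using pos by (intro Bochner_Integration.integral_nonneg) (auto intro: less_imp_le)
  ultimately have A: "?A > 0" by simp
  have C: "poisson_const TYPE('n) s = 1 / ?A"
    unfolding poisson_const_def
  proof (rule the_equality)
    show "\<forall>y>0. (\<integral>z. 1 / ?A * poisson_profile s (z::real^'n) y \<partial>lborel) = 1"
    proof (intro allI impI)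
      fix y :: real assume "y > 0"
      from poisson_profile_integral[OF this, of s, where 'n='n] A
      show "(\<integral>z. 1 / ?A * poisson_profile s (z::real^'n) y \<partial>lborel) = 1"
        by simp
    qed
    fix C assume "\<forall>y>0. (\<integral>z. C * poisson_profile s (z::real^'n) y \<partial>lborel) = 1"
    then have "C * ?A = 1" by (auto dest!: spec[of _ 1])
    then show "C = 1 / ?A" using A by (simp add: field_simps)
  qed
  show "poisson_const TYPE('n::finite) s > 0" using A by (simp add: C)
  show "(\<integral>z. poisson_kernel s (z::real^'n) y \<partial>lborel) = 1" if "y > 0"
    using A poisson_profile_integral[OF that, of s, where 'n='n] by (simp add: poisson_kernel_def C)
qed

lemma poisson_kernel_measurable[measurable]: "(\<lambda>z. poisson_kernel s z y) \<in> borel_measurable borel"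
  unfolding poisson_kernel_def by measurable

lemma poisson_kernel_nonneg: "s > 0 \<Longrightarrow> poisson_kernel s (z :: real^'n) y \<ge> 0"
  using poisson_const_pos(1)[where 'n='n, of s] by (simp add: poisson_kernel_def poisson_profile_eq)

lemma poisson_kernel_uminus[simp]: "poisson_kernel s (- z) y = poisson_kernel s z y"
  by (simp add: poisson_kernel_def poisson_profile_def)

lemma poisson_kernel_integrable:
  assumes y: "y \<noteq> 0" and s: "s > 0"
  shows "integrable lborel (\<lambda>z :: real ^ 'n. poisson_kernel s z y)"
  unfolding poisson_kernel_def poisson_profile_eq using powr_kernel_integrable[OF y s, where 'n='n] by simp

text \<open>The kernel decays like |z|^(-n-2s), so its first moment is finite precisely when 2s > 1.
  This is the integrable majorant for the y-derivative of \<psi>(x - y z).\<close>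

lemma poisson_kernel_moment:
  assumes s: "1 / 2 < s"
  shows "integrable lborel (\<lambda>z :: real ^ 'n. norm z * poisson_kernel s z 1)"
proof -
  have "integrable lborel (\<lambda>z :: real ^ 'n. norm z * powr_kernel s 0 z 1)"
  proof (rule integrable_two_powers[where R=1 and \<beta>=0 and \<beta>'="1 - (real CARD('n) + 2 * s)"])
    fix z :: "real ^ 'n"
    have "powr_kernel s 0 z 1 \<le> (1\<^sup>2) powr (- (real CARD('n) + 2 * s) / 2)"
      unfolding powr_kernel_def diff_0_right using s by (intro powr_mono2') auto
    then have "powr_kernel s 0 z 1 \<le> 1" by simp
    then show "\<bar>norm z * powr_kernel s 0 z 1\<bar> \<le> 1 * norm z powr 0" if "z \<noteq> 0" "norm z < 1"
      using that mult_mono[of "norm z" 1 "powr_kernel s 0 z 1" 1] by simp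
    show "\<bar>norm z * powr_kernel s 0 z 1\<bar> \<le> 1 * norm z powr (1 - (real CARD('n) + 2 * s))" if "1 \<le> norm z"
    proof -
      have "norm z powr (1 - (real CARD('n) + 2 * s)) = norm z * norm z powr (- (real CARD('n) + 2 * s))"
        using that powr_mult_base[of "norm z" "- (real CARD('n) + 2 * s)"] by (simp add: algebra_simps)
      moreover have "z \<noteq> 0" using that by auto
      ultimately show ?thesis using powr_kernel_le_powr[of z s 1] s by (simp add: mult_left_mono)
    qed
  qed (use s in auto)
  then show ?thesis unfolding poisson_kernel_def poisson_profile_eq
    by (simp add: mult.left_commute[of "norm _"])
qed

section \<open>Regularity of the extension\<close>

lemma real_derivative_bound:
  fixes f :: "real \<Rightarrow> real"
  assumes "convex S" and "\<And>x. x \<in> S \<Longrightarrow> (f has_real_derivative f' x) (at x)"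
    and B: "\<And>x. x \<in> S \<Longrightarrow> \<bar>f' x\<bar> \<le> B" and "x \<in> S" "y \<in> S"
  shows "\<bar>f x - f y\<bar> \<le> B * \<bar>x - y\<bar>"
  using gradient_bound[of S f f' B x y] assms by (simp add: has_field_derivative_def)

lemma poisson_kernel_scale:
  fixes z :: "real ^ 'n"
  assumes y: "y > 0"
  shows "poisson_kernel s (y *\<^sub>R z) y * y ^ CARD('n) = poisson_kernel s z 1"
  using poisson_profile_scale[OF y, of s z] by (simp add: poisson_kernel_def mult.assoc)

lemma integral_poisson_scale:
  fixes f :: "real ^ 'n \<Rightarrow> real"
  assumes y: "y > 0" and [measurable]: "f \<in> borel_measurable borel"
  shows "(\<integral>z. poisson_kernel s z y * f z \<partial>lborel) = (\<integral>z. poisson_kernel s z 1 * f (y *\<^sub>R z) \<partial>lborel)"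
proof -
  have "(\<integral>z. poisson_kernel s z y * f z \<partial>lborel) = y ^ CARD('n) * (\<integral>z. poisson_kernel s (y *\<^sub>R z) y * f (y *\<^sub>R z) \<partial>lborel)"
    using y by (subst lborel_integral_affine[of y _ 0]) auto
  also have "\<dots> = (\<integral>z. (poisson_kernel s (y *\<^sub>R z) y * y ^ CARD('n)) * f (y *\<^sub>R z) \<partial>lborel)"
    by (subst integral_mult_right_zero[symmetric]) (simp only: mult_ac)
  finally show ?thesis by (simp only: poisson_kernel_scale[OF y])
qed

locale holder_C1 =
  fixes s M :: real and \<psi> :: "real ^ 'n \<Rightarrow> real" and g :: "real ^ 'n \<Rightarrow> real ^ 'n"
  assumes s: "1 / 2 < s" "s < 1"
    and deriv: "(\<psi> has_derivative (\<lambda>h. g x \<bullet> h)) (at x)"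
    and \<psi>_bound: "\<bar>\<psi> x\<bar> \<le> M" and g_bound: "norm (g x) \<le> M"
    and g_holder: "norm (g x - g z) \<le> M * norm (x - z) powr s"
begin

lemma M_nonneg: "M \<ge> 0" using \<psi>_bound[of 0] by simp

lemma cont_\<psi>: "continuous_on A \<psi>"
  by (rule has_derivative_continuous_on, rule has_derivative_at_withinI, rule deriv)

lemma cont_g: "continuous_on A g"
proof -
  have "isCont g x" for x
  proof -
    have "((\<lambda>z. M * norm (z - x) powr s) \<longlongrightarrow> M * norm (x - x) powr s) (at x)"
    proof (rule tendsto_mult[OF tendsto_const tendsto_powr'])
      show "((\<lambda>z. norm (z - x)) \<longlongrightarrow> norm (x - x)) (at x)" by (intro tendsto_intros)
    qed (use s in auto)
    then have l: "((\<lambda>z. M * norm (z - x) powr s) \<longlongrightarrow> 0) (at x)" by simp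
    have "((\<lambda>z. g z - g x) \<longlongrightarrow> 0) (at x)"
      by (rule Lim_null_comparison[OF _ l]) (simp add: g_holder)
    then show ?thesis unfolding isCont_def by (rule LIM_zero_cancel)
  qed
  then show ?thesis by (simp add: continuous_at_imp_continuous_on)
qed

lemma \<psi>_measurable[measurable]: "\<psi> \<in> borel_measurable borel"
  by (rule borel_measurable_continuous_onI[OF cont_\<psi>])

lemma g_measurable[measurable]: "g \<in> borel_measurable borel"
  by (rule borel_measurable_continuous_onI[OF cont_g])

lemma integrable_kernel_\<psi>:
  fixes k :: "real ^ 'n \<Rightarrow> real"
  assumes "integrable lborel k"
  shows "integrable lborel (\<lambda>z. k z * \<psi> (x - y *\<^sub>R z))"
proof (rule Bochner_Integration.integrable_bound)
  show "integrable lborel (\<lambda>z. k z * M)" using assms by simp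
qed (use assms M_nonneg \<psi>_bound in \<open>auto simp: abs_mult intro!: mult_left_mono AE_I2\<close>)

text \<open>The substitution z -> y z moves y from the kernel into the argument of \<psi>. At y = 0
  the kernel has mass 1, and for y < 0 its evenness absorbs the sign, so one formula covers both
  half spaces and their interface.\<close>

lemma ext_eq: "extension s \<psi> (x, y) = (\<integral>z. poisson_kernel s z 1 * \<psi> (x - y *\<^sub>R z) \<partial>lborel)"
proof -
  consider "y = 0" | "y > 0" | "y < 0" by linarith
  then show ?thesis
  proof cases
    case 1
    then show ?thesis using poisson_const_pos(2)[of s 1, where 'n='n] s by (simp add: extension_def)
  next
    case 2
    then show ?thesis using integral_poisson_scale[OF 2, of "\<lambda>z. \<psi> (x - z)"] by (simp add: extension_def)
  next
    case 3
    then have "extension s \<psi> (x, y) = (\<integral>z. poisson_kernel s z 1 * \<psi> (x + y *\<^sub>R z) \<partial>lborel)"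
      using integral_poisson_scale[of "-y" "\<lambda>z. \<psi> (x - z)"] by (simp add: extension_def)
    also have "\<dots> = (\<integral>z. poisson_kernel s z 1 * \<psi> (x - y *\<^sub>R z) \<partial>lborel)"
      by (subst lborel_integral_affine[of "-1" _ 0]) auto
    finally show ?thesis .
  qed
qed

definition ext_grad :: "(real ^ 'n) \<times> real \<Rightarrow> (real ^ 'n) \<times> real" where
  "ext_grad p = (\<integral>z. poisson_kernel s z 1 *\<^sub>R g (fst p - snd p *\<^sub>R z) \<partial>lborel,
     - (\<integral>z. poisson_kernel s z 1 * (g (fst p - snd p *\<^sub>R z) \<bullet> z) \<partial>lborel))"

lemma poisson_kernel_integrable1: "integrable lborel (\<lambda>z :: real ^ 'n. poisson_kernel s z 1)"
  using s by (intro poisson_kernel_integrable) auto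

lemma integrable_grad_fst: "integrable lborel (\<lambda>z. poisson_kernel s z 1 *\<^sub>R g (x - y *\<^sub>R z))"
proof (rule Bochner_Integration.integrable_bound)
  show "integrable lborel (\<lambda>z :: real ^ 'n. poisson_kernel s z 1 * M)"
    using poisson_kernel_integrable1 by simp
qed (use M_nonneg g_bound poisson_kernel_nonneg[of s] s in \<open>auto simp: abs_mult intro!: mult_left_mono AE_I2\<close>)

lemma grad_snd_bound:
  fixes z :: "real ^ 'n"
  shows "\<bar>poisson_kernel s z 1 * (g w \<bullet> z)\<bar> \<le> M * (norm z * poisson_kernel s z 1)"
proof -
  have "\<bar>g w \<bullet> z\<bar> \<le> M * norm z"
    using Cauchy_Schwarz_ineq2[of "g w" z] mult_right_mono[OF g_bound[of w] norm_ge_zero[of z]] by linarith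
  then show ?thesis
    using mult_left_mono[of "\<bar>g w \<bullet> z\<bar>" "M * norm z" "poisson_kernel s z 1"] poisson_kernel_nonneg[of s z 1] s
    by (simp add: abs_mult mult_ac)
qed

lemma integrable_grad_snd: "integrable lborel (\<lambda>z. poisson_kernel s z 1 * (g (x - y *\<^sub>R z) \<bullet> z))"
proof (rule Bochner_Integration.integrable_bound)
  show "integrable lborel (\<lambda>z :: real ^ 'n. M * (norm z * poisson_kernel s z 1))"
    using poisson_kernel_moment[OF s(1), where 'n='n] by simp
qed (use grad_snd_bound in \<open>auto intro!: AE_I2 intro: order_trans[OF _ abs_ge_self]\<close>)

lemma ext_grad_inner:
  "ext_grad p \<bullet> h = (\<integral>z. poisson_kernel s z 1 * (g (fst p - snd p *\<^sub>R z) \<bullet> (fst h - snd h *\<^sub>R z)) \<partial>lborel)"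
proof -
  have 1: "(\<integral>z. poisson_kernel s z 1 *\<^sub>R g (fst p - snd p *\<^sub>R z) \<partial>lborel) \<bullet> fst h
    = (\<integral>z. (poisson_kernel s z 1 *\<^sub>R g (fst p - snd p *\<^sub>R z)) \<bullet> fst h \<partial>lborel)"
    using integrable_grad_fst by (rule integral_inner_left[symmetric])
  have 2: "integrable lborel (\<lambda>z. (poisson_kernel s z 1 *\<^sub>R g (fst p - snd p *\<^sub>R z)) \<bullet> fst h)"
    using integrable_grad_fst by (rule integrable_inner_left)
  have "(\<integral>z. poisson_kernel s z 1 * (g (fst p - snd p *\<^sub>R z) \<bullet> (fst h - snd h *\<^sub>R z)) \<partial>lborel)
     = (\<integral>z. (poisson_kernel s z 1 *\<^sub>R g (fst p - snd p *\<^sub>R z)) \<bullet> fst h - snd h * (poisson_kernel s z 1 * (g (fst p - snd p *\<^sub>R z) \<bullet> z)) \<partial>lborel)"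
    by (rule Bochner_Integration.integral_cong) (auto simp: algebra_simps)
  also have "\<dots> = (\<integral>z. (poisson_kernel s z 1 *\<^sub>R g (fst p - snd p *\<^sub>R z)) \<bullet> fst h \<partial>lborel)
    - (\<integral>z. snd h * (poisson_kernel s z 1 * (g (fst p - snd p *\<^sub>R z) \<bullet> z)) \<partial>lborel)"
    by (rule Bochner_Integration.integral_diff[OF 2 integrable_mult_right[OF integrable_grad_snd]])
  also have "\<dots> = ext_grad p \<bullet> h"
    unfolding 1[symmetric] by (simp add: inner_prod_def ext_grad_def)
  finally show ?thesis by simp
qed

lemma norm_shift_le:
  fixes h :: "(real ^ 'n) \<times> real"
  shows "norm (fst h - snd h *\<^sub>R z) \<le> norm h * (1 + norm z)"
proof -
  have "norm (fst h - snd h *\<^sub>R z) \<le> norm (fst h) + \<bar>snd h\<bar> * norm z"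
    using norm_triangle_ineq4[of "fst h" "snd h *\<^sub>R z"] by simp
  also have "\<dots> \<le> norm h + norm h * norm z"
    using norm_fst_le[of "fst h" "snd h"] norm_snd_le[of "snd h" "fst h"] by (intro add_mono mult_right_mono) auto
  finally show ?thesis by (simp add: algebra_simps)
qed

text \<open>With the kernel fixed at height 1 the derivative falls on \<psi>, and y = 0 is a point
  like any other. An increment h moves the argument of \<psi> by at most |h| (1 + |z|), which the
  kernel and its first moment integrate.\<close>

lemma ext_has_derivative: "(extension s \<psi> has_derivative (\<lambda>h. ext_grad p \<bullet> h)) (at p)"
proof -
  have e: "extension s \<psi> = (\<lambda>p. \<integral>z. poisson_kernel s z 1 * \<psi> (fst p - snd p *\<^sub>R z) \<partial>lborel)"
    using ext_eq by (auto simp: fun_eq_iff)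
  show ?thesis
    unfolding e ext_grad_inner
  proof (rule has_derivative_integral(2)[where e=1 and w="\<lambda>z. M * poisson_kernel s z 1 + M * (norm z * poisson_kernel s z 1)"])
    show "integrable lborel (\<lambda>z. poisson_kernel s z 1 * \<psi> (fst q - snd q *\<^sub>R z))" for q
      by (rule integrable_kernel_\<psi>[OF poisson_kernel_integrable1])
    show "integrable lborel (\<lambda>z :: real ^ 'n. M * poisson_kernel s z 1 + M * (norm z * poisson_kernel s z 1))"
      using poisson_kernel_integrable1 poisson_kernel_moment[OF s(1), where 'n='n] by simp
    fix z :: "real ^ 'n"
    have "((\<lambda>p. \<psi> (fst p - snd p *\<^sub>R z)) has_derivative (\<lambda>h. g (fst p - snd p *\<^sub>R z) \<bullet> (fst h - snd h *\<^sub>R z))) (at p)"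
      by (rule has_derivative_compose[where g=\<psi> and f="\<lambda>p. fst p - snd p *\<^sub>R z"])
        (use deriv in \<open>auto intro!: derivative_eq_intros\<close>)
    then show "((\<lambda>p. poisson_kernel s z 1 * \<psi> (fst p - snd p *\<^sub>R z)) has_derivative
      (\<lambda>h. poisson_kernel s z 1 * (g (fst p - snd p *\<^sub>R z) \<bullet> (fst h - snd h *\<^sub>R z)))) (at p)"
      by (rule has_derivative_mult_right)
    fix q :: "(real ^ 'n) \<times> real"
    have "\<bar>\<psi> (fst q - snd q *\<^sub>R z) - \<psi> (fst p - snd p *\<^sub>R z)\<bar> \<le> M * norm ((fst q - snd q *\<^sub>R z) - (fst p - snd p *\<^sub>R z))"
      by (rule gradient_bound[of UNIV]) (use deriv g_bound in auto)
    also have "(fst q - snd q *\<^sub>R z) - (fst p - snd p *\<^sub>R z) = fst (q - p) - snd (q - p) *\<^sub>R z"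
      by (simp add: algebra_simps)
    also have "M * norm \<dots> \<le> M * (norm (q - p) * (1 + norm z))"
      by (rule mult_left_mono[OF norm_shift_le M_nonneg])
    finally show "\<bar>poisson_kernel s z 1 * \<psi> (fst q - snd q *\<^sub>R z) - poisson_kernel s z 1 * \<psi> (fst p - snd p *\<^sub>R z)\<bar>
        \<le> (M * poisson_kernel s z 1 + M * (norm z * poisson_kernel s z 1)) * norm (q - p)"
      using mult_left_mono[of "\<bar>\<psi> (fst q - snd q *\<^sub>R z) - \<psi> (fst p - snd p *\<^sub>R z)\<bar>" "M * (norm (q - p) * (1 + norm z))" "poisson_kernel s z 1"]
        poisson_kernel_nonneg[of s z 1] s
      unfolding right_diff_distrib[symmetric] abs_mult by (simp add: algebra_simps)
  qed simp
qed

lemma ext_grad_continuous: "continuous_on UNIV ext_grad"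
proof -
  have "continuous_on UNIV (\<lambda>p. ext_grad p \<bullet> h)" for h
    unfolding ext_grad_inner
  proof (rule continuous_at_imp_continuous_on, rule ballI, rule integral_isCont)
    fix p :: "(real ^ 'n) \<times> real"
    let ?w = "\<lambda>z :: real ^ 'n. M * norm h * poisson_kernel s z 1 + M * norm h * (norm z * poisson_kernel s z 1)"
    show "integrable lborel ?w"
      using poisson_kernel_integrable1 poisson_kernel_moment[OF s(1), where 'n='n] by simp
    show "isCont (\<lambda>p. poisson_kernel s z 1 * (g (fst p - snd p *\<^sub>R z) \<bullet> (fst h - snd h *\<^sub>R z))) p" for z
    proof -
      have "isCont (\<lambda>p. g (fst p - snd p *\<^sub>R z)) p"
        using continuous_on_compose2[OF cont_g[of UNIV], of UNIV "\<lambda>p. fst p - snd p *\<^sub>R z"]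
        by (cases p) (simp add: continuous_on_eq_continuous_at continuous_on_diff continuous_on_fst continuous_on_snd continuous_on_scaleR continuous_on_id)
      then show ?thesis by (intro continuous_intros)
    qed
    have "\<bar>poisson_kernel s z 1 * (g w \<bullet> (fst h - snd h *\<^sub>R z))\<bar> \<le> ?w z" for z w
    proof -
      have "\<bar>g w \<bullet> (fst h - snd h *\<^sub>R z)\<bar> \<le> norm (g w) * norm (fst h - snd h *\<^sub>R z)"
        by (rule Cauchy_Schwarz_ineq2)
      also have "\<dots> \<le> M * (norm h * (1 + norm z))"
        by (rule mult_mono[OF g_bound norm_shift_le]) (use M_nonneg in auto)
      finally show ?thesis
        using mult_left_mono[of "\<bar>g w \<bullet> (fst h - snd h *\<^sub>R z)\<bar>" "M * (norm h * (1 + norm z))" "poisson_kernel s z 1"]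
          poisson_kernel_nonneg[of s z 1] s
        unfolding abs_mult by (simp add: algebra_simps)
    qed
    then show "\<forall>\<^sub>F q in at p. (\<lambda>z. poisson_kernel s z 1 * (g (fst q - snd q *\<^sub>R z) \<bullet> (fst h - snd h *\<^sub>R z))) \<in> borel_measurable lborel \<and>
       (\<forall>z\<in>space lborel. \<bar>poisson_kernel s z 1 * (g (fst q - snd q *\<^sub>R z) \<bullet> (fst h - snd h *\<^sub>R z))\<bar> \<le> ?w z)"
      by (intro always_eventually) simp
  qed simp
  then show ?thesis by (subst continuous_on_componentwise) blast
qed

end

text \<open>Up to the factor \<open>y\<^sup>a = y\<^sup>1\<^sup>-\<^sup>2\<^sup>s\<close>, the kernels \<open>kernel_x\<close> and \<open>kernel_y\<close> are the derivatives of the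
  Poisson kernel; \<open>kernel_xx\<close> and \<open>kernel_m\<close> are derivatives of these.\<close>

definition kernel_x :: "real \<Rightarrow> real ^ 'n \<Rightarrow> real ^ 'n \<Rightarrow> real \<Rightarrow> real" where
  "kernel_x s b z y = - ((real CARD('n) + 2 * s) * poisson_const TYPE('n) s * y * powr_kernel s 1 z y * (z \<bullet> b))"

definition kernel_y :: "real \<Rightarrow> real ^ 'n \<Rightarrow> real \<Rightarrow> real" where
  "kernel_y s z y = poisson_const TYPE('n) s *
    (2 * s * powr_kernel s 0 z y - (real CARD('n) + 2 * s) * y\<^sup>2 * powr_kernel s 1 z y)"

definition kernel_xx :: "real \<Rightarrow> real ^ 'n \<Rightarrow> real ^ 'n \<Rightarrow> real ^ 'n \<Rightarrow> real \<Rightarrow> real" where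
  "kernel_xx s b h z y = - ((real CARD('n) + 2 * s) * poisson_const TYPE('n) s * y *
    (powr_kernel s 1 z y * (h \<bullet> b) - (real CARD('n) + 2 * s + 2) * powr_kernel s 2 z y * (z \<bullet> h) * (z \<bullet> b)))"

definition kernel_m :: "real \<Rightarrow> real ^ 'n \<Rightarrow> real \<Rightarrow> real" where
  "kernel_m s z y = poisson_const TYPE('n) s * (real CARD('n) + 2 * s) *
    ((real CARD('n) + 2 * s + 2) * y ^ 3 * powr_kernel s 2 z y - (2 * s + 2) * y * powr_kernel s 1 z y)"

lemma kernel_uminus[simp]: "kernel_y s (- z) y = kernel_y s z y"
  by (simp add: kernel_y_def)

lemma kernel_measurable[measurable]:
  "(\<lambda>z. kernel_x s b z y) \<in> borel_measurable borel"
  "(\<lambda>z. kernel_y s z y) \<in> borel_measurable borel"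
  "(\<lambda>z. kernel_xx s b h z y) \<in> borel_measurable borel"
  "(\<lambda>z. kernel_m s z y) \<in> borel_measurable borel"
  unfolding kernel_x_def kernel_y_def kernel_xx_def kernel_m_def by measurable

lemma powr_2s_pred: "y > 0 \<Longrightarrow> y powr (2 * s) = y * y powr (2 * s - 1)" for y s :: real
  using powr_mult_base[of y "2 * s - 1"] by simp

lemma poisson_deriv_y:
  fixes z :: "real ^ 'n"
  assumes y: "y > 0"
  shows "((\<lambda>y. poisson_kernel s z y) has_real_derivative y powr (2 * s - 1) * kernel_y s z y) (at y)"
proof -
  have "((\<lambda>y. y powr (2 * s) * powr_kernel s 0 z y) has_real_derivative
    2 * s * y powr (2 * s - 1) * powr_kernel s 0 z y
      + - (real CARD('n) + 2 * s + 2 * 0) * y * powr_kernel s (0 + 1) z y * y powr (2 * s)) (at y)"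
    by (rule DERIV_mult[OF has_real_derivative_powr[OF y] powr_kernel_deriv_y]) (use y in simp)
  from DERIV_cmult[OF this, of "poisson_const TYPE('n) s"] show ?thesis
    unfolding poisson_kernel_def poisson_profile_eq
    by (rule DERIV_cong) (unfold kernel_y_def powr_2s_pred[OF y], simp add: power2_eq_square algebra_simps)
qed

lemma kernel_y_deriv:
  fixes z :: "real ^ 'n"
  assumes y: "y > 0"
  shows "((\<lambda>y. kernel_y s z y) has_real_derivative kernel_m s z y) (at y)"
proof -
  have k0: "((\<lambda>y. powr_kernel s 0 z y) has_real_derivative - (real CARD('n) + 2 * s) * y * powr_kernel s 1 z y) (at y)"
    using powr_kernel_deriv_y[of y s 0 z] y by simp
  have k1: "((\<lambda>y. powr_kernel s 1 z y) has_real_derivative - (real CARD('n) + 2 * s + 2) * y * powr_kernel s 2 z y) (at y)"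
    using powr_kernel_deriv_y[of y s 1 z] y by simp
  show ?thesis
    unfolding kernel_y_def
    by (rule derivative_eq_intros k0 k1 refl | simp)+
      (simp add: kernel_m_def power2_eq_square power3_eq_cube algebra_simps)
qed

lemma poisson_deriv_z:
  fixes z :: "real ^ 'n"
  assumes y: "y > 0"
  shows "((\<lambda>z. poisson_kernel s z y) has_derivative (\<lambda>h. y powr (2 * s - 1) * kernel_x s h z y)) (at z)"
proof -
  have k0: "((\<lambda>z. powr_kernel s 0 z y) has_derivative (\<lambda>h. - (real CARD('n) + 2 * s) * powr_kernel s 1 z y * (z \<bullet> h))) (at z)"
    using powr_kernel_deriv_z[of y s 0 z] y by simp
  show ?thesis
    unfolding poisson_kernel_def poisson_profile_eq
    using has_derivative_mult_right[OF has_derivative_mult_right[OF k0, of "y powr (2 * s)"], of "poisson_const TYPE('n) s"]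
    by (rule has_derivative_eq_rhs) (unfold kernel_x_def powr_2s_pred[OF y], simp add: fun_eq_iff algebra_simps)
qed

lemma kernel_x_deriv:
  fixes z :: "real ^ 'n"
  assumes y: "y > 0"
  shows "((\<lambda>z. kernel_x s b z y) has_derivative (\<lambda>h. kernel_xx s b h z y)) (at z)"
proof -
  have k1: "((\<lambda>z. powr_kernel s 1 z y) has_derivative (\<lambda>h. - (real CARD('n) + 2 * s + 2) * powr_kernel s 2 z y * (z \<bullet> h))) (at z)"
    using powr_kernel_deriv_z[of y s 1 z] y by simp
  have "((\<lambda>z. powr_kernel s 1 z y * (z \<bullet> b)) has_derivative
     (\<lambda>h. powr_kernel s 1 z y * (h \<bullet> b) + (- (real CARD('n) + 2 * s + 2) * powr_kernel s 2 z y * (z \<bullet> h)) * (z \<bullet> b))) (at z)"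
    by (rule has_derivative_mult[OF k1]) (auto intro!: derivative_eq_intros)
  note d = has_derivative_mult_right[OF this, of "- ((real CARD('n) + 2 * s) * poisson_const TYPE('n) s * y)"]
  have 1: "kernel_x s b z y = - ((real CARD('n) + 2 * s) * poisson_const TYPE('n) s * y) * (powr_kernel s 1 z y * (z \<bullet> b))" for z
    by (simp add: kernel_x_def)
  have 2: "kernel_xx s b h z y = - ((real CARD('n) + 2 * s) * poisson_const TYPE('n) s * y) *
     (powr_kernel s 1 z y * (h \<bullet> b) + (- (real CARD('n) + 2 * s + 2) * powr_kernel s 2 z y * (z \<bullet> h)) * (z \<bullet> b))" for h
    by (simp add: kernel_xx_def algebra_simps)
  show ?thesis unfolding 1 2 by (rule d)
qed

text \<open>This is div(y^a grad P) = 0 for the Poisson kernel P: the sum is y^a times the Laplacian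
  of P in x, and \<open>kernel_m\<close> is the y-derivative of y^a times the y-derivative of P. It
  rests on |z|^2 = (|z|^2 + y^2) - y^2 and the index rule \<open>powr_kernel_Suc\<close>.\<close>

lemma kernel_xx_trace:
  fixes z :: "real ^ 'n"
  assumes y: "y > 0"
  shows "(\<Sum>b\<in>Basis. kernel_xx s b b z y) = - kernel_m s z y"
proof -
  let ?c = "(real CARD('n) + 2 * s) * poisson_const TYPE('n) s * y"
  have "(\<Sum>b\<in>Basis. kernel_xx s b b z y) =
    (\<Sum>b\<in>(Basis :: (real ^ 'n) set). - (?c * (powr_kernel s 1 z y - (real CARD('n) + 2 * s + 2) * powr_kernel s 2 z y * ((z \<bullet> b) * (z \<bullet> b)))))"
    by (rule sum.cong) (auto simp: kernel_xx_def inner_same_Basis)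
  also have "\<dots> = - (?c * (real CARD('n) * powr_kernel s 1 z y - (real CARD('n) + 2 * s + 2) * powr_kernel s 2 z y * (norm z)\<^sup>2))"
    unfolding sum_negf sum_distrib_left[symmetric] sum_subtractf
    by (simp add: power2_norm_eq_inner euclidean_inner[of z z])
  finally have e: "(\<Sum>b\<in>Basis. kernel_xx s b b z y) =
    - (?c * (real CARD('n) * powr_kernel s 1 z y - (real CARD('n) + 2 * s + 2) * powr_kernel s 2 z y * (norm z)\<^sup>2))" .
  have n: "powr_kernel s 2 z y * (norm z)\<^sup>2 = powr_kernel s 1 z y - y\<^sup>2 * powr_kernel s 2 z y"
    using powr_kernel_Suc[of y z s 1] y by (simp add: algebra_simps)
  show ?thesis
    unfolding e mult.assoc[of _ "powr_kernel s 2 z y"] n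
    by (simp add: kernel_m_def power2_eq_square power3_eq_cube algebra_simps)
qed

context
  fixes s :: real assumes s: "0 < s"
begin

text \<open>This and the next three bounds share the majorant \<open>powr_kernel s 0\<close>. Second
  derivatives lose a factor 1/y, which is harmless because they are used only with y bounded away
  from 0.\<close>

lemma kernel_y_bound:
  fixes z :: "real ^ 'n"
  assumes y: "y > 0"
  shows "\<bar>kernel_y s z y\<bar> \<le> poisson_const TYPE('n) s * (real CARD('n) + 4 * s) * powr_kernel s 0 z y"
proof -
  have "\<bar>2 * s * powr_kernel s 0 z y - (real CARD('n) + 2 * s) * (y\<^sup>2 * powr_kernel s 1 z y)\<bar>
      \<le> 2 * s * powr_kernel s 0 z y + (real CARD('n) + 2 * s) * (y\<^sup>2 * powr_kernel s 1 z y)"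
    using s by (intro order_trans[OF abs_triangle_ineq4]) (simp add: abs_mult)
  also have "\<dots> \<le> 2 * s * powr_kernel s 0 z y + (real CARD('n) + 2 * s) * powr_kernel s 0 z y"
    using powr_kernel_le(1)[of y s 0 z] y s by (intro add_mono mult_left_mono) auto
  finally have "\<bar>2 * s * powr_kernel s 0 z y - (real CARD('n) + 2 * s) * (y\<^sup>2 * powr_kernel s 1 z y)\<bar>
      \<le> (real CARD('n) + 4 * s) * powr_kernel s 0 z y" by (simp add: algebra_simps)
  from mult_left_mono[OF this, of "poisson_const TYPE('n) s"] poisson_const_pos(1)[OF s, where 'n='n]
  show ?thesis by (simp add: kernel_y_def abs_mult mult.assoc)
qed

lemma kernel_m_bound:
  fixes z :: "real ^ 'n"
  assumes y: "y > 0"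
  shows "\<bar>kernel_m s z y\<bar> \<le> poisson_const TYPE('n) s * (real CARD('n) + 2 * s) * (real CARD('n) + 4 * s + 4) / y * powr_kernel s 0 z y"
proof -
  let ?k = "real CARD('n) + 2 * s + 2"
  have k2: "y\<^sup>2 * (y\<^sup>2 * powr_kernel s 2 z y) \<le> y\<^sup>2 * powr_kernel s 1 z y"
    using powr_kernel_le(1)[of y s 1 z] y by (intro mult_left_mono) auto
  have k1: "y\<^sup>2 * powr_kernel s 1 z y \<le> powr_kernel s 0 z y"
    using powr_kernel_le(1)[of y s 0 z] y by simp
  have "\<bar>?k * (y\<^sup>2 * (y\<^sup>2 * powr_kernel s 2 z y)) - (2 * s + 2) * (y\<^sup>2 * powr_kernel s 1 z y)\<bar>
      \<le> ?k * (y\<^sup>2 * (y\<^sup>2 * powr_kernel s 2 z y)) + (2 * s + 2) * (y\<^sup>2 * powr_kernel s 1 z y)"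
    using s by (intro order_trans[OF abs_triangle_ineq4]) (simp add: abs_mult)
  also have "\<dots> \<le> ?k * powr_kernel s 0 z y + (2 * s + 2) * powr_kernel s 0 z y"
    using k1 k2 s by (intro add_mono mult_left_mono) auto
  finally have "\<bar>?k * (y\<^sup>2 * (y\<^sup>2 * powr_kernel s 2 z y)) - (2 * s + 2) * (y\<^sup>2 * powr_kernel s 1 z y)\<bar>
      \<le> (real CARD('n) + 4 * s + 4) * powr_kernel s 0 z y" by (simp add: algebra_simps)
  moreover have "?k * (y\<^sup>2 * (y\<^sup>2 * powr_kernel s 2 z y)) - (2 * s + 2) * (y\<^sup>2 * powr_kernel s 1 z y)
     = y * (?k * y ^ 3 * powr_kernel s 2 z y - (2 * s + 2) * y * powr_kernel s 1 z y)"
    by (simp add: power2_eq_square power3_eq_cube algebra_simps)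
  ultimately have "\<bar>?k * y ^ 3 * powr_kernel s 2 z y - (2 * s + 2) * y * powr_kernel s 1 z y\<bar>
     \<le> (real CARD('n) + 4 * s + 4) * powr_kernel s 0 z y / y"
    using y by (simp only: abs_mult) (simp add: field_simps)
  from mult_left_mono[OF this, of "poisson_const TYPE('n) s * (real CARD('n) + 2 * s)"] poisson_const_pos(1)[OF s, where 'n='n] s
  show ?thesis by (simp add: kernel_m_def abs_mult mult.assoc)
qed

lemma kernel_x_bound:
  fixes z :: "real ^ 'n"
  assumes y: "y > 0"
  shows "\<bar>kernel_x s b z y\<bar> \<le> poisson_const TYPE('n) s * (real CARD('n) + 2 * s) * norm b * powr_kernel s 0 z y"
proof -
  have "\<bar>y * powr_kernel s 1 z y * (z \<bullet> b)\<bar> \<le> (y * norm z * powr_kernel s 1 z y) * norm b"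
    using Cauchy_Schwarz_ineq2[of z b] mult_left_mono[of "\<bar>z \<bullet> b\<bar>" "norm z * norm b" "y * powr_kernel s 1 z y"] y
    by (simp add: abs_mult mult_ac)
  also have "\<dots> \<le> powr_kernel s 0 z y * norm b"
    using powr_kernel_le(3)[of y z s 0] y by (intro mult_right_mono) auto
  finally show ?thesis
    using mult_left_mono[of "\<bar>y * powr_kernel s 1 z y * (z \<bullet> b)\<bar>" "powr_kernel s 0 z y * norm b" "poisson_const TYPE('n) s * (real CARD('n) + 2 * s)"]
      poisson_const_pos(1)[OF s, where 'n='n] s
    by (simp add: kernel_x_def abs_mult mult_ac)
qed

lemma kernel_xx_bound:
  fixes z :: "real ^ 'n"
  assumes y: "y > 0" and b: "norm b = 1"
  shows "\<bar>kernel_xx s b b z y\<bar> \<le> poisson_const TYPE('n) s * (real CARD('n) + 2 * s) * (real CARD('n) + 2 * s + 3) / y * powr_kernel s 0 z y"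
proof -
  let ?k = "real CARD('n) + 2 * s + 2"
  have bb: "b \<bullet> b = 1" using b by (simp add: dot_square_norm)
  have zb: "(z \<bullet> b) * (z \<bullet> b) \<le> (norm z)\<^sup>2"
    using Cauchy_Schwarz_ineq[of z b] bb by (simp add: power2_eq_square power2_norm_eq_inner[unfolded power2_eq_square])
  have "powr_kernel s 2 z y * ((z \<bullet> b) * (z \<bullet> b)) \<le> powr_kernel s 1 z y"
    using mult_left_mono[OF zb powr_kernel_nonneg[of s 2 z y]] powr_kernel_le(2)[of y z s 1] y by (simp add: mult.commute)
  then have Y: "?k * (powr_kernel s 2 z y * ((z \<bullet> b) * (z \<bullet> b))) \<le> ?k * powr_kernel s 1 z y"
    using s by (intro mult_left_mono) auto
  have gen: "\<bar>X - Y\<bar> \<le> (k + 1) * X" if "Y \<le> k * X" "0 \<le> Y" "0 \<le> X" "0 \<le> k" for X Y k :: real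
    using that mult_nonneg_nonneg[of k X] by (simp add: algebra_simps abs_le_iff)
  have "\<bar>powr_kernel s 1 z y * (b \<bullet> b) - ?k * powr_kernel s 2 z y * (z \<bullet> b) * (z \<bullet> b)\<bar> \<le> (real CARD('n) + 2 * s + 3) * powr_kernel s 1 z y"
    using gen[OF Y] s unfolding bb by (simp add: mult.assoc add.assoc)
  also have "\<dots> \<le> (real CARD('n) + 2 * s + 3) * (powr_kernel s 0 z y / y\<^sup>2)"
    using powr_kernel_le(1)[of y s 0 z] y s by (intro mult_left_mono) (auto simp: field_simps)
  finally have "y * \<bar>powr_kernel s 1 z y * (b \<bullet> b) - ?k * powr_kernel s 2 z y * (z \<bullet> b) * (z \<bullet> b)\<bar> \<le> y * ((real CARD('n) + 2 * s + 3) * (powr_kernel s 0 z y / y\<^sup>2))"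
    using y by (intro mult_left_mono) auto
  also have "\<dots> = (real CARD('n) + 2 * s + 3) / y * powr_kernel s 0 z y"
    using y by (simp add: power2_eq_square)
  finally show ?thesis
    using mult_left_mono[of "y * \<bar>powr_kernel s 1 z y * (b \<bullet> b) - ?k * powr_kernel s 2 z y * (z \<bullet> b) * (z \<bullet> b)\<bar>"
       "(real CARD('n) + 2 * s + 3) / y * powr_kernel s 0 z y" "poisson_const TYPE('n) s * (real CARD('n) + 2 * s)"]
      poisson_const_pos(1)[OF s, where 'n='n] s y
    by (simp add: kernel_xx_def abs_mult mult_ac)
qed

lemma kernel_integrable:
  assumes y: "y > 0"
  shows "integrable lborel (\<lambda>z :: real ^ 'n. kernel_x s b z y)"
    "integrable lborel (\<lambda>z :: real ^ 'n. kernel_y s z y)"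
    "norm b = 1 \<Longrightarrow> integrable lborel (\<lambda>z :: real ^ 'n. kernel_xx s b b z y)"
    "integrable lborel (\<lambda>z :: real ^ 'n. kernel_m s z y)"
proof -
  have dom: "integrable lborel f" if "\<And>z. \<bar>f z\<bar> \<le> c * powr_kernel s 0 z y" "f \<in> borel_measurable borel"
    for f :: "real ^ 'n \<Rightarrow> real" and c
  proof (rule Bochner_Integration.integrable_bound)
    show "integrable lborel (\<lambda>z :: real ^ 'n. c * powr_kernel s 0 z y)"
      using powr_kernel_integrable[of y s, where 'n='n] y s by simp
  qed (use that in \<open>auto intro!: AE_I2 intro: order_trans[OF _ abs_ge_self]\<close>)
  show "integrable lborel (\<lambda>z :: real ^ 'n. kernel_x s b z y)"
    by (rule dom[OF kernel_x_bound[OF y]]) simp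
  show "integrable lborel (\<lambda>z :: real ^ 'n. kernel_y s z y)"
    by (rule dom[OF kernel_y_bound[OF y]]) simp
  show "integrable lborel (\<lambda>z :: real ^ 'n. kernel_m s z y)"
    by (rule dom[OF kernel_m_bound[OF y]]) simp
  show "integrable lborel (\<lambda>z :: real ^ 'n. kernel_xx s b b z y)" if "norm b = 1"
    by (rule dom[OF kernel_xx_bound[OF y that]]) simp
qed

end

section \<open>Derivatives of the extension through its kernel\<close>

context holder_C1
begin

lemma s0: "s > 0" using s by simp

text \<open>Here the derivative falls on the kernel and \<psi> enters through its bound M. The
  window (y/2, 2y) keeps the kernels away from their singularity at height 0.\<close>

lemma conv_deriv_y:
  fixes k k' :: "real ^ 'n \<Rightarrow> real \<Rightarrow> real"
  assumes y: "y > 0"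
    and int: "\<And>t. t > 0 \<Longrightarrow> integrable lborel (\<lambda>z. k z t)"
    and der: "\<And>z t. t > 0 \<Longrightarrow> ((\<lambda>t. k z t) has_real_derivative k' z t) (at t)"
    and bnd: "\<And>z t. y / 2 < t \<Longrightarrow> t < 2 * y \<Longrightarrow> \<bar>k' z t\<bar> \<le> w z"
    and w: "integrable lborel w"
  shows "((\<lambda>t. \<integral>z. k z t * \<psi> (x - z) \<partial>lborel) has_real_derivative (\<integral>z. k' z y * \<psi> (x - z) \<partial>lborel)) (at y)"
proof -
  have "((\<lambda>t. \<integral>z. k z t * \<psi> (x - z) \<partial>lborel) has_derivative (\<lambda>h. \<integral>z. (k' z y * h) * \<psi> (x - z) \<partial>lborel)) (at y)"
  proof (rule has_derivative_integral(2)[where e="y/2" and w="\<lambda>z. w z * M"])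
    fix t assume t: "dist t y < y / 2"
    then have t': "y / 2 < t" "t < 2 * y" using y by (auto simp: dist_real_def abs_if split: if_splits)
    then show "integrable lborel (\<lambda>z. k z t * \<psi> (x - z))"
      using integrable_kernel_\<psi>[OF int[of t], of x 1] y by simp
    fix z
    have "\<bar>k z t - k z y\<bar> \<le> w z * \<bar>t - y\<bar>"
      by (rule real_derivative_bound[of "{y/2<..<2*y}" "k z" "k' z"]) (use der bnd t' y in auto)
    then have "\<bar>k z t - k z y\<bar> * \<bar>\<psi> (x - z)\<bar> \<le> (w z * \<bar>t - y\<bar>) * M"
      using \<psi>_bound[of "x - z"] by (intro mult_mono) auto
    then show "\<bar>k z t * \<psi> (x - z) - k z y * \<psi> (x - z)\<bar> \<le> w z * M * norm (t - y)"
      unfolding left_diff_distrib[symmetric] abs_mult by (simp add: mult_ac)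
  next
    fix z
    show "((\<lambda>t. k z t * \<psi> (x - z)) has_derivative (\<lambda>h. (k' z y * h) * \<psi> (x - z))) (at y)"
      using der[OF y] by (intro has_derivative_mult_left) (simp add: has_field_derivative_def)
  qed (use y w in auto)
  moreover have "(\<integral>z. (k' z y * h) * \<psi> (x - z) \<partial>lborel) = (\<integral>z. k' z y * \<psi> (x - z) \<partial>lborel) * h" for h
    by (subst integral_mult_left_zero[symmetric]) (simp only: mult_ac)
  ultimately show ?thesis unfolding has_field_derivative_def by (simp only:)
qed

definition ext_y :: "real ^ 'n \<Rightarrow> real \<Rightarrow> real" where
  "ext_y x y = (\<integral>z. kernel_y s z y * \<psi> (x - z) \<partial>lborel)"

definition ext_m :: "real ^ 'n \<Rightarrow> real \<Rightarrow> real" where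
  "ext_m x y = (\<integral>z. kernel_m s z y * \<psi> (x - z) \<partial>lborel)"

lemma ext_deriv_y:
  assumes y: "y > 0"
  shows "((\<lambda>t. extension s \<psi> (x, t)) has_real_derivative y powr (2 * s - 1) * ext_y x y) (at y)"
proof -
  let ?c = "poisson_const TYPE('n) s * (real CARD('n) + 4 * s)"
  have "((\<lambda>t. \<integral>z. poisson_kernel s z t * \<psi> (x - z) \<partial>lborel) has_real_derivative
     (\<integral>z. (y powr (2 * s - 1) * kernel_y s z y) * \<psi> (x - z) \<partial>lborel)) (at y)"
  proof (rule conv_deriv_y[OF y, where w="\<lambda>z. (2 * y) powr (2 * s - 1) * (?c * powr_kernel s 0 z (y / 2))"])
    fix z :: "real ^ 'n" and t :: real
    assume t: "y / 2 < t" "t < 2 * y"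
    have "\<bar>kernel_y s z t\<bar> \<le> ?c * powr_kernel s 0 z t"
      using t y by (intro kernel_y_bound s0) auto
    also have "\<dots> \<le> ?c * powr_kernel s 0 z (y / 2)"
      using t y poisson_const_pos(1)[OF s0, where 'n='n] s0 by (intro mult_left_mono powr_kernel_mono) auto
    finally have "t powr (2 * s - 1) * \<bar>kernel_y s z t\<bar> \<le> (2 * y) powr (2 * s - 1) * (?c * powr_kernel s 0 z (y / 2))"
      using t y s by (intro mult_mono powr_mono2) auto
    then show "\<bar>t powr (2 * s - 1) * kernel_y s z t\<bar> \<le> (2 * y) powr (2 * s - 1) * (?c * powr_kernel s 0 z (y / 2))"
      by (simp add: abs_mult)
  next
    show "integrable lborel (\<lambda>z :: real ^ 'n. (2 * y) powr (2 * s - 1) * (?c * powr_kernel s 0 z (y / 2)))"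
      using powr_kernel_integrable[of "y / 2" s, where 'n='n] y s0 by simp
  qed (use s0 in \<open>auto intro: poisson_kernel_integrable poisson_deriv_y\<close>)
  also have "(\<integral>z. (y powr (2 * s - 1) * kernel_y s z y) * \<psi> (x - z) \<partial>lborel) = y powr (2 * s - 1) * ext_y x y"
    unfolding ext_y_def by (simp only: mult.assoc integral_mult_right_zero)
  finally have d: "((\<lambda>t. \<integral>z. poisson_kernel s z t * \<psi> (x - z) \<partial>lborel) has_real_derivative y powr (2 * s - 1) * ext_y x y) (at y)" .
  have "eventually (\<lambda>t. (\<integral>z. poisson_kernel s z t * \<psi> (x - z) \<partial>lborel) = extension s \<psi> (x, t)) (nhds y)"
    using eventually_nhds_in_open[of "{0<..}" y] y by (auto elim!: eventually_mono simp: extension_def)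
  from DERIV_cong_ev[OF refl this refl] d show ?thesis by blast
qed

text \<open>The same derivative computed twice, once with the derivative on \<psi> and once on the
  kernel; uniqueness of derivatives identifies them. The first form is continuous up to y = 0, the
  second exhibits the factor y^(2s-1) and can be differentiated again.\<close>

lemma ext_grad_snd:
  assumes y: "y > 0"
  shows "snd (ext_grad (x, y)) = y powr (2 * s - 1) * ext_y x y"
proof -
  have "((\<lambda>t. extension s \<psi> ((x, 0) + t *\<^sub>R (0, 1))) has_real_derivative ext_grad ((x, 0) + y *\<^sub>R (0, 1)) \<bullet> (0, 1)) (at y)"
    by (rule has_derivative_imp_DERIV_line[OF ext_has_derivative])
  then have "((\<lambda>t. extension s \<psi> (x, t)) has_real_derivative snd (ext_grad (x, y))) (at y)"
    by (simp add: inner_prod_def)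
  then show ?thesis using ext_deriv_y[OF y] by (rule DERIV_unique)
qed

lemma ext_y_deriv:
  assumes y: "y > 0"
  shows "((\<lambda>t. ext_y x t) has_real_derivative ext_m x y) (at y)"
  unfolding ext_y_def ext_m_def
proof (rule conv_deriv_y[OF y])
  let ?c = "poisson_const TYPE('n) s * (real CARD('n) + 2 * s) * (real CARD('n) + 4 * s + 4)"
  fix z :: "real ^ 'n" and t :: real
  assume t: "y / 2 < t" "t < 2 * y"
  have c: "?c \<ge> 0" using poisson_const_pos(1)[OF s0, where 'n='n] s0 by simp
  have "\<bar>kernel_m s z t\<bar> \<le> ?c / t * powr_kernel s 0 z t"
    using t y by (intro kernel_m_bound s0) auto
  also have "\<dots> \<le> ?c / (y / 2) * powr_kernel s 0 z (y / 2)"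
    using t y c s0 by (intro mult_mono divide_left_mono powr_kernel_mono) auto
  finally show "\<bar>kernel_m s z t\<bar> \<le> ?c / (y / 2) * powr_kernel s 0 z (y / 2)" .
next
  show "integrable lborel (\<lambda>z :: real ^ 'n. poisson_const TYPE('n) s * (real CARD('n) + 2 * s) * (real CARD('n) + 4 * s + 4) / (y / 2) * powr_kernel s 0 z (y / 2))"
    using powr_kernel_integrable[of "y / 2" s, where 'n='n] y s0 by simp
qed (use s0 in \<open>auto intro: kernel_integrable kernel_y_deriv\<close>)

text \<open>Integration by parts in z: the derivative of P(z, y) \<psi>(x - z) in direction b
  integrates to 0, which moves the derivative from \<psi> to the kernel. Rescaling z then returns to
  the form with the kernel at height 1.\<close>

lemma ext_grad_fst:
  assumes y: "y > 0"
  shows "fst (ext_grad (x, y)) \<bullet> b = y powr (2 * s - 1) * (\<integral>z. kernel_x s b z y * \<psi> (x - z) \<partial>lborel)"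
proof -
  let ?P = "\<lambda>z :: real ^ 'n. poisson_kernel s z y"
  let ?d = "\<lambda>z h :: real ^ 'n. ?P z * - (g (x - z) \<bullet> h) + y powr (2 * s - 1) * kernel_x s h z y * \<psi> (x - z)"
  have i1: "integrable lborel (\<lambda>z. ?P z * (g (x - z) \<bullet> b))"
  proof (rule Bochner_Integration.integrable_bound)
    show "integrable lborel (\<lambda>z. ?P z * (M * norm b))"
      using poisson_kernel_integrable[of y s, where 'n='n] y s0 by simp
    have "\<bar>g w \<bullet> b\<bar> \<le> M * norm b" for w
      using Cauchy_Schwarz_ineq2[of "g w" b] mult_right_mono[OF g_bound[of w] norm_ge_zero[of b]] by linarith
    then show "AE z in lborel. norm (?P z * (g (x - z) \<bullet> b)) \<le> norm (?P z * (M * norm b))"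
      using M_nonneg by (auto simp: abs_mult intro!: AE_I2 mult_left_mono)
  qed simp
  have i2: "integrable lborel (\<lambda>z. kernel_x s b z y * \<psi> (x - z))"
    using integrable_kernel_\<psi>[OF kernel_integrable(1)[OF s0 y], of b x 1] by simp
  have "(\<integral>z. ?d z b \<partial>lborel) = 0"
  proof (rule integral_directional_derivative_eq_0[where f="\<lambda>z. ?P z * \<psi> (x - z)" and f'="?d" and e=b])
    fix z :: "real ^ 'n"
    have "((\<lambda>z. \<psi> (x - z)) has_derivative (\<lambda>h. g (x - z) \<bullet> (- h))) (at z)"
      by (rule has_derivative_compose[where g=\<psi> and f="\<lambda>z. x - z"]) (use deriv in \<open>auto intro!: derivative_eq_intros\<close>)
    then have "((\<lambda>z. \<psi> (x - z)) has_derivative (\<lambda>h. - (g (x - z) \<bullet> h))) (at z)" by simp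
    then show "((\<lambda>z. ?P z * \<psi> (x - z)) has_derivative ?d z) (at z)"
      by (rule has_derivative_mult[OF poisson_deriv_z[OF y]])
  next
    show "integrable lborel (\<lambda>z. ?P z * \<psi> (x - z))"
      using integrable_kernel_\<psi>[of ?P x 1] poisson_kernel_integrable[of y s, where 'n='n] y s0 by simp
    have "integrable lborel (\<lambda>z. - (?P z * (g (x - z) \<bullet> b)) + y powr (2 * s - 1) * (kernel_x s b z y * \<psi> (x - z)))"
      using i1 i2 by simp
    then show "integrable lborel (\<lambda>z. ?d z b)" by (simp add: mult.assoc)
    have "continuous_on UNIV ?P"
      unfolding poisson_kernel_def poisson_profile_eq using y by (intro continuous_intros) auto
    moreover have "continuous_on UNIV (\<lambda>z. kernel_x s b z y)"
      unfolding kernel_x_def using y by (intro continuous_intros) auto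
    moreover have "continuous_on UNIV (\<lambda>z. \<psi> (x - z))" "continuous_on UNIV (\<lambda>z. g (x - z))"
      by (auto intro!: continuous_on_compose2[OF cont_\<psi>[of UNIV]] continuous_on_compose2[OF cont_g[of UNIV]] continuous_intros)
    ultimately show "continuous_on UNIV (\<lambda>z. ?d z b)" by (intro continuous_intros)
  qed
  also have "(\<integral>z. ?d z b \<partial>lborel) = (\<integral>z. - (?P z * (g (x - z) \<bullet> b)) + y powr (2 * s - 1) * (kernel_x s b z y * \<psi> (x - z)) \<partial>lborel)"
    by (simp add: mult.assoc)
  also have "\<dots> = - (\<integral>z. ?P z * (g (x - z) \<bullet> b) \<partial>lborel) + y powr (2 * s - 1) * (\<integral>z. kernel_x s b z y * \<psi> (x - z) \<partial>lborel)"
    using i1 i2 by (subst Bochner_Integration.integral_add) simp_all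
  finally have "(\<integral>z. ?P z * (g (x - z) \<bullet> b) \<partial>lborel) = y powr (2 * s - 1) * (\<integral>z. kernel_x s b z y * \<psi> (x - z) \<partial>lborel)" by simp
  moreover have "fst (ext_grad (x, y)) \<bullet> b = (\<integral>z. poisson_kernel s z 1 * (g (x - y *\<^sub>R z) \<bullet> b) \<partial>lborel)"
    using ext_grad_inner[of "(x, y)" "(b, 0)"] by (simp add: inner_prod_def)
  moreover have "\<dots> = (\<integral>z. ?P z * (g (x - z) \<bullet> b) \<partial>lborel)"
    by (rule integral_poisson_scale[OF y, symmetric]) simp
  ultimately show ?thesis by simp
qed

end

section \<open>The fractional Laplacian as a weighted normal derivative\<close>

context holder_C1
begin

text \<open>Averaging over z and -z removes the odd first-order part of \<psi>(x) - \<psi>(x - z),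
  so that the principal value becomes an absolutely convergent integral.\<close>

definition half_diff :: "real ^ 'n \<Rightarrow> real ^ 'n \<Rightarrow> real" where
  "half_diff x z = \<psi> x - (\<psi> (x + z) + \<psi> (x - z)) / 2"

lemma half_diff_measurable[measurable]: "half_diff x \<in> borel_measurable borel"
  unfolding half_diff_def by measurable

lemma half_diff_bound: "\<bar>half_diff x z\<bar> \<le> 2 * M"
  using \<psi>_bound[of x] \<psi>_bound[of "x + z"] \<psi>_bound[of "x - z"] unfolding half_diff_def abs_le_iff by (simp add: field_simps)

text \<open>As a function of t, \<psi>(x + t z) + \<psi>(x - t z) has derivative (g(x + t z) - g(x -
  t z)) . z, and the Hoelder bound of g at distance 2 t |z| gives |z|^s |z|.\<close>

lemma half_diff_bound': "\<bar>half_diff x z\<bar> \<le> M * norm z powr (1 + s)"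
proof -
  let ?f = "\<lambda>t::real. \<psi> (x + t *\<^sub>R z) + \<psi> (x + t *\<^sub>R (- z))"
  let ?f' = "\<lambda>t::real. g (x + t *\<^sub>R z) \<bullet> z + g (x + t *\<^sub>R (- z)) \<bullet> (- z)"
  have "\<bar>?f 1 - ?f 0\<bar> \<le> (2 * M * norm z powr (1 + s)) * \<bar>1 - 0\<bar>"
  proof (rule real_derivative_bound[of "{0..1}" ?f ?f'])
    fix t :: real assume t: "t \<in> {0..1}"
    show "(?f has_real_derivative ?f' t) (at t)"
      by (intro DERIV_add has_derivative_imp_DERIV_line deriv)
    have "norm ((x + t *\<^sub>R z) - (x + t *\<^sub>R (- z))) = norm ((2 * t) *\<^sub>R z)"
      by (rule arg_cong[where f=norm]) (simp add: scaleR_2[symmetric])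
    also have "\<dots> \<le> 2 * norm z" using t by (simp add: mult_right_mono)
    finally have n: "norm ((x + t *\<^sub>R z) - (x + t *\<^sub>R (- z))) \<le> 2 * norm z" .
    have "norm (g (x + t *\<^sub>R z) - g (x + t *\<^sub>R (- z))) \<le> M * norm ((x + t *\<^sub>R z) - (x + t *\<^sub>R (- z))) powr s"
      by (rule g_holder)
    also have "\<dots> \<le> M * (2 * norm z) powr s"
      using n s by (intro mult_left_mono powr_mono2 M_nonneg) auto
    \<comment> \<open>The factor 2^s is rounded up to 2, which the 1/2 in \<open>half_diff\<close>
      cancels at the end.\<close>
    also have "\<dots> \<le> M * (2 * norm z powr s)"
      using s powr_mono[of s 1 2] by (intro mult_left_mono M_nonneg) (simp add: powr_mult mult_right_mono)
    finally have "norm (g (x + t *\<^sub>R z) - g (x + t *\<^sub>R (- z))) * norm z \<le> (M * (2 * norm z powr s)) * norm z"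
      by (rule mult_right_mono) simp
    also have "\<dots> = 2 * M * norm z powr (1 + s)"
      by (simp add: powr_mult_base[symmetric])
    finally have "norm (g (x + t *\<^sub>R z) - g (x + t *\<^sub>R (- z))) * norm z \<le> 2 * M * norm z powr (1 + s)" .
    moreover have "?f' t = (g (x + t *\<^sub>R z) - g (x + t *\<^sub>R (- z))) \<bullet> z" by (simp add: inner_diff_left)
    ultimately show "\<bar>?f' t\<bar> \<le> 2 * M * norm z powr (1 + s)"
      using Cauchy_Schwarz_ineq2[of "g (x + t *\<^sub>R z) - g (x + t *\<^sub>R (- z))" z] by simp
  qed auto
  then have "\<bar>(\<psi> (x + z) + \<psi> (x - z)) - 2 * \<psi> x\<bar> \<le> 2 * M * norm z powr (1 + s)" by simp
  moreover have "half_diff x z = - ((\<psi> (x + z) + \<psi> (x - z)) - 2 * \<psi> x) / 2"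
    by (simp add: half_diff_def field_simps)
  ultimately show ?thesis by simp
qed

text \<open>Independent of x, which yields continuity of \<open>pv\<close> and bounds uniform in x.
  Near 0 its exponent is 1 - s - n, integrable since s < 1; outside the unit ball it is -n -
  2s.\<close>

definition diff_majorant :: "real ^ 'n \<Rightarrow> real" where
  "diff_majorant z = norm z powr (- (real CARD('n) + 2 * s)) * (if norm z < 1 then M * norm z powr (1 + s) else 2 * M)"

lemma half_diff_majorant: "norm z powr (- (real CARD('n) + 2 * s)) * \<bar>half_diff x z\<bar> \<le> diff_majorant z"
  unfolding diff_majorant_def using half_diff_bound[of x z] half_diff_bound'[of x z]
  by (intro mult_left_mono) auto

lemma diff_majorant_nonneg: "diff_majorant z \<ge> 0"
  using M_nonneg by (simp add: diff_majorant_def)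

lemma diff_majorant_integrable: "integrable lborel diff_majorant"
proof (rule integrable_two_powers[where R=1 and \<beta>="1 - s - real CARD('n)" and \<beta>'="- (real CARD('n) + 2 * s)"])
  show "diff_majorant \<in> borel_measurable borel" unfolding diff_majorant_def by measurable
  show "\<bar>diff_majorant z\<bar> \<le> M * norm z powr (1 - s - real CARD('n))" if "norm z < 1" for z
  proof -
    have "norm z powr (- (real CARD('n) + 2 * s)) * norm z powr (1 + s) = norm z powr (1 - s - real CARD('n))"
      by (simp add: powr_add[symmetric] algebra_simps)
    then show ?thesis using that M_nonneg by (simp add: diff_majorant_def abs_mult mult.left_commute)
  qed
  show "\<bar>diff_majorant z\<bar> \<le> (2 * M) * norm z powr (- (real CARD('n) + 2 * s))" if "1 \<le> norm z" for z
    using that M_nonneg by (simp add: diff_majorant_def abs_mult)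
qed (use s in auto)

definition pv :: "real ^ 'n \<Rightarrow> real" where
  "pv x = (\<integral>z. norm z powr (- (real CARD('n) + 2 * s)) * half_diff x z \<partial>lborel)"

lemma pv_integrable: "integrable lborel (\<lambda>z. norm z powr (- (real CARD('n) + 2 * s)) * half_diff x z)"
  by (rule Bochner_Integration.integrable_bound[OF diff_majorant_integrable])
    (use half_diff_majorant diff_majorant_nonneg in \<open>auto simp: abs_mult intro!: AE_I2 intro: order_trans\<close>)

lemma pv_continuous: "continuous_on UNIV pv"
  unfolding pv_def
proof (rule continuous_at_imp_continuous_on, rule ballI, rule integral_isCont)
  fix x :: "real ^ 'n"
  show "\<forall>\<^sub>F p in at x. (\<lambda>z. norm z powr (- (real CARD('n) + 2 * s)) * half_diff p z) \<in> borel_measurable lborel \<and>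
      (\<forall>z\<in>space lborel. \<bar>norm z powr (- (real CARD('n) + 2 * s)) * half_diff p z\<bar> \<le> diff_majorant z)"
    using half_diff_majorant by (intro always_eventually) (simp add: abs_mult)
  show "isCont (\<lambda>p. norm z powr (- (real CARD('n) + 2 * s)) * half_diff p z) x" for z
    using cont_\<psi>[of UNIV] continuous_on_compose2[OF cont_\<psi>[of UNIV], of UNIV "\<lambda>x. x + z"]
      continuous_on_compose2[OF cont_\<psi>[of UNIV], of UNIV "\<lambda>x. x - z"]
    unfolding half_diff_def
    by (intro continuous_intros) (simp_all add: continuous_on_eq_continuous_at continuous_on_add continuous_on_diff continuous_on_id)
qed (use diff_majorant_integrable in auto)

text \<open>For each truncation radius the integrals with z and with -z converge separately and
  agree, so their mean may be taken inside; \<open>diff_majorant\<close> then lets the radius tend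
  to 0.\<close>

lemma pv_integral_eq: "pv_integral s \<psi> x = pv x"
proof -
  let ?I = "\<lambda>\<epsilon>. set_lebesgue_integral lborel {z. \<epsilon> < norm (x - z)}
         (\<lambda>z. (\<psi> x - \<psi> z) / norm (x - z) powr (real CARD('n) + 2 * s))"
  have cut: "?I \<epsilon> = (\<integral>z. indicator {z. \<epsilon> < norm z} z * (norm z powr (- (real CARD('n) + 2 * s)) * half_diff x z) \<partial>lborel)" if e: "\<epsilon> > 0" for \<epsilon>
  proof -
    let ?h = "\<lambda>z. indicator {z. \<epsilon> < norm z} z * (norm z powr (- (real CARD('n) + 2 * s)) * (\<psi> x - \<psi> (x - z)))"
    let ?k = "\<lambda>z. indicator {z. \<epsilon> < norm z} z * (norm z powr (- (real CARD('n) + 2 * s)) * (\<psi> x - \<psi> (x + z)))"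
    have ih: "integrable lborel ?h"
    proof (rule integrable_two_powers[where R=\<epsilon> and A=0 and \<beta>=0 and \<beta>'="- (real CARD('n) + 2 * s)" and A'="2 * M"])
      show "\<bar>?h z\<bar> \<le> 2 * M * norm z powr (- (real CARD('n) + 2 * s))" for z
        using \<psi>_bound[of x] \<psi>_bound[of "x - z"] M_nonneg abs_triangle_ineq4[of "\<psi> x" "\<psi> (x - z)"]
        by (auto simp: indicator_def abs_mult mult.commute[of "2 * M"] intro!: mult_left_mono)
    qed (use e s in \<open>auto simp: indicator_def\<close>)
    have ind: "indicator {z. \<epsilon> < norm z} (- z) = (indicator {z. \<epsilon> < norm z} z :: real)" for z :: "real ^ 'n"
      by (simp add: indicator_def)
    have ik: "integrable lborel ?k" and ek: "(\<integral>z. ?k z \<partial>lborel) = (\<integral>z. ?h z \<partial>lborel)"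
      using lborel_integrable_affine[OF ih, of "-1" 0] lborel_integral_affine[of "-1" ?h 0] by (auto simp: ind)
    have div: "v / norm z powr (real CARD('n) + 2 * s) = norm z powr (- (real CARD('n) + 2 * s)) * v" for v and z :: "real ^ 'n"
      by (simp only: powr_minus_divide) simp
    have "?I \<epsilon> = (\<integral>z. ?h z \<partial>lborel)"
      unfolding set_lebesgue_integral_def
      by (subst lborel_integral_affine[of "-1" _ x]) (auto simp: div indicator_def intro!: Bochner_Integration.integral_cong)
    also have "\<dots> = ((\<integral>z. ?h z \<partial>lborel) + (\<integral>z. ?k z \<partial>lborel)) / 2" unfolding ek by simp
    also have "\<dots> = (\<integral>z. (?h z + ?k z) / 2 \<partial>lborel)" using ih ik by simp
    also have "\<dots> = (\<integral>z. indicator {z. \<epsilon> < norm z} z * (norm z powr (- (real CARD('n) + 2 * s)) * half_diff x z) \<partial>lborel)"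
      by (rule Bochner_Integration.integral_cong) (auto simp: half_diff_def indicator_def field_simps)
    finally show ?thesis .
  qed
  have "((\<lambda>\<epsilon>. \<integral>z. indicator {z. \<epsilon> < norm z} z * (norm z powr (- (real CARD('n) + 2 * s)) * half_diff x z) \<partial>lborel) \<longlongrightarrow> pv x) (at_right 0)"
    unfolding pv_def
  proof (rule integral_tendsto_at[OF _ diff_majorant_integrable])
    show "\<forall>\<^sub>F \<epsilon> in at_right 0. (\<lambda>z. indicator {z. \<epsilon> < norm z} z * (norm z powr (- (real CARD('n) + 2 * s)) * half_diff x z)) \<in> borel_measurable lborel \<and>
        (AE z in lborel. \<bar>indicator {z. \<epsilon> < norm z} z * (norm z powr (- (real CARD('n) + 2 * s)) * half_diff x z)\<bar> \<le> diff_majorant z)"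
      using half_diff_majorant diff_majorant_nonneg by (intro always_eventually allI conjI AE_I2) (auto simp: abs_mult indicator_def)
    show "AE z in lborel. ((\<lambda>\<epsilon>. indicator {z. \<epsilon> < norm z} z * (norm z powr (- (real CARD('n) + 2 * s)) * half_diff x z)) \<longlongrightarrow> norm z powr (- (real CARD('n) + 2 * s)) * half_diff x z) (at_right 0)"
      using AE_lborel_singleton[of 0]
    proof eventually_elim
      case (elim z)
      have "eventually (\<lambda>\<epsilon>. \<epsilon> < norm z) (at_right (0::real))"
        using elim by (intro eventually_at_right_real[THEN eventually_mono]) auto
      then show ?case by (intro tendsto_eventually) (auto elim!: eventually_mono simp: indicator_def)
    qed
  qed simp
  moreover have "eventually (\<lambda>\<epsilon>. (\<integral>z. indicator {z. \<epsilon> < norm z} z * (norm z powr (- (real CARD('n) + 2 * s)) * half_diff x z) \<partial>lborel) = ?I \<epsilon>) (at_right 0)"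
    using eventually_at_right_less[of "0::real"] by eventually_elim (simp add: cut)
  ultimately have "(?I \<longlongrightarrow> pv x) (at_right 0)" by (rule Lim_transform_eventually)
  then show ?thesis unfolding pv_integral_def by (intro tendsto_Lim) auto
qed

text \<open>The extension of the constant 1 is 1, so its y-derivative vanishes; the constant is
  itself an instance of \<open>holder_C1\<close>.\<close>

lemma integral_kernel_y: 
  assumes y: "y > 0"
  shows "(\<integral>z. kernel_y s (z :: real ^ 'n) y \<partial>lborel) = 0"
proof -
  interpret one: holder_C1 s 1 "\<lambda>_ :: real ^ 'n. 1" "\<lambda>_. 0"
    by unfold_locales (use s in auto)
  have "extension s (\<lambda>_ :: real ^ 'n. 1) (0, t) = 1" for t
    using one.ext_eq[of 0 t] poisson_const_pos(2)[of s 1, where 'n='n] s by simp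
  then have "y powr (2 * s - 1) * one.ext_y 0 y = 0"
    using one.ext_deriv_y[OF y, of 0] by (intro DERIV_unique[OF _ DERIV_const]) simp
  then show ?thesis using y by (simp add: one.ext_y_def)
qed

text \<open>Mass zero of \<open>kernel_y\<close> inserts \<psi>(x) at no cost, and its evenness
  symmetrises in z. In this form the integrand has a majorant that does not depend on y.\<close>

lemma ext_y_eq:
  assumes y: "y > 0"
  shows "ext_y x y = - (\<integral>z. kernel_y s z y * half_diff x z \<partial>lborel)"
proof -
  have i: "integrable lborel (\<lambda>z. kernel_y s z y * \<psi> (x - z))"
    using integrable_kernel_\<psi>[OF kernel_integrable(2)[OF s0 y], of x 1] by simp
  have i': "integrable lborel (\<lambda>z. kernel_y s z y * \<psi> (x + z))"
    and e: "(\<integral>z. kernel_y s z y * \<psi> (x + z) \<partial>lborel) = ext_y x y"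
    using lborel_integrable_affine[OF i, of "-1" 0] lborel_integral_affine[of "-1" "\<lambda>z. kernel_y s z y * \<psi> (x - z)" 0]
    by (auto simp: ext_y_def)
  have i0: "integrable lborel (\<lambda>z :: real ^ 'n. kernel_y s z y)" by (rule kernel_integrable[OF s0 y])
  have "(\<integral>z. kernel_y s z y * half_diff x z \<partial>lborel)
    = (\<integral>z. \<psi> x * kernel_y s z y - (kernel_y s z y * \<psi> (x + z) + kernel_y s z y * \<psi> (x - z)) / 2 \<partial>lborel)"
    by (rule Bochner_Integration.integral_cong) (auto simp: half_diff_def field_simps)
  also have "\<dots> = - ext_y x y"
    using i i' i0 by (simp add: e ext_y_def[symmetric] integral_kernel_y[OF y])
  finally show ?thesis by simp
qed

lemma ext_y_majorant:
  assumes y: "y > 0"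
  shows "AE z in lborel. \<bar>kernel_y s z y * half_diff x z\<bar> \<le> (poisson_const TYPE('n) s * (real CARD('n) + 4 * s)) * diff_majorant z"
  using AE_lborel_singleton[of 0]
proof eventually_elim
  case (elim z)
  have c: "(poisson_const TYPE('n) s * (real CARD('n) + 4 * s)) \<ge> 0" using poisson_const_pos(1)[OF s0, where 'n='n] s0 by simp
  have "\<bar>kernel_y s z y\<bar> \<le> (poisson_const TYPE('n) s * (real CARD('n) + 4 * s)) * powr_kernel s 0 z y" by (rule kernel_y_bound[OF s0 y])
  also have "\<dots> \<le> (poisson_const TYPE('n) s * (real CARD('n) + 4 * s)) * norm z powr (- (real CARD('n) + 2 * s))"
    using elim s0 by (intro mult_left_mono c powr_kernel_le_powr) auto
  finally have "\<bar>kernel_y s z y\<bar> * \<bar>half_diff x z\<bar> \<le> ((poisson_const TYPE('n) s * (real CARD('n) + 4 * s)) * norm z powr (- (real CARD('n) + 2 * s))) * \<bar>half_diff x z\<bar>"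
    by (rule mult_right_mono) simp
  also have "\<dots> \<le> (poisson_const TYPE('n) s * (real CARD('n) + 4 * s)) * diff_majorant z"
    using mult_left_mono[OF half_diff_majorant c] by (simp only: mult.assoc)
  finally show ?case by (simp add: abs_mult)
qed

lemma ext_y_bound:
  assumes y: "y > 0"
  shows "\<bar>ext_y x y\<bar> \<le> (poisson_const TYPE('n) s * (real CARD('n) + 4 * s)) * (\<integral>z. diff_majorant z \<partial>lborel)"
proof -
  have i: "integrable lborel (\<lambda>z. (poisson_const TYPE('n) s * (real CARD('n) + 4 * s)) * diff_majorant z)" using diff_majorant_integrable by simp
  have j: "integrable lborel (\<lambda>z. kernel_y s z y * half_diff x z)"
    by (rule Bochner_Integration.integrable_bound[OF i])
      (use ext_y_majorant[OF y, of x] in \<open>auto elim!: eventually_mono intro: order_trans[OF _ abs_ge_self]\<close>)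
  have "\<bar>ext_y x y\<bar> \<le> (\<integral>z. \<bar>kernel_y s z y * half_diff x z\<bar> \<partial>lborel)"
    unfolding ext_y_eq[OF y] abs_minus_cancel by (rule integral_abs_bound)
  also have "\<dots> \<le> (\<integral>z. (poisson_const TYPE('n) s * (real CARD('n) + 4 * s)) * diff_majorant z \<partial>lborel)"
    by (rule integral_mono_AE[OF integrable_abs[OF j] i ext_y_majorant[OF y]])
  finally show ?thesis by simp
qed

text \<open>For z different from 0, \<open>kernel_y\<close> tends to its first term, 2s times
  \<open>poisson_const\<close> times |z|^(-n-2s), as the other term carries y^2. This is the origin
  of the value of the normalising constant.\<close>

lemma ext_y_limit: "((\<lambda>y. ext_y x y) \<longlongrightarrow> - (2 * s * poisson_const TYPE('n) s * pv x)) (at_right 0)"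
proof -
  have "((\<lambda>y. \<integral>z. kernel_y s z y * half_diff x z \<partial>lborel) \<longlongrightarrow>
    (\<integral>z. 2 * s * poisson_const TYPE('n) s * (norm z powr (- (real CARD('n) + 2 * s)) * half_diff x z) \<partial>lborel)) (at_right 0)"
  proof (rule integral_tendsto_at)
    show "integrable lborel (\<lambda>z. (poisson_const TYPE('n) s * (real CARD('n) + 4 * s)) * diff_majorant z)" using diff_majorant_integrable by simp
    show "\<forall>\<^sub>F y in at_right 0. (\<lambda>z. kernel_y s z y * half_diff x z) \<in> borel_measurable lborel \<and>
        (AE z in lborel. \<bar>kernel_y s z y * half_diff x z\<bar> \<le> (poisson_const TYPE('n) s * (real CARD('n) + 4 * s)) * diff_majorant z)"
      using eventually_at_right_less[of "0::real"] by eventually_elim (use ext_y_majorant in simp)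
    show "AE z in lborel. ((\<lambda>y. kernel_y s z y * half_diff x z) \<longlongrightarrow>
       2 * s * poisson_const TYPE('n) s * (norm z powr (- (real CARD('n) + 2 * s)) * half_diff x z)) (at_right 0)"
      using AE_lborel_singleton[of 0]
    proof eventually_elim
      case (elim z)
      have k: "((\<lambda>y. powr_kernel s j z y) \<longlongrightarrow> powr_kernel s j z 0) (at_right 0)" for j
        unfolding powr_kernel_def by (rule tendsto_powr) (use elim in \<open>auto intro!: tendsto_eq_intros\<close>)
      have "((\<lambda>y. kernel_y s z y) \<longlongrightarrow> poisson_const TYPE('n) s * (2 * s * powr_kernel s 0 z 0
          - (real CARD('n) + 2 * s) * 0\<^sup>2 * powr_kernel s 1 z 0)) (at_right 0)"
        unfolding kernel_y_def by (intro tendsto_intros k)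
      then have "((\<lambda>y. kernel_y s z y * half_diff x z) \<longlongrightarrow> poisson_const TYPE('n) s * (2 * s * norm z powr (- (real CARD('n) + 2 * s))) * half_diff x z) (at_right 0)"
        using elim by (intro tendsto_mult tendsto_const) (simp add: powr_kernel_0)
      then show ?case by (simp add: mult_ac)
    qed
  qed simp
  then have "((\<lambda>y. - (\<integral>z. kernel_y s z y * half_diff x z \<partial>lborel)) \<longlongrightarrow> - (2 * s * poisson_const TYPE('n) s * pv x)) (at_right 0)"
    unfolding pv_def by (intro tendsto_minus) simp
  moreover have "eventually (\<lambda>y. - (\<integral>z. kernel_y s z y * half_diff x z \<partial>lborel) = ext_y x y) (at_right 0)"
    using eventually_at_right_less[of "0::real"] by eventually_elim (simp add: ext_y_eq)
  ultimately show ?thesis by (rule Lim_transform_eventually)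
qed

lemma ext_weighted_deriv_limit:
  "((\<lambda>y. y powr (1 - 2 * s) * deriv (\<lambda>t. extension s \<psi> (x, t)) y) \<longlongrightarrow>
     - (2 * s * poisson_const TYPE('n) s * pv_integral s \<psi> x)) (at_right 0)"
proof -
  have "eventually (\<lambda>y. ext_y x y = y powr (1 - 2 * s) * deriv (\<lambda>t. extension s \<psi> (x, t)) y) (at_right 0)"
    using eventually_at_right_less[of "0::real"]
  proof eventually_elim
    case (elim y)
    have "y powr (1 - 2 * s) * y powr (2 * s - 1) = 1" using elim by (simp flip: powr_add)
    then show ?case using DERIV_imp_deriv[OF ext_deriv_y[OF elim, of x]] by (simp flip: mult.assoc)
  qed
  from Lim_transform_eventually[OF ext_y_limit this] show ?thesis unfolding pv_integral_eq .
qed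

end

section \<open>The weak equation for the extension\<close>

lemma compact_support_integrable:
  fixes f :: "'a::euclidean_space \<Rightarrow> real"
  assumes c: "continuous_on UNIV f" and z: "\<And>x. norm x > R \<Longrightarrow> f x = 0"
  shows "integrable lborel f"
proof -
  have "integrable lborel (\<lambda>x. indicator (cball 0 R) x *\<^sub>R f x)"
    by (rule borel_integrable_compact) (use c in \<open>auto intro: continuous_on_subset\<close>)
  moreover have "(\<lambda>x. indicator (cball 0 R) x *\<^sub>R f x) = f"
    using z by (auto simp: fun_eq_iff indicator_def not_le)
  ultimately show ?thesis by simp
qed

lemma compact_support_bounded:
  fixes f :: "'a::euclidean_space \<Rightarrow> 'b::real_normed_vector"
  assumes c: "continuous_on UNIV f" and z: "\<And>x. norm x > R \<Longrightarrow> f x = 0"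
  obtains B where "B > 0" "\<And>x. norm (f x) \<le> B"
proof -
  have "bounded (f ` cball 0 R)"
    by (rule compact_imp_bounded, rule compact_continuous_image) (use c in \<open>auto intro: continuous_on_subset\<close>)
  then obtain B where B: "B > 0" "\<forall>x\<in>cball 0 R. norm (f x) \<le> B"
    by (auto simp: bounded_pos)
  have "norm (f x) \<le> B" for x
    using B z[of x] by (cases "norm x \<le> R") (auto simp: not_le)
  with B(1) show ?thesis by (rule that)
qed

text \<open>Moves the bounded function \<psi> outside, so that the inner integral contains only the
  kernel q and the test function c.\<close>

lemma fubini_conv:
  fixes q \<psi> c :: "'a::euclidean_space \<Rightarrow> real"
  assumes q: "integrable lborel q" and c: "integrable lborel c"
    and \<psi>[measurable]: "\<psi> \<in> borel_measurable borel" and M: "\<And>x. \<bar>\<psi> x\<bar> \<le> M"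
  shows "integrable lborel (\<lambda>x. (\<integral>z. q z * \<psi> (x - z) \<partial>lborel) * c x)"
    and "(\<integral>x. (\<integral>z. q z * \<psi> (x - z) \<partial>lborel) * c x \<partial>lborel) = (\<integral>z. \<psi> z * (\<integral>x. q (x - z) * c x \<partial>lborel) \<partial>lborel)"
proof -
  have [measurable]: "q \<in> borel_measurable borel" "c \<in> borel_measurable borel" using q c by auto
  have M0: "M \<ge> 0" using M[of 0] by simp
  have iq: "integrable lborel (\<lambda>z. q (x - z))" for x
    using lborel_integrable_affine[OF q, of "-1" x] by simp
  have flip: "(\<integral>z. f (x - z) \<partial>lborel) = (\<integral>z. f z \<partial>lborel)" if "f \<in> borel_measurable borel" for f :: "'a \<Rightarrow> real" and x
    using lborel_integral_affine[OF _ that, of "-1" x] by simp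
  have iq\<psi>: "integrable lborel (\<lambda>z. q (x - z) * \<psi> z)" for x
    by (rule Bochner_Integration.integrable_bound[of _ "\<lambda>z. q (x - z) * M"])
      (use iq M M0 in \<open>auto simp: abs_mult intro!: AE_I2 mult_left_mono\<close>)
  have e: "(\<integral>z. q z * \<psi> (x - z) \<partial>lborel) = (\<integral>z. q (x - z) * \<psi> z \<partial>lborel)" for x
    using flip[of "\<lambda>z. q z * \<psi> (x - z)" x] by simp
  let ?F = "\<lambda>(x, z). q (x - z) * \<psi> z * c x"
  have I: "integrable (lborel \<Otimes>\<^sub>M lborel) ?F"
  proof (rule lborel_pair.Fubini_integrable)
    have b: "(\<integral>z. norm (?F (x, z)) \<partial>lborel) \<le> M * (\<integral>z. \<bar>q z\<bar> \<partial>lborel) * \<bar>c x\<bar>" for x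
    proof -
      have "(\<integral>z. norm (?F (x, z)) \<partial>lborel) = (\<integral>z. \<bar>q (x - z) * \<psi> z\<bar> \<partial>lborel) * \<bar>c x\<bar>"
        by (simp add: abs_mult)
      also have "(\<integral>z. \<bar>q (x - z) * \<psi> z\<bar> \<partial>lborel) \<le> (\<integral>z. M * \<bar>q (x - z)\<bar> \<partial>lborel)"
        using iq\<psi> iq M by (intro integral_mono integrable_abs integrable_mult_right) (auto simp: abs_mult mult.commute[of M] intro!: mult_left_mono)
      also have "\<dots> = M * (\<integral>z. \<bar>q z\<bar> \<partial>lborel)" using flip[of "\<lambda>z. \<bar>q z\<bar>" x] by simp
      finally show ?thesis by (simp add: mult_right_mono)
    qed
    have ic: "integrable lborel (\<lambda>x. M * (\<integral>z. \<bar>q z\<bar> \<partial>lborel) * \<bar>c x\<bar>)" using c by simp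
    show "integrable lborel (\<lambda>x. \<integral>z. norm (?F (x, z)) \<partial>lborel)"
    proof (rule Bochner_Integration.integrable_bound[OF ic])
      show "AE x in lborel. norm (\<integral>z. norm (?F (x, z)) \<partial>lborel) \<le> norm (M * (\<integral>z. \<bar>q z\<bar> \<partial>lborel) * \<bar>c x\<bar>)"
      proof (rule AE_I2)
        fix x
        have "0 \<le> (\<integral>z. norm (?F (x, z)) \<partial>lborel)" by simp
        then show "norm (\<integral>z. norm (?F (x, z)) \<partial>lborel) \<le> norm (M * (\<integral>z. \<bar>q z\<bar> \<partial>lborel) * \<bar>c x\<bar>)"
          using b[of x] by simp
      qed
    qed simp
    show "AE x in lborel. integrable lborel (\<lambda>z. ?F (x, z))"
      using iq\<psi> by simp
  qed simp
  show "integrable lborel (\<lambda>x. (\<integral>z. q z * \<psi> (x - z) \<partial>lborel) * c x)"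
    using lborel_pair.integrable_fst'[OF I] unfolding e by simp
  have "(\<integral>x. (\<integral>z. q z * \<psi> (x - z) \<partial>lborel) * c x \<partial>lborel) = (\<integral>x. \<integral>z. q (x - z) * \<psi> z * c x \<partial>lborel \<partial>lborel)"
    unfolding e by simp
  also have "\<dots> = (\<integral>z. \<integral>x. q (x - z) * \<psi> z * c x \<partial>lborel \<partial>lborel)"
    using lborel_pair.Fubini_integral[of "\<lambda>x z. ?F (x, z)"] I by simp
  also have "\<dots> = (\<integral>z. \<psi> z * (\<integral>x. q (x - z) * c x \<partial>lborel) \<partial>lborel)"
    by (subst integral_mult_right_zero[symmetric]) (simp only: mult_ac)
  finally show "(\<integral>x. (\<integral>z. q z * \<psi> (x - z) \<partial>lborel) * c x \<partial>lborel) = (\<integral>z. \<psi> z * (\<integral>x. q (x - z) * c x \<partial>lborel) \<partial>lborel)" .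
qed

text \<open>After Fubini the integration by parts takes place between q and \<gamma> for each fixed
  shift, so \<psi> is never differentiated.\<close>

lemma conv_parts:
  fixes q \<psi> \<gamma> :: "'a::euclidean_space \<Rightarrow> real"
  assumes q: "\<And>z. (q has_derivative q' z) (at z)" "integrable lborel q" "integrable lborel (\<lambda>z. q' z b)"
      "continuous_on UNIV (\<lambda>z. q' z b)"
    and \<gamma>: "\<And>x. (\<gamma> has_derivative \<gamma>' x) (at x)" "continuous_on UNIV (\<lambda>x. \<gamma>' x b)"
      "\<And>x. norm x > R \<Longrightarrow> \<gamma> x = 0" "\<And>x. norm x > R \<Longrightarrow> \<gamma>' x b = 0"
    and \<psi>: "\<psi> \<in> borel_measurable borel" "\<And>x. \<bar>\<psi> x\<bar> \<le> M"
  shows "(\<integral>x. (\<integral>z. q z * \<psi> (x - z) \<partial>lborel) * \<gamma>' x b \<partial>lborel) = - (\<integral>x. (\<integral>z. q' z b * \<psi> (x - z) \<partial>lborel) * \<gamma> x \<partial>lborel)"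
proof -
  have c\<gamma>: "continuous_on UNIV \<gamma>" by (rule has_derivative_continuous_on, rule has_derivative_at_withinI, rule \<gamma>)
  have cq: "continuous_on UNIV q" by (rule has_derivative_continuous_on, rule has_derivative_at_withinI, rule q)
  have i\<gamma>: "integrable lborel \<gamma>" "integrable lborel (\<lambda>x. \<gamma>' x b)"
    using compact_support_integrable c\<gamma> \<gamma> by blast+
  obtain B where B: "B > 0" "\<And>x. norm (\<gamma> x) \<le> B" using compact_support_bounded[OF c\<gamma> \<gamma>(3)] by metis
  obtain B' where B': "B' > 0" "\<And>x. norm (\<gamma>' x b) \<le> B'" using compact_support_bounded[OF \<gamma>(2) \<gamma>(4)] by metis
  have [measurable]: "\<gamma> \<in> borel_measurable borel" "(\<lambda>x. \<gamma>' x b) \<in> borel_measurable borel" "q \<in> borel_measurable borel"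
    "(\<lambda>x. q' x b) \<in> borel_measurable borel"
    using i\<gamma> q by auto
  have parts: "(\<integral>x. q (x - z) * \<gamma>' x b \<partial>lborel) = - (\<integral>x. q' (x - z) b * \<gamma> x \<partial>lborel)" for z
  proof -
    have s: "integrable lborel (\<lambda>x. f (x - z))" if "integrable lborel f" for f :: "'a \<Rightarrow> real"
      using lborel_integrable_affine[OF that, of 1 "- z"] by simp
    have dom: "integrable lborel (\<lambda>x. f (x - z) * h x)" if "integrable lborel f" "h \<in> borel_measurable borel" "\<And>x. norm (h x) \<le> K" for f h :: "'a \<Rightarrow> real" and K
    proof (rule Bochner_Integration.integrable_bound)
      show "integrable lborel (\<lambda>x. f (x - z) * K)" using s[OF that(1)] by simp
      have "0 \<le> K" using that(3)[of 0] norm_ge_zero order_trans by blast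
      then show "AE x in lborel. norm (f (x - z) * h x) \<le> norm (f (x - z) * K)"
        using that(3) by (auto simp: abs_mult intro!: AE_I2 mult_left_mono)
    qed (use that in auto)
    have i1: "integrable lborel (\<lambda>x. q (x - z) * \<gamma>' x b)" by (rule dom[OF q(2) _ B'(2)]) simp
    have i2: "integrable lborel (\<lambda>x. q' (x - z) b * \<gamma> x)" by (rule dom[OF q(3) _ B(2)]) simp
    have "(\<integral>x. q (x - z) * \<gamma>' x b + q' (x - z) b * \<gamma> x \<partial>lborel) = 0"
    proof (rule integral_directional_derivative_eq_0[where f="\<lambda>x. q (x - z) * \<gamma> x" and f'="\<lambda>x h. q (x - z) * \<gamma>' x h + q' (x - z) h * \<gamma> x" and e=b])
      fix x
      have "((\<lambda>x. q (x - z)) has_derivative q' (x - z)) (at x)"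
        by (rule has_derivative_compose[of "\<lambda>x. x - z" "\<lambda>h. h" x UNIV q "q' (x - z)", OF _ q(1)])
          (auto intro!: derivative_eq_intros)
      from has_derivative_mult[OF this \<gamma>(1)]
      show "((\<lambda>x. q (x - z) * \<gamma> x) has_derivative (\<lambda>h. q (x - z) * \<gamma>' x h + q' (x - z) h * \<gamma> x)) (at x)" .
      show "integrable lborel (\<lambda>x. q (x - z) * \<gamma> x)" by (rule dom[OF q(2) _ B(2)]) simp
      show "integrable lborel (\<lambda>x. q (x - z) * \<gamma>' x b + q' (x - z) b * \<gamma> x)" using i1 i2 by simp
      have "continuous_on UNIV (\<lambda>x. q (x - z))" "continuous_on UNIV (\<lambda>x. q' (x - z) b)"
        by (auto intro!: continuous_on_compose2[OF cq] continuous_on_compose2[OF q(4)] continuous_intros)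
      then show "continuous_on UNIV (\<lambda>x. q (x - z) * \<gamma>' x b + q' (x - z) b * \<gamma> x)"
        by (intro continuous_intros \<gamma> c\<gamma>)
    qed
    then show ?thesis using i1 i2 by simp
  qed
  show ?thesis
    unfolding fubini_conv(2)[OF q(2) i\<gamma>(2) \<psi>] fubini_conv(2)[OF q(3) i\<gamma>(1) \<psi>] parts by simp
qed

section \<open>The weight and the test functions on the whole space\<close>

lemma snd_borel_weight: "(\<lambda>p :: 'a::euclidean_space \<times> real. \<bar>snd p\<bar> powr a) \<in> borel_measurable borel"
proof -
  have [measurable]: "(snd :: 'a \<times> real \<Rightarrow> real) \<in> borel_measurable borel"
    by (intro borel_measurable_continuous_onI continuous_on_snd continuous_on_id)
  show ?thesis by measurable
qed

text \<open>The ball lies in a cylinder, on which the weight is a function of y alone; Fubini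
  reduces the claim to |y|^a on an interval with a > -1.\<close>

lemma integrable_weight_box:
  assumes a: "a > -1"
  shows "integrable lborel (\<lambda>p :: 'a::euclidean_space \<times> real. indicator (ball 0 r) p * \<bar>snd p\<bar> powr a)"
proof (cases "r > 0")
  case True
  have i: "integrable lborel (\<lambda>y::real. norm y powr a * indicator (ball 0 r) y)"
    by (rule integrable_powr_ball) (use a True in auto)
  let ?f = "\<lambda>(x::'a, y::real). indicator (ball 0 r) x * (norm y powr a * indicator (ball 0 r) y)"
  have "integrable (lborel \<Otimes>\<^sub>M lborel) ?f"
  proof (rule lborel_pair.Fubini_integrable)
    have fin: "emeasure lborel (ball (0::'a) r) < \<infinity>" by (rule emeasure_lborel_ball_finite)
    show "integrable lborel (\<lambda>x. \<integral>y. norm (?f (x, y)) \<partial>lborel)"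
      using fin by (simp add: abs_mult integrable_indicator_iff)
    show "AE x in lborel. integrable lborel (\<lambda>y. ?f (x, y))"
      using i by simp
  qed simp
  then have I: "integrable lborel ?f" by (simp add: lborel_prod)
  show ?thesis
  proof (rule Bochner_Integration.integrable_bound[OF I])
    show "AE p in lborel. norm (indicator (ball 0 r) p * \<bar>snd p\<bar> powr a) \<le> norm (?f p)"
    proof (rule AE_I2)
      fix p :: "'a \<times> real"
      have "norm (fst p) \<le> norm p" "\<bar>snd p\<bar> \<le> norm p"
        using norm_fst_le[of "fst p" "snd p"] norm_snd_le[of "snd p" "fst p"] by auto
      then show "norm (indicator (ball 0 r) p * \<bar>snd p\<bar> powr a) \<le> norm (?f p)"
        by (auto simp: indicator_def split_def)
    qed
    show "(\<lambda>p :: 'a \<times> real. indicator (ball 0 r) p * \<bar>snd p\<bar> powr a) \<in> borel_measurable lborel"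
      by (intro borel_measurable_times borel_measurable_indicator)
        (use snd_borel_weight[of a] in simp_all)
  qed
qed (simp add: ball_empty)

text \<open>Integrability over the ball passes to the sphere: on the shell 1/2 < t < 1 the radial
  factor t^(N-1) t^a is bounded below by a positive constant, so by polar coordinates an infinite
  sphere integral would force an infinite ball integral.\<close>

lemma weight_homogeneous:
  assumes a: "a > -1"
  shows "homogeneous_weight (\<lambda>p :: 'a::euclidean_space \<times> real. \<bar>snd p\<bar> powr a) a"
proof
  have [measurable]: "(\<lambda>p :: 'a \<times> real. \<bar>snd p\<bar> powr a) \<in> borel_measurable borel"
    by (rule snd_borel_weight)
  then show "(\<lambda>p :: 'a \<times> real. \<bar>snd p\<bar> powr a) \<in> borel_measurable borel" .
  show "\<bar>snd (t *\<^sub>R p)\<bar> powr a = t powr a * \<bar>snd p\<bar> powr a" if "t > 0" for t and p :: "'a \<times> real"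
    using that by (simp add: abs_mult powr_mult)
  show "0 < real DIM('a \<times> real) + a" using a by simp
  show "integrable unit_sphere_measure (\<lambda>p :: 'a \<times> real. \<bar>snd p\<bar> powr a)"
  proof (rule integrableI_bounded)
    let ?N = "DIM('a \<times> real)"
    let ?I = "\<integral>\<^sup>+p. ennreal (norm (\<bar>snd p\<bar> powr a)) \<partial>(unit_sphere_measure :: ('a \<times> real) measure)"
    have "(\<integral>\<^sup>+t. indicator {1/2<..<1::real} t * (ennreal ((1/2) ^ (?N - 1) * min 1 ((1/2) powr a)) * ?I) \<partial>lborel) \<le>
      (\<integral>\<^sup>+t. \<integral>\<^sup>+p. ennreal (if 0 < t then t ^ (?N - 1) else 0) * ennreal (indicator (ball 0 1) (t *\<^sub>R p) * \<bar>snd (t *\<^sub>R p)\<bar> powr a) \<partial>(unit_sphere_measure :: ('a \<times> real) measure) \<partial>lborel)"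
    proof (rule nn_integral_mono)
      fix t :: real
      show "indicator {1/2<..<1::real} t * (ennreal ((1/2) ^ (?N - 1) * min 1 ((1/2) powr a)) * ?I) \<le>
        (\<integral>\<^sup>+p. ennreal (if 0 < t then t ^ (?N - 1) else 0) * ennreal (indicator (ball 0 1) (t *\<^sub>R p) * \<bar>snd (t *\<^sub>R p)\<bar> powr a) \<partial>(unit_sphere_measure :: ('a \<times> real) measure))"
      proof (cases "t \<in> {1/2<..<1}")
        case True
        \<comment> \<open>The minimum covers both signs of a: t^a is at least (1/2)^a for a >= 0 and
          at least 1 otherwise.\<close>
        have ta: "min 1 ((1/2) powr a) \<le> t powr a"
        proof (cases "a \<ge> 0")
          case a0: True
          then have "(1/2) powr a \<le> t powr a" using True by (intro powr_mono2) auto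
          then show ?thesis by simp
        next
          case a0: False
          then have "1 powr a \<le> t powr a" using True by (intro powr_mono2') auto
          then show ?thesis by simp
        qed
        have tp: "(1/2) ^ (?N - 1) * min 1 ((1/2) powr a) \<le> t ^ (?N - 1) * t powr a"
          using True ta by (intro mult_mono power_mono) auto
        have "ennreal ((1/2) ^ (?N - 1) * min 1 ((1/2) powr a)) * ?I =
          (\<integral>\<^sup>+p. ennreal ((1/2) ^ (?N - 1) * min 1 ((1/2) powr a)) * ennreal (norm (\<bar>snd p\<bar> powr a)) \<partial>(unit_sphere_measure :: ('a \<times> real) measure))"
          by (rule nn_integral_cmult[symmetric]) simp
        also have "\<dots> \<le> (\<integral>\<^sup>+p. ennreal (if 0 < t then t ^ (?N - 1) else 0) * ennreal (indicator (ball 0 1) (t *\<^sub>R p) * \<bar>snd (t *\<^sub>R p)\<bar> powr a) \<partial>(unit_sphere_measure :: ('a \<times> real) measure))"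
        proof (rule nn_integral_mono_AE)
          show "AE p in (unit_sphere_measure :: ('a \<times> real) measure). ennreal ((1/2) ^ (?N - 1) * min 1 ((1/2) powr a)) * ennreal (norm (\<bar>snd p\<bar> powr a))
            \<le> ennreal (if 0 < t then t ^ (?N - 1) else 0) * ennreal (indicator (ball 0 1) (t *\<^sub>R p) * \<bar>snd (t *\<^sub>R p)\<bar> powr a)"
            using AE_unit_sphere[where 'a="'a \<times> real"]
          proof eventually_elim
            case (elim p)
            have "(1/2) ^ (?N - 1) * min 1 ((1/2) powr a) * (\<bar>snd p\<bar> powr a) \<le> t ^ (?N - 1) * t powr a * \<bar>snd p\<bar> powr a"
              by (rule mult_right_mono[OF tp]) simp
            moreover have "\<bar>snd (t *\<^sub>R p)\<bar> powr a = t powr a * \<bar>snd p\<bar> powr a"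
              using True by (simp add: abs_mult powr_mult)
            moreover have "indicator (ball 0 1) (t *\<^sub>R p) = (1::real)"
              using True elim by (simp add: indicator_def)
            ultimately show ?case
              using True by (simp add: ennreal_mult[symmetric] mult.assoc del: snd_scaleR)
          qed
        qed
        finally show ?thesis using True by simp
      qed simp
    qed
    also have "\<dots> = (\<integral>\<^sup>+p. ennreal (indicator (ball 0 1) p * \<bar>snd p\<bar> powr a) \<partial>(lborel :: ('a \<times> real) measure))"
      by (rule nn_integral_polar[symmetric]) simp
    also have "\<dots> < \<infinity>"
      using integrable_weight_box[OF a, of 1, where 'a='a] by (simp add: integrable_iff_bounded abs_mult)
    finally have "ennreal ((1/2) ^ (?N - 1) * min 1 ((1/2) powr a)) * ?I * emeasure lborel {1/2<..<1::real} < \<infinity>"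
      by (simp add: nn_integral_multc mult.commute)
    moreover have "min 1 ((1/2) powr a) \<noteq> 0" by (simp add: min_def)
    moreover have "emeasure lborel {1/2<..<1::real} = ennreal (1/2)" by simp
    ultimately show "?I < \<infinity>" by (auto simp: ennreal_mult_less_top ennreal_mult_eq_top_iff less_top)
  qed simp
qed

lemma integrable_snd_indicator:
  fixes f :: "'a::euclidean_space \<times> real \<Rightarrow> real"
  assumes f: "integrable lborel f" and A: "A \<in> sets borel"
  shows "integrable lborel (\<lambda>p. indicator A (snd p) * f p)"
proof -
  have "(snd -` A :: ('a \<times> real) set) \<in> sets borel"
    using measurable_sets[OF borel_measurable_continuous_onI[OF continuous_on_snd[OF continuous_on_id]] A] by simp
  then have "integrable lborel (\<lambda>p. indicator (snd -` A) p *\<^sub>R f p)"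
    by (intro integrable_mult_indicator f) simp
  then show ?thesis by (simp add: indicator_def)
qed

text \<open>The gradient Z is a parameter rather than derived from \<zeta>, so that tested
  expressions are explicit integrands. Class C^1 with bounded support admits V times a
  cutoff.\<close>

locale test_fun =
  fixes \<zeta> :: "(real ^ 'n) \<times> real \<Rightarrow> real" and Z :: "(real ^ 'n) \<times> real \<Rightarrow> (real ^ 'n) \<times> real" and R :: real
  assumes \<zeta>_deriv: "(\<zeta> has_derivative (\<lambda>h. Z p \<bullet> h)) (at p)"
    and Z_cont: "continuous_on UNIV Z"
    and \<zeta>_supp: "norm p > R \<Longrightarrow> \<zeta> p = 0" and Z_supp: "norm p > R \<Longrightarrow> Z p = 0"
begin

lemma \<zeta>_cont: "continuous_on A \<zeta>"
  by (rule has_derivative_continuous_on, rule has_derivative_at_withinI, rule \<zeta>_deriv)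

lemma slice_supp: "norm x > R \<Longrightarrow> \<zeta> (x, y) = 0" "norm x > R \<Longrightarrow> Z (x, y) = 0"
  "\<bar>y\<bar> > R \<Longrightarrow> \<zeta> (x, y) = 0" "\<bar>y\<bar> > R \<Longrightarrow> Z (x, y) = 0"
proof -
  have "norm x \<le> norm (x, y)" "norm y \<le> norm (x, y)" by (rule norm_fst_le, rule norm_snd_le)
  then show "norm x > R \<Longrightarrow> \<zeta> (x, y) = 0" "norm x > R \<Longrightarrow> Z (x, y) = 0"
    "\<bar>y\<bar> > R \<Longrightarrow> \<zeta> (x, y) = 0" "\<bar>y\<bar> > R \<Longrightarrow> Z (x, y) = 0"
    using \<zeta>_supp Z_supp by auto
qed

lemma slice_deriv_x: "((\<lambda>x. \<zeta> (x, y)) has_derivative (\<lambda>h. fst (Z (x, y)) \<bullet> h)) (at x)"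
proof -
  have "((\<lambda>x. \<zeta> (x, y)) has_derivative (\<lambda>h. Z (x, y) \<bullet> (h, 0))) (at x)"
    by (rule has_derivative_compose[of "\<lambda>x. (x, y)" "\<lambda>h. (h, 0)" x UNIV \<zeta>, OF _ \<zeta>_deriv])
      (auto intro!: derivative_eq_intros)
  then show ?thesis by (simp add: inner_prod_def)
qed

lemma slice_deriv_y: "((\<lambda>y. \<zeta> (x, y)) has_real_derivative snd (Z (x, y))) (at y)"
  using has_derivative_imp_DERIV_line[where f=\<zeta> and a="(x, 0)" and t=y and h="(0, 1)", OF \<zeta>_deriv] by (simp add: inner_prod_def)

lemma slice_cont_x: "continuous_on UNIV (\<lambda>x. \<zeta> (x, y))" "continuous_on UNIV (\<lambda>x. Z (x, y))"
  by (auto intro!: continuous_on_compose2[OF \<zeta>_cont[of UNIV]] continuous_on_compose2[OF Z_cont] continuous_intros)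

lemma reflect: "test_fun (\<lambda>p. \<zeta> (fst p, - snd p)) (\<lambda>p. (fst (Z (fst p, - snd p)), - snd (Z (fst p, - snd p)))) R"
proof
  fix p :: "(real ^ 'n) \<times> real"
  have "((\<lambda>p. \<zeta> (fst p, - snd p)) has_derivative (\<lambda>h. Z (fst p, - snd p) \<bullet> (fst h, - snd h))) (at p)"
    by (rule has_derivative_compose[of "\<lambda>p. (fst p, - snd p)" "\<lambda>h. (fst h, - snd h)" p UNIV \<zeta>, OF _ \<zeta>_deriv])
      (auto intro!: derivative_eq_intros)
  then show "((\<lambda>p. \<zeta> (fst p, - snd p)) has_derivative (\<lambda>h. (fst (Z (fst p, - snd p)), - snd (Z (fst p, - snd p))) \<bullet> h)) (at p)"
    by (simp add: inner_prod_def)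
  have "norm (fst p, - snd p) = norm p" by (simp add: norm_prod_def)
  then show "\<zeta> (fst p, - snd p) = 0" "(fst (Z (fst p, - snd p)), - snd (Z (fst p, - snd p))) = 0" if "norm p > R"
    using that \<zeta>_supp[of "(fst p, - snd p)"] Z_supp[of "(fst p, - snd p)"] by (auto simp: zero_prod_def)
  have "continuous_on UNIV (\<lambda>p. Z (fst p, - snd p))"
    by (auto intro!: continuous_on_compose2[OF Z_cont] continuous_intros)
  then show "continuous_on UNIV (\<lambda>p. (fst (Z (fst p, - snd p)), - snd (Z (fst p, - snd p))))"
    by (intro continuous_intros)
qed

end

section \<open>The weak equation by slices of constant height\<close>

locale extension_test = holder_C1 s M \<psi> g + test_fun \<zeta> Z R
  for s M :: real and \<psi> :: "real ^ 'n \<Rightarrow> real" and g and \<zeta> :: "(real ^ 'n) \<times> real \<Rightarrow> real" and Z R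
begin

lemma powr_cancel: "y > 0 \<Longrightarrow> y powr (1 - 2 * s) * y powr (2 * s - 1) = 1"
  by (simp flip: powr_add)

text \<open>On a slice the horizontal part is integrated by parts in x, with the derivatives landing
  on the kernels; \<open>kernel_xx_trace\<close> converts the result into the kernel of
  \<open>ext_m\<close>.\<close>

lemma weak_x:
  assumes y: "y > 0"
  shows "(\<integral>x. y powr (1 - 2 * s) * (fst (ext_grad (x, y)) \<bullet> fst (Z (x, y))) \<partial>lborel) = (\<integral>x. ext_m x y * \<zeta> (x, y) \<partial>lborel)"
proof -
  let ?c = "\<lambda>b x. fst (Z (x, y)) \<bullet> b"
  have ic: "integrable lborel (?c b)" for b
    by (rule compact_support_integrable[of _ R]) (use slice_cont_x slice_supp in \<open>auto intro!: continuous_intros\<close>)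
  have iz: "integrable lborel (\<lambda>x. \<zeta> (x, y))"
    by (rule compact_support_integrable[of _ R]) (use slice_cont_x slice_supp in auto)
  note fub = fubini_conv[OF _ _ \<psi>_measurable \<psi>_bound]
  have e: "y powr (1 - 2 * s) * (fst (ext_grad (x, y)) \<bullet> fst (Z (x, y))) =
      (\<Sum>b\<in>Basis. (\<integral>z. kernel_x s b z y * \<psi> (x - z) \<partial>lborel) * ?c b x)" for x
  proof -
    have "fst (ext_grad (x, y)) \<bullet> fst (Z (x, y)) = (\<Sum>b\<in>Basis. (fst (ext_grad (x, y)) \<bullet> b) * ?c b x)"
      by (rule euclidean_inner)
    also have "\<dots> = y powr (2 * s - 1) * (\<Sum>b\<in>Basis. (\<integral>z. kernel_x s b z y * \<psi> (x - z) \<partial>lborel) * ?c b x)"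
      by (simp add: ext_grad_fst[OF y] sum_distrib_left mult.assoc)
    finally show ?thesis using powr_cancel[OF y] by (simp flip: mult.assoc)
  qed
  have p: "(\<integral>x. (\<integral>z. kernel_x s b z y * \<psi> (x - z) \<partial>lborel) * ?c b x \<partial>lborel) =
      - (\<integral>x. (\<integral>z. kernel_xx s b b z y * \<psi> (x - z) \<partial>lborel) * \<zeta> (x, y) \<partial>lborel)" if b: "b \<in> Basis" for b
  proof (rule conv_parts[where q="\<lambda>z. kernel_x s b z y" and q'="\<lambda>z h. kernel_xx s b h z y" and b=b and \<gamma>="\<lambda>x. \<zeta> (x, y)" and \<gamma>'="\<lambda>x h. fst (Z (x, y)) \<bullet> h" and R=R])
    show "continuous_on UNIV (\<lambda>z. kernel_xx s b b z y)"
      unfolding kernel_xx_def using y by (intro continuous_intros) auto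
    show "integrable lborel (\<lambda>z. kernel_xx s b b z y)" using b by (intro kernel_integrable s0 y) auto
    show "continuous_on UNIV (\<lambda>x. fst (Z (x, y)) \<bullet> b)" by (intro continuous_intros slice_cont_x)
  qed (use y slice_supp in \<open>auto intro: kernel_x_deriv kernel_integrable s0 slice_deriv_x \<psi>_bound\<close>)
  have "(\<integral>x. y powr (1 - 2 * s) * (fst (ext_grad (x, y)) \<bullet> fst (Z (x, y))) \<partial>lborel) =
     (\<Sum>b\<in>Basis. (\<integral>x. (\<integral>z. kernel_x s b z y * \<psi> (x - z) \<partial>lborel) * ?c b x \<partial>lborel))"
    unfolding e by (rule Bochner_Integration.integral_sum) (intro fub(1) kernel_integrable s0 y ic)
  also have "\<dots> = (\<Sum>b\<in>(Basis::(real^'n) set). - (\<integral>x. (\<integral>z. kernel_xx s b b z y * \<psi> (x - z) \<partial>lborel) * \<zeta> (x, y) \<partial>lborel))"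
    by (rule sum.cong[OF refl p])
  also have "\<dots> = - (\<integral>x. (\<Sum>b\<in>Basis. (\<integral>z. kernel_xx s b b z y * \<psi> (x - z) \<partial>lborel) * \<zeta> (x, y)) \<partial>lborel)"
    unfolding sum_negf
    by (subst Bochner_Integration.integral_sum) (auto intro!: fub(1) kernel_integrable s0 y iz)
  also have "(\<lambda>x. \<Sum>b\<in>Basis. (\<integral>z. kernel_xx s b b z y * \<psi> (x - z) \<partial>lborel) * \<zeta> (x, y)) = (\<lambda>x. - (ext_m x y * \<zeta> (x, y)))"
  proof
    fix x
    have "(\<Sum>b\<in>Basis. (\<integral>z. kernel_xx s b b z y * \<psi> (x - z) \<partial>lborel)) = (\<integral>z. (\<Sum>b\<in>Basis. kernel_xx s b b z y * \<psi> (x - z)) \<partial>lborel)"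
      using integrable_kernel_\<psi>[OF kernel_integrable(3)[OF s0 y], of _ x 1]
      by (intro Bochner_Integration.integral_sum[symmetric]) auto
    also have "\<dots> = - ext_m x y"
      by (simp add: sum_distrib_right[symmetric] kernel_xx_trace[OF y] ext_m_def)
    finally show "(\<Sum>b\<in>Basis. (\<integral>z. kernel_xx s b b z y * \<psi> (x - z) \<partial>lborel) * \<zeta> (x, y)) = - (ext_m x y * \<zeta> (x, y))"
      by (simp add: sum_distrib_right[symmetric])
  qed
  finally show ?thesis by simp
qed

lemma ext_m_bound:
  assumes y: "y > 0"
  obtains E where "\<And>x t. y / 2 < t \<Longrightarrow> \<bar>ext_m x t\<bar> \<le> E"
proof -
  let ?c = "poisson_const TYPE('n) s * (real CARD('n) + 2 * s) * (real CARD('n) + 4 * s + 4)"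
  let ?k = "\<lambda>z :: real ^ 'n. ?c / (y / 2) * powr_kernel s 0 z (y / 2) * M"
  have c: "?c \<ge> 0" using poisson_const_pos(1)[OF s0, where 'n='n] s0 by simp
  have ik: "integrable lborel ?k"
    using powr_kernel_integrable[of "y / 2" s, where 'n='n] y s0 by simp
  have "\<bar>ext_m x t\<bar> \<le> (\<integral>z. ?k z \<partial>lborel)" if t: "y / 2 < t" for x t
  proof -
    have t0: "t > 0" using t y by simp
    have "\<bar>kernel_m s z t * \<psi> (x - z)\<bar> \<le> ?k z" for z
    proof -
      have "\<bar>kernel_m s z t\<bar> \<le> ?c / t * powr_kernel s 0 z t"
        by (rule kernel_m_bound[OF s0 t0])
      also have "\<dots> \<le> ?c / (y / 2) * powr_kernel s 0 z (y / 2)"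
        using t y c s0 by (intro mult_mono divide_left_mono powr_kernel_mono) auto
      finally show ?thesis unfolding abs_mult by (intro mult_mono \<psi>_bound) (use c y in auto)
    qed
    moreover have "integrable lborel (\<lambda>z. kernel_m s z t * \<psi> (x - z))"
      using integrable_kernel_\<psi>[OF kernel_integrable(4)[OF s0 t0], of x 1] by simp
    ultimately have "(\<integral>z. \<bar>kernel_m s z t * \<psi> (x - z)\<bar> \<partial>lborel) \<le> (\<integral>z. ?k z \<partial>lborel)"
      using ik by (intro integral_mono) auto
    then show ?thesis unfolding ext_m_def by (rule order_trans[OF integral_abs_bound])
  qed
  then show ?thesis by (rule that)
qed

definition flux :: "real \<Rightarrow> real" where
  "flux y = (\<integral>x. ext_y x y * \<zeta> (x, y) \<partial>lborel)"

definition energy :: "real \<Rightarrow> real" where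
  "energy y = (\<integral>x. \<bar>y\<bar> powr (1 - 2 * s) * (ext_grad (x, y) \<bullet> Z (x, y)) \<partial>lborel)"

lemma bounds:
  obtains B where "B > 0" "\<And>p. \<bar>\<zeta> p\<bar> \<le> B" "\<And>p. \<bar>snd (Z p)\<bar> \<le> B"
proof -
  obtain B1 where B1: "B1 > 0" "\<And>p. norm (\<zeta> p) \<le> B1"
    using compact_support_bounded[OF \<zeta>_cont \<zeta>_supp] by metis
  obtain B2 where B2: "B2 > 0" "\<And>p. norm (Z p) \<le> B2"
    using compact_support_bounded[OF Z_cont Z_supp] by metis
  have "\<bar>snd (Z p)\<bar> \<le> B1 + B2" for p
    using B1(1) B2(2)[of p] norm_snd_le[of "snd (Z p)" "fst (Z p)"] by simp
  moreover have "\<bar>\<zeta> p\<bar> \<le> B1 + B2" for p using B1(2)[of p] B2(1) by simp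
  ultimately show ?thesis using B1(1) B2(1) by (intro that[of "B1 + B2"]) auto
qed

lemma ext_y_eq_grad: "y > 0 \<Longrightarrow> ext_y x y = y powr (1 - 2 * s) * snd (ext_grad (x, y))"
  using powr_cancel[of y] by (simp add: ext_grad_snd flip: mult.assoc)

lemma ext_grad_slice_cont: "continuous_on UNIV (\<lambda>x. ext_grad (x, y))"
  by (auto intro!: continuous_on_compose2[OF ext_grad_continuous] continuous_intros)

lemma flux_integrable: "y > 0 \<Longrightarrow> integrable lborel (\<lambda>x. ext_y x y * \<zeta> (x, y))"
  by (rule compact_support_integrable[of _ R])
    (use slice_supp in \<open>auto simp: ext_y_eq_grad intro!: continuous_intros slice_cont_x ext_grad_slice_cont\<close>)

text \<open>\<open>flux\<close> pairs y^a times the y-derivative of the extension with \<zeta> on a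
  slice. By the product rule its derivative contains \<open>ext_m\<close> times \<zeta>, which
  \<open>weak_x\<close> identifies as the horizontal energy. Thus the slice energy is an exact
  derivative in y.\<close>

lemma flux_deriv:
  assumes y: "y > 0"
  shows "(flux has_real_derivative energy y) (at y)"
proof -
  obtain B where B: "B > 0" "\<And>p. \<bar>\<zeta> p\<bar> \<le> B" "\<And>p. \<bar>snd (Z p)\<bar> \<le> B" using bounds by metis
  obtain E where E: "\<And>x t. y / 2 < t \<Longrightarrow> \<bar>ext_m x t\<bar> \<le> E" using ext_m_bound[OF y] by metis
  obtain F where F: "\<And>x t. t > 0 \<Longrightarrow> \<bar>ext_y x t\<bar> \<le> F" using ext_y_bound by metis
  let ?d = "\<lambda>x t. ext_m x t * \<zeta> (x, t) + snd (Z (x, t)) * ext_y x t"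
  have d: "((\<lambda>t. ext_y x t * \<zeta> (x, t)) has_real_derivative ?d x t) (at t)" if "t > 0" for x t
    by (rule DERIV_mult[OF ext_y_deriv[OF that] slice_deriv_y])
  have E0: "E \<ge> 0" using E[of y 0] y by auto
  have "((\<lambda>t. \<integral>x. ext_y x t * \<zeta> (x, t) \<partial>lborel) has_derivative (\<lambda>h. \<integral>x. ?d x y * h \<partial>lborel)) (at y)"
  proof (rule has_derivative_integral(2)[where e="y/2" and w="\<lambda>x. indicator (cball 0 R) x * (E * B + B * F)"])
    fix t assume t: "dist t y < y / 2"
    then have t': "y / 2 < t" "t < 2 * y" using y by (auto simp: dist_real_def abs_if split: if_splits)
    then show "integrable lborel (\<lambda>x. ext_y x t * \<zeta> (x, t))" using y by (intro flux_integrable) auto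
    fix x
    show "\<bar>ext_y x t * \<zeta> (x, t) - ext_y x y * \<zeta> (x, y)\<bar> \<le> indicator (cball 0 R) x * (E * B + B * F) * norm (t - y)"
    proof (cases "norm x \<le> R")
      case True
      have "\<bar>ext_y x t * \<zeta> (x, t) - ext_y x y * \<zeta> (x, y)\<bar> \<le> (E * B + B * F) * \<bar>t - y\<bar>"
      proof (rule real_derivative_bound[of "{y/2<..<2*y}" "\<lambda>t. ext_y x t * \<zeta> (x, t)" "?d x"])
        fix r assume r: "r \<in> {y/2<..<2*y}"
        then show "((\<lambda>t. ext_y x t * \<zeta> (x, t)) has_real_derivative ?d x r) (at r)" using y by (intro d) auto
        have "\<bar>?d x r\<bar> \<le> \<bar>ext_m x r\<bar> * \<bar>\<zeta> (x, r)\<bar> + \<bar>snd (Z (x, r))\<bar> * \<bar>ext_y x r\<bar>"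
          unfolding abs_mult[symmetric] by (rule abs_triangle_ineq)
        also have "\<dots> \<le> E * B + B * F"
          using r y B by (intro add_mono mult_mono E F) (auto intro: E0)
        finally show "\<bar>?d x r\<bar> \<le> E * B + B * F" .
      qed (use t' y in auto)
      then show ?thesis using True by simp
    next
      case False
      then show ?thesis using slice_supp by (simp add: not_le)
    qed
  next
    show "((\<lambda>t. ext_y x t * \<zeta> (x, t)) has_derivative (\<lambda>h. ?d x y * h)) (at y)" for x
      using d[OF y, of x] by (simp add: has_field_derivative_def)
    have "emeasure lborel (cball 0 R :: (real ^ 'n) set) < \<infinity>" by (rule emeasure_lborel_cball_finite)
    then show "integrable lborel (\<lambda>x :: real ^ 'n. indicator (cball 0 R) x * (E * B + B * F))"
      by (intro integrable_mult_left integrable_real_indicator) auto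
  qed (use y in auto)
  moreover have "(\<integral>x. ?d x y * h \<partial>lborel) = energy y * h" for h
  proof -
    have i1: "integrable lborel (\<lambda>x. ext_m x y * \<zeta> (x, y))"
      unfolding ext_m_def
      by (intro fubini_conv(1)[OF kernel_integrable(4)[OF s0 y] _ \<psi>_measurable \<psi>_bound] compact_support_integrable[of _ R])
        (use slice_supp in \<open>auto intro: slice_cont_x\<close>)
    have i2: "integrable lborel (\<lambda>x. snd (Z (x, y)) * ext_y x y)"
      by (rule compact_support_integrable[of _ R])
        (use y slice_supp in \<open>auto simp: ext_y_eq_grad intro!: continuous_intros slice_cont_x ext_grad_slice_cont\<close>)
    have i3: "integrable lborel (\<lambda>x. y powr (1 - 2 * s) * (fst (ext_grad (x, y)) \<bullet> fst (Z (x, y))))"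
      by (rule compact_support_integrable[of _ R])
        (use slice_supp in \<open>auto intro!: continuous_intros slice_cont_x ext_grad_slice_cont\<close>)
    have "(\<integral>x. ?d x y * h \<partial>lborel) = (\<integral>x. ?d x y \<partial>lborel) * h" by simp
    also have "(\<integral>x. ?d x y \<partial>lborel) = (\<integral>x. y powr (1 - 2 * s) * (fst (ext_grad (x, y)) \<bullet> fst (Z (x, y))) \<partial>lborel) + (\<integral>x. snd (Z (x, y)) * ext_y x y \<partial>lborel)"
      using i1 i2 weak_x[OF y] by simp
    also have "\<dots> = (\<integral>x. y powr (1 - 2 * s) * (fst (ext_grad (x, y)) \<bullet> fst (Z (x, y))) + snd (Z (x, y)) * ext_y x y \<partial>lborel)"
      using i2 i3 by simp
    also have "\<dots> = energy y"
      unfolding energy_def using y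
      by (intro Bochner_Integration.integral_cong) (auto simp: ext_y_eq_grad inner_prod_def algebra_simps)
    finally show ?thesis .
  qed
  ultimately show ?thesis unfolding has_field_derivative_def flux_def[abs_def] by (simp only:)
qed

lemma flux_limit: "(flux \<longlongrightarrow> (\<integral>x. - (2 * s * poisson_const TYPE('n) s * pv x) * \<zeta> (x, 0) \<partial>lborel)) (at_right 0)"
proof -
  obtain B where B: "B > 0" "\<And>p. \<bar>\<zeta> p\<bar> \<le> B" "\<And>p. \<bar>snd (Z p)\<bar> \<le> B" using bounds by metis
  obtain F where F: "\<And>x t. t > 0 \<Longrightarrow> \<bar>ext_y x t\<bar> \<le> F" using ext_y_bound by metis
  have F0: "F \<ge> 0" using F[of 1 0] by auto
  show ?thesis
    unfolding flux_def[abs_def]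
  proof (rule integral_tendsto_at)
    have "emeasure lborel (cball 0 R :: (real ^ 'n) set) < \<infinity>" by (rule emeasure_lborel_cball_finite)
    then show "integrable lborel (\<lambda>x :: real ^ 'n. indicator (cball 0 R) x * (F * B))"
      by (intro integrable_mult_left integrable_real_indicator) auto
    have [measurable]: "(\<lambda>x. \<zeta> (x, 0)) \<in> borel_measurable borel" "pv \<in> borel_measurable borel"
      using slice_cont_x pv_continuous by (auto intro: borel_measurable_continuous_onI)
    show "(\<lambda>x. - (2 * s * poisson_const TYPE('n) s * pv x) * \<zeta> (x, 0)) \<in> borel_measurable lborel" by simp
    have "\<bar>ext_y x y * \<zeta> (x, y)\<bar> \<le> indicator (cball 0 R) x * (F * B)" if "y > 0" for x y
    proof (cases "norm x \<le> R")
      case True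
      then show ?thesis using F[OF that, of x] B(2)[of "(x, y)"] F0 by (auto simp: abs_mult intro!: mult_mono)
    qed (use slice_supp in \<open>simp add: not_le\<close>)
    from this show "\<forall>\<^sub>F y in at_right 0. (\<lambda>x. ext_y x y * \<zeta> (x, y)) \<in> borel_measurable lborel \<and>
        (AE x in lborel. \<bar>ext_y x y * \<zeta> (x, y)\<bar> \<le> indicator (cball 0 R) x * (F * B))"
      by (intro eventually_mono[OF eventually_at_right_less[of "0::real"]])
        (use borel_measurable_integrable[OF flux_integrable] in \<open>auto intro!: AE_I2\<close>)
    have "((\<lambda>y. \<zeta> (x, y)) \<longlongrightarrow> \<zeta> (x, 0)) (at_right 0)" for x
      using DERIV_isCont[OF slice_deriv_y[of x 0]] unfolding isCont_def by (rule tendsto_mono[rotated]) (rule at_le, simp)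
    then show "AE x in lborel. ((\<lambda>y. ext_y x y * \<zeta> (x, y)) \<longlongrightarrow> - (2 * s * poisson_const TYPE('n) s * pv x) * \<zeta> (x, 0)) (at_right 0)"
      by (intro AE_I2 tendsto_mult ext_y_limit)
  qed
qed

text \<open>Integrating the slice energy from 0 to a height beyond the support of \<zeta> leaves
  minus the limit of \<open>flux\<close> at 0, known from \<open>flux_limit\<close>.\<close>

lemma energy_integral:
  "(\<integral>y. indicator {0<..} y * energy y \<partial>lborel) = (\<integral>x. 2 * s * poisson_const TYPE('n) s * pv x * \<zeta> (x, 0) \<partial>lborel)"
  and weighted_integrable: "integrable lborel (\<lambda>p. \<bar>snd p\<bar> powr (1 - 2 * s) * (ext_grad p \<bullet> Z p))"
  and half_integral: "(\<integral>p. indicator {0<..} (snd p) * (\<bar>snd p\<bar> powr (1 - 2 * s) * (ext_grad p \<bullet> Z p)) \<partial>lborel) = (\<integral>y. indicator {0<..} y * energy y \<partial>lborel)"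
proof -
  interpret w: homogeneous_weight "\<lambda>p :: (real ^ 'n) \<times> real. \<bar>snd p\<bar> powr (1 - 2 * s)" "1 - 2 * s"
    by (rule weight_homogeneous) (use s in simp)
  let ?k = "\<lambda>p. ext_grad p \<bullet> Z p"
  have ck: "continuous_on UNIV ?k" by (intro continuous_intros ext_grad_continuous Z_cont)
  have "integrable lborel (\<lambda>p. indicator (ball 0 (R + 1)) p * (?k p * \<bar>snd p\<bar> powr (1 - 2 * s)))"
    by (rule w.ball_int_integrable[OF ck])
  moreover have "indicator (ball 0 (R + 1)) p * (?k p * \<bar>snd p\<bar> powr (1 - 2 * s)) = \<bar>snd p\<bar> powr (1 - 2 * s) * ?k p" for p
    using Z_supp[of p] by (auto simp: indicator_def)
  ultimately show I: "integrable lborel (\<lambda>p. \<bar>snd p\<bar> powr (1 - 2 * s) * ?k p)" by simp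
  let ?f = "\<lambda>p. indicator {0<..} (snd p) * (\<bar>snd p\<bar> powr (1 - 2 * s) * ?k p)"
  have If: "integrable lborel ?f"
    by (rule integrable_snd_indicator[OF I]) simp
  then have If': "integrable (lborel \<Otimes>\<^sub>M lborel) (\<lambda>(x, y). ?f (x, y))" by (simp add: lborel_prod split_def)
  have slice: "(\<integral>x. ?f (x, y) \<partial>lborel) = indicator {0<..} y * energy y" for y
    by (simp add: energy_def)
  have ie: "integrable lborel (\<lambda>y. indicator {0<..} y * energy y)"
    using lborel_pair.integrable_snd[of "\<lambda>x y. ?f (x, y)"] If' unfolding slice by simp
  show "(\<integral>p. ?f p \<partial>lborel) = (\<integral>y. indicator {0<..} y * energy y \<partial>lborel)"
    using lborel_pair.integral_snd[of "\<lambda>x y. ?f (x, y)"] If' unfolding slice by (simp add: lborel_prod split_def)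
  let ?L = "\<integral>x. - (2 * s * poisson_const TYPE('n) s * pv x) * \<zeta> (x, 0) \<partial>lborel"
  \<comment> \<open>\<open>flux\<close> is given its limit as value for y <= 0, which makes it
    continuous on the closed interval starting at 0.\<close>
  let ?\<Phi> = "\<lambda>y. if y \<le> 0 then ?L else flux y"
  define T where "T = \<bar>R\<bar> + 1"
  have T: "T > 0" by (simp add: T_def)
  have "(energy has_integral (?\<Phi> T - ?\<Phi> 0)) {0..T}"
  proof (rule fundamental_theorem_of_calculus_interior)
    have d: "(?\<Phi> has_real_derivative energy y) (at y)" if "y > 0" for y
    proof -
      have "eventually (\<lambda>y. flux y = ?\<Phi> y) (nhds y)"
        using eventually_nhds_in_open[of "{0<..}" y] that by (auto elim!: eventually_mono)
      from DERIV_cong_ev[OF refl this refl] flux_deriv[OF that] show ?thesis by blast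
    qed
    then show "(?\<Phi> has_vector_derivative energy y) (at y)" if "y \<in> {0<..<T}" for y
      using that by (simp add: has_real_derivative_iff_has_vector_derivative)
    show "continuous_on {0..T} ?\<Phi>"
      unfolding continuous_on_eq_continuous_within
    proof
      fix y assume y: "y \<in> {0..T}"
      show "continuous (at y within {0..T}) ?\<Phi>"
      proof (cases "y = 0")
        case True
        have "eventually (\<lambda>y. flux y = ?\<Phi> y) (at_right 0)"
          using eventually_at_right_less[of "0::real"] by eventually_elim simp
        from Lim_transform_eventually[OF flux_limit this] have "(?\<Phi> \<longlongrightarrow> ?L) (at_right 0)" .
        then show ?thesis using True T by (simp add: continuous_within at_within_Icc_at_right)
      next
        case False
        then have "y > 0" using y by simp
        from DERIV_isCont[OF d[OF this]] show ?thesis by (rule continuous_at_imp_continuous_at_within)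
      qed
    qed
  qed (use T in simp)
  moreover have "?\<Phi> T = 0" using T slice_supp(3)[of T] by (simp add: flux_def T_def)
  ultimately have hi: "(energy has_integral - ?L) {0..T}" by simp
  have "((\<lambda>y. indicator {0<..} y * energy y) has_integral (\<integral>y. indicator {0<..} y * energy y \<partial>lborel)) UNIV"
    using ie by (rule has_integral_integral_lborel)
  moreover have "((\<lambda>y. indicator {0<..} y * energy y) has_integral - ?L) UNIV"
  proof -
    have "((\<lambda>y. if y \<in> {0..T} then energy y else 0) has_integral - ?L) UNIV"
      using hi by (simp only: has_integral_restrict_UNIV)
    then show ?thesis
    proof (rule has_integral_spike[of "{0}", rotated 2])
      show "indicator {0<..} y * energy y = (if y \<in> {0..T} then energy y else 0)" if "y \<in> UNIV - {0}" for y
        using that slice_supp(4)[of y] by (auto simp: indicator_def energy_def T_def)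
    qed simp
  qed
  ultimately have "(\<integral>y. indicator {0<..} y * energy y \<partial>lborel) = - ?L"
    by (rule has_integral_unique)
  also have "- ?L = (\<integral>x. 2 * s * poisson_const TYPE('n) s * pv x * \<zeta> (x, 0) \<partial>lborel)"
    by simp
  finally show "(\<integral>y. indicator {0<..} y * energy y \<partial>lborel) = (\<integral>x. 2 * s * poisson_const TYPE('n) s * pv x * \<zeta> (x, 0) \<partial>lborel)" .
qed

end

context holder_C1
begin

lemma ext_grad_reflect: "ext_grad (x, - y) = (fst (ext_grad (x, y)), - snd (ext_grad (x, y)))"
proof (rule prod_eqI)
  have 1: "extension s \<psi> (x, - y) = extension s \<psi> (x, y)" for x y by (simp add: extension_def)
  have d: "((\<lambda>p. extension s \<psi> (fst p, - snd p)) has_derivative (\<lambda>h. ext_grad (x, - y) \<bullet> (fst h, - snd h))) (at (x, y))"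
    by (rule has_derivative_compose[of "\<lambda>p. (fst p, - snd p)" "\<lambda>h. (fst h, - snd h)" "(x, y)" UNIV "extension s \<psi>"])
      (auto intro!: derivative_eq_intros simp: ext_has_derivative)
  have "(\<lambda>h. ext_grad (x, - y) \<bullet> (fst h, - snd h)) = (\<lambda>h. ext_grad (x, y) \<bullet> h)"
    by (rule has_derivative_unique[OF _ ext_has_derivative[of "(x, y)"]]) (use d in \<open>simp add: 1\<close>)
  then have e: "fst (ext_grad (x, - y)) \<bullet> a - snd (ext_grad (x, - y)) * b = fst (ext_grad (x, y)) \<bullet> a + snd (ext_grad (x, y)) * b" for a b
    by (auto simp: fun_eq_iff inner_prod_def)
  show "fst (ext_grad (x, - y)) = fst (fst (ext_grad (x, y)), - snd (ext_grad (x, y)))"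
    using e[of _ 0] by (subst vector_eq_rdot[symmetric]) simp
  show "snd (ext_grad (x, - y)) = snd (fst (ext_grad (x, y)), - snd (ext_grad (x, y)))"
    using e[of 0 1] by simp
qed

text \<open>Because the extension is even, the integral over y < 0 is the upper one for the
  reflected test function. Reflection keeps the trace on y = 0, so both halves give the same
  boundary term, hence the factor 2.\<close>

lemma weak_equation:
  assumes "test_fun \<zeta> Z R"
  shows "integrable lborel (\<lambda>p. \<bar>snd p\<bar> powr (1 - 2 * s) * (ext_grad p \<bullet> Z p))"
    and "(\<integral>p. \<bar>snd p\<bar> powr (1 - 2 * s) * (ext_grad p \<bullet> Z p) \<partial>lborel) =
      2 * (\<integral>x. 2 * s * poisson_const TYPE('n) s * pv_integral s \<psi> x * \<zeta> (x, 0) \<partial>lborel)"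
proof -
  interpret T: extension_test s M \<psi> g \<zeta> Z R
    using assms holder_C1_axioms by (simp add: extension_test_def)
  let ?\<zeta> = "\<lambda>p. \<zeta> (fst p, - snd p)" and ?Z = "\<lambda>p. (fst (Z (fst p, - snd p)), - snd (Z (fst p, - snd p)))"
  interpret T': extension_test s M \<psi> g ?\<zeta> ?Z R
    using T.reflect holder_C1_axioms by (simp add: extension_test_def)
  let ?f = "\<lambda>p. \<bar>snd p\<bar> powr (1 - 2 * s) * (ext_grad p \<bullet> Z p)"
  show I: "integrable lborel ?f" by (rule T.weighted_integrable)
  let ?N = "\<integral>x. 2 * s * poisson_const TYPE('n) s * pv x * \<zeta> (x, 0) \<partial>lborel"
  have i: "integrable lborel (\<lambda>p. indicator {0<..} (snd p) * ?f p)" "integrable lborel (\<lambda>p. indicator {..<0} (snd p) * ?f p)"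
    by (rule integrable_snd_indicator[OF I]; simp)+
  have 1: "(\<integral>p. indicator {0<..} (snd p) * ?f p \<partial>lborel) = ?N"
    using T.half_integral T.energy_integral by simp
  have "(\<integral>p. indicator {..<0} (snd p) * ?f p \<partial>lborel) = (\<integral>p. indicator {0<..} (snd p) * (\<bar>snd p\<bar> powr (1 - 2 * s) * (ext_grad p \<bullet> ?Z p)) \<partial>lborel)"
  proof -
    have "(\<integral>p. indicator {..<0} (snd p) * ?f p \<partial>lborel) = (\<integral>x. \<integral>y. indicator {..<0} y * ?f (x, y) \<partial>lborel \<partial>lborel)"
      using lborel_pair.integral_fst'[of "\<lambda>p. indicator {..<0} (snd p) * ?f p"] i(2) by (simp add: lborel_prod)
    also have "\<dots> = (\<integral>x. \<integral>y. indicator {0<..} y * (\<bar>y\<bar> powr (1 - 2 * s) * (ext_grad (x, y) \<bullet> ?Z (x, y))) \<partial>lborel \<partial>lborel)"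
    proof (rule Bochner_Integration.integral_cong[OF refl])
      fix x
      show "(\<integral>y. indicator {..<0} y * ?f (x, y) \<partial>lborel) = (\<integral>y. indicator {0<..} y * (\<bar>y\<bar> powr (1 - 2 * s) * (ext_grad (x, y) \<bullet> ?Z (x, y))) \<partial>lborel)"
        by (subst lborel_integral_real_affine[of "-1" _ 0])
          (auto intro!: Bochner_Integration.integral_cong simp: ext_grad_reflect inner_prod_def indicator_def)
    qed
    also have "\<dots> = (\<integral>p. indicator {0<..} (snd p) * (\<bar>snd p\<bar> powr (1 - 2 * s) * (ext_grad p \<bullet> ?Z p)) \<partial>lborel)"
    proof -
      have "integrable lborel (\<lambda>p. indicator {0<..} (snd p) * (\<bar>snd p\<bar> powr (1 - 2 * s) * (ext_grad p \<bullet> ?Z p)))"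
        by (rule integrable_snd_indicator[OF T'.weighted_integrable]) simp
      then show ?thesis
        using lborel_pair.integral_fst'[of "\<lambda>p. indicator {0<..} (snd p) * (\<bar>snd p\<bar> powr (1 - 2 * s) * (ext_grad p \<bullet> ?Z p))"] by (simp add: lborel_prod)
    qed
    finally show ?thesis .
  qed
  then have 2: "(\<integral>p. indicator {..<0} (snd p) * ?f p \<partial>lborel) = ?N"
    using T'.half_integral T'.energy_integral by simp
  have "(\<integral>p. ?f p \<partial>lborel) = (\<integral>p. indicator {0<..} (snd p) * ?f p + indicator {..<0} (snd p) * ?f p \<partial>lborel)"
    by (rule Bochner_Integration.integral_cong) (auto simp: indicator_def)
  then show "(\<integral>p. ?f p \<partial>lborel) = 2 * (\<integral>x. 2 * s * poisson_const TYPE('n) s * pv_integral s \<psi> x * \<zeta> (x, 0) \<partial>lborel)"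
    unfolding Bochner_Integration.integral_add[OF i] 1 2 pv_integral_eq by simp
qed

end

section \<open>Differentiating a Weiss-type functional\<close>

lemma max_0_square_deriv: "((\<lambda>t. (max 0 t)\<^sup>2) has_real_derivative 2 * max 0 t) (at (t::real))"
proof -
  consider "t > 0" | "t < 0" | "t = 0" by linarith
  then show ?thesis
  proof cases
    case 1
    have ev: "eventually (\<lambda>t::real. (max 0 t)\<^sup>2 = t\<^sup>2) (nhds t)"
      using eventually_nhds_in_open[of "{0<..}" t] 1 by (auto elim!: eventually_mono)
    have "((\<lambda>t. t\<^sup>2) has_real_derivative 2 * max 0 t) (at t)"
      using 1 by (auto intro!: derivative_eq_intros)
    then show ?thesis using DERIV_cong_ev[OF refl ev refl] by blast
  next
    case 2
    have ev: "eventually (\<lambda>t::real. (max 0 t)\<^sup>2 = 0) (nhds t)"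
      using eventually_nhds_in_open[of "{..<0}" t] 2 by (auto elim!: eventually_mono)
    have "((\<lambda>t. 0) has_real_derivative 2 * max 0 t) (at t)"
      using 2 by (auto intro!: derivative_eq_intros)
    then show ?thesis using DERIV_cong_ev[OF refl ev refl] by blast
  next
    case 3
    have "((\<lambda>h::real. max 0 h) \<longlongrightarrow> max 0 0) (at 0)" by (intro tendsto_intros)
    moreover have "eventually (\<lambda>h::real. max 0 h = ((max 0 (0 + h))\<^sup>2 - (max 0 0)\<^sup>2) / h) (at 0)"
      using eventually_neq_at_within[of "0::real" 0 UNIV]
      by eventually_elim (auto simp: max_def power2_eq_square)
    ultimately have "((\<lambda>h::real. ((max 0 (0 + h))\<^sup>2 - (max 0 0)\<^sup>2) / h) \<longlongrightarrow> 0) (at 0)"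
      by (simp only: Lim_transform_eventually max.idem)
    then show ?thesis using 3 by (simp add: DERIV_def)
  qed
qed

text \<open>The square makes it C^1 across |p| = r; its gradient is -4 \<open>bump'\<close> times p,
  where \<open>bump'\<close> is again a polynomial in |p|^2 inside the ball.\<close>

definition bump :: "real \<Rightarrow> 'a::real_inner \<Rightarrow> real" where
  "bump r p = (max 0 (r\<^sup>2 - p \<bullet> p))\<^sup>2"

definition bump' :: "real \<Rightarrow> 'a::real_inner \<Rightarrow> real" where
  "bump' r p = max 0 (r\<^sup>2 - p \<bullet> p)"

lemma bump_deriv: "(bump r has_derivative (\<lambda>h. (- (4 * bump' r p) *\<^sub>R p) \<bullet> h)) (at p)"
proof -
  have "((\<lambda>p. r\<^sup>2 - p \<bullet> p) has_derivative (\<lambda>h. - 2 * (p \<bullet> h))) (at p)"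
    by (auto intro!: derivative_eq_intros simp: inner_commute)
  from DERIV_compose_FDERIV[OF max_0_square_deriv this]
  show ?thesis unfolding bump_def bump'_def by (elim has_derivative_eq_rhs) (simp add: fun_eq_iff)
qed

lemma bump_cont[continuous_intros]: "continuous_on A (bump r)" "continuous_on A (bump' r)"
  unfolding bump_def bump'_def by (intro continuous_intros)+

lemma bump_supp:
  assumes "norm p \<ge> r" "r > 0" shows "bump r p = 0" "bump' r p = 0"
proof -
  have "r\<^sup>2 \<le> (norm p)\<^sup>2" using assms by (intro power_mono) auto
  then show "bump r p = 0" "bump' r p = 0"
    by (simp_all add: bump_def bump'_def power2_norm_eq_inner max_absorb1)
qed

lemma bump_nonneg[simp]: "bump r p \<ge> 0" "bump' r p \<ge> 0"
  by (simp_all add: bump_def bump'_def)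

lemma bump_le: "bump' r p \<le> r\<^sup>2" "bump r p \<le> r ^ 4"
proof -
  show 1: "bump' r p \<le> r\<^sup>2" by (simp add: bump'_def)
  have "bump r p = (bump' r p)\<^sup>2" by (simp add: bump_def bump'_def)
  also have "\<dots> \<le> (r\<^sup>2)\<^sup>2" by (rule power_mono[OF 1]) simp
  finally show "bump r p \<le> r ^ 4" by simp
qed

lemma bump_eq:
  assumes "norm p < r" shows "bump r p = (r\<^sup>2 - p \<bullet> p)\<^sup>2" "bump' r p = r\<^sup>2 - p \<bullet> p"
proof -
  have "(norm p)\<^sup>2 \<le> r\<^sup>2" using assms by (intro power_mono) auto
  then show "bump r p = (r\<^sup>2 - p \<bullet> p)\<^sup>2" "bump' r p = r\<^sup>2 - p \<bullet> p"
    by (simp_all add: bump_def bump'_def power2_norm_eq_inner)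
qed

lemma bump_slice[simp]: "bump r (x, 0::real) = bump r x"
  by (simp add: bump_def inner_prod_def)

context homogeneous_weight
begin

text \<open>Moments against the test functions \<open>bump'\<close> and \<open>bump\<close>: differentiating them once and twice
  in the radius yields integrals over balls and spheres.\<close>

definition mom1 :: "('a \<Rightarrow> real) \<Rightarrow> real \<Rightarrow> real" where
  "mom1 k r = r\<^sup>2 * ball_int k r - ball_int (\<lambda>p. (p \<bullet> p) * k p) r"

definition mom2 :: "('a \<Rightarrow> real) \<Rightarrow> real \<Rightarrow> real" where
  "mom2 k r = r\<^sup>2 * mom1 k r - mom1 (\<lambda>p. (p \<bullet> p) * k p) r"

lemma cont_sq: "continuous_on UNIV k \<Longrightarrow> continuous_on UNIV (\<lambda>p::'a. (p \<bullet> p) * k p :: real)"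
  by (intro continuous_intros)

lemma mom1_eq:
  assumes k: "continuous_on UNIV k" and r: "r > 0"
  shows "integrable lborel (\<lambda>p. bump' r p * (k p * W p))"
    and "(\<integral>p. bump' r p * (k p * W p) \<partial>lborel) = mom1 k r"
proof -
  note i = ball_int_integrable[OF k, of r] ball_int_integrable[OF cont_sq[OF k], of r]
  have e: "bump' r p * (k p * W p) = r\<^sup>2 * (indicator (ball 0 r) p * (k p * W p)) - indicator (ball 0 r) p * ((p \<bullet> p) * k p * W p)" for p
  proof (cases "norm p < r")
    case True
    then show ?thesis by (simp add: bump_eq power2_eq_square algebra_simps)
  next
    case False
    then show ?thesis using r by (simp add: bump_supp)
  qed
  show "integrable lborel (\<lambda>p. bump' r p * (k p * W p))"
    unfolding e using i by (intro Bochner_Integration.integrable_diff integrable_mult_right)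
  show "(\<integral>p. bump' r p * (k p * W p) \<partial>lborel) = mom1 k r"
    unfolding e mom1_def ball_int_def
    by (subst Bochner_Integration.integral_diff[OF integrable_mult_right[OF i(1)] i(2)]) simp
qed

lemma mom2_eq:
  assumes k: "continuous_on UNIV k" and r: "r > 0"
  shows "integrable lborel (\<lambda>p. bump r p * (k p * W p))"
    and "(\<integral>p. bump r p * (k p * W p) \<partial>lborel) = mom2 k r"
proof -
  note i = mom1_eq(1)[OF k r] mom1_eq(1)[OF cont_sq[OF k] r]
  have e: "bump r p * (k p * W p) = r\<^sup>2 * (bump' r p * (k p * W p)) - bump' r p * ((p \<bullet> p) * k p * W p)" for p
  proof (cases "norm p < r")
    case True
    then show ?thesis by (simp add: bump_eq power2_eq_square algebra_simps)
  next
    case False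
    then show ?thesis using r by (simp add: bump_supp)
  qed
  show "integrable lborel (\<lambda>p. bump r p * (k p * W p))"
    unfolding e using i by (intro Bochner_Integration.integrable_diff integrable_mult_right)
  show "(\<integral>p. bump r p * (k p * W p) \<partial>lborel) = mom2 k r"
    unfolding e mom2_def
    by (subst Bochner_Integration.integral_diff[OF integrable_mult_right[OF i(1)] i(2)])
      (simp add: mom1_eq(2)[OF k r] mom1_eq(2)[OF cont_sq[OF k] r])
qed

text \<open>The boundary terms cancel because |p|^2 = r^2 on the sphere; only the explicit r^2
  contributes. In \<open>mom2_deriv\<close> the ball integrals recombine to a second copy of
  \<open>mom1\<close>, hence the 4 there.\<close>

lemma mom1_deriv:
  assumes k: "continuous_on UNIV k" and r: "r > 0"
  shows "(mom1 k has_real_derivative 2 * r * ball_int k r) (at r)"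
proof -
  have "sph_int (\<lambda>p. (p \<bullet> p) * k p) r = r\<^sup>2 * sph_int k r"
    using sph_int_norm_power[OF k r, of 2] by (simp add: power2_norm_eq_inner)
  moreover have "((\<lambda>r. r\<^sup>2 * ball_int k r - ball_int (\<lambda>p. (p \<bullet> p) * k p) r) has_real_derivative
     (2 * r * ball_int k r + sph_int k r * r\<^sup>2) - sph_int (\<lambda>p. (p \<bullet> p) * k p) r) (at r)"
    by (rule DERIV_diff[OF DERIV_mult ball_int_deriv[OF cont_sq[OF k] r]])
      (use ball_int_deriv[OF k r] in \<open>auto intro!: derivative_eq_intros\<close>)
  ultimately show ?thesis by (simp add: mom1_def[abs_def])
qed

lemma mom2_deriv:
  assumes k: "continuous_on UNIV k" and r: "r > 0"
  shows "(mom2 k has_real_derivative 4 * r * mom1 k r) (at r)"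
proof -
  have "((\<lambda>r. r\<^sup>2 * mom1 k r - mom1 (\<lambda>p. (p \<bullet> p) * k p) r) has_real_derivative
     (2 * r * mom1 k r + (2 * r * ball_int k r) * r\<^sup>2) - 2 * r * ball_int (\<lambda>p. (p \<bullet> p) * k p) r) (at r)"
    by (rule DERIV_diff[OF DERIV_mult mom1_deriv[OF cont_sq[OF k] r]])
      (use mom1_deriv[OF k r] in \<open>auto intro!: derivative_eq_intros\<close>)
  then show ?thesis unfolding mom2_def[abs_def]
    by (rule DERIV_cong) (simp add: mom1_def algebra_simps)
qed

end

lemma DERIV_unique_on_pos:
  assumes "\<And>r. r > 0 \<Longrightarrow> f r = g r" and r: "(r::real) > 0"
    and "(f has_real_derivative a) (at r)" "(g has_real_derivative b) (at r)"
  shows "a = b"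
proof -
  have "eventually (\<lambda>r. f r = g r) (nhds r)"
    using eventually_nhds_in_open[of "{0<..}" r] assms by (auto elim!: eventually_mono)
  from DERIV_cong_ev[OF refl this refl] assms show ?thesis by (blast intro: DERIV_unique)
qed

text \<open>An identity valid for all r > 0 may be differentiated. The first derivative turns
  \<open>mom2\<close> into 4r \<open>mom1\<close> and \<open>mom1\<close> into 2r
  \<open>ball_int\<close>; after division by 2r a second one yields integrals over balls and
  spheres. Two weights appear because one side lives in R^(n+1) and the other on y = 0.\<close>

lemma moment_identity:
  assumes W: "homogeneous_weight W \<alpha>" and W': "homogeneous_weight W' \<alpha>'"
    and c: "continuous_on UNIV f" "continuous_on UNIV g" "continuous_on UNIV k"
    and eq: "\<And>r. r > 0 \<Longrightarrow> homogeneous_weight.mom2 W f r + homogeneous_weight.mom1 W g r = homogeneous_weight.mom2 W' k r"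
    and r: "r > 0"
  shows "4 * r * homogeneous_weight.ball_int W f r + homogeneous_weight.sph_int W g r = 4 * r * homogeneous_weight.ball_int W' k r"
proof -
  interpret W: homogeneous_weight W \<alpha> by (rule W)
  interpret W': homogeneous_weight W' \<alpha>' by (rule W')
  have eq1: "2 * W.mom1 f r + W.ball_int g r = 2 * W'.mom1 k r" if r: "r > 0" for r
  proof -
    have "4 * r * W.mom1 f r + 2 * r * W.ball_int g r = 4 * r * W'.mom1 k r"
      using eq r by (rule DERIV_unique_on_pos)
        (auto intro!: DERIV_add W.mom2_deriv W.mom1_deriv W'.mom2_deriv c r)
    then have "2 * r * (2 * W.mom1 f r + W.ball_int g r) = 2 * r * (2 * W'.mom1 k r)"
      by (simp add: algebra_simps)
    then show ?thesis using r by simp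
  qed
  have "2 * (2 * r * W.ball_int f r) + W.sph_int g r = 2 * (2 * r * W'.ball_int k r)"
    by (rule DERIV_unique_on_pos[OF eq1 r DERIV_add[OF DERIV_cmult[OF W.mom1_deriv[OF c(1) r]] W.ball_int_deriv[OF c(2) r]]
      DERIV_cmult[OF W'.mom1_deriv[OF c(3) r]]])
  then show ?thesis by simp
qed

lemma unit_weight: "homogeneous_weight (\<lambda>x :: 'a::euclidean_space. 1) 0"
  by unfold_locales auto

section \<open>The energy and Rellich identities\<close>

text \<open>What the derivative of the Weiss functional requires, with the free boundary point moved
  to the origin. w plays the role of the one-sided weighted normal derivative on y = 0, and the
  factor 2 in \<open>weak\<close> comes from the two half spaces. K is a parameter, so that the
  error constant can be seen not to depend on the point.\<close>

locale weiss_setting =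
  fixes s K :: real and V :: "(real ^ 'n) \<times> real \<Rightarrow> real" and G :: "(real ^ 'n) \<times> real \<Rightarrow> (real ^ 'n) \<times> real"
    and w h :: "real ^ 'n \<Rightarrow> real"
  assumes s: "1 / 2 < s" "s < 1"
    and V_deriv: "(V has_derivative (\<lambda>h. G p \<bullet> h)) (at p)"
    and G_cont: "continuous_on UNIV G"
    and w_cont: "continuous_on UNIV w" and h_cont: "continuous_on UNIV h"
    and weak: "test_fun \<zeta> Z R \<Longrightarrow>
      (\<integral>p. \<bar>snd p\<bar> powr (1 - 2 * s) * (G p \<bullet> Z p) \<partial>lborel) = - (2 * (\<integral>x. w x * \<zeta> (x, 0) \<partial>lborel))"
    and wV: "w x * V (x, 0) = h x / 2 * V (x, 0)"
    and wG: "w x *\<^sub>R fst (G (x, 0)) = (h x / 2) *\<^sub>R fst (G (x, 0))"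
    and h_bound: "\<bar>h x\<bar> \<le> K * norm x powr s"
    and V_bound: "\<bar>V (x, 0)\<bar> \<le> K * norm x powr (1 + s)"
    and G_bound: "norm (fst (G (x, 0))) \<le> K * norm x powr s"
begin

sublocale W: homogeneous_weight "\<lambda>p :: (real ^ 'n) \<times> real. \<bar>snd p\<bar> powr (1 - 2 * s)" "1 - 2 * s"
  by (rule weight_homogeneous) (use s in simp)

sublocale T: homogeneous_weight "\<lambda>x :: real ^ 'n. 1" 0
  by (rule unit_weight)

lemma V_cont: "continuous_on A V"
  by (rule has_derivative_continuous_on, rule has_derivative_at_withinI, rule V_deriv)

lemma slice_cont: "continuous_on UNIV (\<lambda>x. V (x, 0))" "continuous_on UNIV (\<lambda>x. G (x, 0))"
  by (auto intro!: continuous_on_compose2[OF V_cont[of UNIV]] continuous_on_compose2[OF G_cont] continuous_intros)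

abbreviation "GG \<equiv> \<lambda>p. G p \<bullet> G p"
abbreviation "VG \<equiv> \<lambda>p. V p * (G p \<bullet> p)"
abbreviation "QG \<equiv> \<lambda>p. (G p \<bullet> p)\<^sup>2"
abbreviation "hV \<equiv> \<lambda>x. h x * V (x, 0)"
abbreviation "hG \<equiv> \<lambda>x. h x * (fst (G (x, 0)) \<bullet> x)"

lemma cont: "continuous_on UNIV GG" "continuous_on UNIV VG" "continuous_on UNIV QG" "continuous_on UNIV hV" "continuous_on UNIV hG"
  by (intro continuous_intros G_cont V_cont h_cont slice_cont)+

lemma bump_test:
  assumes f: "\<And>p. (f has_derivative (\<lambda>h. F p \<bullet> h)) (at p)" and F: "continuous_on UNIV F" and r: "r > 0"
  shows "test_fun (\<lambda>p :: (real ^ 'n) \<times> real. bump r p * f p) (\<lambda>p. bump r p *\<^sub>R F p - (4 * bump' r p * f p) *\<^sub>R p) r"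
proof
  fix p
  have "((\<lambda>p. bump r p * f p) has_derivative (\<lambda>h. bump r p * (F p \<bullet> h) + ((- (4 * bump' r p) *\<^sub>R p) \<bullet> h) * f p)) (at p)"
    by (rule has_derivative_mult[OF bump_deriv f])
  then show "((\<lambda>p. bump r p * f p) has_derivative (\<lambda>h. (bump r p *\<^sub>R F p - (4 * bump' r p * f p) *\<^sub>R p) \<bullet> h)) (at p)"
    by (elim has_derivative_eq_rhs) (simp add: fun_eq_iff inner_diff_left mult_ac)
  have "continuous_on UNIV f" by (rule has_derivative_continuous_on, rule has_derivative_at_withinI, rule f)
  then show "continuous_on UNIV (\<lambda>p. bump r p *\<^sub>R F p - (4 * bump' r p * f p) *\<^sub>R p)"
    by (intro continuous_intros F)
  assume "norm p > r"
  then have "bump r p = 0" "bump' r p = 0" using bump_supp[of r p] r by auto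
  then show "bump r p * f p = 0" "bump r p *\<^sub>R F p - (4 * bump' r p * f p) *\<^sub>R p = 0" by simp_all
qed

text \<open>The test function \<open>bump\<close> times V contributes |G|^2 against
  \<open>bump\<close> and -4 V (G . p) against \<open>bump'\<close>, the shape required by
  \<open>moment_identity\<close>; on y = 0, \<open>wV\<close> replaces -2 w V by -h V.\<close>

lemma energy_identity:
  assumes r: "r > 0"
  shows "r * W.ball_int GG r - W.sph_int VG r = - (r * T.ball_int hV r)"
proof -
  \<comment> \<open>The summand with coefficient 0 only gives the integrand the form of
    \<open>sph_int_lincomb\<close>.\<close>
  have "4 * r * W.ball_int GG r + W.sph_int (\<lambda>p. - 4 * VG p + 0 * VG p) r = 4 * r * T.ball_int (\<lambda>x. - hV x) r"
  proof (rule moment_identity[OF W.homogeneous_weight_axioms T.homogeneous_weight_axioms _ _ _ _ r])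
    fix r :: real assume r: "r > 0"
    have c: "continuous_on UNIV (\<lambda>p. - 4 * VG p + 0 * VG p)" by (intro continuous_intros cont)
    have "W.mom2 GG r + W.mom1 (\<lambda>p. - 4 * VG p + 0 * VG p) r =
      (\<integral>p. bump r p * (GG p * \<bar>snd p\<bar> powr (1 - 2 * s)) + bump' r p * ((- 4 * VG p + 0 * VG p) * \<bar>snd p\<bar> powr (1 - 2 * s)) \<partial>lborel)"
      unfolding W.mom2_eq(2)[OF cont(1) r, symmetric] W.mom1_eq(2)[OF c r, symmetric]
      by (rule Bochner_Integration.integral_add[symmetric, OF W.mom2_eq(1)[OF cont(1) r] W.mom1_eq(1)[OF c r]])
    also have "\<dots> = (\<integral>p. \<bar>snd p\<bar> powr (1 - 2 * s) * (G p \<bullet> (bump r p *\<^sub>R G p - (4 * bump' r p * V p) *\<^sub>R p)) \<partial>lborel)"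
      by (rule Bochner_Integration.integral_cong) (auto simp: inner_diff_right algebra_simps)
    also have "\<dots> = - (2 * (\<integral>x. w x * (bump r (x, 0::real) * V (x, 0)) \<partial>lborel))"
      by (rule weak[OF bump_test[OF V_deriv G_cont r]])
    also have "\<dots> = (\<integral>x. bump r x * (- hV x * 1) \<partial>lborel)"
    proof -
      have "w x * (bump r (x, 0::real) * V (x, 0)) = - (1/2) * (bump r x * (- hV x * 1))" for x
        using wV[of x] by (simp add: mult.left_commute[of "w x"])
      then have "(\<integral>x. w x * (bump r (x, 0::real) * V (x, 0)) \<partial>lborel) = (\<integral>x. - (1/2) * (bump r x * (- hV x * 1)) \<partial>lborel)"
        by (simp only:)
      then show ?thesis by simp
    qed
    also have "\<dots> = T.mom2 (\<lambda>x. - hV x) r"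
      by (rule T.mom2_eq(2)[OF _ r]) (intro continuous_intros cont)
    finally show "W.mom2 GG r + W.mom1 (\<lambda>p. - 4 * VG p + 0 * VG p) r = T.mom2 (\<lambda>x. - hV x) r" .
  qed (intro continuous_intros cont)+
  moreover have "T.ball_int (\<lambda>x. - hV x) r = - T.ball_int hV r" by (simp add: T.ball_int_def)
  ultimately show ?thesis
    unfolding W.sph_int_lincomb[OF cont(2) cont(2) r] by simp
qed

end

context homogeneous_weight
begin

lemma ball_int_lincomb:
  assumes "continuous_on UNIV k" "continuous_on UNIV l"
  shows "ball_int (\<lambda>p. a * k p + b * l p) r = a * ball_int k r + b * ball_int l r"
proof -
  note i = ball_int_integrable[OF assms(1), of r] ball_int_integrable[OF assms(2), of r]
  have "ball_int (\<lambda>p. a * k p + b * l p) r = (\<integral>p. a * (indicator (ball 0 r) p * (k p * W p)) + b * (indicator (ball 0 r) p * (l p * W p)) \<partial>lborel)"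
    unfolding ball_int_def by (rule Bochner_Integration.integral_cong) (auto simp: algebra_simps)
  also have "\<dots> = a * ball_int k r + b * ball_int l r"
    unfolding ball_int_def
    by (subst Bochner_Integration.integral_add[OF integrable_mult_right[OF i(1)] integrable_mult_right[OF i(2)]]) simp
  finally show ?thesis .
qed

lemma mom1_lincomb:
  assumes "continuous_on UNIV k" "continuous_on UNIV l"
  shows "mom1 (\<lambda>p. a * k p + b * l p) r = a * mom1 k r + b * mom1 l r"
proof -
  have "(\<lambda>p. (p \<bullet> p) * (a * k p + b * l p)) = (\<lambda>p. a * ((p \<bullet> p) * k p) + b * ((p \<bullet> p) * l p))"
    by (simp add: fun_eq_iff algebra_simps)
  then show ?thesis
    unfolding mom1_def by (simp only: ball_int_lincomb assms cont_sq) (simp only: algebra_simps)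
qed

lemma mom2_lincomb:
  assumes "continuous_on UNIV k" "continuous_on UNIV l"
  shows "mom2 (\<lambda>p. a * k p + b * l p) r = a * mom2 k r + b * mom2 l r"
proof -
  have "(\<lambda>p. (p \<bullet> p) * (a * k p + b * l p)) = (\<lambda>p. a * ((p \<bullet> p) * k p) + b * ((p \<bullet> p) * l p))"
    by (simp add: fun_eq_iff algebra_simps)
  then show ?thesis
    unfolding mom2_def by (simp only: mom1_lincomb assms cont_sq) (simp only: algebra_simps)
qed

lemma weighted_integrable:
  assumes k: "continuous_on UNIV k" and z: "\<And>p. norm p > r \<Longrightarrow> k p = 0"
  shows "integrable lborel (\<lambda>p. W p * k p)"
proof -
  have "indicator (ball 0 (r + 1)) p * (k p * W p) = W p * k p" for p
    using z[of p] by (auto simp: indicator_def)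
  then have "(\<lambda>p. indicator (ball 0 (r + 1)) p * (k p * W p)) = (\<lambda>p. W p * k p)" by (simp only: fun_eq_iff simp_thms)
  then show ?thesis using ball_int_integrable[OF k, of "r + 1"] by (simp only:)
qed

text \<open>\<open>bump\<close> is homogeneous of degree 4 jointly in r and p, the weight of degree
  \<alpha> and the volume element of degree N; the exponent is minus their sum.\<close>

lemma mom2_scale:
  assumes k: "continuous_on UNIV k" and l: "l > 0" and r: "r > 0"
  shows "(\<integral>p. W p * (bump r p * k (l *\<^sub>R p)) \<partial>lborel) = l powr (- (real DIM('a) + 4 + \<alpha>)) * mom2 k (l * r)"
proof -
  have [measurable]: "k \<in> borel_measurable borel" "bump (l * r) \<in> borel_measurable (borel :: 'a measure)"
    using k by (auto intro: borel_measurable_continuous_onI bump_cont)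
  have b: "bump (l * r) (l *\<^sub>R p) = l ^ 4 * bump r p" for p :: 'a
  proof -
    have "max 0 ((l * r)\<^sup>2 - l *\<^sub>R p \<bullet> l *\<^sub>R p) = l\<^sup>2 * max 0 (r\<^sup>2 - p \<bullet> p)"
      using l by (simp add: max_mult_distrib_left power_mult_distrib algebra_simps power2_eq_square)
    then show ?thesis by (simp add: bump_def power_mult_distrib flip: power_mult)
  qed
  have "mom2 k (l * r) = (\<integral>p. bump (l * r) p * (k p * W p) \<partial>lborel)"
    using l r by (intro mom2_eq(2)[OF k, symmetric]) simp
  also have "\<dots> = l ^ DIM('a) * (\<integral>p. bump (l * r) (l *\<^sub>R p) * (k (l *\<^sub>R p) * W (l *\<^sub>R p)) \<partial>lborel)"
    using l by (subst lborel_integral_affine[of l _ 0]) auto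
  also have "\<dots> = l ^ DIM('a) * (\<integral>p. (l ^ 4 * l powr \<alpha>) * (W p * (bump r p * k (l *\<^sub>R p))) \<partial>lborel)"
    by (simp add: b W_hom[OF l] mult_ac)
  also have "\<dots> = (l ^ DIM('a) * l ^ 4 * l powr \<alpha>) * (\<integral>p. W p * (bump r p * k (l *\<^sub>R p)) \<partial>lborel)"
    by simp
  also have "l ^ DIM('a) * l ^ 4 * l powr \<alpha> = l powr (real DIM('a) + 4 + \<alpha>)"
  proof -
    have "l ^ DIM('a) = l powr real DIM('a)" "l ^ 4 = l powr 4" using l by (simp_all add: powr_realpow)
    then show ?thesis by (simp only: powr_add)
  qed
  finally have e: "mom2 k (l * r) = l powr (real DIM('a) + 4 + \<alpha>) * (\<integral>p. W p * (bump r p * k (l *\<^sub>R p)) \<partial>lborel)" .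
  have "l powr (- (real DIM('a) + 4 + \<alpha>)) * l powr (real DIM('a) + 4 + \<alpha>) = 1"
    using l by (simp only: powr_add[symmetric]; simp)
  then show ?thesis unfolding e mult.assoc[symmetric] by simp
qed

end

context weiss_setting
begin

abbreviation "wt \<equiv> \<lambda>p :: (real ^ 'n) \<times> real. \<bar>snd p\<bar> powr (1 - 2 * s)"

text \<open>The weak equation for V is tested with \<zeta>(p / l) and rescaled. The thick and thin
  integrals scale by l^(n + 1 - 2s) and l^n, so V(l p) solves the same equation with density l^(2s)
  w(l x).\<close>

lemma weak_scaled:
  assumes T: "test_fun \<zeta> Z R" and l: "l > 0"
  shows "(\<integral>p. wt p * (l * (G (l *\<^sub>R p) \<bullet> Z p)) \<partial>lborel) = - (2 * (\<integral>x. l powr (2 * s) * w (l *\<^sub>R x) * \<zeta> (x, 0) \<partial>lborel))"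
proof -
  interpret t: test_fun \<zeta> Z R by (rule T)
  let ?\<zeta> = "\<lambda>q. \<zeta> ((1 / l) *\<^sub>R q)" and ?Z = "\<lambda>q. (1 / l) *\<^sub>R Z ((1 / l) *\<^sub>R q)"
  have T': "test_fun ?\<zeta> ?Z (l * R)"
  proof
    fix p
    have "(?\<zeta> has_derivative (\<lambda>h. Z ((1 / l) *\<^sub>R p) \<bullet> ((1 / l) *\<^sub>R h))) (at p)"
      by (rule has_derivative_compose[of "\<lambda>q. (1 / l) *\<^sub>R q" "\<lambda>h. (1 / l) *\<^sub>R h" p UNIV \<zeta>, OF _ t.\<zeta>_deriv])
        (auto intro!: derivative_eq_intros)
    then show "(?\<zeta> has_derivative (\<lambda>h. ?Z p \<bullet> h)) (at p)" by simp
    have "continuous_on UNIV (\<lambda>q. Z ((1 / l) *\<^sub>R q))"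
      by (rule continuous_on_compose2[OF t.Z_cont]) (auto intro!: continuous_intros)
    then show "continuous_on UNIV ?Z" by (intro continuous_intros)
    assume "norm p > l * R"
    then have "norm ((1 / l) *\<^sub>R p) > R" using l by (simp add: field_simps)
    then show "?\<zeta> p = 0" "?Z p = 0" using t.\<zeta>_supp t.Z_supp by auto
  qed
  have [measurable]: "G \<in> borel_measurable borel" "Z \<in> borel_measurable borel" "\<zeta> \<in> borel_measurable borel" "w \<in> borel_measurable borel"
    using G_cont t.Z_cont t.\<zeta>_cont w_cont by (auto intro: borel_measurable_continuous_onI)
  have m1: "(\<lambda>p. wt p * (G p \<bullet> ?Z p)) \<in> borel_measurable borel"
    by (rule borel_measurable_times[OF snd_borel_weight]) measurable
  have m2: "(\<lambda>x. w x * ?\<zeta> (x, 0)) \<in> borel_measurable borel"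
    by (rule borel_measurable_continuous_onI) (auto intro!: continuous_intros w_cont continuous_on_compose2[OF t.\<zeta>_cont[of UNIV]])
  have ln: "l \<noteq> 0" using l by simp
  have "(\<integral>p. wt p * (G p \<bullet> ?Z p) \<partial>lborel) = l ^ (CARD('n) + 1) * (\<integral>p. wt (l *\<^sub>R p) * (G (l *\<^sub>R p) \<bullet> ?Z (l *\<^sub>R p)) \<partial>lborel)"
    using lborel_integral_affine[OF ln m1, of 0] l
    by (simp only: add_0_left abs_of_pos DIM_prod DIM_cart DIM_real mult_1_right)
  also have "(\<integral>p. wt (l *\<^sub>R p) * (G (l *\<^sub>R p) \<bullet> ?Z (l *\<^sub>R p)) \<partial>lborel) = (\<integral>p. l powr (1 - 2 * s) / l * (wt p * (G (l *\<^sub>R p) \<bullet> Z p)) \<partial>lborel)"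
    using l by (intro Bochner_Integration.integral_cong) (auto simp: abs_mult powr_mult)
  finally have 1: "(\<integral>p. wt p * (G p \<bullet> ?Z p) \<partial>lborel) = l ^ (CARD('n) + 1) * (l powr (1 - 2 * s) / l * (\<integral>p. wt p * (G (l *\<^sub>R p) \<bullet> Z p) \<partial>lborel))"
    by (simp only: integral_mult_right_zero)
  have 2: "(\<integral>x. w x * ?\<zeta> (x, 0) \<partial>lborel) = l ^ CARD('n) * (\<integral>x. w (l *\<^sub>R x) * \<zeta> (x, 0) \<partial>lborel)"
    using lborel_integral_affine[OF ln m2, of 0] l
    by (simp only: add_0_left abs_of_pos DIM_prod DIM_cart DIM_real mult_1_right; simp)
  have "l ^ CARD('n) * (l powr (1 - 2 * s) * (\<integral>p. wt p * (G (l *\<^sub>R p) \<bullet> Z p) \<partial>lborel)) = l ^ CARD('n) * (- (2 * (\<integral>x. w (l *\<^sub>R x) * \<zeta> (x, 0) \<partial>lborel)))"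
    using weak[OF T'] unfolding 1 2 using l by simp
  then have 3: "l powr (1 - 2 * s) * (\<integral>p. wt p * (G (l *\<^sub>R p) \<bullet> Z p) \<partial>lborel) = - (2 * (\<integral>x. w (l *\<^sub>R x) * \<zeta> (x, 0) \<partial>lborel))"
    by (rule mult_left_cancel[THEN iffD1, rotated]) (use l in simp)
  have "l powr (2 * s) * l powr (1 - 2 * s) = l" using l by (simp flip: powr_add)
  then have "l * (\<integral>p. wt p * (G (l *\<^sub>R p) \<bullet> Z p) \<partial>lborel) = l powr (2 * s) * (- (2 * (\<integral>x. w (l *\<^sub>R x) * \<zeta> (x, 0) \<partial>lborel)))"
    unfolding 3[symmetric] by (simp flip: mult.assoc)
  then show ?thesis by (simp add: mult.assoc mult.left_commute[of _ l])
qed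

lemma V_scale_deriv: "((\<lambda>l. V (l *\<^sub>R p)) has_real_derivative G (t *\<^sub>R p) \<bullet> p) (at t)"
  using has_derivative_imp_DERIV_line[where f=V and a=0 and t=t and h=p, OF V_deriv] by simp

lemma scaled_cont: "continuous_on UNIV (\<lambda>p. V (l *\<^sub>R p))" "continuous_on UNIV (\<lambda>p. G (l *\<^sub>R p))"
  by (auto intro!: continuous_on_compose2[OF V_cont[of UNIV]] continuous_on_compose2[OF G_cont] continuous_intros)

text \<open>Testing with \<open>\<eta> (V(\<lambda> \<cdot>) - V)\<close> and letting \<open>\<lambda>\<close> tend to 1 replaces the test function
  \<open>\<eta> p \<cdot> \<nabla>V\<close> of the Rellich identity, which is not differentiable enough.\<close>

lemma dilation_identity:
  assumes l: "l > 0" and r: "r > 0"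
  shows "l powr (2 * s - real CARD('n) - 4) * W.mom2 GG (l * r) - W.mom2 GG r =
    4 * (\<integral>p. wt p * (bump' r p * (V (l *\<^sub>R p) - V p) * (p \<bullet> (l *\<^sub>R G (l *\<^sub>R p) + G p))) \<partial>lborel)
    - 2 * (\<integral>x. (l powr (2 * s) * w (l *\<^sub>R x) + w x) * (bump r x * (V (l *\<^sub>R x, 0) - V (x, 0))) \<partial>lborel)"
proof -
  let ?f = "\<lambda>p. V (l *\<^sub>R p) - V p" and ?F = "\<lambda>p. l *\<^sub>R G (l *\<^sub>R p) - G p"
  let ?Z = "\<lambda>p. bump r p *\<^sub>R ?F p - (4 * bump' r p * ?f p) *\<^sub>R p"
  have F: "continuous_on UNIV ?F" by (intro continuous_intros scaled_cont G_cont)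
  have f: "(?f has_derivative (\<lambda>h. ?F p \<bullet> h)) (at p)" for p
  proof -
    have "((\<lambda>p. V (l *\<^sub>R p)) has_derivative (\<lambda>h. G (l *\<^sub>R p) \<bullet> (l *\<^sub>R h))) (at p)"
      by (rule has_derivative_compose[of "\<lambda>q. l *\<^sub>R q" "\<lambda>h. l *\<^sub>R h" p UNIV V, OF _ V_deriv])
        (auto intro!: derivative_eq_intros)
    from has_derivative_diff[OF this V_deriv[of p]] show ?thesis by (simp add: inner_diff_left)
  qed
  have cf: "continuous_on UNIV ?f" by (intro continuous_intros scaled_cont V_cont)
  have t: "test_fun (\<lambda>p. bump r p * ?f p) ?Z r" by (rule bump_test[OF f F r])
  interpret t: test_fun "\<lambda>p. bump r p * ?f p" ?Z r by (rule t)
  have i1: "integrable lborel (\<lambda>p. wt p * (G p \<bullet> ?Z p))"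
    by (rule W.weighted_integrable[of _ r]) (use t.Z_cont t.Z_supp G_cont in \<open>auto intro!: continuous_intros simp del: inner_diff_right\<close>)
  have i2: "integrable lborel (\<lambda>p. wt p * (l * (G (l *\<^sub>R p) \<bullet> ?Z p)))"
    by (rule W.weighted_integrable[of _ r]) (use t.Z_cont t.Z_supp scaled_cont in \<open>auto intro!: continuous_intros simp del: inner_diff_right\<close>)
  have b: "bump r p = 0" "bump' r p = 0" if "norm p > r" for p :: "'b::real_inner"
    using bump_supp[of r p] that r by auto
  have j1: "integrable lborel (\<lambda>p. wt p * (bump r p * (l\<^sup>2 * GG (l *\<^sub>R p))))"
    and j2: "integrable lborel (\<lambda>p. wt p * (bump r p * GG p))"
    and j3: "integrable lborel (\<lambda>p. wt p * (bump' r p * ?f p * (p \<bullet> (l *\<^sub>R G (l *\<^sub>R p) + G p))))"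
    by (rule W.weighted_integrable[of _ r]; use b in \<open>auto intro!: continuous_intros scaled_cont G_cont cf\<close>)+
  have k: "integrable lborel (\<lambda>x. w (l *\<^sub>R x) * (bump r x * ?f (x, 0)))" "integrable lborel (\<lambda>x. w x * (bump r x * ?f (x, 0)))"
  proof -
    have c: "continuous_on UNIV (\<lambda>x. ?f (x, 0))" by (rule continuous_on_compose2[OF cf]) (auto intro!: continuous_intros)
    have cw: "continuous_on UNIV (\<lambda>x. w (l *\<^sub>R x))" by (rule continuous_on_compose2[OF w_cont]) (auto intro!: continuous_intros)
    show "integrable lborel (\<lambda>x. w (l *\<^sub>R x) * (bump r x * ?f (x, 0)))" "integrable lborel (\<lambda>x. w x * (bump r x * ?f (x, 0)))"
      by (rule compact_support_integrable[of _ r]; use b in \<open>auto intro!: continuous_intros c[simplified] cw w_cont\<close>)+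
  qed
  \<comment> \<open>The equations of V(l p) and of V are added, both tested with the cutoff times
    V(l p) - V(p). The mixed products cancel, leaving the difference of squares |l G(l p)|^2 -
    |G(p)|^2.\<close>
  have "(\<integral>p. wt p * (l * (G (l *\<^sub>R p) \<bullet> ?Z p)) \<partial>lborel) + (\<integral>p. wt p * (G p \<bullet> ?Z p) \<partial>lborel)
     = (\<integral>p. wt p * (l * (G (l *\<^sub>R p) \<bullet> ?Z p)) + wt p * (G p \<bullet> ?Z p) \<partial>lborel)"
    by (rule Bochner_Integration.integral_add[OF i2 i1, symmetric])
  also have "\<dots> = (\<integral>p. wt p * (bump r p * (l\<^sup>2 * GG (l *\<^sub>R p))) - wt p * (bump r p * GG p)
      - 4 * (wt p * (bump' r p * ?f p * (p \<bullet> (l *\<^sub>R G (l *\<^sub>R p) + G p)))) \<partial>lborel)"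
    by (rule Bochner_Integration.integral_cong)
      (auto simp: inner_diff_right inner_add_right inner_commute power2_eq_square algebra_simps)
  also have "\<dots> = (\<integral>p. wt p * (bump r p * (l\<^sup>2 * GG (l *\<^sub>R p))) \<partial>lborel) - (\<integral>p. wt p * (bump r p * GG p) \<partial>lborel)
      - 4 * (\<integral>p. wt p * (bump' r p * ?f p * (p \<bullet> (l *\<^sub>R G (l *\<^sub>R p) + G p))) \<partial>lborel)"
    by (simp only: Bochner_Integration.integral_diff Bochner_Integration.integrable_diff j1 j2 j3 integrable_mult_right integral_mult_right_zero)
  also have "(\<integral>p. wt p * (bump r p * (l\<^sup>2 * GG (l *\<^sub>R p))) \<partial>lborel) = l\<^sup>2 * (\<integral>p. wt p * (bump r p * GG (l *\<^sub>R p)) \<partial>lborel)"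
    by (subst integral_mult_right_zero[symmetric]) (simp only: mult_ac)
  also have "\<dots> = l\<^sup>2 * (l powr (- (real DIM((real ^ 'n) \<times> real) + 4 + (1 - 2 * s))) * W.mom2 GG (l * r))"
    by (simp only: W.mom2_scale[OF cont(1) l r])
  also have "\<dots> = l powr (2 * s - real CARD('n) - 4) * W.mom2 GG (l * r)"
  proof -
    have "l powr 2 * l powr (- (real DIM((real ^ 'n) \<times> real) + 4 + (1 - 2 * s))) = l powr (2 * s - real CARD('n) - 4)"
      by (simp add: powr_add[symmetric] algebra_simps)
    then show ?thesis using l by (simp add: mult.assoc[symmetric])
  qed
  also have "(\<integral>p. wt p * (bump r p * GG p) \<partial>lborel) = W.mom2 GG r"
    unfolding W.mom2_eq(2)[OF cont(1) r, symmetric] by (simp only: mult_ac)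
  finally have "l powr (2 * s - real CARD('n) - 4) * W.mom2 GG (l * r) - W.mom2 GG r
      - 4 * (\<integral>p. wt p * (bump' r p * ?f p * (p \<bullet> (l *\<^sub>R G (l *\<^sub>R p) + G p))) \<partial>lborel)
    = - (2 * (\<integral>x. l powr (2 * s) * w (l *\<^sub>R x) * (bump r (x, 0::real) * ?f (x, 0)) \<partial>lborel)) - 2 * (\<integral>x. w x * (bump r (x, 0::real) * ?f (x, 0)) \<partial>lborel)"
    unfolding weak_scaled[OF t l] weak[OF t] by simp
  also have "\<dots> = - 2 * ((\<integral>x. l powr (2 * s) * (w (l *\<^sub>R x) * (bump r x * ?f (x, 0))) \<partial>lborel) + (\<integral>x. w x * (bump r x * ?f (x, 0)) \<partial>lborel))"
    by (simp add: mult.assoc)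
  also have "(\<integral>x. l powr (2 * s) * (w (l *\<^sub>R x) * (bump r x * ?f (x, 0))) \<partial>lborel) + (\<integral>x. w x * (bump r x * ?f (x, 0)) \<partial>lborel)
      = (\<integral>x. (l powr (2 * s) * w (l *\<^sub>R x) + w x) * (bump r x * (V (l *\<^sub>R x, 0) - V (x, 0))) \<partial>lborel)"
    by (subst Bochner_Integration.integral_add[OF integrable_mult_right[OF k(1)] k(2), symmetric])
      (simp add: algebra_simps)
  finally show ?thesis by simp
qed

text \<open>For l within 1/2 of 1 and |p| < r the segment from p to l p stays in the ball of radius
  2 r, where G is bounded. This bounds the difference quotient of V, and the weight on the ball is
  the integrable majorant.\<close>

lemma dilation_limit_thick:
  assumes r: "r > 0"
  shows "((\<lambda>l. \<integral>p. wt p * (bump' r p * ((V (l *\<^sub>R p) - V p) / (l - 1)) * (p \<bullet> (l *\<^sub>R G (l *\<^sub>R p) + G p))) \<partial>lborel)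
    \<longlongrightarrow> (\<integral>p. wt p * (bump' r p * (G p \<bullet> p) * (p \<bullet> (G p + G p))) \<partial>lborel)) (at 1)"
proof -
  obtain B where B: "B \<ge> 0" "\<And>p. norm p \<le> 2 * r \<Longrightarrow> norm (G p) \<le> B" using W.bounded_on_cball[OF G_cont] by metis
  let ?w = "\<lambda>p. (r\<^sup>2 * (B * r) * (r * (3 * B))) * (indicator (ball 0 r) p * \<bar>wt p\<bar>)"
  have m: "wt \<in> borel_measurable borel" by (rule snd_borel_weight)
  have cm: "(\<lambda>p. wt p * k p) \<in> borel_measurable lborel" if "continuous_on UNIV k" for k :: "(real ^ 'n) \<times> real \<Rightarrow> real"
    unfolding measurable_lborel1 measurable_lborel2
    by (rule borel_measurable_times[OF m borel_measurable_continuous_onI[OF that]])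
  show ?thesis
  proof (rule integral_tendsto_at[where w="?w"])
    show "integrable lborel ?w" by (intro integrable_mult_right W.integrable_weight_ball)
    show "(\<lambda>p. wt p * (bump' r p * (G p \<bullet> p) * (p \<bullet> (G p + G p)))) \<in> borel_measurable lborel"
      by (intro cm continuous_intros G_cont)
    show "AE p in lborel. ((\<lambda>l. wt p * (bump' r p * ((V (l *\<^sub>R p) - V p) / (l - 1)) * (p \<bullet> (l *\<^sub>R G (l *\<^sub>R p) + G p)))) \<longlongrightarrow>
        wt p * (bump' r p * (G p \<bullet> p) * (p \<bullet> (G p + G p)))) (at 1)"
    proof (rule AE_I2)
      fix p :: "(real ^ 'n) \<times> real"
      have 1: "((\<lambda>l. (V (l *\<^sub>R p) - V p) / (l - 1)) \<longlongrightarrow> G p \<bullet> p) (at 1)"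
        using V_scale_deriv[of p 1] by (simp add: has_field_derivative_iff)
      have "isCont (\<lambda>l. G (l *\<^sub>R p)) 1"
        using continuous_on_compose2[OF G_cont, of UNIV "\<lambda>l. l *\<^sub>R p"] by (simp add: continuous_on_eq_continuous_at continuous_on_scaleR continuous_on_id continuous_on_const)
      then have "((\<lambda>l. G (l *\<^sub>R p)) \<longlongrightarrow> G p) (at 1)" by (simp add: isCont_def)
      then have "((\<lambda>l. p \<bullet> (l *\<^sub>R G (l *\<^sub>R p) + G p)) \<longlongrightarrow> p \<bullet> (1 *\<^sub>R G p + G p)) (at 1)" by (intro tendsto_intros)
      then have 2: "((\<lambda>l. p \<bullet> (l *\<^sub>R G (l *\<^sub>R p) + G p)) \<longlongrightarrow> p \<bullet> (G p + G p)) (at 1)" by simp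
      show "((\<lambda>l. wt p * (bump' r p * ((V (l *\<^sub>R p) - V p) / (l - 1)) * (p \<bullet> (l *\<^sub>R G (l *\<^sub>R p) + G p)))) \<longlongrightarrow>
        wt p * (bump' r p * (G p \<bullet> p) * (p \<bullet> (G p + G p)))) (at 1)"
        by (intro tendsto_mult tendsto_const 1 2)
    qed
    have "eventually (\<lambda>l::real. dist l 1 < 1/2 \<and> l \<noteq> 1) (at 1)" by (auto simp: eventually_at intro!: exI[of _ "1/2"])
    then show "\<forall>\<^sub>F l in at 1. (\<lambda>p. wt p * (bump' r p * ((V (l *\<^sub>R p) - V p) / (l - 1)) * (p \<bullet> (l *\<^sub>R G (l *\<^sub>R p) + G p)))) \<in> borel_measurable lborel \<and>
      (AE p in lborel. \<bar>wt p * (bump' r p * ((V (l *\<^sub>R p) - V p) / (l - 1)) * (p \<bullet> (l *\<^sub>R G (l *\<^sub>R p) + G p)))\<bar> \<le> ?w p)"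
    proof eventually_elim
      case (elim l)
      then have "\<bar>l - 1\<bar> < 1/2" by (simp only: dist_real_def)
      then have l: "1/2 < l" "l < 3/2" "l \<noteq> 1" using elim unfolding abs_less_iff by auto
      have "\<bar>wt p * (bump' r p * ((V (l *\<^sub>R p) - V p) / (l - 1)) * (p \<bullet> (l *\<^sub>R G (l *\<^sub>R p) + G p)))\<bar> \<le> ?w p" for p
      proof (cases "norm p < r")
        case True
        have np: "norm (t *\<^sub>R p) \<le> 2 * r" if "0 \<le> t" "t < 3/2" for t
          using that True mult_mono[of t 2 "norm p" r] by simp
        have "\<bar>V (l *\<^sub>R p) - V (1 *\<^sub>R p)\<bar> \<le> B * norm (l *\<^sub>R p - 1 *\<^sub>R p)"
          by (rule gradient_bound[of "cball 0 (2*r)" V G]) (use V_deriv B np[of l] np[of 1] l in auto)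
        also have "l *\<^sub>R p - 1 *\<^sub>R p = (l - 1) *\<^sub>R p" by (simp add: algebra_simps)
        also have "B * norm ((l - 1) *\<^sub>R p) \<le> B * (\<bar>l - 1\<bar> * r)" using True B by (auto intro!: mult_left_mono)
        finally have a1: "\<bar>(V (l *\<^sub>R p) - V p) / (l - 1)\<bar> \<le> B * r"
          using l by (simp add: abs_divide field_simps)
        have "norm (l *\<^sub>R G (l *\<^sub>R p) + G p) \<le> \<bar>l\<bar> * norm (G (l *\<^sub>R p)) + norm (G p)"
          using norm_triangle_ineq[of "l *\<^sub>R G (l *\<^sub>R p)" "G p"] by simp
        also have "\<dots> \<le> 2 * B + B"
          using l B np[of l] np[of 1] by (intro add_mono mult_mono) auto
        finally have "norm p * norm (l *\<^sub>R G (l *\<^sub>R p) + G p) \<le> r * (3 * B)"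
          using True B r by (intro mult_mono) auto
        then have a2: "\<bar>p \<bullet> (l *\<^sub>R G (l *\<^sub>R p) + G p)\<bar> \<le> r * (3 * B)"
          using Cauchy_Schwarz_ineq2[of p "l *\<^sub>R G (l *\<^sub>R p) + G p"] by linarith
        have "\<bar>bump' r p * ((V (l *\<^sub>R p) - V p) / (l - 1)) * (p \<bullet> (l *\<^sub>R G (l *\<^sub>R p) + G p))\<bar> \<le> r\<^sup>2 * (B * r) * (r * (3 * B))"
          unfolding abs_mult[of "_ * _"] abs_mult[of "bump' r p"]
          using a1 a2 B r bump_le(1)[of r p] by (intro mult_mono) auto
        then have "\<bar>wt p\<bar> * \<bar>bump' r p * ((V (l *\<^sub>R p) - V p) / (l - 1)) * (p \<bullet> (l *\<^sub>R G (l *\<^sub>R p) + G p))\<bar> \<le> \<bar>wt p\<bar> * (r\<^sup>2 * (B * r) * (r * (3 * B)))"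
          by (rule mult_left_mono) simp
        then show ?thesis using True unfolding abs_mult[of "wt p"] by (simp add: mult_ac)
      next
        case False
        then show ?thesis using r bump_supp(2)[of r p] by simp
      qed
      moreover have "(\<lambda>p. wt p * (bump' r p * ((V (l *\<^sub>R p) - V p) / (l - 1)) * (p \<bullet> (l *\<^sub>R G (l *\<^sub>R p) + G p)))) \<in> borel_measurable lborel"
        using l by (intro cm continuous_intros G_cont V_cont scaled_cont) auto
      ultimately show ?case by (intro conjI AE_I2)
    qed
  qed
qed

lemma dilation_limit_thin:
  assumes r: "r > 0"
  shows "((\<lambda>l. \<integral>x. (l powr (2 * s) * w (l *\<^sub>R x) + w x) * (bump r x * ((V (l *\<^sub>R x, 0) - V (x, 0)) / (l - 1))) \<partial>lborel)
    \<longlongrightarrow> (\<integral>x. (w x + w x) * (bump r x * (fst (G (x, 0)) \<bullet> x)) \<partial>lborel)) (at 1)"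
proof -
  obtain B where B: "B \<ge> 0" "\<And>p. norm p \<le> 2 * r \<Longrightarrow> norm (G p) \<le> B" using W.bounded_on_cball[OF G_cont] by metis
  obtain E where E: "E \<ge> 0" "\<And>x. norm x \<le> 2 * r \<Longrightarrow> norm (w x) \<le> E" using T.bounded_on_cball[OF w_cont] by metis
  let ?w = "\<lambda>x :: real ^ 'n. ((4 * E + E) * (r ^ 4 * (B * r))) * (indicator (ball 0 r) x * \<bar>1\<bar>)"
  have cs: "continuous_on UNIV (\<lambda>x. V (l *\<^sub>R x, 0))" "continuous_on UNIV (\<lambda>x. w (l *\<^sub>R x))" for l
    by (auto intro!: continuous_on_compose2[OF V_cont[of UNIV]] continuous_on_compose2[OF w_cont] continuous_intros)
  show ?thesis
  proof (rule integral_tendsto_at[where w="?w"])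
    show "integrable lborel ?w" by (intro integrable_mult_right T.integrable_weight_ball)
    have "continuous_on UNIV (\<lambda>x. (w x + w x) * (bump r x * (fst (G (x, 0)) \<bullet> x)))"
      by (intro continuous_intros w_cont slice_cont)
    then show "(\<lambda>x. (w x + w x) * (bump r x * (fst (G (x, 0)) \<bullet> x))) \<in> borel_measurable lborel"
      using borel_measurable_continuous_onI by simp
    show "AE x in lborel. ((\<lambda>l. (l powr (2 * s) * w (l *\<^sub>R x) + w x) * (bump r x * ((V (l *\<^sub>R x, 0) - V (x, 0)) / (l - 1)))) \<longlongrightarrow>
        (w x + w x) * (bump r x * (fst (G (x, 0)) \<bullet> x))) (at 1)"
    proof (rule AE_I2)
      fix x :: "real ^ 'n"
      have 1: "((\<lambda>l. (V (l *\<^sub>R x, 0) - V (x, 0)) / (l - 1)) \<longlongrightarrow> fst (G (x, 0)) \<bullet> x) (at 1)"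
        using V_scale_deriv[of "(x, 0)" 1] by (simp add: has_field_derivative_iff inner_prod_def)
      have "isCont (\<lambda>l. w (l *\<^sub>R x)) 1"
        using continuous_on_compose2[OF w_cont, of UNIV "\<lambda>l. l *\<^sub>R x"] by (simp add: continuous_on_eq_continuous_at continuous_on_scaleR continuous_on_id continuous_on_const)
      then have wl: "((\<lambda>l. w (l *\<^sub>R x)) \<longlongrightarrow> w x) (at 1)" by (simp add: isCont_def)
      have "((\<lambda>l::real. l powr (2 * s)) \<longlongrightarrow> 1 powr (2 * s)) (at 1)" by (intro tendsto_intros) simp
      then have "((\<lambda>l::real. l powr (2 * s)) \<longlongrightarrow> 1) (at 1)" by simp
      then have 2: "((\<lambda>l. l powr (2 * s) * w (l *\<^sub>R x) + w x) \<longlongrightarrow> 1 * w x + w x) (at 1)" by (intro tendsto_intros wl)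
      have "((\<lambda>l. (l powr (2 * s) * w (l *\<^sub>R x) + w x) * (bump r x * ((V (l *\<^sub>R x, 0) - V (x, 0)) / (l - 1)))) \<longlongrightarrow>
        (1 * w x + w x) * (bump r x * (fst (G (x, 0)) \<bullet> x))) (at 1)"
        by (intro tendsto_mult tendsto_const 1 2)
      then show "((\<lambda>l. (l powr (2 * s) * w (l *\<^sub>R x) + w x) * (bump r x * ((V (l *\<^sub>R x, 0) - V (x, 0)) / (l - 1)))) \<longlongrightarrow>
        (w x + w x) * (bump r x * (fst (G (x, 0)) \<bullet> x))) (at 1)" by simp
    qed
    have "eventually (\<lambda>l::real. dist l 1 < 1/2 \<and> l \<noteq> 1) (at 1)" by (auto simp: eventually_at intro!: exI[of _ "1/2"])
    then show "\<forall>\<^sub>F l in at 1. (\<lambda>x. (l powr (2 * s) * w (l *\<^sub>R x) + w x) * (bump r x * ((V (l *\<^sub>R x, 0) - V (x, 0)) / (l - 1)))) \<in> borel_measurable lborel \<and>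
      (AE x in lborel. \<bar>(l powr (2 * s) * w (l *\<^sub>R x) + w x) * (bump r x * ((V (l *\<^sub>R x, 0) - V (x, 0)) / (l - 1)))\<bar> \<le> ?w x)"
    proof eventually_elim
      case (elim l)
      then have "\<bar>l - 1\<bar> < 1/2" by (simp only: dist_real_def)
      then have l: "1/2 < l" "l < 3/2" "l \<noteq> 1" using elim unfolding abs_less_iff by auto
      have "l powr (2 * s) \<le> 2 powr (2 * s)" using l s by (intro powr_mono2) auto
      also have "\<dots> \<le> 2 powr 2" using s by (intro powr_mono) auto
      finally have l4: "l powr (2 * s) \<le> 4" by simp
      have "\<bar>(l powr (2 * s) * w (l *\<^sub>R x) + w x) * (bump r x * ((V (l *\<^sub>R x, 0) - V (x, 0)) / (l - 1)))\<bar> \<le> ?w x" for x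
      proof (cases "norm x < r")
        case True
        have np: "norm (t *\<^sub>R x) \<le> 2 * r" if "0 \<le> t" "t < 3/2" for t
          using that True mult_mono[of t 2 "norm x" r] by simp
        have "\<bar>V (l *\<^sub>R x, 0) - V (x, 0)\<bar> \<le> B * norm ((l *\<^sub>R x, 0::real) - (x, 0))"
          by (rule gradient_bound[of "cball 0 (2*r)" V G]) (use V_deriv B np[of l] np[of 1] l in auto)
        also have "(l *\<^sub>R x, 0::real) - (x, 0) = ((l - 1) *\<^sub>R x, 0)" by (simp add: algebra_simps)
        also have "B * norm ((l - 1) *\<^sub>R x, 0::real) \<le> B * (\<bar>l - 1\<bar> * r)" using True B by (auto intro!: mult_left_mono)
        finally have a1: "\<bar>(V (l *\<^sub>R x, 0) - V (x, 0)) / (l - 1)\<bar> \<le> B * r"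
          using l by (simp add: abs_divide field_simps)
        have "\<bar>l powr (2 * s) * w (l *\<^sub>R x) + w x\<bar> \<le> \<bar>l powr (2 * s)\<bar> * \<bar>w (l *\<^sub>R x)\<bar> + \<bar>w x\<bar>"
          unfolding abs_mult[symmetric] by (rule abs_triangle_ineq)
        also have "\<dots> \<le> 4 * E + E"
          using l l4 E np[of l] np[of 1] by (intro add_mono mult_mono) auto
        finally have a2: "\<bar>l powr (2 * s) * w (l *\<^sub>R x) + w x\<bar> \<le> 4 * E + E" .
        have "\<bar>(l powr (2 * s) * w (l *\<^sub>R x) + w x) * (bump r x * ((V (l *\<^sub>R x, 0) - V (x, 0)) / (l - 1)))\<bar> \<le> (4 * E + E) * (r ^ 4 * (B * r))"
          unfolding abs_mult[of "_ + _"] abs_mult[of "bump r x"]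
          using a1 a2 B E r bump_le(2)[of r x] by (intro mult_mono) auto
        then show ?thesis using True by simp
      next
        case False
        then show ?thesis using r bump_supp(1)[of r x] by simp
      qed
      moreover have "continuous_on UNIV (\<lambda>x. (l powr (2 * s) * w (l *\<^sub>R x) + w x) * (bump r x * ((V (l *\<^sub>R x, 0) - V (x, 0)) / (l - 1))))"
        using l by (intro continuous_intros cs w_cont slice_cont) auto
      then have "(\<lambda>x. (l powr (2 * s) * w (l *\<^sub>R x) + w x) * (bump r x * ((V (l *\<^sub>R x, 0) - V (x, 0)) / (l - 1)))) \<in> borel_measurable lborel"
        unfolding measurable_lborel2 by (rule borel_measurable_continuous_onI)
      ultimately show ?case by (intro conjI AE_I2)
    qed
  qed
qed

text \<open>\<open>dilation_identity\<close> is divided by l - 1. The left side becomes the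
  difference quotient at 1 of l^(2s-n-4) times \<open>mom2\<close> at radius l r; on the right the
  two dilation limits apply, and \<open>wG\<close> turns w into h / 2.\<close>

lemma dilation_moments:
  assumes r: "r > 0"
  shows "(2 * s - real CARD('n) - 4) * W.mom2 GG r + 4 * r\<^sup>2 * W.mom1 GG r = 8 * W.mom1 QG r - 2 * T.mom2 hG r"
proof -
  let ?c = "2 * s - real CARD('n) - 4"
  let ?B = "\<lambda>l. l powr ?c * W.mom2 GG (l * r)"
  let ?P = "\<lambda>l. \<integral>p. wt p * (bump' r p * ((V (l *\<^sub>R p) - V p) / (l - 1)) * (p \<bullet> (l *\<^sub>R G (l *\<^sub>R p) + G p))) \<partial>lborel"
  let ?Q = "\<lambda>l. \<integral>x. (l powr (2 * s) * w (l *\<^sub>R x) + w x) * (bump r x * ((V (l *\<^sub>R x, 0) - V (x, 0)) / (l - 1))) \<partial>lborel"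
  have "((\<lambda>l. W.mom2 GG (l * r)) has_real_derivative (4 * (1 * r) * W.mom1 GG (1 * r)) * r) (at 1)"
    by (rule DERIV_chain2[of "W.mom2 GG"]) (use r in \<open>auto intro!: W.mom2_deriv cont derivative_eq_intros\<close>)
  then have "(?B has_real_derivative (?c * 1 powr (?c - 1)) * W.mom2 GG (1 * r) + ((4 * (1 * r) * W.mom1 GG (1 * r)) * r) * 1 powr ?c) (at 1)"
    by (intro DERIV_mult has_real_derivative_powr) auto
  then have lim1: "((\<lambda>l. (?B l - ?B 1) / (l - 1)) \<longlongrightarrow> ?c * W.mom2 GG r + 4 * r\<^sup>2 * W.mom1 GG r) (at 1)"
    by (simp add: has_field_derivative_iff power2_eq_square mult_ac)
  have lim2: "((\<lambda>l. 4 * ?P l - 2 * ?Q l) \<longlongrightarrow> 4 * (\<integral>p. wt p * (bump' r p * (G p \<bullet> p) * (p \<bullet> (G p + G p))) \<partial>lborel)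
      - 2 * (\<integral>x. (w x + w x) * (bump r x * (fst (G (x, 0)) \<bullet> x)) \<partial>lborel)) (at 1)"
    by (intro tendsto_intros dilation_limit_thick dilation_limit_thin r)
  have ev: "eventually (\<lambda>l. 4 * ?P l - 2 * ?Q l = (?B l - ?B 1) / (l - 1)) (at 1)"
  proof -
    have "eventually (\<lambda>l::real. dist l 1 < 1 \<and> l \<noteq> 1) (at 1)" by (auto simp: eventually_at intro!: exI[of _ 1])
    then show ?thesis
    proof eventually_elim
      case (elim l)
      then have l: "l > 0" "l \<noteq> 1" by (auto simp: dist_real_def)
      have P: "?P l = (\<integral>p. wt p * (bump' r p * (V (l *\<^sub>R p) - V p) * (p \<bullet> (l *\<^sub>R G (l *\<^sub>R p) + G p))) \<partial>lborel) / (l - 1)"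
        by (simp flip: integral_divide_zero)
      have Q: "?Q l = (\<integral>x. (l powr (2 * s) * w (l *\<^sub>R x) + w x) * (bump r x * (V (l *\<^sub>R x, 0) - V (x, 0))) \<partial>lborel) / (l - 1)"
        by (simp flip: integral_divide_zero)
      have D: "?B l - ?B 1 = 4 * (\<integral>p. wt p * (bump' r p * (V (l *\<^sub>R p) - V p) * (p \<bullet> (l *\<^sub>R G (l *\<^sub>R p) + G p))) \<partial>lborel)
          - 2 * (\<integral>x. (l powr (2 * s) * w (l *\<^sub>R x) + w x) * (bump r x * (V (l *\<^sub>R x, 0) - V (x, 0))) \<partial>lborel)"
        unfolding dilation_identity[OF l(1) r, symmetric] by simp
      show ?case unfolding P Q D by (simp only: diff_divide_distrib times_divide_eq_right)
    qed
  qed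
  have "?c * W.mom2 GG r + 4 * r\<^sup>2 * W.mom1 GG r = 4 * (\<integral>p. wt p * (bump' r p * (G p \<bullet> p) * (p \<bullet> (G p + G p))) \<partial>lborel)
      - 2 * (\<integral>x. (w x + w x) * (bump r x * (fst (G (x, 0)) \<bullet> x)) \<partial>lborel)"
    by (rule tendsto_unique[OF _ lim1 Lim_transform_eventually[OF lim2 ev]]) simp
  also have "(\<integral>p. wt p * (bump' r p * (G p \<bullet> p) * (p \<bullet> (G p + G p))) \<partial>lborel) = 2 * W.mom1 QG r"
    unfolding W.mom1_eq(2)[OF cont(3) r, symmetric] integral_mult_right_zero[symmetric]
    by (rule Bochner_Integration.integral_cong) (auto simp: inner_add_right inner_commute power2_eq_square algebra_simps)
  also have "(\<integral>x. (w x + w x) * (bump r x * (fst (G (x, 0)) \<bullet> x)) \<partial>lborel) = T.mom2 hG r"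
    unfolding T.mom2_eq(2)[OF cont(5) r, symmetric]
  proof (rule Bochner_Integration.integral_cong[OF refl])
    fix x
    have "(w x *\<^sub>R fst (G (x, 0))) \<bullet> x = ((h x / 2) *\<^sub>R fst (G (x, 0))) \<bullet> x" by (simp only: wG)
    then have "w x * (fst (G (x, 0)) \<bullet> x) = h x / 2 * (fst (G (x, 0)) \<bullet> x)" by simp
    then show "(w x + w x) * (bump r x * (fst (G (x, 0)) \<bullet> x)) = bump r x * (hG x * 1)" by (simp add: algebra_simps)
  qed
  finally show ?thesis by simp
qed

text \<open>By the definition of \<open>mom2\<close>, the term 4 r^2 \<open>mom1\<close> of |G|^2 is
  4 \<open>mom2\<close> of |G|^2 plus 4 \<open>mom1\<close> of |p|^2 |G|^2. This changes the
  coefficient 2s - n - 4 into 2s - n and removes the explicit r, so that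
  \<open>moment_identity\<close> applies.\<close>

lemma rellich_identity:
  assumes r: "r > 0"
  shows "r * (2 * s - real CARD('n)) * W.ball_int GG r + r\<^sup>2 * W.sph_int GG r - 2 * W.sph_int QG r = - (2 * r * T.ball_int hG r)"
proof -
  let ?c = "2 * s - real CARD('n)"
  let ?f = "\<lambda>p. ?c * GG p + 0 * GG p" and ?g = "\<lambda>p :: (real ^ 'n) \<times> real. 4 * ((p \<bullet> p) * GG p) + (- 8) * QG p" and ?k = "\<lambda>x. (- 2) * hG x + 0 * hG x"
  have main: "4 * r * W.ball_int ?f r + W.sph_int ?g r = 4 * r * T.ball_int ?k r"
  proof (rule moment_identity[OF W.homogeneous_weight_axioms T.homogeneous_weight_axioms _ _ _ _ r])
    fix r :: real assume r: "r > 0"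
    have "W.mom2 ?f r + W.mom1 ?g r = ?c * W.mom2 GG r + 4 * W.mom1 (\<lambda>p. (p \<bullet> p) * GG p) r - 8 * W.mom1 QG r"
      by (simp only: W.mom2_lincomb W.mom1_lincomb cont W.cont_sq; simp)
    also have "4 * W.mom1 (\<lambda>p. (p \<bullet> p) * GG p) r = 4 * r\<^sup>2 * W.mom1 GG r - 4 * W.mom2 GG r"
      by (simp add: W.mom2_def)
    finally have "W.mom2 ?f r + W.mom1 ?g r = - 2 * T.mom2 hG r"
      using dilation_moments[OF r] by (simp add: algebra_simps)
    also have "\<dots> = T.mom2 ?k r" by (simp only: T.mom2_lincomb cont; simp)
    finally show "W.mom2 ?f r + W.mom1 ?g r = T.mom2 ?k r" .
  qed (intro continuous_intros cont)+
  have e1: "W.sph_int (\<lambda>p. (p \<bullet> p) * GG p) r = r\<^sup>2 * W.sph_int GG r"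
    using W.sph_int_norm_power[OF cont(1) r, of 2] by (simp add: power2_norm_eq_inner)
  have e2: "W.ball_int ?f r = ?c * W.ball_int GG r" by (simp only: W.ball_int_lincomb cont; simp)
  have e3: "W.sph_int ?g r = 4 * W.sph_int (\<lambda>p. (p \<bullet> p) * GG p) r - 8 * W.sph_int QG r"
    by (simp only: W.sph_int_lincomb[OF _ _ r] cont W.cont_sq)
  have e4: "T.ball_int ?k r = - 2 * T.ball_int hG r" by (simp only: T.ball_int_lincomb cont; simp)
  have gen: "r * c * E + r\<^sup>2 * D - 2 * Q = - (2 * r * S)" if "4 * r * (c * E) + (4 * (r\<^sup>2 * D) - 8 * Q) = 4 * r * (- 2 * S)"
    for c E D Q S :: real
    using that by (simp add: algebra_simps)
  show ?thesis using main unfolding e2 e3 e1 e4 by (rule gen)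
qed

end

section \<open>The derivative of the Weiss functional and its error term\<close>

text \<open>The three summands follow the terms of \<open>weiss_error\<close>: the sphere integral
  of h V gives the surface area, the two ball integrals divided by r give the volume of the unit
  ball with coefficients |n - 2s| and 2. K^2 stems from products of two bounds.\<close>

definition weiss_err_const :: "'n::finite itself \<Rightarrow> real \<Rightarrow> real \<Rightarrow> real" where
  "weiss_err_const _ s K =
    K\<^sup>2 * (sphere_area TYPE(real ^ 'n) + (\<bar>real CARD('n) - 2 * s\<bar> + 2) * unit_ball_vol (real CARD('n)))"

lemma weiss_err_const_nonneg: "weiss_err_const TYPE('n::finite) s K \<ge> 0"
  using sphere_area_nonneg[where 'a="real ^ 'n"] unit_ball_vol_nonneg[of "real CARD('n)"]
  by (simp add: weiss_err_const_def)

context weiss_setting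
begin

definition weiss_fun :: "real \<Rightarrow> real" where
  "weiss_fun r = 1 / r ^ (CARD('n) + 2) * (W.ball_int GG r + T.ball_int hV r)
     - (1 + s) / r ^ (CARD('n) + 3) * W.sph_int (\<lambda>p. (V p)\<^sup>2) r"

definition deficit :: "real \<Rightarrow> real" where
  "deficit r = W.sph_int (\<lambda>p. ((1 + s) * V p / r - G p \<bullet> (p /\<^sub>R r))\<^sup>2) r"

text \<open>What remains of r^(n+2) times the derivative once twice \<open>deficit\<close> is split
  off; all its terms live on y = 0.\<close>

definition weiss_error :: "real \<Rightarrow> real" where
  "weiss_error r = T.sph_int hV r - (real CARD('n) - 2 * s) * T.ball_int hV r / r - 2 * T.ball_int hG r / r"

lemma K_nonneg: "K \<ge> 0"
proof -
  obtain x :: "real ^ 'n" where "norm x = 1" using vector_choose_size[of 1] by auto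
  then show ?thesis using h_bound[of x] by simp
qed

lemma deficit_eq:
  assumes r: "r > 0"
  shows "deficit r = (1 + s)\<^sup>2 / r\<^sup>2 * W.sph_int (\<lambda>p. (V p)\<^sup>2) r - 2 * (1 + s) / r\<^sup>2 * W.sph_int VG r + 1 / r\<^sup>2 * W.sph_int QG r"
proof -
  have cV: "continuous_on UNIV (\<lambda>p. (V p)\<^sup>2)" by (intro continuous_intros V_cont)
  have c1: "continuous_on UNIV (\<lambda>p. (1 + s)\<^sup>2 / r\<^sup>2 * (V p)\<^sup>2 + (- 2 * (1 + s) / r\<^sup>2) * VG p)"
    by (intro continuous_intros V_cont cont)
  have "(\<lambda>p. ((1 + s) * V p / r - G p \<bullet> (p /\<^sub>R r))\<^sup>2) =
     (\<lambda>p. 1 * ((1 + s)\<^sup>2 / r\<^sup>2 * (V p)\<^sup>2 + (- 2 * (1 + s) / r\<^sup>2) * VG p) + 1 / r\<^sup>2 * QG p)"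
    using r by (auto simp: fun_eq_iff field_simps power2_eq_square)
  then have "deficit r = 1 * W.sph_int (\<lambda>p. (1 + s)\<^sup>2 / r\<^sup>2 * (V p)\<^sup>2 + (- 2 * (1 + s) / r\<^sup>2) * VG p) r + 1 / r\<^sup>2 * W.sph_int QG r"
    unfolding deficit_def by (simp only: W.sph_int_lincomb[OF c1 cont(3) r])
  moreover have "1 * (a * F + (- 2 * (1 + s) / r\<^sup>2) * J) + q = a * F - 2 * (1 + s) / r\<^sup>2 * J + q" for a F J q :: real
    using r by (simp add: field_simps)
  ultimately show ?thesis by (simp only: W.sph_int_lincomb[OF cV cont(2) r])
qed

text \<open>The algebra behind the completed square, with P = r^(n+2). E and D stand for the ball
  and sphere integrals of |G|^2; F, J, Q for the sphere integrals of V^2, V (G . p), (G . p)^2; T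
  and t for the thin ball and sphere integrals of h V, and S for the remaining thin ball integral.
  The energy and Rellich identities eliminate J and D.\<close>

lemma weiss_algebra:
  fixes r n P E T F J Q D t S :: real
  assumes r: "r > 0" and P: "P > 0"
    and 1: "r * E - J = - (r * T)" and 2: "r * (2 * s - n) * E + r\<^sup>2 * D - 2 * Q = - (2 * r * S)"
  shows "(D + t) / P - (n + 2) * (E + T) / (P * r)
      - (1 + s) * (((n + 1 - 2 * s) / r * F + 2 * J / r) / (P * r) - (n + 3) * F / (P * r\<^sup>2))
    = 2 / P * ((1 + s)\<^sup>2 / r\<^sup>2 * F - 2 * (1 + s) / r\<^sup>2 * J + 1 / r\<^sup>2 * Q)
      + (t - (n - 2 * s) * T / r - 2 * S / r) / P"
proof -
  have J: "J = r * (E + T)" using 1 by (simp add: algebra_simps)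
  have D: "D = ((n - 2 * s) * r * E + 2 * Q - 2 * r * S) / r\<^sup>2" using 2 r by (simp add: field_simps)
  show ?thesis unfolding J D using r P by (simp add: field_simps power2_eq_square)
qed

lemma weiss_fun_deriv:
  assumes r: "r > 0"
  shows "(weiss_fun has_real_derivative (2 / r ^ (CARD('n) + 2) * deficit r + weiss_error r / r ^ (CARD('n) + 2))) (at r)"
proof -
  let ?n = "real CARD('n)"
  define P where "P = r ^ (CARD('n) + 2)"
  have P: "P > 0" using r by (simp add: P_def)
  have pow: "((\<lambda>r. 1 / r ^ m) has_real_derivative - (real m / (r ^ m * r))) (at r)" if "m > 0" for m
  proof -
    have "((\<lambda>r. inverse (r ^ m)) has_real_derivative - (inverse (r ^ m) * (real m * r ^ (m - 1)) * inverse (r ^ m))) (at r)"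
      by (rule DERIV_inverse'[OF DERIV_cong[OF DERIV_pow]]) (use r in auto)
    moreover have "inverse (r ^ m) * (real m * r ^ (m - 1)) * inverse (r ^ m) = real m / (r ^ m * r)"
      using r power_minus_mult[OF that, of r] by (simp add: field_simps)
    ultimately show ?thesis by (simp add: inverse_eq_divide)
  qed
  \<comment> \<open>The exponent N - 1 + a equals n + 1 - 2s, since the sphere lies in dimension N =
    n + 1.\<close>
  have F: "(W.sph_int (\<lambda>p. (V p)\<^sup>2) has_real_derivative ((?n + 1 - 2 * s) / r * W.sph_int (\<lambda>p. (V p)\<^sup>2) r + 2 * W.sph_int VG r / r)) (at r)"
  proof -
    have d: "((\<lambda>p. (V p)\<^sup>2) has_derivative (\<lambda>h. ((2 * V p) *\<^sub>R G p) \<bullet> h)) (at p)" for p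
      unfolding power2_eq_square
      by (rule has_derivative_eq_rhs[OF has_derivative_mult[OF V_deriv V_deriv]]) (auto simp: fun_eq_iff)
    have c: "continuous_on UNIV (\<lambda>p. (2 * V p) *\<^sub>R G p)" by (intro continuous_intros V_cont G_cont)
    have "W.sph_int (\<lambda>p. ((2 * V p) *\<^sub>R G p) \<bullet> p) r = W.sph_int (\<lambda>p. 2 * VG p + 0 * VG p) r"
      by (simp add: mult.assoc)
    also have "\<dots> = 2 * W.sph_int VG r" by (simp only: W.sph_int_lincomb[OF cont(2) cont(2) r]; simp)
    finally have e: "W.sph_int (\<lambda>p. ((2 * V p) *\<^sub>R G p) \<bullet> p) r = 2 * W.sph_int VG r" .
    show ?thesis
      using W.sph_int_deriv[OF d c r] unfolding e by (rule DERIV_cong) simp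
  qed
  have I: "((\<lambda>r. W.ball_int GG r + T.ball_int hV r) has_real_derivative (W.sph_int GG r + T.sph_int hV r)) (at r)"
    by (intro DERIV_add W.ball_int_deriv T.ball_int_deriv cont r)
  have d1: "((\<lambda>r. 1 / r ^ (CARD('n) + 2) * (W.ball_int GG r + T.ball_int hV r)) has_real_derivative
      - (real (CARD('n) + 2) / (P * r)) * (W.ball_int GG r + T.ball_int hV r) + (W.sph_int GG r + T.sph_int hV r) * (1 / P)) (at r)"
    unfolding P_def by (rule DERIV_mult[OF pow I]) simp
  have d2: "((\<lambda>r. 1 / r ^ (CARD('n) + 3) * W.sph_int (\<lambda>p. (V p)\<^sup>2) r) has_real_derivative
      - (real (CARD('n) + 3) / (P * r * r)) * W.sph_int (\<lambda>p. (V p)\<^sup>2) r + ((?n + 1 - 2 * s) / r * W.sph_int (\<lambda>p. (V p)\<^sup>2) r + 2 * W.sph_int VG r / r) * (1 / (P * r))) (at r)"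
    using DERIV_mult[OF pow[of "CARD('n) + 3"] F] by (simp add: P_def eval_nat_numeral mult_ac)
  have eq: "weiss_fun = (\<lambda>r. 1 / r ^ (CARD('n) + 2) * (W.ball_int GG r + T.ball_int hV r) - (1 + s) * (1 / r ^ (CARD('n) + 3) * W.sph_int (\<lambda>p. (V p)\<^sup>2) r))"
    by (simp add: fun_eq_iff weiss_fun_def)
  have gen: "(- (real (CARD('n) + 2) / (P * r)) * I + I' * (1 / P)) - (1 + s) * (- (real (CARD('n) + 3) / (P * r * r)) * F + F' * (1 / (P * r)))
     = I' / P - (?n + 2) * I / (P * r) - (1 + s) * (F' / (P * r) - (?n + 3) * F / (P * r\<^sup>2))" for I I' F F' :: real
    by (simp add: power2_eq_square algebra_simps)
  have "(weiss_fun has_real_derivative (W.sph_int GG r + T.sph_int hV r) / P - (?n + 2) * (W.ball_int GG r + T.ball_int hV r) / (P * r)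
      - (1 + s) * (((?n + 1 - 2 * s) / r * W.sph_int (\<lambda>p. (V p)\<^sup>2) r + 2 * W.sph_int VG r / r) / (P * r)
          - (?n + 3) * W.sph_int (\<lambda>p. (V p)\<^sup>2) r / (P * r\<^sup>2))) (at r)"
    unfolding eq gen[symmetric] by (rule DERIV_diff[OF d1 DERIV_cmult[OF d2]])
  then show ?thesis
    unfolding weiss_algebra[OF r P energy_identity[OF r] rellich_identity[OF r]] deficit_eq[OF r, symmetric]
      weiss_error_def[symmetric] unfolding P_def .
qed

lemma hV_bound: "norm x \<le> r \<Longrightarrow> \<bar>hV x\<bar> \<le> K\<^sup>2 * r powr (1 + 2 * s)"
  and hG_bound: "norm x \<le> r \<Longrightarrow> \<bar>hG x\<bar> \<le> K\<^sup>2 * r powr (1 + 2 * s)"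
proof -
  assume x: "norm x \<le> r"
  have K: "K \<ge> 0" by (rule K_nonneg)
  have e: "norm x powr s * norm x powr (1 + s) \<le> r powr (1 + 2 * s)"
  proof -
    have "norm x powr s * norm x powr (1 + s) = norm x powr (1 + 2 * s)" by (simp add: algebra_simps flip: powr_add)
    also have "\<dots> \<le> r powr (1 + 2 * s)" using x s by (intro powr_mono2) auto
    finally show ?thesis .
  qed
  have "\<bar>hV x\<bar> \<le> (K * norm x powr s) * (K * norm x powr (1 + s))"
    unfolding abs_mult using h_bound[of x] V_bound[of x] K by (intro mult_mono) auto
  also have "\<dots> = K\<^sup>2 * (norm x powr s * norm x powr (1 + s))" by (simp add: power2_eq_square mult_ac)
  finally show "\<bar>hV x\<bar> \<le> K\<^sup>2 * r powr (1 + 2 * s)" using e by (meson mult_left_mono order_trans zero_le_power2)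
  have "\<bar>fst (G (x, 0)) \<bullet> x\<bar> \<le> K * norm x powr s * norm x"
    using Cauchy_Schwarz_ineq2[of "fst (G (x, 0))" x] mult_right_mono[OF G_bound[of x] norm_ge_zero[of x]] by linarith
  then have "\<bar>hG x\<bar> \<le> (K * norm x powr s) * (K * norm x powr s * norm x)"
    unfolding abs_mult using h_bound[of x] K by (intro mult_mono) auto
  also have "\<dots> = K\<^sup>2 * (norm x powr s * norm x powr (1 + s))"
    using powr_mult_base[of "norm x" s] by (simp add: power2_eq_square mult_ac)
  finally show "\<bar>hG x\<bar> \<le> K\<^sup>2 * r powr (1 + 2 * s)" using e by (meson mult_left_mono order_trans zero_le_power2)
qed

text \<open>Power count: integrands of size r^(1 + 2s), a factor r^(n-1) from the sphere or from the
  volume divided by r, and the division by r^(n+2) leave r^(2s-2).\<close>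

lemma weiss_error_bound:
  assumes r: "r > 0"
  shows "\<bar>weiss_error r / r ^ (CARD('n) + 2)\<bar> \<le> weiss_err_const TYPE('n) s K * r powr (2 * s - 2)"
proof -
  let ?A = "sphere_area TYPE(real ^ 'n)" and ?o = "unit_ball_vol (real CARD('n))" and ?n = "real CARD('n)"
  let ?X = "K\<^sup>2 * r powr (1 + 2 * s)"
  have X: "?X \<ge> 0" by simp
  have rn: "r ^ CARD('n) = r powr ?n" using r by (simp add: powr_realpow)
  have pw: "r powr (1 + 2 * s) * r powr (?n - 1) = r powr (2 * s - 2) * r ^ (CARD('n) + 2)"
  proof -
    have "r ^ (CARD('n) + 2) = r powr (?n + 2)" by (simp only: powr_realpow[OF r, symmetric] of_nat_add of_nat_numeral)
    then show ?thesis by (simp add: powr_add[symmetric] algebra_simps)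
  qed
  have vol: "(\<integral>x. indicator (ball 0 r) x * \<bar>1\<bar> \<partial>(lborel :: (real ^ 'n) measure)) = ?o * r powr ?n"
    using content_ball[of r "0 :: real ^ 'n"] r by (simp add: rn)
  have "\<bar>T.sph_int hV r\<bar> \<le> ?X * r powr (?n - 1 + 0) * (\<integral>x. \<bar>1\<bar> \<partial>(unit_sphere_measure :: (real ^ 'n) measure))"
    using T.sph_int_bound[OF cont(4) r, of ?X] hV_bound[of _ r] by simp
  then have t: "\<bar>T.sph_int hV r\<bar> \<le> ?X * r powr (?n - 1) * ?A"
    by (simp add: sphere_area_def)
  have B: "\<bar>T.ball_int k r\<bar> / r \<le> ?X * r powr (?n - 1) * ?o"
    if "continuous_on UNIV k" "\<And>x. norm x \<le> r \<Longrightarrow> \<bar>k x\<bar> \<le> ?X" for k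
  proof -
    have "\<bar>T.ball_int k r\<bar> \<le> ?X * (?o * r powr ?n)"
      using T.ball_int_bound[OF that(1), of r ?X] that(2) unfolding vol by simp
    also have "r powr ?n = r * r powr (?n - 1)" using r powr_mult_base[of r "?n - 1"] by simp
    finally show ?thesis using r by (simp add: field_simps)
  qed
  have "\<bar>weiss_error r\<bar> \<le> \<bar>T.sph_int hV r\<bar> + \<bar>?n - 2 * s\<bar> * (\<bar>T.ball_int hV r\<bar> / r) + 2 * (\<bar>T.ball_int hG r\<bar> / r)"
  proof -
    have "\<bar>a - b - c\<bar> \<le> \<bar>a\<bar> + \<bar>b\<bar> + \<bar>c\<bar>" for a b c :: real by linarith
    from this[of "T.sph_int hV r" "(?n - 2 * s) * T.ball_int hV r / r" "2 * T.ball_int hG r / r"]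
    show ?thesis using r by (simp add: weiss_error_def abs_mult)
  qed
  also have "\<dots> \<le> ?X * r powr (?n - 1) * ?A + \<bar>?n - 2 * s\<bar> * (?X * r powr (?n - 1) * ?o) + 2 * (?X * r powr (?n - 1) * ?o)"
    by (intro add_mono mult_left_mono t B cont hV_bound hG_bound) auto
  also have "\<dots> = (r powr (1 + 2 * s) * r powr (?n - 1)) * weiss_err_const TYPE('n) s K"
    by (simp add: weiss_err_const_def algebra_simps)
  finally have "\<bar>weiss_error r\<bar> \<le> (r powr (2 * s - 2) * r ^ (CARD('n) + 2)) * weiss_err_const TYPE('n) s K" unfolding pw .
  then show ?thesis using r by (simp add: abs_divide divide_le_eq mult_ac)
qed

text \<open>The added term has derivative C (2s - 1) r^(2s-2), which absorbs the error whatever its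
  sign.\<close>

lemma weiss_monotonicity:
  assumes r: "r > 0" and C: "C * (2 * s - 1) \<ge> weiss_err_const TYPE('n) s K"
  obtains D where "((\<lambda>\<rho>. weiss_fun \<rho> + C * \<rho> powr (2 * s - 1)) has_real_derivative D) (at r)"
    "D \<ge> 2 / r ^ (CARD('n) + 2) * deficit r" 
proof
  show "((\<lambda>\<rho>. weiss_fun \<rho> + C * \<rho> powr (2 * s - 1)) has_real_derivative
    (2 / r ^ (CARD('n) + 2) * deficit r + weiss_error r / r ^ (CARD('n) + 2)) + C * ((2 * s - 1) * r powr (2 * s - 1 - 1))) (at r)"
    by (intro DERIV_add weiss_fun_deriv DERIV_cmult has_real_derivative_powr r)
  have "weiss_err_const TYPE('n) s K * r powr (2 * s - 2) \<le> C * (2 * s - 1) * r powr (2 * s - 2)"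
    by (rule mult_right_mono[OF C]) simp
  moreover have "2 * s - 1 - 1 = 2 * s - 2" by simp
  ultimately show "2 / r ^ (CARD('n) + 2) * deficit r \<le>
    (2 / r ^ (CARD('n) + 2) * deficit r + weiss_error r / r ^ (CARD('n) + 2)) + C * ((2 * s - 1) * r powr (2 * s - 1 - 1))"
    using weiss_error_bound[OF r] by (simp only: abs_le_iff mult.assoc) linarith
qed

end

section \<open>Hoelder continuity of the fractional Laplacian\<close>

definition pv_holder_const :: "'n::finite itself \<Rightarrow> real \<Rightarrow> real \<Rightarrow> real \<Rightarrow> real" where
  "pv_holder_const _ s L \<alpha> = L * sphere_area TYPE(real ^ 'n) / (1 + \<alpha> - 2 * s) + L / 2 * sphere_area TYPE(real ^ 'n) / (1 - s)"

text \<open>The condition \<open>mixed\<close> covers all of \<open>C\<^sup>3\<^sup>s\<close>: it holds with \<open>\<alpha> = 3s - 1\<close>, \<open>\<beta> = 0\<close> if \<open>3s \<le> 2\<close>, and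
  with \<open>\<alpha> = 1\<close>, \<open>\<beta> = 3s - 2\<close> if \<open>3s > 2\<close>.\<close>

locale holder_mixed = holder_C1 s M \<psi> g
  for s M :: real and \<psi> :: "real ^ 'n \<Rightarrow> real" and g +
  fixes L \<alpha> \<beta> :: real
  assumes L: "L \<ge> 0" and exponents: "\<alpha> \<le> 1" "\<beta> \<ge> 0" "\<alpha> + \<beta> = 3 * s - 1" "2 * s < 1 + \<alpha>"
    and mixed: "norm (g x - g (x + e) - g (x + z) + g (x + z + e)) \<le> L * norm z powr \<alpha> * norm e powr \<beta>"
begin

text \<open>The line argument for a single \<open>half_diff\<close> is applied to y -> \<psi>(y) -
  \<psi>(y + e), whose gradient differences are the mixed differences of g. The power 1 + \<alpha> >
  2s makes the bound integrable against |z|^(-n-2s) near 0.\<close>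

lemma half_diff_near: "\<bar>half_diff x z - half_diff (x + e) z\<bar> \<le> L * norm z powr (1 + \<alpha>) * norm e powr \<beta>"
proof -
  let ?\<Phi> = "\<lambda>y. \<psi> y - \<psi> (y + e)" and ?H = "\<lambda>y. g y - g (y + e)"
  have d: "(?\<Phi> has_derivative (\<lambda>h. ?H y \<bullet> h)) (at y)" for y
  proof -
    have "((\<lambda>y. \<psi> (y + e)) has_derivative (\<lambda>h. g (y + e) \<bullet> h)) (at y)"
      by (rule has_derivative_compose[of "\<lambda>y. y + e" "\<lambda>h. h" y UNIV \<psi>, OF _ deriv]) (auto intro!: derivative_eq_intros)
    from has_derivative_diff[OF deriv[of y] this] show ?thesis by (simp add: inner_diff_left)
  qed
  let ?f = "\<lambda>t::real. ?\<Phi> (x + t *\<^sub>R z) + ?\<Phi> (x + t *\<^sub>R (- z))"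
  let ?f' = "\<lambda>t::real. ?H (x + t *\<^sub>R z) \<bullet> z + ?H (x + t *\<^sub>R (- z)) \<bullet> (- z)"
  have "\<bar>?f 1 - ?f 0\<bar> \<le> (2 * (L * norm z powr (1 + \<alpha>) * norm e powr \<beta>)) * \<bar>1 - 0\<bar>"
  proof (rule real_derivative_bound[of "{0..1}" ?f ?f'])
    fix t :: real assume t: "t \<in> {0..1}"
    show "(?f has_real_derivative ?f' t) (at t)"
      by (intro DERIV_add has_derivative_imp_DERIV_line d)
    have a0: "\<alpha> \<ge> 0" using exponents s by linarith
    have "norm ((2 * t) *\<^sub>R z) powr \<alpha> \<le> (2 * norm z) powr \<alpha>"
      using t a0 by (intro powr_mono2) (auto simp: mult_right_mono)
    also have "\<dots> = 2 powr \<alpha> * norm z powr \<alpha>" by (simp add: powr_mult)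
    also have "\<dots> \<le> 2 * norm z powr \<alpha>" using powr_mono[of \<alpha> 1 2] exponents by (intro mult_right_mono) auto
    finally have n: "norm ((2 * t) *\<^sub>R z) powr \<alpha> \<le> 2 * norm z powr \<alpha>" .
    have e: "x + t *\<^sub>R (- z) + (2 * t) *\<^sub>R z = x + t *\<^sub>R z"
      by (simp only: mult_2 scaleR_left_distrib) simp
    have "norm (?H (x + t *\<^sub>R (- z)) - ?H (x + t *\<^sub>R z)) \<le> L * norm ((2 * t) *\<^sub>R z) powr \<alpha> * norm e powr \<beta>"
      using mixed[of "x + t *\<^sub>R (- z)" e "(2 * t) *\<^sub>R z"] unfolding e by (simp add: algebra_simps)
    also have "\<dots> \<le> L * (2 * norm z powr \<alpha>) * norm e powr \<beta>"
      using n L by (intro mult_right_mono mult_left_mono) auto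
    finally have "norm (?H (x + t *\<^sub>R z) - ?H (x + t *\<^sub>R (- z))) * norm z \<le> (L * (2 * norm z powr \<alpha>) * norm e powr \<beta>) * norm z"
      unfolding norm_minus_commute[of "?H (x + t *\<^sub>R z)"] by (rule mult_right_mono) simp
    also have "\<dots> = 2 * (L * norm z powr (1 + \<alpha>) * norm e powr \<beta>)"
      using powr_mult_base[of "norm z" \<alpha>] by (simp add: mult_ac)
    finally have b: "norm (?H (x + t *\<^sub>R z) - ?H (x + t *\<^sub>R (- z))) * norm z \<le> 2 * (L * norm z powr (1 + \<alpha>) * norm e powr \<beta>)" .
    have "?f' t = (?H (x + t *\<^sub>R z) - ?H (x + t *\<^sub>R (- z))) \<bullet> z" by (simp only: inner_diff_left inner_minus_right)
    then show "\<bar>?f' t\<bar> \<le> 2 * (L * norm z powr (1 + \<alpha>) * norm e powr \<beta>)"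
      using Cauchy_Schwarz_ineq2[of "?H (x + t *\<^sub>R z) - ?H (x + t *\<^sub>R (- z))" z] b by (simp only:)
  qed auto
  moreover have "half_diff x z - half_diff (x + e) z = - (?f 1 - ?f 0) / 2"
    by (simp add: half_diff_def field_simps)
  ultimately show ?thesis by simp
qed

text \<open>For large z the mean value inequality is used in x instead: the x-gradient of
  \<open>half_diff\<close> is, up to sign, half the second difference of g with step z, which is
  \<open>mixed\<close> with both increments equal to z. The power 3s - 1 < 2s makes the tail
  converge.\<close>

lemma half_diff_far: "\<bar>half_diff x z - half_diff (x + e) z\<bar> \<le> L / 2 * norm z powr (3 * s - 1) * norm e"
proof -
  let ?H = "\<lambda>y. g y - (1/2) *\<^sub>R (g (y + z) + g (y - z))"
  have d: "((\<lambda>y. half_diff y z) has_derivative (\<lambda>h. ?H y \<bullet> h)) (at y)" for y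
  proof -
    have s: "((\<lambda>y. \<psi> (y + v)) has_derivative (\<lambda>h. g (y + v) \<bullet> h)) (at y)" for v
      by (rule has_derivative_compose[of "\<lambda>y. y + v" "\<lambda>h. h" y UNIV \<psi>, OF _ deriv]) (auto intro!: derivative_eq_intros)
    have "((\<lambda>y. \<psi> y - (1/2) * (\<psi> (y + z) + \<psi> (y + (- z)))) has_derivative (\<lambda>h. g y \<bullet> h - (1/2) * (g (y + z) \<bullet> h + g (y + (- z)) \<bullet> h))) (at y)"
      by (intro has_derivative_diff has_derivative_mult_right has_derivative_add deriv s)
    then show ?thesis by (simp add: half_diff_def inner_diff_left inner_add_left)
  qed
  have b: "norm (?H y) \<le> L / 2 * norm z powr (3 * s - 1)" for y
  proof -
    have "norm (g (y - z) - g (y - z + z) - g (y - z + z) + g (y - z + z + z)) \<le> L * norm z powr \<alpha> * norm z powr \<beta>"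
      by (rule mixed)
    moreover have "g (y - z) - g (y - z + z) - g (y - z + z) + g (y - z + z + z) = (- 2) *\<^sub>R ?H y"
      by (simp add: scaleR_2 algebra_simps)
    moreover have "norm z powr \<alpha> * norm z powr \<beta> = norm z powr (3 * s - 1)"
      using exponents(3) by (simp flip: powr_add)
    ultimately show ?thesis by (simp add: mult.assoc)
  qed
  have "\<bar>half_diff x z - half_diff (x + e) z\<bar> \<le> (L / 2 * norm z powr (3 * s - 1)) * norm (x - (x + e))"
    by (rule gradient_bound[of UNIV "\<lambda>y. half_diff y z" ?H]) (use d b in auto)
  then show ?thesis by simp
qed

text \<open>The integral is split at |z| = |e|. The inner part gives |e|^\<beta> |e|^(1 + \<alpha> -
  2s), the outer one |e| |e|^(s - 1); since \<alpha> + \<beta> = 3s - 1 both are |e|^s. The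
  denominators of \<open>pv_holder_const\<close> come from the two radial integrals.\<close>

lemma pv_holder: "\<bar>pv x - pv x'\<bar> \<le> pv_holder_const TYPE('n) s L \<alpha> * norm (x' - x) powr s"
proof (cases "x' = x")
  case False
  define e where "e = x' - x"
  define R where "R = norm e"
  have R: "R > 0" using False by (simp add: R_def e_def)
  have x': "x' = x + e" by (simp add: e_def)
  let ?\<sigma> = "- (real CARD('n) + 2 * s)"
  let ?f = "\<lambda>z. norm z powr ?\<sigma> * half_diff x z - norm z powr ?\<sigma> * half_diff (x + e) z"
  have f: "\<bar>?f z\<bar> = norm z powr ?\<sigma> * \<bar>half_diff x z - half_diff (x + e) z\<bar>" for z
    unfolding right_diff_distrib[symmetric] abs_mult by simp
  have "\<bar>pv x - pv x'\<bar> = \<bar>\<integral>z. ?f z \<partial>lborel\<bar>"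
    unfolding pv_def x' by (simp only: Bochner_Integration.integral_diff[OF pv_integrable pv_integrable])
  also have "\<dots> \<le> (\<integral>z. \<bar>?f z\<bar> \<partial>lborel)" by (rule integral_abs_bound)
  also have "\<dots> \<le> L * R powr \<beta> * (sphere_area TYPE(real ^ 'n) * R powr (real DIM(real ^ 'n) + (1 + \<alpha> + ?\<sigma>)) / (real DIM(real ^ 'n) + (1 + \<alpha> + ?\<sigma>)))
     + L / 2 * R * (sphere_area TYPE(real ^ 'n) * R powr (real DIM(real ^ 'n) + (3 * s - 1 + ?\<sigma>)) / - (real DIM(real ^ 'n) + (3 * s - 1 + ?\<sigma>)))"
  proof (rule integral_two_powers_bound[OF _ R])
    show "?f \<in> borel_measurable borel" by measurable
    show "\<bar>?f z\<bar> \<le> L * R powr \<beta> * norm z powr (1 + \<alpha> + ?\<sigma>)" for z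
      unfolding f powr_add[of "norm z" "1 + \<alpha>"] R_def
      using mult_left_mono[OF half_diff_near[of x z e], of "norm z powr ?\<sigma>"] by (simp only: mult_ac powr_ge_zero simp_thms)
    show "\<bar>?f z\<bar> \<le> L / 2 * R * norm z powr (3 * s - 1 + ?\<sigma>)" for z
      unfolding f powr_add[of "norm z" "3 * s - 1"] R_def
      using mult_left_mono[OF half_diff_far[of x z e], of "norm z powr ?\<sigma>"] by (simp only: mult_ac powr_ge_zero simp_thms)
  qed (use exponents s in auto)
  also have "\<dots> = pv_holder_const TYPE('n) s L \<alpha> * R powr s"
  proof -
    have 1: "R powr \<beta> * R powr (1 + \<alpha> - 2 * s) = R powr s"
      using exponents(3) by (simp add: algebra_simps flip: powr_add)
    have 2: "R * R powr (s - 1) = R powr s" using powr_mult_base[of R "s - 1"] R by simp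
    have 3: "real DIM(real ^ 'n) + (1 + \<alpha> + ?\<sigma>) = 1 + \<alpha> - 2 * s" "real DIM(real ^ 'n) + (3 * s - 1 + ?\<sigma>) = s - 1" by simp_all
    have alg: "L * R powr \<beta> * (A * R powr (1 + \<alpha> - 2 * s) / (1 + \<alpha> - 2 * s)) + L / 2 * R * (A * R powr (s - 1) / - (s - 1))
      = L * A / (1 + \<alpha> - 2 * s) * (R powr \<beta> * R powr (1 + \<alpha> - 2 * s)) + L / 2 * A / (1 - s) * (R * R powr (s - 1))" for A
      by (simp add: mult_ac)
    show ?thesis unfolding 3 alg 1 2 by (simp add: pv_holder_const_def algebra_simps)
  qed
  finally show ?thesis by (simp add: R_def e_def)
qed simp

end

section \<open>The function spaces\<close>

definition grad_of :: "('a::euclidean_space \<Rightarrow> real) \<Rightarrow> 'a \<Rightarrow> 'a" where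
  "grad_of f x = (\<Sum>b\<in>Basis. partial_deriv b f x *\<^sub>R b)"

lemma grad_of_deriv:
  fixes f :: "'a::euclidean_space \<Rightarrow> real"
  assumes "f differentiable_on UNIV"
  shows "(f has_derivative (\<lambda>h. grad_of f x \<bullet> h)) (at x)"
proof -
  have d: "(f has_derivative frechet_derivative f (at x)) (at x)"
    using assms by (simp add: differentiable_on_def frechet_derivative_works)
  then have l: "linear (frechet_derivative f (at x))" by (rule has_derivative_linear)
  have "frechet_derivative f (at x) h = grad_of f x \<bullet> h" for h
  proof -
    have "frechet_derivative f (at x) h = frechet_derivative f (at x) (\<Sum>b\<in>Basis. (h \<bullet> b) *\<^sub>R b)"
      by (simp add: euclidean_representation)
    also have "\<dots> = (\<Sum>b\<in>Basis. (h \<bullet> b) * frechet_derivative f (at x) b)"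
      using l by (simp add: linear_sum linear_cmul)
    finally show ?thesis
      by (simp add: grad_of_def partial_deriv_def inner_sum_left inner_commute[of h] mult.commute)
  qed
  then have "frechet_derivative f (at x) = (\<lambda>h. grad_of f x \<bullet> h)" by (rule ext)
  with d show ?thesis by simp
qed

lemma norm_sum_Basis_le: "norm (\<Sum>b\<in>Basis. c b *\<^sub>R b :: 'a::euclidean_space) \<le> (\<Sum>b\<in>Basis. \<bar>c b\<bar>)"
  by (rule order_trans[OF norm_sum]) simp

lemma grad_of_diff_le:
  fixes f :: "'a::euclidean_space \<Rightarrow> real"
  shows "norm (grad_of f x - grad_of f z) \<le> (\<Sum>b\<in>Basis. \<bar>partial_deriv b f x - partial_deriv b f z\<bar>)"
  using norm_sum_Basis_le[of "\<lambda>b. partial_deriv b f x - partial_deriv b f z"]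
  by (simp add: grad_of_def scaleR_diff_left sum_subtractf)

lemma Ck_space_mono: "f \<in> Ck_space k \<Longrightarrow> j \<le> k \<Longrightarrow> f \<in> Ck_space j"
  unfolding Ck_space_def mem_Collect_eq by (meson less_le_trans order_trans)

lemma Ck_space_1:
  fixes f :: "'a::euclidean_space \<Rightarrow> real"
  assumes f: "f \<in> Ck_space 1"
  obtains M where "\<And>x. (f has_derivative (\<lambda>h. grad_of f x \<bullet> h)) (at x)" "\<And>x. \<bar>f x\<bar> \<le> M" "\<And>x. norm (grad_of f x) \<le> M"
proof -
  have d: "f differentiable_on UNIV" using f by (auto simp: Ck_space_def)
  have "bounded (range f)" using f by (auto simp: Ck_space_def)
  then obtain M0 where M0: "\<And>x. \<bar>f x\<bar> \<le> M0" by (auto simp: bounded_iff)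
  have "\<exists>M. \<forall>x. \<bar>partial_deriv b f x\<bar> \<le> M" if "b \<in> Basis" for b
  proof -
    have m: "partial_deriv b f \<in> partial_derivs 1 f" using that by auto
    have "\<forall>g\<in>partial_derivs 1 f. bounded (range g)" using f unfolding Ck_space_def by blast
    from this[rule_format, OF m] show ?thesis by (auto simp: bounded_iff)
  qed
  then obtain M where M: "\<And>b x. b \<in> Basis \<Longrightarrow> \<bar>partial_deriv b f x\<bar> \<le> M b" by metis
  have g: "norm (grad_of f x) \<le> (\<Sum>b\<in>Basis. M b)" for x
    unfolding grad_of_def by (rule order_trans[OF norm_sum_Basis_le sum_mono]) (rule M)
  have n: "0 \<le> M0" "0 \<le> (\<Sum>b\<in>Basis. M b)"
    using order_trans[OF abs_ge_zero M0] order_trans[OF norm_ge_zero g] by auto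
  show ?thesis
  proof (rule that[of "M0 + (\<Sum>b\<in>Basis. M b)"])
    show "\<bar>f x\<bar> \<le> M0 + (\<Sum>b\<in>Basis. M b)" for x using M0[of x] n by linarith
    show "norm (grad_of f x) \<le> M0 + (\<Sum>b\<in>Basis. M b)" for x using g[of x] n by linarith
  qed (rule grad_of_deriv[OF d])
qed

lemma Ck_space_partial:
  assumes "f \<in> Ck_space (Suc k)" "b \<in> Basis"
  shows "partial_deriv b f \<in> Ck_space k"
proof -
  have sub: "partial_derivs j (partial_deriv b f) \<subseteq> partial_derivs (Suc j) f" for j using assms(2) by auto
  have "\<forall>j<k. \<forall>g\<in>partial_derivs j (partial_deriv b f). g differentiable_on UNIV"
  proof (intro allI impI)
    fix j assume "j < k"
    then have "Suc j < Suc k" by simp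
    then have "\<forall>g\<in>partial_derivs (Suc j) f. g differentiable_on UNIV"
      using assms(1) unfolding Ck_space_def by blast
    then show "\<forall>g\<in>partial_derivs j (partial_deriv b f). g differentiable_on UNIV"
      using sub[of j] by blast
  qed
  moreover have "\<forall>j\<le>k. \<forall>g\<in>partial_derivs j (partial_deriv b f). continuous_on UNIV g \<and> bounded (range g)"
  proof (intro allI impI)
    fix j assume "j \<le> k"
    then have "Suc j \<le> Suc k" by simp
    then have "\<forall>g\<in>partial_derivs (Suc j) f. continuous_on UNIV g \<and> bounded (range g)"
      using assms(1) unfolding Ck_space_def by blast
    then show "\<forall>g\<in>partial_derivs j (partial_deriv b f). continuous_on UNIV g \<and> bounded (range g)"
      using sub[of j] by blast
  qed
  ultimately show ?thesis by (simp add: Ck_space_def)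
qed

lemma Ck_space_2_lipschitz:
  fixes f :: "'a::euclidean_space \<Rightarrow> real"
  assumes f: "f \<in> Ck_space 2"
  obtains L where "L \<ge> 0" "\<And>x z. norm (grad_of f x - grad_of f z) \<le> L * norm (x - z)"
proof -
  have f': "f \<in> Ck_space (Suc 1)" using f by (simp add: numeral_2_eq_2)
  have "\<exists>M. \<forall>x z. \<bar>partial_deriv b f x - partial_deriv b f z\<bar> \<le> M * norm (x - z)" if b: "b \<in> Basis" for b
  proof -
    obtain M where M: "\<And>x. (partial_deriv b f has_derivative (\<lambda>h. grad_of (partial_deriv b f) x \<bullet> h)) (at x)"
      "\<And>x. norm (grad_of (partial_deriv b f) x) \<le> M"
      using Ck_space_1[OF Ck_space_partial[OF f' b]] by metis
    have "\<bar>partial_deriv b f x - partial_deriv b f z\<bar> \<le> M * norm (x - z)" for x z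
      by (rule gradient_bound[of UNIV "partial_deriv b f" "grad_of (partial_deriv b f)"]) (use M in auto)
    then show ?thesis by blast
  qed
  then obtain M where M: "\<And>b x z. b \<in> Basis \<Longrightarrow> \<bar>partial_deriv b f x - partial_deriv b f z\<bar> \<le> M b * norm (x - z)" by metis
  have "norm (grad_of f x - grad_of f z) \<le> \<bar>\<Sum>b\<in>Basis. M b\<bar> * norm (x - z)" for x z
  proof -
    have "(\<Sum>b\<in>Basis. \<bar>partial_deriv b f x - partial_deriv b f z\<bar>) \<le> (\<Sum>b\<in>Basis. M b) * norm (x - z)"
      unfolding sum_distrib_right by (rule sum_mono[OF M])
    also have "\<dots> \<le> \<bar>\<Sum>b\<in>Basis. M b\<bar> * norm (x - z)" by (intro mult_right_mono) auto
    finally show ?thesis using grad_of_diff_le[of f x z] by (rule order_trans[rotated])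
  qed
  then show ?thesis by (intro that[of "\<bar>\<Sum>b\<in>Basis. M b\<bar>"]) auto
qed

text \<open>At distances up to 1 a smaller exponent gives a larger power; beyond 1 the bound 2 M on
  the difference suffices because |x - z|^s >= 1.\<close>

lemma holder_lower_exponent:
  fixes g :: "'a::real_normed_vector \<Rightarrow> 'b::real_normed_vector"
  assumes M: "\<And>x. norm (g x) \<le> M" and L: "L \<ge> 0" "\<And>x z. norm (g x - g z) \<le> L * norm (x - z) powr \<alpha>"
    and s: "0 < s" "s \<le> \<alpha>"
  shows "norm (g x - g z) \<le> (2 * M + L) * norm (x - z) powr s"
proof (cases "norm (x - z) \<le> 1")
  case True
  have M0: "M \<ge> 0" using M[of x] norm_ge_zero order_trans by blast
  have "norm (x - z) powr \<alpha> \<le> norm (x - z) powr s"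
    using powr_mono'[of s \<alpha> "norm (x - z)"] s True by simp
  then have "L * norm (x - z) powr \<alpha> \<le> L * norm (x - z) powr s" using L by (intro mult_left_mono) auto
  also have "\<dots> \<le> (2 * M + L) * norm (x - z) powr s" using M0 by (intro mult_right_mono) auto
  finally show ?thesis using L(2)[of x z] by linarith
next
  case False
  have M0: "M \<ge> 0" using M[of x] norm_ge_zero order_trans by blast
  have "norm (g x - g z) \<le> 2 * M" using norm_triangle_ineq4[of "g x" "g z"] M[of x] M[of z] by linarith
  also have "\<dots> \<le> (2 * M + L) * 1" using L by simp
  also have "\<dots> \<le> (2 * M + L) * norm (x - z) powr s"
    using False s L M0 ge_one_powr_ge_zero[of "norm (x - z)" s] by (intro mult_left_mono) auto
  finally show ?thesis .
qed

lemma Ck_space_2_holder_C1: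
  fixes \<psi> :: "real ^ 'n \<Rightarrow> real"
  assumes s: "1 / 2 < s" "s < 1" and \<psi>: "\<psi> \<in> Ck_space 2"
  obtains M where "holder_C1 s M \<psi> (grad_of \<psi>)"
proof -
  have "\<psi> \<in> Ck_space 1" using \<psi> by (rule Ck_space_mono) simp
  then obtain M where M: "\<And>x. (\<psi> has_derivative (\<lambda>h. grad_of \<psi> x \<bullet> h)) (at x)" "\<And>x. \<bar>\<psi> x\<bar> \<le> M" "\<And>x. norm (grad_of \<psi> x) \<le> M"
    using Ck_space_1 by metis
  obtain L where L: "L \<ge> 0" "\<And>x z. norm (grad_of \<psi> x - grad_of \<psi> z) \<le> L * norm (x - z)"
    using Ck_space_2_lipschitz[OF \<psi>] by metis
  have M0: "M \<ge> 0" using order_trans[OF abs_ge_zero M(2)] by auto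
  have h: "norm (grad_of \<psi> x - grad_of \<psi> z) \<le> (2 * M + L) * norm (x - z) powr s" for x z
    by (rule holder_lower_exponent[where \<alpha>=1]) (use M L s in auto)
  have "holder_C1 s (2 * M + L) \<psi> (grad_of \<psi>)"
  proof
    show "\<bar>\<psi> x\<bar> \<le> 2 * M + L" "norm (grad_of \<psi> x) \<le> 2 * M + L" for x
      using M(2)[of x] M(3)[of x] M0 L(1) by linarith+
  qed (use s M h in auto)
  then show ?thesis by (rule that)
qed

lemma floor_frac: "of_int k \<le> \<alpha> \<Longrightarrow> \<alpha> < of_int k + 1 \<Longrightarrow> \<lfloor>\<alpha>\<rfloor> = k \<and> frac \<alpha> = \<alpha> - of_int k" for \<alpha> :: real
  by (auto simp: frac_def floor_unique)

lemma holder_space_order_1: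
  fixes \<psi> :: "'a::euclidean_space \<Rightarrow> real"
  assumes \<alpha>: "0 < \<alpha>" "\<alpha> < 1" and \<psi>: "\<psi> \<in> holder_space (1 + \<alpha>)"
  obtains L where "L \<ge> 0" "\<psi> \<in> Ck_space 1" "\<And>x z. norm (grad_of \<psi> x - grad_of \<psi> z) \<le> L * norm (x - z) powr \<alpha>"
proof -
  have fl: "\<lfloor>1 + \<alpha>\<rfloor> = 1" "frac (1 + \<alpha>) = \<alpha>" using floor_frac[of 1 "1 + \<alpha>"] \<alpha> by auto
  have C1: "\<psi> \<in> Ck_space 1" using \<psi> unfolding holder_space_def fl by simp
  have H: "\<forall>g\<in>partial_derivs 1 \<psi>. \<exists>M. \<forall>x z. \<bar>g x - g z\<bar> \<le> M * norm (x - z) powr \<alpha>"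
    using \<psi> \<alpha> unfolding holder_space_def fl by simp
  have "\<exists>M. \<forall>x z. \<bar>partial_deriv b \<psi> x - partial_deriv b \<psi> z\<bar> \<le> M * norm (x - z) powr \<alpha>" if "b \<in> Basis" for b
  proof -
    have "partial_deriv b \<psi> \<in> partial_derivs 1 \<psi>" using that by auto
    from H[rule_format, OF this] show ?thesis by simp
  qed
  then obtain M where M: "\<And>b x z. b \<in> Basis \<Longrightarrow> \<bar>partial_deriv b \<psi> x - partial_deriv b \<psi> z\<bar> \<le> M b * norm (x - z) powr \<alpha>" by metis
  have "norm (grad_of \<psi> x - grad_of \<psi> z) \<le> \<bar>\<Sum>b\<in>Basis. M b\<bar> * norm (x - z) powr \<alpha>" for x z
  proof -
    have "(\<Sum>b\<in>Basis. \<bar>partial_deriv b \<psi> x - partial_deriv b \<psi> z\<bar>) \<le> (\<Sum>b\<in>Basis. M b) * norm (x - z) powr \<alpha>"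
      unfolding sum_distrib_right by (rule sum_mono[OF M])
    also have "\<dots> \<le> \<bar>\<Sum>b\<in>Basis. M b\<bar> * norm (x - z) powr \<alpha>" by (intro mult_right_mono) auto
    finally show ?thesis using grad_of_diff_le[of \<psi> x z] by (rule order_trans[rotated])
  qed
  with C1 show ?thesis by (intro that[of "\<bar>\<Sum>b\<in>Basis. M b\<bar>"]) auto
qed

text \<open>For each first partial derivative f, the function y -> f(y) - f(y + e) has a gradient of
  size |e|^\<delta> by the Hoelder condition on the second derivatives; the mean value inequality in
  direction z supplies the factor |z|.\<close>

lemma holder_space_order_2:
  fixes \<psi> :: "'a::euclidean_space \<Rightarrow> real"
  assumes \<delta>: "0 < \<delta>" "\<delta> < 1" and \<psi>: "\<psi> \<in> holder_space (2 + \<delta>)"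
  obtains L where "L \<ge> 0" "\<psi> \<in> Ck_space 2"
    "\<And>x z e. norm (grad_of \<psi> x - grad_of \<psi> (x + e) - grad_of \<psi> (x + z) + grad_of \<psi> (x + z + e)) \<le> L * norm z * norm e powr \<delta>"
proof -
  have fl: "\<lfloor>2 + \<delta>\<rfloor> = 2" "frac (2 + \<delta>) = \<delta>" using floor_frac[of 2 "2 + \<delta>"] \<delta> by auto
  have C2: "\<psi> \<in> Ck_space 2" using \<psi> unfolding holder_space_def fl by simp
  have C2': "\<psi> \<in> Ck_space (Suc 1)" using C2 by (simp add: numeral_2_eq_2)
  have H: "\<forall>g\<in>partial_derivs 2 \<psi>. \<exists>M. \<forall>x z. \<bar>g x - g z\<bar> \<le> M * norm (x - z) powr \<delta>"
    using \<psi> \<delta> unfolding holder_space_def fl by simp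
  have "\<exists>M. \<forall>x z e. \<bar>partial_deriv b \<psi> x - partial_deriv b \<psi> (x + e) - partial_deriv b \<psi> (x + z) + partial_deriv b \<psi> (x + z + e)\<bar> \<le> M * norm e powr \<delta> * norm z"
    if b: "b \<in> Basis" for b
  proof -
    let ?f = "partial_deriv b \<psi>"
    have "?f \<in> Ck_space 1" using C2' b by (rule Ck_space_partial)
    then have d: "\<And>x. (?f has_derivative (\<lambda>h. grad_of ?f x \<bullet> h)) (at x)" using Ck_space_1 by metis
    have "\<exists>M. \<forall>x z. \<bar>partial_deriv c ?f x - partial_deriv c ?f z\<bar> \<le> M * norm (x - z) powr \<delta>" if "c \<in> Basis" for c
    proof -
      have "partial_deriv c ?f \<in> partial_derivs 2 \<psi>" using that b by (auto simp: numeral_2_eq_2)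
      from H[rule_format, OF this] show ?thesis by simp
    qed
    then obtain M where M: "\<And>c x z. c \<in> Basis \<Longrightarrow> \<bar>partial_deriv c ?f x - partial_deriv c ?f z\<bar> \<le> M c * norm (x - z) powr \<delta>" by metis
    let ?M = "\<Sum>c\<in>(Basis::'a set). M c"
    have g: "norm (grad_of ?f x - grad_of ?f z) \<le> ?M * norm (x - z) powr \<delta>" for x z
      by (rule order_trans[OF grad_of_diff_le], unfold sum_distrib_right, rule sum_mono[OF M])
    have "\<bar>?f x - ?f (x + e) - ?f (x + z) + ?f (x + z + e)\<bar> \<le> ?M * norm e powr \<delta> * norm z" for x z e
    proof -
      have dd: "((\<lambda>y. ?f y - ?f (y + e)) has_derivative (\<lambda>h. (grad_of ?f y - grad_of ?f (y + e)) \<bullet> h)) (at y)" for y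
      proof -
        have "((\<lambda>y. ?f (y + e)) has_derivative (\<lambda>h. grad_of ?f (y + e) \<bullet> h)) (at y)"
          by (rule has_derivative_compose[of "\<lambda>y. y + e" "\<lambda>h. h" y UNIV ?f, OF _ d]) (auto intro!: derivative_eq_intros)
        from has_derivative_diff[OF d[of y] this] show ?thesis by (simp add: inner_diff_left)
      qed
      have "\<bar>(?f x - ?f (x + e)) - (?f (x + z) - ?f (x + z + e))\<bar> \<le> (?M * norm e powr \<delta>) * norm (x - (x + z))"
      proof (rule gradient_bound[of UNIV "\<lambda>y. ?f y - ?f (y + e)" "\<lambda>y. grad_of ?f y - grad_of ?f (y + e)"])
        show "norm (grad_of ?f y - grad_of ?f (y + e)) \<le> ?M * norm e powr \<delta>" for y using g[of y "y + e"] by simp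
      qed (use dd in auto)
      then show ?thesis by (simp add: algebra_simps)
    qed
    then show ?thesis by blast
  qed
  then obtain M where M: "\<And>b x z e. b \<in> Basis \<Longrightarrow> \<bar>partial_deriv b \<psi> x - partial_deriv b \<psi> (x + e) - partial_deriv b \<psi> (x + z) + partial_deriv b \<psi> (x + z + e)\<bar> \<le> M b * norm e powr \<delta> * norm z"
    by metis
  let ?M = "\<Sum>b\<in>(Basis::'a set). M b"
  have "norm (grad_of \<psi> x - grad_of \<psi> (x + e) - grad_of \<psi> (x + z) + grad_of \<psi> (x + z + e)) \<le> \<bar>?M\<bar> * norm z * norm e powr \<delta>" for x z e
  proof -
    let ?c = "\<lambda>b. partial_deriv b \<psi> x - partial_deriv b \<psi> (x + e) - partial_deriv b \<psi> (x + z) + partial_deriv b \<psi> (x + z + e)"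
    have eq: "grad_of \<psi> x - grad_of \<psi> (x + e) - grad_of \<psi> (x + z) + grad_of \<psi> (x + z + e) = (\<Sum>b\<in>Basis. ?c b *\<^sub>R b)"
      by (simp add: grad_of_def scaleR_diff_left scaleR_add_left sum_subtractf sum.distrib)
    have "norm (grad_of \<psi> x - grad_of \<psi> (x + e) - grad_of \<psi> (x + z) + grad_of \<psi> (x + z + e)) \<le> (\<Sum>b\<in>(Basis::'a set). \<bar>?c b\<bar>)"
      unfolding eq by (rule norm_sum_Basis_le)
    also have "\<dots> \<le> (\<Sum>b\<in>(Basis::'a set). M b * norm e powr \<delta> * norm z)" by (rule sum_mono[OF M])
    also have "\<dots> = ?M * (norm e powr \<delta> * norm z)" by (simp add: sum_distrib_right mult.assoc)
    also have "\<dots> \<le> \<bar>?M\<bar> * (norm e powr \<delta> * norm z)" by (intro mult_right_mono) auto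
    finally show ?thesis by (simp add: mult_ac)
  qed
  with C2 show ?thesis by (intro that[of "\<bar>?M\<bar>"]) auto
qed

lemma holder_space_1s_holder_C1:
  fixes \<psi> :: "real ^ 'n \<Rightarrow> real"
  assumes s: "1 / 2 < s" "s < 1" and \<psi>: "\<psi> \<in> holder_space (1 + s)"
  obtains M where "holder_C1 s M \<psi> (grad_of \<psi>)"
proof -
  obtain L where L: "L \<ge> 0" "\<psi> \<in> Ck_space 1" "\<And>x z. norm (grad_of \<psi> x - grad_of \<psi> z) \<le> L * norm (x - z) powr s"
    using holder_space_order_1[OF _ s(2) \<psi>] s by auto
  obtain M where M: "\<And>x. (\<psi> has_derivative (\<lambda>h. grad_of \<psi> x \<bullet> h)) (at x)" "\<And>x. \<bar>\<psi> x\<bar> \<le> M" "\<And>x. norm (grad_of \<psi> x) \<le> M"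
    using Ck_space_1[OF L(2)] by metis
  have M0: "M \<ge> 0" using order_trans[OF abs_ge_zero M(2)] by auto
  have "holder_C1 s (M + L) \<psi> (grad_of \<psi>)"
  proof
    show "\<bar>\<psi> x\<bar> \<le> M + L" "norm (grad_of \<psi> x) \<le> M + L" for x
      using M(2)[of x] M(3)[of x] M0 L(1) by linarith+
    show "norm (grad_of \<psi> x - grad_of \<psi> z) \<le> (M + L) * norm (x - z) powr s" for x z
      by (rule order_trans[OF L(3) mult_right_mono]) (use M0 in auto)
  qed (use s M in auto)
  then show ?thesis by (rule that)
qed

lemma holder_space_3s_holder_mixed:
  fixes \<psi> :: "real ^ 'n \<Rightarrow> real"
  assumes s: "1 / 2 < s" "s < 1" and \<psi>: "\<psi> \<in> holder_space (3 * s)"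
  obtains M L \<alpha> \<beta> where "holder_mixed s M \<psi> (grad_of \<psi>) L \<alpha> \<beta>"
proof -
  note result = that
  have first_order: thesis
    if \<alpha>: "\<alpha> = 3 * s - 1" "\<alpha> \<le> 1" and L: "L \<ge> 0" "\<psi> \<in> Ck_space 1" "\<And>x z. norm (grad_of \<psi> x - grad_of \<psi> z) \<le> L * norm (x - z) powr \<alpha>" for \<alpha> L
  proof -
    obtain M where M: "\<And>x. (\<psi> has_derivative (\<lambda>h. grad_of \<psi> x \<bullet> h)) (at x)" "\<And>x. \<bar>\<psi> x\<bar> \<le> M" "\<And>x. norm (grad_of \<psi> x) \<le> M"
      using Ck_space_1[OF L(2)] by metis
    have M0: "M \<ge> 0" using order_trans[OF abs_ge_zero M(2)] by auto
    \<comment> \<open>The lower exponent is admissible because s > 1/2 gives s <= 3s - 1.\<close>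
    have h: "norm (grad_of \<psi> x - grad_of \<psi> z) \<le> (2 * M + L) * norm (x - z) powr s" for x z
      by (rule holder_lower_exponent[OF M(3) L(1) L(3)]) (use s \<alpha> in auto)
    \<comment> \<open>With \<beta> = 0 the mixed difference is bounded by two differences of step z,
      hence 2 L.\<close>
    have "holder_mixed s (2 * M + L) \<psi> (grad_of \<psi>) (2 * L) \<alpha> 0"
    proof
      show "\<bar>\<psi> x\<bar> \<le> 2 * M + L" "norm (grad_of \<psi> x) \<le> 2 * M + L" for x
        using M(2)[of x] M(3)[of x] M0 L(1) by linarith+
      show "norm (grad_of \<psi> x - grad_of \<psi> (x + e) - grad_of \<psi> (x + z) + grad_of \<psi> (x + z + e)) \<le> 2 * L * norm z powr \<alpha> * norm e powr 0" for x z e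
      \<comment> \<open>Since \<open>0 powr 0 = 0\<close>, the right side is 0 for e = 0; the left
        side vanishes there as well.\<close>
      proof (cases "e = 0")
        case False
        have eq: "grad_of \<psi> x - grad_of \<psi> (x + e) - grad_of \<psi> (x + z) + grad_of \<psi> (x + z + e)
          = (grad_of \<psi> x - grad_of \<psi> (x + z)) - (grad_of \<psi> (x + e) - grad_of \<psi> (x + e + z))" by (simp add: algebra_simps)
        have "norm (grad_of \<psi> x - grad_of \<psi> (x + e) - grad_of \<psi> (x + z) + grad_of \<psi> (x + z + e)) \<le> norm (grad_of \<psi> x - grad_of \<psi> (x + z)) + norm (grad_of \<psi> (x + e) - grad_of \<psi> (x + e + z))"
          unfolding eq by (rule norm_triangle_ineq4)
        also have "\<dots> \<le> L * norm z powr \<alpha> + L * norm z powr \<alpha>"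
          using L(3)[of x "x + z"] L(3)[of "x + e" "x + e + z"] by (intro add_mono) auto
        finally show ?thesis using False by simp
      qed simp
    qed (use s M h \<alpha> L in auto)
    then show thesis by (rule result)
  qed
  consider "3 * s < 2" | "3 * s = 2" | "3 * s > 2" by linarith
  then show thesis
  proof cases
    case 1
    obtain L where "L \<ge> 0" "\<psi> \<in> Ck_space 1" "\<And>x z. norm (grad_of \<psi> x - grad_of \<psi> z) \<le> L * norm (x - z) powr (3 * s - 1)"
      using holder_space_order_1[of "3 * s - 1" \<psi>] \<psi> s 1 by auto
    then show thesis using 1 by (intro first_order[of "3 * s - 1" L]) auto
  next
    \<comment> \<open>The order 3s is an integer, so \<open>holder_space\<close> contains no Hoelder
      condition; bounded second derivatives make the gradient Lipschitz, which is the case \<alpha>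
      = 1.\<close>
    case 2
    have fl: "\<lfloor>3 * s\<rfloor> = 2" using floor_frac[of 2 "3 * s"] 2 by auto
    have C2: "\<psi> \<in> Ck_space 2" using \<psi> unfolding holder_space_def fl by simp
    obtain L where L: "L \<ge> 0" "\<And>x z. norm (grad_of \<psi> x - grad_of \<psi> z) \<le> L * norm (x - z)"
      using Ck_space_2_lipschitz[OF C2] by metis
    have "\<psi> \<in> Ck_space 1" using C2 by (rule Ck_space_mono) simp
    then show thesis using 2 L by (intro first_order[of 1 L]) auto
  next
    case 3
    have e: "2 + (3 * s - 2) = 3 * s" by simp
    obtain L where L: "L \<ge> 0" "\<psi> \<in> Ck_space 2"
      "\<And>x z e. norm (grad_of \<psi> x - grad_of \<psi> (x + e) - grad_of \<psi> (x + z) + grad_of \<psi> (x + z + e)) \<le> L * norm z * norm e powr (3 * s - 2)"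
      using holder_space_order_2[of "3 * s - 2" \<psi>] \<psi> s 3 unfolding e by auto
    obtain M where M: "holder_C1 s M \<psi> (grad_of \<psi>)" using Ck_space_2_holder_C1[OF s L(2)] by metis
    interpret holder_C1 s M \<psi> "grad_of \<psi>" by (rule M)
    have "holder_mixed s M \<psi> (grad_of \<psi>) L 1 (3 * s - 2)"
      by unfold_locales (use L s 3 in auto)
    then show thesis by (rule result)
  qed
qed

section \<open>The normalising constant\<close>

text \<open>Trigonometric functions in one direction are closed under partial derivatives; the cosine
  has a nonzero principal value integral, so the constant is unique.\<close>

definition trig :: "'a::euclidean_space \<Rightarrow> real \<Rightarrow> real \<Rightarrow> 'a \<Rightarrow> real" where
  "trig b p q = (\<lambda>x. p * cos (x \<bullet> b) + q * sin (x \<bullet> b))"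

lemma trig_deriv:
  "(trig b p q has_derivative (\<lambda>h. q * (h \<bullet> b) * cos (x \<bullet> b) - p * (h \<bullet> b) * sin (x \<bullet> b))) (at x)"
  unfolding trig_def by (auto intro!: derivative_eq_intros simp: algebra_simps)

lemma trig_partial_deriv: "partial_deriv c (trig b p q) = trig b (q * (c \<bullet> b)) (- p * (c \<bullet> b))"
  unfolding partial_deriv_def
  by (rule ext) (subst frechet_derivative_at[OF trig_deriv, symmetric], simp add: trig_def)

lemma trig_partial_derivs: "g \<in> partial_derivs j (trig b p q) \<Longrightarrow> \<exists>p q. g = trig b p q"
  by (induction j arbitrary: p q) (auto simp: trig_partial_deriv)

lemma trig_Ck_space: "trig b p q \<in> Ck_space k"
proof -
  have d: "trig b p q differentiable_on UNIV" for p q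
    using trig_deriv[of b p q] by (auto simp: differentiable_on_def differentiable_def)
  have c: "continuous_on UNIV (trig b p q)" for p q
    unfolding trig_def by (intro continuous_intros)
  have "\<bar>trig b p q x\<bar> \<le> \<bar>p\<bar> + \<bar>q\<bar>" for p q x
  proof -
    have "\<bar>p * cos (x \<bullet> b)\<bar> \<le> \<bar>p\<bar> * 1" "\<bar>q * sin (x \<bullet> b)\<bar> \<le> \<bar>q\<bar> * 1"
      unfolding abs_mult by (intro mult_left_mono; simp)+
    then show ?thesis unfolding trig_def by linarith
  qed
  then have b: "bounded (range (trig b p q))" for p q by (auto simp: bounded_iff)
  show ?thesis unfolding Ck_space_def using trig_partial_derivs d c b by blast
qed

text \<open>The constant is described through \<open>Ck_space 2\<close>, to which u and \<phi> need
  not belong: its value is found on that class and then used for them. Existence is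
  \<open>ext_weighted_deriv_limit\<close>; for uniqueness one function with nonzero principal value
  at one point is enough.\<close>

lemma frac_lap_const_eq:
  assumes s: "1 / 2 < s" "s < 1"
  shows "frac_lap_const TYPE('n::finite) s = 2 * s * poisson_const TYPE('n) s"
  unfolding frac_lap_const_def
proof (rule the_equality)
  let ?c = "2 * s * poisson_const TYPE('n) s"
  have lim: "((\<lambda>y. y powr (1 - 2 * s) * deriv (\<lambda>t. extension s \<psi> (x, t)) y) \<longlongrightarrow> - (?c * pv_integral s \<psi> x)) (at_right 0)"
    if "\<psi> \<in> Ck_space 2" for \<psi> :: "real ^ 'n \<Rightarrow> real" and x
  proof -
    obtain M where "holder_C1 s M \<psi> (grad_of \<psi>)" using Ck_space_2_holder_C1[OF s \<open>\<psi> \<in> Ck_space 2\<close>] by metis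
    then interpret holder_C1 s M \<psi> "grad_of \<psi>" .
    show ?thesis by (rule ext_weighted_deriv_limit)
  qed
  then show "?c > 0 \<and> (\<forall>\<psi>\<in>Ck_space 2. \<forall>x :: real ^ 'n. ((\<lambda>y. y powr (1 - 2 * s) * deriv (\<lambda>t. extension s \<psi> (x, t)) y) \<longlongrightarrow> - (?c * pv_integral s \<psi> x)) (at_right 0))"
    using poisson_const_pos(1)[of s, where 'n='n] s by auto
  fix c assume c: "c > 0 \<and> (\<forall>\<psi>\<in>Ck_space 2. \<forall>x :: real ^ 'n. ((\<lambda>y. y powr (1 - 2 * s) * deriv (\<lambda>t. extension s \<psi> (x, t)) y) \<longlongrightarrow> - (c * pv_integral s \<psi> x)) (at_right 0))"
  obtain b :: "real ^ 'n" where b: "b \<in> Basis" using nonempty_Basis by blast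
  let ?\<psi> = "trig b 1 0"
  have C2: "?\<psi> \<in> Ck_space 2" by (rule trig_Ck_space)
  obtain M where "holder_C1 s M ?\<psi> (grad_of ?\<psi>)" using Ck_space_2_holder_C1[OF s C2] by metis
  then interpret holder_C1 s M ?\<psi> "grad_of ?\<psi>" .
  have hd: "half_diff 0 z = 1 - cos (z \<bullet> b)" for z
    unfolding half_diff_def by (simp add: trig_def)
  have "pv 0 \<noteq> 0"
  proof
    assume "pv 0 = 0"
    then have "AE z in lborel. norm z powr (- (real CARD('n) + 2 * s)) * half_diff 0 z = 0"
      unfolding pv_def by (subst (asm) integral_nonneg_eq_0_iff_AE[OF pv_integrable]) (auto simp: hd)
    \<comment> \<open>On this ball 0 < z . b < 1, hence 1 - cos(z . b) > 0; a ball of positive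
      measure cannot lie in the exceptional null set.\<close>
    then have "AE z in lborel. z \<notin> ball ((1/2) *\<^sub>R b) (1/4)"
    proof eventually_elim
      case (elim z)
      show ?case
      proof
        assume "z \<in> ball ((1/2) *\<^sub>R b) (1/4)"
        then have "norm ((1/2) *\<^sub>R b - z) < 1/4" by (simp add: dist_norm)
        then have "\<bar>((1/2) *\<^sub>R b - z) \<bullet> b\<bar> < 1/4"
          using Basis_le_norm[OF b, of "(1/2) *\<^sub>R b - z"] by linarith
        then have zb: "0 < z \<bullet> b" "z \<bullet> b < 1" using b unfolding abs_less_iff by (auto simp: inner_diff_left inner_same_Basis)
        then have "z \<noteq> 0" by auto
        then have "cos (z \<bullet> b) = 1" using elim by (simp add: hd)
        moreover have "cos (z \<bullet> b) < cos 0" using zb pi_gt3 by (intro cos_monotone_0_pi) auto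
        ultimately show False by simp
      qed
    qed
    then have "emeasure lborel (ball ((1/2) *\<^sub>R b) (1/4)) = 0"
      by (intro AE_iff_measurable[THEN iffD1]) auto
    then show False using unit_ball_vol_pos[of "real CARD('n)"] by (simp add: emeasure_ball)
  qed
  moreover have "- (c * pv_integral s ?\<psi> 0) = - (?c * pv_integral s ?\<psi> 0)"
    using c C2 lim[OF C2, of 0] by (intro tendsto_unique[OF trivial_limit_at_right_real]) auto
  ultimately show "c = ?c" unfolding pv_integral_eq by simp
qed

section \<open>The height function at a free boundary point\<close>

context holder_C1
begin

lemma ext_grad_fst_0: "fst (ext_grad (x, 0)) = g x"
proof -
  have "(\<integral>z. poisson_kernel s (z :: real ^ 'n) 1 *\<^sub>R g x \<partial>lborel) = (\<integral>z. poisson_kernel s (z :: real ^ 'n) 1 \<partial>lborel) *\<^sub>R g x"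
    by (rule integral_scaleR_left) (rule poisson_kernel_integrable1)
  then show ?thesis using poisson_const_pos(2)[OF s0, of 1, where 'n='n] by (simp add: ext_grad_def)
qed

text \<open>Free boundary points are moved to the origin, where the calculus of balls and spheres
  about 0 applies; the constant M is unchanged.\<close>

lemma translate: "holder_C1 s M (\<lambda>x. \<psi> (c + x)) (\<lambda>x. g (c + x))"
proof
  show "((\<lambda>x. \<psi> (c + x)) has_derivative (\<lambda>h. g (c + x) \<bullet> h)) (at x)" for x
    by (rule has_derivative_compose[of "\<lambda>x. c + x" "\<lambda>h. h" x UNIV \<psi>, OF _ deriv]) (auto intro!: derivative_eq_intros)
  show "norm (g (c + x) - g (c + z)) \<le> M * norm (x - z) powr s" for x z
    using g_holder[of "c + x" "c + z"] by simp
qed (use s \<psi>_bound g_bound in auto)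

lemma extension_translate: "extension s (\<lambda>x. \<psi> (c + x)) p = extension s \<psi> ((c, 0) + p)"
  by (cases p) (simp add: extension_def algebra_simps)

lemma pv_integral_translate: "pv_integral s (\<lambda>x. \<psi> (c + x)) x = pv_integral s \<psi> (c + x)"
proof -
  interpret t: holder_C1 s M "\<lambda>x. \<psi> (c + x)" "\<lambda>x. g (c + x)" by (rule translate)
  show ?thesis unfolding t.pv_integral_eq pv_integral_eq t.pv_def pv_def t.half_diff_def half_diff_def
    by (simp add: algebra_simps)
qed

lemma frac_lap_eq: "frac_lap s \<psi> x = 2 * s * poisson_const TYPE('n) s * pv x"
  by (simp add: frac_lap_def frac_lap_const_eq[OF s] pv_integral_eq)

lemma frac_lap_continuous: "continuous_on UNIV (frac_lap s \<psi>)"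
  unfolding frac_lap_eq[abs_def] by (intro continuous_intros pv_continuous)

end

section \<open>The correction term of the height function\<close>

text \<open>At t = 0 the difference quotient is at most |h|^(b-1), which tends to 0 because b > 1.
  With b = 2s this is one more place where s > 1/2 enters.\<close>

lemma powr_abs_deriv:
  fixes t b :: real
  assumes b: "b > 1"
  shows "((\<lambda>t. \<bar>t\<bar> powr b) has_real_derivative b * (sgn t * \<bar>t\<bar> powr (b - 1))) (at t)"
proof -
  consider "t > 0" | "t < 0" | "t = 0" by linarith
  then show ?thesis
  proof cases
    case 1
    have ev: "eventually (\<lambda>t. \<bar>t\<bar> powr b = t powr b) (nhds t)"
      using eventually_nhds_in_open[of "{0<..}" t] 1 by (auto elim!: eventually_mono)
    have "((\<lambda>t. t powr b) has_real_derivative b * (sgn t * \<bar>t\<bar> powr (b - 1))) (at t)"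
      using has_real_derivative_powr[OF 1, of b] 1 by simp
    then show ?thesis using DERIV_cong_ev[OF refl ev refl] by blast
  next
    case 2
    have ev: "eventually (\<lambda>t. \<bar>t\<bar> powr b = (- t) powr b) (nhds t)"
      using eventually_nhds_in_open[of "{..<0}" t] 2 by (auto elim!: eventually_mono)
    have "((\<lambda>t. (- t) powr b) has_real_derivative (b * (- t) powr (b - 1)) * (- 1)) (at t)"
      by (rule DERIV_chain2[of "\<lambda>x. x powr b"]) (use 2 in \<open>auto intro!: has_real_derivative_powr derivative_eq_intros\<close>)
    then have "((\<lambda>t. (- t) powr b) has_real_derivative b * (sgn t * \<bar>t\<bar> powr (b - 1))) (at t)"
      using 2 by simp
    then show ?thesis using DERIV_cong_ev[OF refl ev refl] by blast
  next
    case 3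
    have "((\<lambda>h::real. \<bar>h\<bar> powr (b - 1)) \<longlongrightarrow> \<bar>0\<bar> powr (b - 1)) (at 0)"
      by (rule tendsto_powr') (use b in \<open>auto intro!: tendsto_rabs_zero\<close>)
    then have l: "((\<lambda>h::real. \<bar>h\<bar> powr (b - 1)) \<longlongrightarrow> 0) (at 0)" by simp
    have bd: "norm ((\<bar>0 + h\<bar> powr b - \<bar>0\<bar> powr b) / h) \<le> \<bar>h\<bar> powr (b - 1)" for h :: real
    proof (cases "h = 0")
      case False
      have "\<bar>h\<bar> powr b = \<bar>h\<bar> * \<bar>h\<bar> powr (b - 1)" using powr_mult_base[of "\<bar>h\<bar>" "b - 1"] by simp
      then show ?thesis using False by (simp add: abs_divide)
    qed simp
    have "((\<lambda>h. (\<bar>0 + h\<bar> powr b - \<bar>0\<bar> powr b) / h) \<longlongrightarrow> 0) (at 0)"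
      by (rule Lim_null_comparison[OF always_eventually l], rule allI, rule bd)
    then show ?thesis using 3 by (simp add: DERIV_def)
  qed
qed

lemma powr_abs_deriv_cont:
  assumes b: "b > 1"
  shows "continuous_on UNIV (\<lambda>t::real. sgn t * \<bar>t\<bar> powr (b - 1))"
proof (rule continuous_at_imp_continuous_on, rule ballI)
  fix t :: real
  show "isCont (\<lambda>t. sgn t * \<bar>t\<bar> powr (b - 1)) t"
  proof (cases "t = 0")
    case True
    have "((\<lambda>h::real. \<bar>h\<bar> powr (b - 1)) \<longlongrightarrow> \<bar>0\<bar> powr (b - 1)) (at 0)"
      by (rule tendsto_powr') (use b in \<open>auto intro!: tendsto_rabs_zero\<close>)
    then have l: "((\<lambda>h::real. \<bar>h\<bar> powr (b - 1)) \<longlongrightarrow> 0) (at 0)" by simp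
    have "((\<lambda>h::real. sgn h * \<bar>h\<bar> powr (b - 1)) \<longlongrightarrow> 0) (at 0)"
      by (rule Lim_null_comparison[OF _ l]) (auto intro!: always_eventually simp: abs_mult abs_sgn_eq)
    then show ?thesis using True by (simp add: isCont_def)
  next
    case False
    then show ?thesis by (intro continuous_intros isCont_sgn) auto
  qed
qed

text \<open>|y|^a times the y-derivative of |y|^(2s) is 2s sgn y. On each vertical line sgn y times
  the y-derivative of \<zeta> integrates to -2 \<zeta>(x, 0), so the correction contributes a
  constant density on y = 0.\<close>

lemma sgn_weak_integral:
  assumes "test_fun \<zeta> Z R"
  shows "integrable lborel (\<lambda>p. sgn (snd p) * snd (Z p))"
    and "(\<integral>p. sgn (snd p) * snd (Z p) \<partial>lborel) = - (2 * (\<integral>x. \<zeta> (x, 0) \<partial>lborel))"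
proof -
  interpret test_fun \<zeta> Z R by (rule assms)
  have iZ: "integrable lborel (\<lambda>p. snd (Z p))"
    by (rule compact_support_integrable[of _ R]) (use Z_cont Z_supp in \<open>auto intro!: continuous_intros\<close>)
  have e: "sgn (snd p) * snd (Z p) = indicator {0<..} (snd p) * snd (Z p) - indicator {..<0} (snd p) * snd (Z p)" for p
    by (auto simp: indicator_def sgn_if)
  show I: "integrable lborel (\<lambda>p. sgn (snd p) * snd (Z p))"
    unfolding e using iZ by (intro Bochner_Integration.integrable_diff integrable_snd_indicator) auto
  then have I': "integrable (lborel \<Otimes>\<^sub>M lborel) (\<lambda>p. sgn (snd p) * snd (Z p))" by (simp add: lborel_prod)
  have slice: "(\<integral>y. sgn y * snd (Z (x, y)) \<partial>lborel) = - 2 * \<zeta> (x, 0)" for x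
  proof -
    define T where "T = \<bar>R\<bar> + 1"
    have T: "T > 0" by (simp add: T_def)
    have cZ: "continuous_on A (\<lambda>y. snd (Z (x, y)))" for A
      by (intro continuous_intros continuous_on_compose2[OF Z_cont]) auto
    have ftc: "(\<integral>y. snd (Z (x, y)) * indicator {a..b} y \<partial>lborel) = \<zeta> (x, b) - \<zeta> (x, a)"
      "integrable lborel (\<lambda>y. snd (Z (x, y)) * indicator {a..b} y)" if "a \<le> b" for a b
    proof -
      show "(\<integral>y. snd (Z (x, y)) * indicator {a..b} y \<partial>lborel) = \<zeta> (x, b) - \<zeta> (x, a)"
        by (rule integral_FTC_Icc_real[OF that slice_deriv_y])
          (use cZ[of UNIV] in \<open>simp add: continuous_on_eq_continuous_at\<close>)
      show "integrable lborel (\<lambda>y. snd (Z (x, y)) * indicator {a..b} y)"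
        using borel_integrable_compact[of "{a..b}" "\<lambda>y. snd (Z (x, y))"] cZ by (simp add: mult.commute)
    qed
    have "(\<integral>y. sgn y * snd (Z (x, y)) \<partial>lborel) = (\<integral>y. snd (Z (x, y)) * indicator {0..T} y - snd (Z (x, y)) * indicator {-T..0} y \<partial>lborel)"
    proof (rule integral_cong_AE)
      show "AE y in lborel. sgn y * snd (Z (x, y)) = snd (Z (x, y)) * indicator {0..T} y - snd (Z (x, y)) * indicator {-T..0} y"
        using AE_lborel_singleton[of 0]
      proof eventually_elim
        case (elim y)
        have "Z (x, y) = 0" if "\<bar>y\<bar> > T" using that by (intro slice_supp) (auto simp: T_def)
        then show ?case using elim by (cases "\<bar>y\<bar> > T") (auto simp: indicator_def sgn_if abs_if split: if_splits)
      qed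
      have [measurable]: "(\<lambda>y. snd (Z (x, y))) \<in> borel_measurable borel" by (rule borel_measurable_continuous_onI[OF cZ])
      show "(\<lambda>y. sgn y * snd (Z (x, y))) \<in> borel_measurable lborel"
        "(\<lambda>y. snd (Z (x, y)) * indicator {0..T} y - snd (Z (x, y)) * indicator {-T..0} y) \<in> borel_measurable lborel" by measurable
    qed
    also have "\<dots> = (\<zeta> (x, T) - \<zeta> (x, 0)) - (\<zeta> (x, 0) - \<zeta> (x, - T))"
      using T by (simp add: ftc)
    also have "\<dots> = - 2 * \<zeta> (x, 0)"
      using slice_supp(3)[of T x] slice_supp(3)[of "- T" x] by (simp add: T_def)
    finally show ?thesis .
  qed
  have "(\<integral>p. sgn (snd p) * snd (Z p) \<partial>lborel) = (\<integral>x. \<integral>y. sgn y * snd (Z (x, y)) \<partial>lborel \<partial>lborel)"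
    using lborel_pair.integral_fst'[OF I'] by (simp add: lborel_prod)
  then show "(\<integral>p. sgn (snd p) * snd (Z p) \<partial>lborel) = - (2 * (\<integral>x. \<zeta> (x, 0) \<partial>lborel))"
    unfolding slice by simp
qed

lemma gradient_eqI: "(f has_derivative (\<lambda>h. D \<bullet> h)) (at p) \<Longrightarrow> gradient f p = D"
  unfolding gradient_def gderiv_def
proof (rule the_equality)
  assume D: "(f has_derivative (\<lambda>h. D \<bullet> h)) (at p)"
  then show "(f has_derivative (\<lambda>h. h \<bullet> D)) (at p)" by (simp only: inner_commute)
  show "E = D" if "(f has_derivative (\<lambda>h. h \<bullet> E)) (at p)" for E
    using has_derivative_unique[OF that D] by (simp only: fun_eq_iff inner_commute[of _ E] vector_eq_rdot)
qed

section \<open>From the obstacle problem to the abstract setting\<close>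

text \<open>M covers the bounds on V and its horizontal gradient. The second summand covers h: a
  factor 2 from \<open>source_fun\<close>, 2s \<open>poisson_const\<close> from the fractional
  Laplacian, and the Hoelder constant of the principal value. The sum serves as the single
  K.\<close>

definition height_const :: "'n::finite itself \<Rightarrow> real \<Rightarrow> real \<Rightarrow> real \<Rightarrow> real \<Rightarrow> real" where
  "height_const N s M L \<alpha> = M + 2 * (2 * s * poisson_const N s * pv_holder_const N s L \<alpha>)"

text \<open>x0 enters only in the next locale, which keeps every constant of this one independent of
  it: C has to be chosen before the free boundary point.\<close>

locale obstacle_problem =
  u: holder_C1 s Mu u gu + f: holder_mixed s Mf \<phi> gf L \<alpha> \<beta>
  for s :: real and Mu and u :: "real ^ 'n \<Rightarrow> real" and gu Mf and \<phi> :: "real ^ 'n \<Rightarrow> real" and gf L \<alpha> \<beta> +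
  assumes solution: "obstacle_solution s \<phi> u"

locale free_boundary_point = obstacle_problem s Mu u gu Mf \<phi> gf L \<alpha> \<beta>
  for s Mu and u :: "real ^ 'n \<Rightarrow> real" and gu Mf \<phi> gf L \<alpha> \<beta> +
  fixes x0
  assumes x0: "x0 \<in> free_boundary \<phi> u"
begin

sublocale ut: holder_C1 s Mu "\<lambda>x. u (x0 + x)" "\<lambda>x. gu (x0 + x)" by (rule u.translate)
sublocale ft: holder_C1 s Mf "\<lambda>x. \<phi> (x0 + x)" "\<lambda>x. gf (x0 + x)" by (rule f.translate)

definition V :: "(real ^ 'n) \<times> real \<Rightarrow> real" where
  "V p = height_fun s \<phi> u x0 ((x0, 0) + p)"

definition G :: "(real ^ 'n) \<times> real \<Rightarrow> (real ^ 'n) \<times> real" where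
  "G p = ut.ext_grad p - ft.ext_grad p - (0, frac_lap s \<phi> x0 * (sgn (snd p) * \<bar>snd p\<bar> powr (2 * s - 1)))"

text \<open>The expected limit of y^a times the y-derivative of V as y decreases to 0: the
  extensions of u and \<phi> contribute minus their fractional Laplacians with opposite signs, and
  the correction term subtracts a constant. Off the contact set it equals h / 2.\<close>

definition w :: "real ^ 'n \<Rightarrow> real" where
  "w x = - frac_lap s u (x0 + x) + (frac_lap s \<phi> (x0 + x) - frac_lap s \<phi> x0)"

lemma V_eq: "V p = extension s (\<lambda>x. u (x0 + x)) p - extension s (\<lambda>x. \<phi> (x0 + x)) p
    - 1 / (2 * s) * frac_lap s \<phi> x0 * \<bar>snd p\<bar> powr (2 * s)"
  unfolding u.extension_translate f.extension_translate
  by (cases p) (simp add: V_def height_fun_def)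

lemma V_slice: "V (x, 0) = u (x0 + x) - \<phi> (x0 + x)"
  by (simp add: V_eq extension_def)

lemma G_slice: "fst (G (x, 0)) = gu (x0 + x) - gf (x0 + x)"
  by (simp add: G_def ut.ext_grad_fst_0 ft.ext_grad_fst_0)

lemma inner_0_Pair: "(0, c) \<bullet> h = c * snd h" for h :: "(real ^ 'n) \<times> real"
  by (simp add: inner_prod_def)

lemma height_deriv: "(V has_derivative (\<lambda>h. G p \<bullet> h)) (at p)"
proof -
  have b: "2 * s > 1" using u.s by simp
  have "((\<lambda>p :: (real ^ 'n) \<times> real. \<bar>snd p\<bar> powr (2 * s)) has_derivative (\<lambda>h. snd h * (2 * s * (sgn (snd p) * \<bar>snd p\<bar> powr (2 * s - 1))))) (at p)"
    by (rule DERIV_compose_FDERIV[OF powr_abs_deriv[OF b]]) (auto intro!: derivative_eq_intros)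
  from has_derivative_diff[OF has_derivative_diff[OF ut.ext_has_derivative[of p] ft.ext_has_derivative[of p]]
      has_derivative_mult_right[OF this, of "1 / (2 * s) * frac_lap s \<phi> x0"]]
  show ?thesis
    unfolding V_eq[abs_def] G_def using u.s
    by (elim has_derivative_eq_rhs) (simp add: fun_eq_iff inner_diff_left inner_0_Pair mult_ac)
qed

lemma height_grad_cont: "continuous_on UNIV G"
proof -
  have b: "2 * s > 1" using u.s by simp
  have "continuous_on UNIV (\<lambda>p :: (real ^ 'n) \<times> real. sgn (snd p) * \<bar>snd p\<bar> powr (2 * s - 1))"
    by (rule continuous_on_compose2[OF powr_abs_deriv_cont[OF b]]) (auto intro!: continuous_intros)
  then show ?thesis
    unfolding G_def[abs_def]
    by (intro continuous_on_diff continuous_on_Pair continuous_on_const continuous_on_mult_left ut.ext_grad_continuous ft.ext_grad_continuous)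
qed

lemma height_weak:
  assumes T: "test_fun \<zeta> Z R"
  shows "(\<integral>p. \<bar>snd p\<bar> powr (1 - 2 * s) * (G p \<bullet> Z p) \<partial>lborel) = - (2 * (\<integral>x. w x * \<zeta> (x, 0) \<partial>lborel))"
proof -
  interpret test_fun \<zeta> Z R by (rule T)
  let ?k = "frac_lap s \<phi> x0"
  have e: "\<bar>snd p\<bar> powr (1 - 2 * s) * (G p \<bullet> Z p) = \<bar>snd p\<bar> powr (1 - 2 * s) * (ut.ext_grad p \<bullet> Z p)
      - \<bar>snd p\<bar> powr (1 - 2 * s) * (ft.ext_grad p \<bullet> Z p) - ?k * (sgn (snd p) * snd (Z p))" for p
  proof -
    \<comment> \<open>The weight cancels the power in the derivative of the correction and leaves
      sgn y; at y = 0 both sides are 0.\<close>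
    have "\<bar>snd p\<bar> powr (1 - 2 * s) * (sgn (snd p) * \<bar>snd p\<bar> powr (2 * s - 1)) = sgn (snd p)"
    proof (cases "snd p = 0")
      case False
      have "\<bar>snd p\<bar> powr (1 - 2 * s) * \<bar>snd p\<bar> powr (2 * s - 1) = 1"
        using False by (simp flip: powr_add)
      then show ?thesis by (simp only: mult.left_commute[of _ "sgn _"] mult_1_right)
    qed simp
    moreover have "W * (k * q * z) = k * ((W * q) * z)" for W k q z :: real by (simp only: mult_ac)
    ultimately have "\<bar>snd p\<bar> powr (1 - 2 * s) * (?k * (sgn (snd p) * \<bar>snd p\<bar> powr (2 * s - 1)) * snd (Z p)) = ?k * (sgn (snd p) * snd (Z p))"
      by (simp only:)
    moreover have "G p \<bullet> Z p = ut.ext_grad p \<bullet> Z p - ft.ext_grad p \<bullet> Z p - ?k * (sgn (snd p) * \<bar>snd p\<bar> powr (2 * s - 1)) * snd (Z p)"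
      unfolding G_def inner_diff_left inner_0_Pair by (rule refl)
    ultimately show ?thesis by (simp only: right_diff_distrib)
  qed
  have iz: "integrable lborel (\<lambda>x. k x * \<zeta> (x, 0))" if "continuous_on UNIV k" for k
    by (rule compact_support_integrable[of _ R]) (use that slice_supp in \<open>auto intro!: continuous_intros slice_cont_x\<close>)
  have cu: "continuous_on UNIV (\<lambda>x. frac_lap s u (x0 + x))" "continuous_on UNIV (\<lambda>x. frac_lap s \<phi> (x0 + x))"
    by (auto intro!: continuous_on_compose2[OF u.frac_lap_continuous] continuous_on_compose2[OF f.frac_lap_continuous] continuous_intros)
  have fl: "2 * s * poisson_const TYPE('n) s * pv_integral s (\<lambda>x. u (x0 + x)) x = frac_lap s u (x0 + x)"
    "2 * s * poisson_const TYPE('n) s * pv_integral s (\<lambda>x. \<phi> (x0 + x)) x = frac_lap s \<phi> (x0 + x)" for x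
    unfolding u.pv_integral_translate f.pv_integral_translate by (simp_all add: frac_lap_def frac_lap_const_eq[OF u.s])
  have "(\<integral>p. \<bar>snd p\<bar> powr (1 - 2 * s) * (G p \<bullet> Z p) \<partial>lborel) =
    (\<integral>p. \<bar>snd p\<bar> powr (1 - 2 * s) * (ut.ext_grad p \<bullet> Z p) \<partial>lborel)
      - (\<integral>p. \<bar>snd p\<bar> powr (1 - 2 * s) * (ft.ext_grad p \<bullet> Z p) \<partial>lborel) - ?k * (\<integral>p. sgn (snd p) * snd (Z p) \<partial>lborel)"
    unfolding e
    by (simp only: Bochner_Integration.integral_diff Bochner_Integration.integrable_diff integrable_mult_right integral_mult_right_zero
      ut.weak_equation(1)[OF T] ft.weak_equation(1)[OF T] sgn_weak_integral(1)[OF T])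
  also have "\<dots> = 2 * (\<integral>x. frac_lap s u (x0 + x) * \<zeta> (x, 0) \<partial>lborel) - 2 * (\<integral>x. frac_lap s \<phi> (x0 + x) * \<zeta> (x, 0) \<partial>lborel)
      + 2 * (\<integral>x. ?k * \<zeta> (x, 0) \<partial>lborel)"
    unfolding ut.weak_equation(2)[OF T] ft.weak_equation(2)[OF T] sgn_weak_integral(2)[OF T] fl by simp
  also have "\<dots> = - (2 * (\<integral>x. (- (frac_lap s u (x0 + x) * \<zeta> (x, 0)) + frac_lap s \<phi> (x0 + x) * \<zeta> (x, 0)) - ?k * \<zeta> (x, 0) \<partial>lborel))"
    using iz[OF cu(1)] iz[OF cu(2)] iz[OF continuous_on_const[of UNIV ?k]] by simp
  also have "(\<lambda>x. (- (frac_lap s u (x0 + x) * \<zeta> (x, 0)) + frac_lap s \<phi> (x0 + x) * \<zeta> (x, 0)) - ?k * \<zeta> (x, 0)) = (\<lambda>x. w x * \<zeta> (x, 0))"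
    by (simp add: w_def algebra_simps)
  finally show ?thesis .
qed

lemma above: "u x \<ge> \<phi> x" and complementarity: "u x \<noteq> \<phi> x \<Longrightarrow> frac_lap s u x = 0"
  using solution[unfolded obstacle_solution_def, rule_format, of x] by (auto simp: min_def split: if_splits)

text \<open>At a contact point the differentiable nonnegative function u - \<phi> attains its
  minimum 0.\<close>

lemma grad_contact:
  assumes "u x = \<phi> x" shows "gu x = gf x"
proof -
  have "((\<lambda>x. u x - \<phi> x) has_derivative (\<lambda>h. gu x \<bullet> h - gf x \<bullet> h)) (at x)"
    by (rule has_derivative_diff[OF u.deriv f.deriv])
  then have "(\<lambda>h. gu x \<bullet> h - gf x \<bullet> h) = (\<lambda>h. 0)"
    by (rule differential_zero_maxmin[of x UNIV, rotated 2]) (use assms above in auto)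
  then show ?thesis by (simp add: fun_eq_iff vector_eq_rdot)
qed

text \<open>The contact set is closed by continuity and therefore contains its frontier.\<close>

lemma x0_contact: "u x0 = \<phi> x0"
proof -
  have "closed {x. u x = \<phi> x}"
    by (rule closed_Collect_eq) (use u.cont_\<psi> f.cont_\<psi> in auto)
  then have "frontier {x. u x = \<phi> x} \<subseteq> {x. u x = \<phi> x}" by (rule frontier_subset_closed)
  then show ?thesis using x0 by (auto simp: free_boundary_def)
qed

text \<open>The two gradients agree at x0, so each Hoelder bound can be taken from this common
  value. Integrating the result from x0, where u = \<phi>, gives \<open>diff_bound\<close>.\<close>

lemma grad_diff_bound: "norm (gu (x0 + x) - gf (x0 + x)) \<le> (Mu + Mf) * norm x powr s"
proof -
  have "gu (x0 + x) - gf (x0 + x) = (gu (x0 + x) - gu x0) - (gf (x0 + x) - gf x0)"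
    using grad_contact[OF x0_contact] by simp
  then have "norm (gu (x0 + x) - gf (x0 + x)) \<le> norm (gu (x0 + x) - gu x0) + norm (gf (x0 + x) - gf x0)"
    by (simp only: norm_triangle_ineq4)
  also have "\<dots> \<le> Mu * norm x powr s + Mf * norm x powr s"
    using u.g_holder[of "x0 + x" x0] f.g_holder[of "x0 + x" x0] by (intro add_mono) auto
  finally show ?thesis by (simp add: algebra_simps)
qed

lemma diff_bound: "\<bar>u (x0 + x) - \<phi> (x0 + x)\<bar> \<le> (Mu + Mf) * norm x powr (1 + s)"
proof -
  have "\<bar>(u (x0 + x) - \<phi> (x0 + x)) - (u (x0 + 0) - \<phi> (x0 + 0))\<bar> \<le> ((Mu + Mf) * norm x powr s) * norm (x - 0)"
  proof (rule gradient_bound[of "cball 0 (norm x)" "\<lambda>x. u (x0 + x) - \<phi> (x0 + x)" "\<lambda>x. gu (x0 + x) - gf (x0 + x)"])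
    show "((\<lambda>x. u (x0 + x) - \<phi> (x0 + x)) has_derivative (\<lambda>h. (gu (x0 + z) - gf (x0 + z)) \<bullet> h)) (at z)" for z
      using has_derivative_diff[OF ut.deriv[of z] ft.deriv[of z]] by (simp add: inner_diff_left)
    fix z :: "real ^ 'n" assume "z \<in> cball 0 (norm x)"
    then have "norm z powr s \<le> norm x powr s" using u.s by (intro powr_mono2) auto
    then have "(Mu + Mf) * norm z powr s \<le> (Mu + Mf) * norm x powr s"
      using u.M_nonneg f.M_nonneg by (intro mult_left_mono) auto
    then show "norm (gu (x0 + z) - gf (x0 + z)) \<le> (Mu + Mf) * norm x powr s"
      using grad_diff_bound[of z] by linarith
  qed auto
  moreover have "(Mu + Mf) * norm x powr s * norm (x - 0) = (Mu + Mf) * norm x powr (1 + s)"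
    by (simp add: powr_mult_base[OF norm_ge_zero, symmetric] mult_ac)
  ultimately show ?thesis using x0_contact by (simp only: add_0_right diff_self diff_0_right)
qed

sublocale weiss_setting s "height_const TYPE('n) s (Mu + Mf) L \<alpha>" V G w "\<lambda>x. source_fun s \<phi> x0 (x0 + x)"
proof
  have M: "Mu \<ge> 0" "Mf \<ge> 0" by (rule u.M_nonneg, rule f.M_nonneg)
  have P: "pv_holder_const TYPE('n) s L \<alpha> \<ge> 0" "2 * s * poisson_const TYPE('n) s \<ge> 0"
    using f.L f.exponents u.s sphere_area_nonneg[where 'a="real ^ 'n"] poisson_const_pos(1)[OF u.s0, where 'n='n]
    by (auto simp: pv_holder_const_def)
  then have PP: "0 \<le> 2 * s * poisson_const TYPE('n) s * pv_holder_const TYPE('n) s L \<alpha>" by (simp only: mult_nonneg_nonneg)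
  have b: "Mu + Mf \<le> (height_const TYPE('n) s (Mu + Mf) L \<alpha>)" using PP by (simp add: height_const_def)
  show "1 / 2 < s" "s < 1" by (rule u.s)+
  show "(V has_derivative (\<lambda>h. G p \<bullet> h)) (at p)" for p by (rule height_deriv)
  show "continuous_on UNIV G" by (rule height_grad_cont)
  have cu: "continuous_on UNIV (\<lambda>x. frac_lap s u (x0 + x))" "continuous_on UNIV (\<lambda>x. frac_lap s \<phi> (x0 + x))"
    by (auto intro!: continuous_on_compose2[OF u.frac_lap_continuous] continuous_on_compose2[OF f.frac_lap_continuous] continuous_intros)
  show "continuous_on UNIV w" unfolding w_def[abs_def] by (intro continuous_intros cu)
  show "continuous_on UNIV (\<lambda>x. source_fun s \<phi> x0 (x0 + x))"
    unfolding source_fun_def by (intro continuous_intros cu)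
  show "(\<integral>p. \<bar>snd p\<bar> powr (1 - 2 * s) * (G p \<bullet> Z p) \<partial>lborel) = - (2 * (\<integral>x. w x * \<zeta> (x, 0) \<partial>lborel))"
    if "test_fun \<zeta> Z R" for \<zeta> Z R by (rule height_weak[OF that])
  \<comment> \<open>Either the point is a contact point and V vanishes there, or the fractional
    Laplacian of u is 0 and w = h / 2. The claim for the gradient uses the same dichotomy with
    \<open>grad_contact\<close>.\<close>
  show "w x * V (x, 0) = source_fun s \<phi> x0 (x0 + x) / 2 * V (x, 0)" for x
    using complementarity[of "x0 + x"] by (cases "u (x0 + x) = \<phi> (x0 + x)") (simp_all add: V_slice w_def source_fun_def)
  show "w x *\<^sub>R fst (G (x, 0)) = (source_fun s \<phi> x0 (x0 + x) / 2) *\<^sub>R fst (G (x, 0))" for x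
    using complementarity[of "x0 + x"] grad_contact[of "x0 + x"]
    by (cases "u (x0 + x) = \<phi> (x0 + x)") (simp_all add: G_slice w_def source_fun_def)
  show "\<bar>V (x, 0)\<bar> \<le> (height_const TYPE('n) s (Mu + Mf) L \<alpha>) * norm x powr (1 + s)" for x
    unfolding V_slice by (rule order_trans[OF diff_bound mult_right_mono[OF b]]) simp
  show "norm (fst (G (x, 0))) \<le> (height_const TYPE('n) s (Mu + Mf) L \<alpha>) * norm x powr s" for x
    unfolding G_slice by (rule order_trans[OF grad_diff_bound mult_right_mono[OF b]]) simp
  show "\<bar>source_fun s \<phi> x0 (x0 + x)\<bar> \<le> (height_const TYPE('n) s (Mu + Mf) L \<alpha>) * norm x powr s" for x
  proof -
    have "\<bar>f.pv (x0 + x) - f.pv x0\<bar> \<le> pv_holder_const TYPE('n) s L \<alpha> * norm x powr s"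
      using f.pv_holder[of "x0 + x" x0] by (simp add: norm_minus_commute)
    then have "2 * (2 * s * poisson_const TYPE('n) s * \<bar>f.pv (x0 + x) - f.pv x0\<bar>)
       \<le> 2 * (2 * s * poisson_const TYPE('n) s * (pv_holder_const TYPE('n) s L \<alpha> * norm x powr s))"
      using P by (intro mult_left_mono) auto
    moreover have "\<bar>source_fun s \<phi> x0 (x0 + x)\<bar> = 2 * (2 * s * poisson_const TYPE('n) s * \<bar>f.pv (x0 + x) - f.pv x0\<bar>)"
      by (simp only: source_fun_def f.frac_lap_eq right_diff_distrib[symmetric] abs_mult[of 2]
          abs_mult[of "2 * s * poisson_const TYPE('n) s"] abs_of_nonneg[OF P(2)] abs_numeral)
    moreover have "2 * (2 * s * poisson_const TYPE('n) s * pv_holder_const TYPE('n) s L \<alpha>) * norm x powr s \<le> (height_const TYPE('n) s (Mu + Mf) L \<alpha>) * norm x powr s"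
      using M by (intro mult_right_mono) (auto simp: height_const_def)
    ultimately show ?thesis by (simp add: mult.assoc)
  qed
qed

lemma gradient_height: "gradient (height_fun s \<phi> u x0) ((x0, 0) + p) = G p"
proof (rule gradient_eqI)
  have "((\<lambda>q. V (q - (x0, 0))) has_derivative (\<lambda>h. G p \<bullet> h)) (at ((x0, 0) + p))"
    by (rule has_derivative_compose[of "\<lambda>q. q - (x0, 0)" "\<lambda>h. h" _ UNIV V])
      (use height_deriv[of p] in \<open>auto intro!: derivative_eq_intros\<close>)
  moreover have "(\<lambda>q. V (q - (x0, 0))) = height_fun s \<phi> u x0" by (simp add: V_def fun_eq_iff)
  ultimately show "(height_fun s \<phi> u x0 has_derivative (\<lambda>h. G p \<bullet> h)) (at ((x0, 0) + p))" by simp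
qed

lemma height_measurable: "(\<lambda>p. height_fun s \<phi> u x0 p) \<in> borel_measurable borel"
  "(\<lambda>p. gradient (height_fun s \<phi> u x0) p) \<in> borel_measurable borel"
proof -
  have 1: "height_fun s \<phi> u x0 = (\<lambda>q. V (q - (x0, 0)))" by (simp add: V_def fun_eq_iff)
  have 2: "gradient (height_fun s \<phi> u x0) = (\<lambda>q. G (q - (x0, 0)))"
    using gradient_height[of "q - (x0, 0)" for q] by (simp add: fun_eq_iff)
  have "continuous_on UNIV (\<lambda>q. V (q - (x0, 0)))" "continuous_on UNIV (\<lambda>q. G (q - (x0, 0)))"
    by (auto intro!: continuous_on_compose2[OF V_cont[of UNIV]] continuous_on_compose2[OF height_grad_cont] continuous_intros)
  then show "(\<lambda>p. height_fun s \<phi> u x0 p) \<in> borel_measurable borel"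
    "(\<lambda>p. gradient (height_fun s \<phi> u x0) p) \<in> borel_measurable borel"
    unfolding 2 by (simp_all only: 1 borel_measurable_continuous_onI)
qed

lemma source_measurable: "source_fun s \<phi> x0 \<in> borel_measurable borel"
  unfolding source_fun_def[abs_def]
  by (intro borel_measurable_continuous_onI continuous_intros f.frac_lap_continuous)

text \<open>Translation by (x0, 0) preserves |y| and Lebesgue measure, and
  \<open>gradient_height\<close> evaluates the gradient that the functional defines by
  \<open>THE\<close>.\<close>

lemma weiss_eq:
  assumes r: "r > 0"
  shows "weiss s \<phi> u x0 r = weiss_fun r"
proof -
  note [measurable] = height_measurable source_measurable
  have m: "(\<lambda>p. indicator (ball (x0, 0) r) p * ((norm (gradient (height_fun s \<phi> u x0) p))\<^sup>2 * \<bar>snd p\<bar> powr (1 - 2 * s))) \<in> borel_measurable borel"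
    by (intro borel_measurable_times borel_measurable_indicator snd_borel_weight borel_measurable_power measurable_compose[OF height_measurable(2) borel_measurable_norm]) simp
  have m2: "(\<lambda>x. indicator (ball x0 r) x * (height_fun s \<phi> u x0 (x, 0) * source_fun s \<phi> x0 x)) \<in> borel_measurable borel"
  proof -
    have "(\<lambda>x. height_fun s \<phi> u x0 (x, 0)) = (\<lambda>x. u x - \<phi> x)"
      using V_slice[of "x - x0" for x] by (simp add: V_def fun_eq_iff)
    then have "(\<lambda>x. height_fun s \<phi> u x0 (x, 0)) \<in> borel_measurable borel"
      using u.\<psi>_measurable f.\<psi>_measurable by simp
    then show ?thesis by (intro borel_measurable_times borel_measurable_indicator source_measurable) simp_all
  qed
  have "set_lebesgue_integral lborel (ball (x0, 0) r) (\<lambda>p. (norm (gradient (height_fun s \<phi> u x0) p))\<^sup>2 * \<bar>snd p\<bar> powr (1 - 2 * s))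
    = W.ball_int GG r"
    unfolding set_lebesgue_integral_def real_scaleR_def
    using lborel_integral_affine[OF one_neq_zero m, of "(x0, 0)"]
    by (simp add: gradient_height W.ball_int_def power2_norm_eq_inner indicator_def dist_norm norm_minus_commute)
  moreover have "set_lebesgue_integral lborel (ball x0 r) (\<lambda>x. height_fun s \<phi> u x0 (x, 0) * source_fun s \<phi> x0 x) = T.ball_int hV r"
  proof -
    have "height_fun s \<phi> u x0 (x0 + x, 0) = V (x, 0)" for x by (simp add: V_def)
    then show ?thesis
      unfolding set_lebesgue_integral_def real_scaleR_def
      using lborel_integral_affine[OF one_neq_zero m2, of x0]
      by (simp add: T.ball_int_def indicator_def dist_norm norm_minus_commute mult.commute[of "V _"])
  qed
  moreover have "F_fun s \<phi> u x0 r = W.sph_int (\<lambda>p. (V p)\<^sup>2) r"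
    by (simp add: F_fun_def W.sph_int_def V_def)
  ultimately show ?thesis by (simp add: weiss_def weiss_fun_def I_fun_def)
qed

lemma deficit_sphere:
  assumes r: "r > 0"
  shows "(\<integral>p. ((1 + s) * height_fun s \<phi> u x0 p / r - gradient (height_fun s \<phi> u x0) p \<bullet> ((p - (x0, 0)) /\<^sub>R r))\<^sup>2
      * \<bar>snd p\<bar> powr (1 - 2 * s) \<partial>sphere_measure (x0, 0) r) = deficit r"
proof -
  note [measurable] = height_measurable
  have m: "(\<lambda>p. ((1 + s) * height_fun s \<phi> u x0 p / r - gradient (height_fun s \<phi> u x0) p \<bullet> ((p - (x0, 0)) /\<^sub>R r))\<^sup>2
      * \<bar>snd p\<bar> powr (1 - 2 * s)) \<in> borel_measurable borel"
    by (rule borel_measurable_times[OF _ snd_borel_weight]) measurable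
  have c: "continuous_on UNIV (\<lambda>p. ((1 + s) * V p / r - G p \<bullet> (p /\<^sub>R r))\<^sup>2)"
    using r by (intro continuous_intros V_cont height_grad_cont) auto
  have m': "(\<lambda>p. ((1 + s) * V p / r - G p \<bullet> (p /\<^sub>R r))\<^sup>2 * \<bar>snd p\<bar> powr (1 - 2 * s)) \<in> borel_measurable borel"
    by (rule borel_measurable_times[OF borel_measurable_continuous_onI[OF c] snd_borel_weight])
  show ?thesis
    unfolding integral_sphere_measure[OF m r] deficit_def W.sph_int_def integral_sphere_measure[OF m' r]
    by (simp add: gradient_height V_def)
qed

lemma deficit_nonneg: "deficit r \<ge> 0"
  unfolding deficit_def W.sph_int_def by (rule Bochner_Integration.integral_nonneg) simp

end

theorem theorem3p5:
  fixes s :: real and \<phi> u :: "real ^ 'n \<Rightarrow> real"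
  assumes "1 / 2 < s" and "s < 1"
    and "\<phi> \<in> holder_space (3 * s)"
    and "u \<in> holder_space (1 + s)"
    and "obstacle_solution s \<phi> u"
  shows "\<exists>C>0. \<exists>r0>0. \<forall>x0\<in>free_boundary \<phi> u.
    (\<forall>r\<in>{0<..<r0}. \<exists>D.
       ((\<lambda>\<rho>. weiss s \<phi> u x0 \<rho> + C * \<rho> powr (2 * s - 1)) has_real_derivative D) (at r) \<and>
       D \<ge> 2 / r ^ (CARD('n) + 2) *
         (\<integral>p. ((1 + s) * height_fun s \<phi> u x0 p / r
                - gradient (height_fun s \<phi> u x0) p \<bullet> ((p - (x0, 0)) /\<^sub>R r))\<^sup>2
               * \<bar>snd p\<bar> powr (1 - 2 * s) \<partial>sphere_measure (x0, 0) r)) \<and>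
    mono_on {0<..<r0} (\<lambda>\<rho>. weiss s \<phi> u x0 \<rho> + C * \<rho> powr (2 * s - 1))"
proof -
  note s = assms(1,2)
  obtain Mu where u: "holder_C1 s Mu u (grad_of u)"
    using holder_space_1s_holder_C1[OF s assms(4)] by metis
  obtain Mf L \<alpha> \<beta> where f: "holder_mixed s Mf \<phi> (grad_of \<phi>) L \<alpha> \<beta>"
    using holder_space_3s_holder_mixed[OF s assms(3)] by metis
  interpret obstacle_problem s Mu u "grad_of u" Mf \<phi> "grad_of \<phi>" L \<alpha> \<beta>
    unfolding obstacle_problem_def obstacle_problem_axioms_def using u f assms(5) by blast
  \<comment> \<open>Adding 1 keeps C positive even if the error constant is 0; the denominator
    undoes the factor 2s - 1 from differentiating r^(2s-1). All ingredients are fixed before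
    x0.\<close>
  define C where "C = (weiss_err_const TYPE('n) s (height_const TYPE('n) s (Mu + Mf) L \<alpha>) + 1) / (2 * s - 1)"
  have C: "C > 0" "C * (2 * s - 1) \<ge> weiss_err_const TYPE('n) s (height_const TYPE('n) s (Mu + Mf) L \<alpha>)"
    using s weiss_err_const_nonneg[where 'n='n, of s "height_const TYPE('n) s (Mu + Mf) L \<alpha>"] by (auto simp: C_def intro!: divide_pos_pos)
  show ?thesis
  \<comment> \<open>The derivative estimate holds at every r > 0, so 1 is an arbitrary choice of
    r0.\<close>
  proof (rule exI[of _ C], rule conjI[OF C(1)], rule exI[of _ 1], rule conjI[OF zero_less_one], intro ballI conjI)
    fix x0 assume "x0 \<in> free_boundary \<phi> u"
    then interpret free_boundary_point s Mu u "grad_of u" Mf \<phi> "grad_of \<phi>" L \<alpha> \<beta> x0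
      by unfold_locales
    let ?w = "\<lambda>\<rho>. weiss s \<phi> u x0 \<rho> + C * \<rho> powr (2 * s - 1)"
    have D: "\<exists>D. (?w has_real_derivative D) (at r) \<and> D \<ge> 2 / r ^ (CARD('n) + 2) * deficit r" if r: "r > 0" for r
    proof (rule weiss_monotonicity[OF r C(2)])
      fix D assume D: "((\<lambda>\<rho>. weiss_fun \<rho> + C * \<rho> powr (2 * s - 1)) has_real_derivative D) (at r)"
        "D \<ge> 2 / r ^ (CARD('n) + 2) * deficit r"
      have ev: "eventually (\<lambda>\<rho>. weiss_fun \<rho> + C * \<rho> powr (2 * s - 1) = ?w \<rho>) (nhds r)"
        by (rule eventually_mono[OF eventually_nhds_in_open[of "{0<..}" r]]) (use r in \<open>simp_all add: weiss_eq\<close>)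
      from D(1) have "(?w has_real_derivative D) (at r)"
        by (rule DERIV_cong_ev[OF refl ev refl, THEN iffD1])
      with D(2) show ?thesis by (intro exI conjI)
    qed
    show "\<exists>D. (?w has_real_derivative D) (at r) \<and> D \<ge> 2 / r ^ (CARD('n) + 2) *
         (\<integral>p. ((1 + s) * height_fun s \<phi> u x0 p / r
                - gradient (height_fun s \<phi> u x0) p \<bullet> ((p - (x0, 0)) /\<^sub>R r))\<^sup>2
               * \<bar>snd p\<bar> powr (1 - 2 * s) \<partial>sphere_measure (x0, 0) r)" if "r \<in> {0<..<1}" for r
    proof -
      have r: "r > 0" using that by simp
      show ?thesis unfolding deficit_sphere[OF r] by (rule D[OF r])
    qed
    show "mono_on {0<..<1} ?w"
    proof (rule mono_onI)
      fix a b :: real assume ab: "a \<in> {0<..<1}" "b \<in> {0<..<1}" "a \<le> b"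
      show "?w a \<le> ?w b"
      proof (rule DERIV_nonneg_imp_nondecreasing[OF ab(3)])
        fix r assume "a \<le> r" "r \<le> b"
        then have r: "r > 0" using ab by simp
        then obtain D where "(?w has_real_derivative D) (at r)" "D \<ge> 2 / r ^ (CARD('n) + 2) * deficit r" using D by blast
        moreover have "2 / r ^ (CARD('n) + 2) * deficit r \<ge> 0" using r deficit_nonneg[of r] by simp
        ultimately show "\<exists>D. (?w has_real_derivative D) (at r) \<and> 0 \<le> D" by (meson order_trans)
      qed
    qed
  qed
qed

end
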